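(* Let $r\ge5$ be a fixed integer and $b=2^r$. For $n\ge1$ let $\tau(1,b;n)$ be the number of pairs $(d_1,d_2)$ of positive integers with $d_1d_2^{b}=n$, and define $$\Delta(1,b;x)=\sum_{n\le x}\tau(1,b;n)-\zeta(b)\,x-\zeta(1/b)\,x^{1/b},$$ where $\zeta$ is the Riemann zeta function. Then $\Delta(1,2^r;x)\ll x^{\alpha}\log x$ as $x\to\infty$ (implied constant depending on $r$), where $$\alpha=\frac{2^r-2r}{2^{2r}-r\cdot 2^r-2r^2+2r-4}<\frac{1}{2^r+r}.$$ *)

theory Defs
  imports "HOL-Complex_Analysis.Complex_Analysis" "HOL-Library.Landau_Symbols"
begin

(* The analytic continuation of the Dirichlet series to the punctured plane;
   f 1 = 0 is a dummy value at the pole that makes the function unique. *)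
definition zeta :: "complex \<Rightarrow> complex" where
  "zeta = (THE f. f holomorphic_on (- {1}) \<and>
                  (\<forall>s. Re s > 1 \<longrightarrow> (\<lambda>n. 1 / of_nat (Suc n) powr s) sums f s) \<and>
                  f 1 = 0)"

definition tau1 :: "nat \<Rightarrow> nat \<Rightarrow> nat" where
  "tau1 b n = card {(d1, d2). d1 > 0 \<and> d2 > 0 \<and> d1 * d2 ^ b = n}"

(* zeta is real on the real axis away from 1, so taking Re only changes the type. *)
definition Delta1 :: "nat \<Rightarrow> real \<Rightarrow> real" where
  "Delta1 b x = (\<Sum>n | n \<ge> 1 \<and> real n \<le> x. real (tau1 b n))
                - Re (zeta (of_nat b)) * x
                - Re (zeta (1 / of_nat b)) * x powr (1 / real b)"

definition alpha :: "nat \<Rightarrow> real" where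
  "alpha r = (2 ^ r - 2 * real r) /
             (2 ^ (2 * r) - real r * 2 ^ r - 2 * (real r)\<^sup>2 + 2 * real r - 4)"

end

theory Submission
  imports Defs
begin

text \<open>By the hyperbola method and the Euler--Maclaurin formula, \<open>\<Delta>(1, b; x)\<close> equals
  \<open>- \<Sum> \<psi>(x / n\<^sup>b) - \<Sum> \<psi>((x / n)\<^bsup>1/b\<^esup>) + O(1)\<close>, where \<open>n\<close> runs up to \<open>x\<^bsup>1/(b + 1)\<^esup>\<close> and
  \<open>\<psi>(u) = frac u - 1/2\<close>. The sums are cut into dyadic blocks, on each of which \<open>\<psi>\<close> is replaced by exponential
  sums. If the \<open>r\<close>-th derivative of \<open>x / u\<^sup>b\<close> has size \<open>N\<^bsup>-y\<^esup>\<close> on the block of length \<open>N\<close>, then for most \<open>y\<close> a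
  derivative test of some order \<open>2 \<le> k \<le> r + 1\<close> (Weyl--van der Corput differencing down to the second
  derivative test) bounds the block by \<open>O(x\<^sup>\<alpha>)\<close>. The remaining \<open>y\<close> lie roughly between \<open>3/4\<close> and \<open>2\<close>; there
  one differences only \<open>r - 2\<close> times, applies stationary phase, and estimates the dual sum by a derivative
  test of order \<open>s\<close> depending on \<open>y\<close>. The phases in that case are small holomorphic perturbations of
  monomials on a complex neighbourhood of \<open>[1, 2]\<close>, so that Cauchy's estimates control their derivatives and
  those of their Legendre transforms. The logarithm comes from the number of blocks.\<close>

subsection \<open>Exponential sums\<close>

text \<open>Put \<open>b = 2 ^ r\<close>. Then \<alpha> is \<open>1 / E\<close> with
  \<open>E = b + r + e0\<close>, where \<open>e0 = (2 * r - 4) / (b - 2 * r)\<close> lies in (0, 1];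
  this form also shows \<alpha> < 1 / (b + r). For a block of length N write x = N powr p. The
  hyperbola method leaves only p >= b + 1, and once p >= E the trivial bound N is at most x powr
  \<alpha>. In between one has to save N powr (1 - p / E) over the trivial bound. In the variable y
  = b + r - p this exponent is (y + e0) / E, so the target is linear in y on [-e0, r - 1], and each
  derivative test turns into linear inequalities in y. The obstacle is a gap between consecutive
  orders: order r + 1 covers small y, order r covers y slightly below 2 (for r >= 8 it is used from
  2 - 4.48 / (r + 1) to 2 - 5 / b), and neither covers the whole range between. There the last Weyl
  steps cost more than they gain and are replaced by a passage to the dual sum. The sums over (x /
  n) powr (1 / b) are far easier: the second derivative test alone handles them.\<close>

definition ee :: "real \<Rightarrow> complex" where
  "ee x = cis (2 * pi * x)"

definition esum :: "(real \<Rightarrow> real) \<Rightarrow> int \<Rightarrow> int \<Rightarrow> complex" where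
  "esum g a b = (\<Sum>n\<in>{a..b}. ee (g (of_int n)))"

lemma norm_ee [simp]: "norm (ee x) = 1"
  by (simp add: ee_def)

lemma ee_add: "ee (x + y) = ee x * ee y"
  by (simp add: ee_def cis_mult ring_distribs)

lemma ee_of_int [simp]: "ee (of_int n) = 1"
  by (simp add: ee_def)

lemma ee_0 [simp]: "ee 0 = 1"
  by (simp add: ee_def)

lemma cnj_ee: "cnj (ee x) = ee (- x)"
  by (simp add: ee_def cis_cnj)

lemma ee_diff: "ee (x - y) = ee x * cnj (ee y)"
  using ee_add[of x "- y"] by (simp add: cnj_ee)

lemma ee_diff_int [simp]: "ee (x - of_int n) = ee x"
  by (simp add: ee_diff)

lemma ee_add_int [simp]: "ee (x + of_int n) = ee x"
  by (simp add: ee_add)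

lemma norm_one_minus_ee: "norm (1 - ee x) = 2 * \<bar>sin (pi * x)\<bar>"
proof -
  have "(norm (1 - ee x))\<^sup>2 = (1 - cos (2 * (pi * x)))\<^sup>2 + (sin (2 * (pi * x)))\<^sup>2"
    by (simp add: ee_def cmod_power2 cis.ctr mult.assoc)
  also have "\<dots> = 2 - 2 * cos (2 * (pi * x))"
    using sin_cos_squared_add[of "2 * (pi * x)"] by (simp add: power2_eq_square algebra_simps)
  also have "\<dots> = (2 * \<bar>sin (pi * x)\<bar>)\<^sup>2"
    by (simp add: cos_double_sin power_mult_distrib)
  finally show ?thesis
    by (rule power2_eq_imp_eq) auto
qed

lemma norm_ee_diff_le: "norm (ee x - ee y) \<le> 2 * pi * \<bar>x - y\<bar>"
proof -
  have "ee x - ee y = - ee y * (1 - ee (x - y))"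
    by (simp add: ee_diff algebra_simps) (simp add: ee_def cis_cnj cis_mult flip: mult.assoc)
  then have "norm (ee x - ee y) = 2 * \<bar>sin (pi * (x - y))\<bar>"
    by (simp add: norm_mult norm_one_minus_ee)
  also have "\<dots> \<le> 2 * \<bar>pi * (x - y)\<bar>"
    using abs_sin_x_le_abs_x by simp
  finally show ?thesis by (simp add: abs_mult)
qed

lemma sin_pi_ge:
  assumes "0 \<le> x" "x \<le> 1/2"
  shows "2 * x \<le> sin (pi * x)"
proof -
  have "concave_on {0..pi/2} sin"
    by (rule f''_le0_imp_concave[where f' = cos and f'' = "\<lambda>x. - sin x"])
       (auto intro!: derivative_eq_intros sin_ge_zero)
  from concave_onD[OF this, of "2 * x" 0 "pi/2"] show ?thesis
    using assms by (auto simp: mult.commute)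
qed

lemma sin_pi_ge':
  assumes "0 \<le> t" "t \<le> x" "x \<le> 1 - t" "t \<le> 1/2"
  shows "2 * t \<le> sin (pi * x)"
proof (cases "x \<le> 1/2")
  case True
  then show ?thesis using sin_pi_ge[of x] assms by simp
next
  case False
  have "sin (pi * x) = sin (pi * (1 - x))"
    by (simp add: right_diff_distrib sin_diff)
  then show ?thesis using sin_pi_ge[of "1 - x"] assms False by simp
qed

lemma norm_one_minus_ee_ge:
  assumes "\<bar>x\<bar> \<le> 1/2"
  shows "4 * \<bar>x\<bar> \<le> norm (1 - ee x)"
  using sin_pi_ge[of "\<bar>x\<bar>"] assms
  by (cases "x \<ge> 0") (auto simp: norm_one_minus_ee)

lemma norm_esum_le: "a \<le> b \<Longrightarrow> norm (esum g a b) \<le> of_int (b - a + 1)"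
  unfolding esum_def by (rule order_trans[OF norm_sum]) simp

lemma esum_empty [simp]: "b < a \<Longrightarrow> esum g a b = 0"
  by (simp add: esum_def)

lemma norm_esum_uminus: "norm (esum (\<lambda>u. - g u) a b) = norm (esum g a b)"
proof -
  have "esum (\<lambda>u. - g u) a b = cnj (esum g a b)"
    by (simp add: esum_def cnj_ee)
  then show ?thesis by simp
qed

lemma deriv_ge_imp_diff_ge:
  fixes g1 g2 :: "real \<Rightarrow> real"
  assumes "\<And>u. u \<in> {x..y} \<Longrightarrow> (g1 has_real_derivative g2 u) (at u)"
    and "\<And>u. u \<in> {x..y} \<Longrightarrow> l \<le> g2 u" and "x \<le> y"
  shows "l * (y - x) \<le> g1 y - g1 x"
proof (cases "x < y")
  case True
  obtain z where "x < z" "z < y" "g1 y - g1 x = (y - x) * g2 z"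
    using MVT2[OF True, of g1 g2] assms(1) by auto
  then show ?thesis using assms(2)[of z] True by (simp add: mult.commute mult_left_mono)
qed (use assms in auto)

lemma deriv_le_imp_diff_le:
  fixes g1 g2 :: "real \<Rightarrow> real"
  assumes "\<And>u. u \<in> {x..y} \<Longrightarrow> (g1 has_real_derivative g2 u) (at u)"
    and "\<And>u. u \<in> {x..y} \<Longrightarrow> g2 u \<le> l" and "x \<le> y"
  shows "g1 y - g1 x \<le> l * (y - x)"
  using deriv_ge_imp_diff_ge[of x y "\<lambda>u. - g1 u" "\<lambda>u. - g2 u" "- l"] assms
  by (fastforce intro: DERIV_minus)

lemma ee_power: "ee x ^ n = ee (of_nat n * x)"
  by (simp only: ee_def Complex.DeMoivre mult_ac)

text \<open>For fixed \<open>i\<close> every positive distance is attained by at most two indices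
  \<open>j\<close>. Both the Weyl differencing and the Fejer kernel lead to double sums of this
  kind.\<close>

lemma sum_diff_indices_le:
  fixes T :: "nat \<Rightarrow> real"
  assumes "\<And>q. 0 \<le> T q"
  shows "(\<Sum>i<Q. \<Sum>j<Q. T (nat \<bar>int i - int j\<bar>)) \<le> Q * (T 0 + 2 * (\<Sum>q=1..<Q. T q))"
proof -
  have "(\<Sum>j<Q. T (nat \<bar>int i - int j\<bar>)) \<le> T 0 + 2 * (\<Sum>q=1..<Q. T q)" if i: "i < Q" for i
  proof -
    have "(\<Sum>j<Q. T (nat \<bar>int i - int j\<bar>))
        = (\<Sum>j<i. T (nat \<bar>int i - int j\<bar>)) + (\<Sum>j=i..<Q. T (nat \<bar>int i - int j\<bar>))"
      using i by (simp only: lessThan_atLeast0 sum.atLeastLessThan_concat[of 0 i Q])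
    also have "(\<Sum>j=i..<Q. T (nat \<bar>int i - int j\<bar>)) = T 0 + (\<Sum>j=Suc i..<Q. T (nat \<bar>int i - int j\<bar>))"
      using i by (simp add: sum.atLeast_Suc_lessThan)
    finally have "(\<Sum>j<Q. T (nat \<bar>int i - int j\<bar>))
        = (\<Sum>j<i. T (nat \<bar>int i - int j\<bar>)) + T 0 + (\<Sum>j=Suc i..<Q. T (nat \<bar>int i - int j\<bar>))" by simp
    also have "(\<Sum>j<i. T (nat \<bar>int i - int j\<bar>)) = (\<Sum>q\<in>(\<lambda>j. i - j) ` {..<i}. T q)"
      by (subst sum.reindex) (auto simp: inj_on_def nat_diff_distrib' intro!: sum.cong arg_cong[of _ _ T])
    also have "\<dots> \<le> (\<Sum>q=1..<Q. T q)"
      using i assms by (intro sum_mono2) auto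
    also have "(\<Sum>j=Suc i..<Q. T (nat \<bar>int i - int j\<bar>)) = (\<Sum>q\<in>(\<lambda>j. j - i) ` {Suc i..<Q}. T q)"
      by (subst sum.reindex) (auto simp: inj_on_def nat_diff_distrib' intro!: sum.cong arg_cong[of _ _ T])
    also have "\<dots> \<le> (\<Sum>q=1..<Q. T q)"
      using i assms by (intro sum_mono2) auto
    finally show ?thesis by simp
  qed
  then have "(\<Sum>i<Q. \<Sum>j<Q. T (nat \<bar>int i - int j\<bar>)) \<le> (\<Sum>i<Q. T 0 + 2 * (\<Sum>q=1..<Q. T q))"
    by (intro sum_mono) auto
  then show ?thesis by simp
qed

text \<open>With \<^term>\<open>d n = h (n + 1) - h n\<close> one has \<open>ee (h n) = (ee (h n) - ee (h (n + 1))) * c n\<close> where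
  \<open>c n = 1 / (1 - ee (d n)) = (1 + \<i> cot (\<pi> d n)) / 2\<close>; summation by parts leaves the total
  variation of the monotone sequence \<open>cot (\<pi> d n)\<close>.\<close>

lemma Kusmin_Landau_nat:
  fixes h :: "nat \<Rightarrow> real"
  assumes th: "0 < \<theta>" "\<theta> \<le> 1/2"
    and lo: "\<And>n. n < N \<Longrightarrow> \<theta> \<le> h (Suc n) - h n"
    and hi: "\<And>n. n < N \<Longrightarrow> h (Suc n) - h n \<le> 1 - \<theta>"
    and mono: "\<And>n. Suc n < N \<Longrightarrow> h (Suc n) - h n \<le> h (Suc (Suc n)) - h (Suc n)"
  shows "norm (\<Sum>n\<le>N. ee (h n)) \<le> 2 / \<theta>"
proof (cases N)
  case 0
  have "1 \<le> 2 / \<theta>" using th by (simp add: field_simps)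
  with 0 show ?thesis by simp
next
  case (Suc M)
  define d where "d n = h (Suc n) - h n" for n
  define ct where "ct n = cos (pi * d n) / sin (pi * d n)" for n
  define c where "c n = (1 + \<i> * of_real (ct n)) / 2" for n
  have sn: "2 * \<theta> \<le> sin (pi * d n)" if "n \<le> M" for n
    using sin_pi_ge'[of \<theta> "d n"] lo[of n] hi[of n] that th Suc by (auto simp: d_def)
  have spos: "0 < sin (pi * d n)" if "n \<le> M" for n
    using sn[OF that] th by linarith
  have c_eq: "ee (h n) = (ee (h n) - ee (h (Suc n))) * c n" if "n \<le> M" for n
  proof -
    have s: "sin (pi * d n) \<noteq> 0" using spos[OF that] by simp
    have "(1 - ee (d n)) * c n = 1"
    proof -
      have e: "ee (d n) = cis (pi * d n) * cis (pi * d n)"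
        by (simp add: ee_def cis_mult mult.assoc)
      have ic: "(1 + \<i> * of_real (ct n)) = (\<i> * cnj (cis (pi * d n))) / of_real (sin (pi * d n))"
        using s by (simp add: ct_def complex_eq_iff cis.ctr field_simps)
      have "1 - ee (d n) = - 2 * \<i> * of_real (sin (pi * d n)) * cis (pi * d n)"
        unfolding e using sin_cos_squared_add[of "pi * d n"]
        by (simp add: complex_eq_iff cis.ctr algebra_simps power2_eq_square)
      then have "(1 - ee (d n)) * c n
          = (- 2 * \<i> * of_real (sin (pi * d n)) * cis (pi * d n)) * ((\<i> * cnj (cis (pi * d n))) / of_real (sin (pi * d n))) / 2"
        by (simp add: c_def ic)
      also have "\<dots> = cis (pi * d n) * cnj (cis (pi * d n))"
        using s by (simp add: field_simps)
      also have "\<dots> = 1" by (simp add: cis_cnj cis_mult)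
      finally show ?thesis .
    qed
    moreover have "ee (h (Suc n)) = ee (h n) * ee (d n)"
      by (simp add: d_def flip: ee_add)
    ultimately have "(ee (h n) - ee (h (Suc n))) * c n = ee (h n) * 1"
      by (metis mult.assoc mult.right_neutral right_diff_distrib)
    then show ?thesis by simp
  qed
  have nc: "norm (c n) \<le> 1 / (4 * \<theta>)" if "n \<le> M" for n
  proof -
    have ri: "Re (c n) = 1 / 2" "Im (c n) = ct n / 2" by (simp_all add: c_def)
    have "(norm (c n))\<^sup>2 = (1 + (ct n)\<^sup>2) / 4"
      by (simp only: cmod_power2 ri) (simp add: power_divide add_divide_distrib)
    also have "1 + (ct n)\<^sup>2 = 1 / (sin (pi * d n))\<^sup>2"
      using spos[OF that] sin_cos_squared_add[of "pi * d n"]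
      by (simp add: ct_def power_divide field_simps)
    finally have "(norm (c n))\<^sup>2 = (1 / (2 * sin (pi * d n)))\<^sup>2"
      by (simp add: power_divide power_mult_distrib)
    then have "norm (c n) = 1 / (2 * sin (pi * d n))"
      using spos[OF that] by (simp add: power2_eq_iff_nonneg)
    also have "\<dots> \<le> 1 / (4 * \<theta>)"
      using sn[OF that] th by (intro divide_left_mono) (auto intro!: mult_pos_pos)
    finally show ?thesis .
  qed
  have ctb: "\<bar>ct n\<bar> \<le> 1 / (2 * \<theta>)" if "n \<le> M" for n
  proof -
    have "\<bar>ct n\<bar> = \<bar>cos (pi * d n)\<bar> / sin (pi * d n)"
      using spos[OF that] by (simp add: ct_def)
    also have "\<dots> \<le> 1 / (2 * \<theta>)"
      using sn[OF that] th by (intro frac_le) auto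
    finally show ?thesis .
  qed
  have ctm: "ct (Suc n) \<le> ct n" if "Suc n \<le> M" for n
  proof -
    have le: "d n \<le> d (Suc n)" "d (Suc n) - d n \<le> 1"
      using mono[of n] lo[of n] hi[of "Suc n"] that th Suc by (auto simp: d_def)
    have s: "0 < sin (pi * d n)" "0 < sin (pi * d (Suc n))" using spos that by auto
    have "0 \<le> sin (pi * d (Suc n) - pi * d n)"
      using le by (intro sin_ge_zero) (auto simp: mult_left_mono right_diff_distrib[symmetric])
    then have "cos (pi * d (Suc n)) * sin (pi * d n) \<le> cos (pi * d n) * sin (pi * d (Suc n))"
      by (simp add: sin_diff mult.commute)
    then show ?thesis using s by (simp add: ct_def field_simps)
  qed
  have id: "(\<Sum>n\<le>K. (ee (h n) - ee (h (Suc n))) * c n)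
      = ee (h 0) * c 0 - ee (h (Suc K)) * c K + (\<Sum>n<K. ee (h (Suc n)) * (c (Suc n) - c n))" for K
    by (induction K) (simp_all add: algebra_simps)
  have "(\<Sum>n<K. norm (c (Suc n) - c n)) = (ct 0 - ct K) / 2" if "K \<le> M" for K
    using that
  proof (induction K)
    case (Suc K)
    have "c (Suc K) - c K = \<i> * of_real (ct (Suc K) - ct K) / 2"
      by (simp add: c_def diff_divide_distrib right_diff_distrib flip: diff_divide_distrib)
    then have "norm (c (Suc K) - c K) = norm (\<i> * of_real (ct (Suc K) - ct K) / 2)" by (simp only:)
    also have "\<dots> = (ct K - ct (Suc K)) / 2"
      using ctm[of K] Suc.prems by (simp add: norm_divide norm_mult del: of_real_diff)
    finally show ?case using Suc by simp
  qed simp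
  note var = this[of M]
  have "(\<Sum>n\<le>N. ee (h n)) = (\<Sum>n\<le>M. ee (h n)) + ee (h N)"
    by (simp add: Suc)
  also have "(\<Sum>n\<le>M. ee (h n)) = (\<Sum>n\<le>M. (ee (h n) - ee (h (Suc n))) * c n)"
    by (intro sum.cong) (auto intro: c_eq)
  finally have eq: "(\<Sum>n\<le>N. ee (h n)) = (\<Sum>n\<le>M. (ee (h n) - ee (h (Suc n))) * c n) + ee (h N)" .
  have "norm (\<Sum>n\<le>N. ee (h n)) \<le> norm (ee (h 0) * c 0) + norm (ee (h (Suc M)) * c M)
      + norm (\<Sum>n<M. ee (h (Suc n)) * (c (Suc n) - c n)) + norm (ee (h N))"
    unfolding eq id
    by (intro order_trans[OF norm_triangle_ineq] add_mono order_refl norm_triangle_ineq4)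
  also have "norm (\<Sum>n<M. ee (h (Suc n)) * (c (Suc n) - c n)) \<le> (ct 0 - ct M) / 2"
    by (rule order_trans[OF norm_sum]) (simp add: norm_mult var)
  finally have "norm (\<Sum>n\<le>N. ee (h n)) \<le> norm (c 0) + norm (c M) + (ct 0 - ct M) / 2 + 1"
    by (simp add: norm_mult)
  also have "\<dots> \<le> 1 / (4 * \<theta>) + 1 / (4 * \<theta>) + (1 / (2 * \<theta>) + 1 / (2 * \<theta>)) / 2 + 1 / (2 * \<theta>)"
    using nc[of 0] nc[of M] ctb[of 0] ctb[of M] th
    by (intro add_mono divide_right_mono) (auto simp: abs_le_iff field_simps)
  also have "\<dots> \<le> 2 / \<theta>" using th by (simp add: field_simps)
  finally show ?thesis .
qed

lemma convex_int_set:
  fixes S :: "int set"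
  assumes "finite S" and "\<And>x y z. x \<in> S \<Longrightarrow> z \<in> S \<Longrightarrow> x \<le> y \<Longrightarrow> y \<le> z \<Longrightarrow> y \<in> S"
  obtains p q where "S = {p..q}"
proof (cases "S = {}")
  case True
  then show ?thesis using that[of 1 0] by simp
next
  case False
  have "S \<subseteq> {Min S..Max S}" using assms(1) by auto
  moreover have "{Min S..Max S} \<subseteq> S"
    using assms(2)[OF Min_in[OF assms(1) False] Max_in[OF assms(1) False]] by auto
  ultimately show ?thesis by (intro that) (rule equalityI)
qed

text \<open>The mean value theorem turns the differences of \<open>g\<close> into values of
  \<open>g1\<close> at points of consecutive unit intervals, so monotonicity is inherited.
  Subtracting the linear term \<open>k * n\<close> does not affect \<open>ee\<close> and moves the
  differences into [\<theta>, 1 - \<theta>].\<close>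

lemma Kusmin_Landau:
  assumes der: "\<And>u. u \<in> {real_of_int a..real_of_int b} \<Longrightarrow> (g has_real_derivative g1 u) (at u)"
    and mono: "\<And>u w. real_of_int a \<le> u \<Longrightarrow> u \<le> w \<Longrightarrow> w \<le> real_of_int b \<Longrightarrow> g1 u \<le> g1 w"
    and th: "0 < \<theta>" "\<theta> \<le> 1/2"
    and lo: "\<And>u. u \<in> {real_of_int a..real_of_int b} \<Longrightarrow> of_int k + \<theta> \<le> g1 u"
    and hi: "\<And>u. u \<in> {real_of_int a..real_of_int b} \<Longrightarrow> g1 u \<le> of_int k + 1 - \<theta>"
  shows "norm (esum g a b) \<le> 2 / \<theta>"
proof (cases "a \<le> b")
  case False
  then show ?thesis using th by simp
next
  case True
  define N where "N = nat (b - a)"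
  define h where "h n = g (of_int (a + int n)) - of_int (k * int n)" for n
  have bN: "b = a + int N" using True by (simp add: N_def)
  have "{a..b} = (\<lambda>n. a + int n) ` {..N}"
  proof (intro equalityI subsetI)
    fix x assume "x \<in> {a..b}"
    then have "x = a + int (nat (x - a))" "nat (x - a) \<le> N" by (auto simp: N_def)
    then show "x \<in> (\<lambda>n. a + int n) ` {..N}" by blast
  qed (auto simp: bN)
  then have "esum g a b = (\<Sum>n\<le>N. ee (g (of_int (a + int n))))"
    unfolding esum_def by (simp add: sum.reindex inj_on_def)
  also have "\<dots> = (\<Sum>n\<le>N. ee (h n))"
    unfolding h_def by (simp only: ee_diff_int)
  finally have eq: "esum g a b = (\<Sum>n\<le>N. ee (h n))" .
  have "\<exists>u. of_int (a + int n) < u \<and> u < of_int (a + int n) + 1 \<and> h (Suc n) - h n = g1 u - of_int k"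
    if "n < N" for n
  proof -
    have "\<exists>u. of_int (a + int n) < u \<and> u < of_int (a + int n) + 1 \<and>
        g (of_int (a + int n) + 1) - g (of_int (a + int n)) = (of_int (a + int n) + 1 - of_int (a + int n)) * g1 u"
      by (rule MVT2) (use that bN in \<open>auto intro!: der\<close>)
    then obtain u where "of_int (a + int n) < u" "u < of_int (a + int n) + 1"
        "g (of_int (a + int n) + 1) - g (of_int (a + int n)) = g1 u" by auto
    then show ?thesis by (intro exI[of _ u]) (auto simp: h_def algebra_simps)
  qed
  then obtain u where u: "\<And>n. n < N \<Longrightarrow> of_int (a + int n) < u n"
    "\<And>n. n < N \<Longrightarrow> u n < of_int (a + int n) + 1"
    "\<And>n. n < N \<Longrightarrow> h (Suc n) - h n = g1 (u n) - of_int k" by metis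
  have mem: "u n \<in> {real_of_int a..real_of_int b}" if "n < N" for n
    using u(1,2)[OF that] that bN by auto
  show ?thesis unfolding eq
  proof (rule Kusmin_Landau_nat[OF th])
    fix n assume n: "n < N"
    show "\<theta> \<le> h (Suc n) - h n" "h (Suc n) - h n \<le> 1 - \<theta>"
      using u(3)[OF n] lo[OF mem[OF n]] hi[OF mem[OF n]] by linarith+
  next
    fix n assume n: "Suc n < N"
    have "g1 (u n) \<le> g1 (u (Suc n))"
      using u(1,2)[of n] u(1,2)[of "Suc n"] n mem[of n] mem[of "Suc n"] by (intro mono) auto
    then show "h (Suc n) - h n \<le> h (Suc (Suc n)) - h (Suc n)"
      using u(3)[of n] u(3)[of "Suc n"] n by linarith
  qed
qed

section \<open>The second derivative test\<close>

lemma norm_sum_fibres_le: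
  fixes f :: "'a \<Rightarrow> complex" and \<kappa> :: "'a \<Rightarrow> int"
  assumes "finite A" and "\<And>x. x \<in> A \<Longrightarrow> k1 \<le> \<kappa> x \<and> \<kappa> x \<le> k2" and "k1 \<le> k2 + 1"
    and "\<And>k. norm (\<Sum>x\<in>{x\<in>A. \<kappa> x = k}. f x) \<le> B"
  shows "norm (\<Sum>x\<in>A. f x) \<le> of_int (k2 - k1 + 1) * B"
proof -
  have "(\<Sum>x\<in>A. f x) = (\<Sum>k\<in>{k1..k2}. \<Sum>x\<in>{x\<in>A. \<kappa> x = k}. f x)"
    using assms(1,2) by (intro sum.group[symmetric]) auto
  also have "norm \<dots> \<le> (\<Sum>k\<in>{k1..k2}. B)"
    by (rule order_trans[OF norm_sum]) (intro sum_mono assms)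
  also have "\<dots> = of_int (k2 - k1 + 1) * B" using assms(3) by simp
  finally show ?thesis .
qed

text \<open>The integers are sorted by the integer part of a shift of \<open>g1\<close>. In each
  class the integers with \<open>g1\<close> close to an integer are counted trivially; they are few
  because \<open>g1\<close> grows at rate at least \<open>lam\<close>. The others fall under
  Kusmin--Landau. There are at most \<open>c * lam * N + 2\<close> classes.\<close>

lemma second_derivative_test:
  assumes d1: "\<And>u. u \<in> {real_of_int a..real_of_int b} \<Longrightarrow> (g has_real_derivative g1 u) (at u)"
    and d2: "\<And>u. u \<in> {real_of_int a..real_of_int b} \<Longrightarrow> (g1 has_real_derivative g2 u) (at u)"
    and lam0: "0 < lam" and c: "1 \<le> c"
    and lo: "\<And>u. u \<in> {real_of_int a..real_of_int b} \<Longrightarrow> lam \<le> g2 u"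
    and hi: "\<And>u. u \<in> {real_of_int a..real_of_int b} \<Longrightarrow> g2 u \<le> c * lam"
    and N: "real_of_int (b - a + 1) \<le> N" "0 \<le> N"
  shows "norm (esum g a b) \<le> 10 * c * (N * sqrt lam + 1 / sqrt lam)"
proof (cases "a \<le> b")
  case False
  then show ?thesis using N c lam0 by simp
next
  case ab: True
  \<comment> \<open>This width balances the trivial count 2 * \<theta> / lam against the bound 2 /
    \<theta> of Kusmin--Landau.\<close>
  define \<theta> where "\<theta> = sqrt lam"
  have th0: "0 < \<theta>" "\<theta> * \<theta> = lam" using lam0 by (auto simp: \<theta>_def)
  show ?thesis
  proof (cases "\<theta> \<le> 1/2")
    case False
    have "norm (esum g a b) \<le> N" using norm_esum_le[OF ab, of g] N by linarith
    also have "\<dots> \<le> N * (2 * \<theta>)" using N False by (simp add: mult_left_mono[of 1 "2 * \<theta>" N, simplified])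
    also have "\<dots> \<le> 10 * c * (N * \<theta>)"
      using N th0 c mult_right_mono[of 2 "10 * c" "N * \<theta>"] by (simp add: algebra_simps)
    also have "\<dots> \<le> 10 * c * (N * \<theta> + 1 / \<theta>)"
      using c th0 by (intro mult_left_mono) auto
    finally show ?thesis by (simp add: \<theta>_def)
  next
    case th: True
    \<comment> \<open>The shift by \<theta> places the integers near the stationary point at the
      start of class \<open>k\<close>: below, \<open>A\<close> consists of those with
      \<open>g1\<close> in [k - \<theta>, k + \<theta>) and \<open>B\<close> of those with
      \<open>g1\<close> in [k + \<theta>, k + 1 - \<theta>).\<close>
    define \<gamma> where "\<gamma> n = g1 (of_int n) + \<theta>" for n :: int
    define \<kappa> where "\<kappa> n = \<lfloor>\<gamma> n\<rfloor>" for n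
    have g1m: "lam * (w - u) \<le> g1 w - g1 u" "g1 w - g1 u \<le> c * lam * (w - u)"
      if "real_of_int a \<le> u" "u \<le> w" "w \<le> real_of_int b" for u w
      using that by (auto intro!: deriv_ge_imp_diff_ge[of u w g1 g2] deriv_le_imp_diff_le[of u w g1 g2] d2 lo hi)
    have mono: "g1 u \<le> g1 w" if "real_of_int a \<le> u" "u \<le> w" "w \<le> real_of_int b" for u w
      using g1m(1)[OF that] lam0 that mult_nonneg_nonneg[of lam "w - u"] by linarith
    have gmono: "\<gamma> m \<le> \<gamma> n" if "a \<le> m" "m \<le> n" "n \<le> b" for m n
      using mono[of m n] that by (simp add: \<gamma>_def)
    have kmono: "\<kappa> m \<le> \<kappa> n" if "a \<le> m" "m \<le> n" "n \<le> b" for m n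
      using gmono[OF that] by (simp add: \<kappa>_def floor_mono)
    have cls: "norm (\<Sum>n\<in>{n\<in>{a..b}. \<kappa> n = k}. ee (g (of_int n))) \<le> 5 / \<theta>" for k
    proof -
      define A where "A = {n\<in>{a..b}. \<kappa> n = k \<and> \<gamma> n < of_int k + 2 * \<theta>}"
      define B where "B = {n\<in>{a..b}. \<kappa> n = k \<and> of_int k + 2 * \<theta> \<le> \<gamma> n}"
      have un: "{n\<in>{a..b}. \<kappa> n = k} = A \<union> B" "A \<inter> B = {}" by (auto simp: A_def B_def)
      have fin: "finite A" "finite B"
        by (rule finite_subset[of _ "{a..b}"]; force simp: A_def B_def)+
      obtain p q where A: "A = {p..q}"
      proof (rule convex_int_set[OF fin(1)])
        fix x y z assume H: "x \<in> A" "z \<in> A" "x \<le> y" "y \<le> z"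
        then have "a \<le> x" "z \<le> b" by (auto simp: A_def)
        with H have "\<kappa> x \<le> \<kappa> y" "\<kappa> y \<le> \<kappa> z" "\<gamma> y \<le> \<gamma> z"
          using kmono[of x y] kmono[of y z] gmono[of y z] by linarith+
        moreover have "\<kappa> x = k" "\<kappa> z = k" "\<gamma> z < of_int k + 2 * \<theta>" "a \<le> x" "z \<le> b"
          using H by (auto simp: A_def)
        ultimately show "y \<in> A" unfolding A_def using H(3,4) by (simp; linarith)
      qed
      obtain p' q' where B: "B = {p'..q'}"
      proof (rule convex_int_set[OF fin(2)])
        fix x y z assume H: "x \<in> B" "z \<in> B" "x \<le> y" "y \<le> z"
        then have "a \<le> x" "z \<le> b" by (auto simp: B_def)
        with H have "\<kappa> x \<le> \<kappa> y" "\<kappa> y \<le> \<kappa> z" "\<gamma> x \<le> \<gamma> y"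
          using kmono[of x y] kmono[of y z] gmono[of x y] by linarith+
        moreover have "\<kappa> x = k" "\<kappa> z = k" "of_int k + 2 * \<theta> \<le> \<gamma> x" "a \<le> x" "z \<le> b"
          using H by (auto simp: B_def)
        ultimately show "y \<in> B" unfolding B_def using H(3,4) by (simp; linarith)
      qed
      have nA: "norm (\<Sum>n\<in>A. ee (g (of_int n))) \<le> 2 / \<theta> + 1"
      proof (cases "p \<le> q")
        case True
        then have pq: "p \<in> A" "q \<in> A" by (auto simp: A)
        then have "lam * (of_int q - of_int p) \<le> g1 q - g1 p"
          using True by (intro g1m) (auto simp: A_def)
        also have "\<dots> \<le> 2 * \<theta>"
        proof -
          have "of_int k \<le> \<gamma> p" "\<gamma> q < of_int k + 2 * \<theta>"
            using pq by (auto simp: A_def \<kappa>_def)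
          then show ?thesis by (simp add: \<gamma>_def)
        qed
        finally have "real_of_int (q - p) \<le> 2 / \<theta>"
        proof -
          assume "lam * (of_int q - of_int p) \<le> 2 * \<theta>"
          then have "\<theta> * (\<theta> * of_int (q - p)) \<le> \<theta> * 2"
            by (simp add: mult.assoc flip: th0(2))
          then have "\<theta> * of_int (q - p) \<le> 2" using th0(1) by (simp only: mult_le_cancel_left_pos)
          then show ?thesis using th0(1) by (simp add: field_simps)
        qed
        moreover have "norm (\<Sum>n\<in>A. ee (g (of_int n))) \<le> of_int (q - p + 1)"
          using norm_esum_le[OF True, of g] by (simp add: A esum_def)
        ultimately show ?thesis by simp
      qed (use th0 in \<open>auto simp: A\<close>)
      have nB: "norm (\<Sum>n\<in>B. ee (g (of_int n))) \<le> 2 / \<theta>"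
      proof (cases "p' \<le> q'")
        case True
        then have pq: "p' \<in> B" "q' \<in> B" by (auto simp: B)
        have rng: "real_of_int a \<le> u" "u \<le> real_of_int b" if "u \<in> {real_of_int p'..real_of_int q'}" for u
          using pq that by (auto simp: B_def)
        have lohi: "of_int k + \<theta> \<le> g1 u \<and> g1 u \<le> of_int k + 1 - \<theta>"
          if u: "u \<in> {real_of_int p'..real_of_int q'}" for u
        proof -
          have "g1 p' \<le> g1 u" "g1 u \<le> g1 q'"
            using u rng[OF u] pq by (auto intro!: mono simp: B_def)
          moreover have pq': "of_int k + 2 * \<theta> \<le> \<gamma> p'" "\<lfloor>\<gamma> q'\<rfloor> = k"
            using pq by (auto simp: B_def \<kappa>_def)
          moreover have "\<gamma> q' < of_int k + 1" using pq'(2) by linarith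
          ultimately show ?thesis unfolding \<gamma>_def by linarith
        qed
        have "norm (esum g p' q') \<le> 2 / \<theta>"
        proof (rule Kusmin_Landau)
          show "(g has_real_derivative g1 u) (at u)" if "u \<in> {real_of_int p'..real_of_int q'}" for u
            using rng[OF that] by (intro d1) auto
          show "g1 u \<le> g1 w" if "real_of_int p' \<le> u" "u \<le> w" "w \<le> real_of_int q'" for u w
            using that rng[of u] rng[of w] by (intro mono) auto
        qed (use lohi th th0 in auto)
        then show ?thesis by (simp add: B esum_def)
      qed (use th0 in \<open>auto simp: B\<close>)
      have "norm (\<Sum>n\<in>A \<union> B. ee (g (of_int n))) \<le> (2 / \<theta> + 1) + 2 / \<theta>"
        unfolding sum.union_disjoint[OF fin un(2)] by (intro order_trans[OF norm_triangle_ineq] add_mono nA nB)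
      also have "\<dots> \<le> 5 / \<theta>"
      proof -
        have "1 \<le> 1 / \<theta>" using th th0(1) by simp
        then show ?thesis by simp
      qed
      finally show ?thesis unfolding un .
    qed
    have kab: "\<kappa> a \<le> \<kappa> b" using kmono[of a b] ab by simp
    have "norm (esum g a b) \<le> of_int (\<kappa> b - \<kappa> a + 1) * (5 / \<theta>)"
      unfolding esum_def
      by (rule norm_sum_fibres_le[where \<kappa> = \<kappa>]) (use cls kmono kab in auto)
    also have "of_int (\<kappa> b - \<kappa> a + 1) * (5 / \<theta>) \<le> (c * lam * N + 2) * (5 / \<theta>)"
    proof (rule mult_right_mono)
      have "g1 b - g1 a \<le> c * lam * (of_int b - of_int a)" using ab by (intro g1m) auto
      also have "\<dots> \<le> c * lam * N" using N c lam0 by (intro mult_left_mono) auto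
      finally show "of_int (\<kappa> b - \<kappa> a + 1) \<le> c * lam * N + 2"
        unfolding \<kappa>_def \<gamma>_def by linarith
    qed (use th0(1) in auto)
    also have "(c * lam * N + 2) * (5 / \<theta>) = 5 * c * (N * \<theta>) + 10 * (1 / \<theta>)"
      using th0(1) by (simp add: field_simps flip: th0(2))
    also have "\<dots> \<le> 10 * c * (N * \<theta>) + 10 * c * (1 / \<theta>)"
      using th0(1) c N by (intro add_mono mult_right_mono) auto
    also have "\<dots> = 10 * c * (N * \<theta> + 1 / \<theta>)" by (simp add: ring_distribs)
    finally show ?thesis by (simp add: \<theta>_def)
  qed
qed

text \<open>The sum is averaged over \<open>Q\<close> translates, and Cauchy--Schwarz is applied to
  the outer variable, which takes b - a + Q values. Expanding the square leaves correlations that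
  depend only on the difference of the two shifts.\<close>

lemma Weyl_van_der_Corput:
  assumes ab: "a \<le> b" and Q: "1 \<le> Q"
  shows "(norm (esum g a b))\<^sup>2 \<le> (of_int (b - a + 1) + real Q) / real Q *
    (of_int (b - a + 1) + 2 * (\<Sum>q=1..<Q. norm (esum (\<lambda>u. g (u + real q) - g u) a (b - int q))))"
proof -
  define z where "z n = (if n \<in> {a..b} then ee (g (of_int n)) else 0)" for n
  \<comment> \<open>The \<open>m\<close> for which some \<open>m + i\<close> with
    \<open>i < Q\<close> lies in [a, b]. Since \<open>z\<close> vanishes outside [a, b], every
    translate gives the complete sum.\<close>
  define M where "M = {a - int Q + 1..b}"
  define T where "T q = norm (esum (\<lambda>u. g (u + real q) - g u) a (b - int q))" for q
  have cardM: "real (card M) = of_int (b - a + Q)" using ab Q by (simp add: M_def)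
  have shift: "(\<Sum>m\<in>M. F (m + int j)) = (\<Sum>n\<in>{a..b - int d}. F n)"
    if "j < Q" and F: "\<And>n. n \<notin> {a..b - int d} \<Longrightarrow> F n = 0" for j d and F :: "int \<Rightarrow> complex"
  proof -
    have "(\<Sum>m\<in>M. F (m + int j)) = (\<Sum>n\<in>(\<lambda>m. m + int j) ` M. F n)"
      by (simp add: sum.reindex inj_on_def)
    also have "(\<lambda>m. m + int j) ` M = {a - int Q + 1 + int j..b + int j}"
      by (simp add: M_def add.commute)
    also have "(\<Sum>n\<in>\<dots>. F n) = (\<Sum>n\<in>{a..b - int d}. F n)"
      using that by (intro sum.mono_neutral_right) auto
    finally show ?thesis .
  qed
  have "(\<Sum>m\<in>M. \<Sum>i<Q. z (m + int i)) = (\<Sum>i<Q. \<Sum>m\<in>M. z (m + int i))"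
    by (rule sum.swap)
  also have "\<dots> = (\<Sum>i<Q. esum g a b)"
  proof (intro sum.cong refl)
    fix i assume "i \<in> {..<Q}"
    then have "(\<Sum>m\<in>M. z (m + int i)) = (\<Sum>n\<in>{a..b - int 0}. z n)"
      by (intro shift) (auto simp: z_def)
    also have "\<dots> = esum g a b" unfolding esum_def by (intro sum.cong) (auto simp: z_def)
    finally show "(\<Sum>m\<in>M. z (m + int i)) = esum g a b" .
  qed
  finally have "of_nat Q * esum g a b = (\<Sum>m\<in>M. \<Sum>i<Q. z (m + int i))" by simp
  then have "(real Q * norm (esum g a b))\<^sup>2 = (norm (\<Sum>m\<in>M. \<Sum>i<Q. z (m + int i)))\<^sup>2"
    by (metis norm_mult norm_of_nat)
  also have "\<dots> \<le> (\<Sum>m\<in>M. norm (\<Sum>i<Q. z (m + int i)))\<^sup>2"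
    by (intro power_mono norm_sum) auto
  also have "\<dots> \<le> (\<Sum>m\<in>M. (norm (\<Sum>i<Q. z (m + int i)))\<^sup>2) * of_int (b - a + Q)"
    using sum_squared_le_sum_of_squares[of "\<lambda>m. norm (\<Sum>i<Q. z (m + int i))" M] by (simp add: cardM)
  also have "(\<Sum>m\<in>M. (norm (\<Sum>i<Q. z (m + int i)))\<^sup>2) \<le> (\<Sum>i<Q. \<Sum>j<Q. T (nat \<bar>int i - int j\<bar>))"
  proof -
    define C where "C i j = (\<Sum>m\<in>M. z (m + int i) * cnj (z (m + int j)))" for i j
    have C1: "norm (C i j) = T (i - j)" if "j \<le> i" "i < Q" for i j
    proof -
      have "C i j = (\<Sum>m\<in>M. (\<lambda>n. z (n + int (i - j)) * cnj (z n)) (m + int j))"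
        using that by (simp add: C_def add_ac of_nat_diff)
      also have "\<dots> = (\<Sum>n\<in>{a..b - int (i - j)}. z (n + int (i - j)) * cnj (z n))"
        using that by (intro shift) (auto simp: z_def)
      also have "\<dots> = esum (\<lambda>u. g (u + real (i - j)) - g u) a (b - int (i - j))"
        unfolding esum_def by (intro sum.cong refl) (auto simp: z_def ee_diff simp del: of_nat_diff)
      finally show ?thesis by (simp add: T_def)
    qed
    have C2: "norm (C i j) = T (nat \<bar>int i - int j\<bar>)" if "i < Q" "j < Q" for i j
    proof (cases "j \<le> i")
      case True
      then have "nat \<bar>int i - int j\<bar> = i - j" by simp
      then show ?thesis using C1[OF True that(1)] by metis
    next
      case False
      have "C i j = cnj (C j i)" by (simp add: C_def mult.commute)
      moreover have "nat \<bar>int i - int j\<bar> = j - i" using False by simp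
      ultimately show ?thesis using C1[of i j] that False by simp
    qed
    have "complex_of_real (\<Sum>m\<in>M. (norm (\<Sum>i<Q. z (m + int i)))\<^sup>2)
        = (\<Sum>m\<in>M. (\<Sum>i<Q. z (m + int i)) * cnj (\<Sum>i<Q. z (m + int i)))"
      by (simp only: of_real_sum complex_norm_square)
    also have "\<dots> = (\<Sum>m\<in>M. \<Sum>i<Q. \<Sum>j<Q. z (m + int i) * cnj (z (m + int j)))"
      by (simp only: cnj_sum sum_product)
    also have "\<dots> = (\<Sum>i<Q. \<Sum>m\<in>M. \<Sum>j<Q. z (m + int i) * cnj (z (m + int j)))"
      by (rule sum.swap)
    also have "\<dots> = (\<Sum>i<Q. \<Sum>j<Q. C i j)"
      unfolding C_def by (intro sum.cong[OF refl]) (rule sum.swap)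
    finally have e: "complex_of_real (\<Sum>m\<in>M. (norm (\<Sum>i<Q. z (m + int i)))\<^sup>2) = (\<Sum>i<Q. \<Sum>j<Q. C i j)" .
    have "(\<Sum>m\<in>M. (norm (\<Sum>i<Q. z (m + int i)))\<^sup>2) = norm (complex_of_real (\<Sum>m\<in>M. (norm (\<Sum>i<Q. z (m + int i)))\<^sup>2))"
      unfolding norm_of_real by (rule abs_of_nonneg[symmetric]) (intro sum_nonneg zero_le_power2)
    also have "\<dots> = norm (\<Sum>i<Q. \<Sum>j<Q. C i j)" unfolding e ..
    also have "\<dots> \<le> (\<Sum>i<Q. \<Sum>j<Q. norm (C i j))"
      by (intro order_trans[OF norm_sum] sum_mono norm_sum)
    also have "\<dots> = (\<Sum>i<Q. \<Sum>j<Q. T (nat \<bar>int i - int j\<bar>))"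
      by (intro sum.cong refl) (auto simp: C2)
    finally show ?thesis .
  qed
  also have "\<dots> \<le> Q * (T 0 + 2 * (\<Sum>q=1..<Q. T q))"
    by (rule sum_diff_indices_le) (simp add: T_def)
  also have "T 0 = of_int (b - a + 1)"
  proof -
    have "esum (\<lambda>u. g (u + real 0) - g u) a (b - int 0) = of_int (b - a + 1)"
      using ab by (simp add: esum_def)
    then have "T 0 = \<bar>of_int (b - a + 1)\<bar>" unfolding T_def by (simp only: norm_of_int)
    then show ?thesis using ab by simp
  qed
  finally have "(real Q * norm (esum g a b))\<^sup>2
      \<le> real Q * (of_int (b - a + 1) + 2 * (\<Sum>q=1..<Q. T q)) * of_int (b - a + Q)"
    using ab by (simp add: mult_right_mono)
  also have "\<dots> \<le> real Q * (of_int (b - a + 1) + 2 * (\<Sum>q=1..<Q. T q)) * (of_int (b - a + 1) + Q)"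
    using ab by (intro mult_left_mono mult_nonneg_nonneg add_nonneg_nonneg sum_nonneg) (auto simp: T_def)
  finally have "real Q * (real Q * (norm (esum g a b))\<^sup>2) \<le>
      real Q * ((of_int (b - a + 1) + 2 * (\<Sum>q=1..<Q. T q)) * (of_int (b - a + 1) + Q))"
    by (simp add: power_mult_distrib power2_eq_square mult_ac)
  then have "real Q * (norm (esum g a b))\<^sup>2 \<le>
      (of_int (b - a + 1) + 2 * (\<Sum>q=1..<Q. T q)) * (of_int (b - a + 1) + Q)"
    using Q by (simp add: mult_le_cancel_left_pos)
  then show ?thesis using Q by (simp add: T_def field_simps)
qed

lemma sum_inverse_sqrt_le: "(\<Sum>q=1..n. 1 / sqrt (real q)) \<le> 2 * sqrt (real n)"
proof (induction n)
  case (Suc n)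
  have "1 = (sqrt (Suc n) - sqrt n) * (sqrt (Suc n) + sqrt n)"
    by (simp add: algebra_simps)
  also have "\<dots> \<le> (sqrt (Suc n) - sqrt n) * (2 * sqrt (Suc n))"
    by (intro mult_left_mono) auto
  finally have "1 / sqrt (Suc n) \<le> 2 * sqrt (Suc n) - 2 * sqrt n"
    by (simp add: field_simps)
  then show ?case using Suc by simp
qed simp

text \<open>In the predicate \<open>G j t g a b\<close>, \<open>g\<close> is a \<open>j\<close>-fold difference of the original phase and \<open>t\<close>
  is the product of \<open>t0\<close> with the shifts used; the \<open>j\<close>-th differencing step uses shifts up to
  \<open>Z ^ 2 ^ j\<close>. The factor \<open>1 + sqrt (T / t)\<close> permits estimates which deteriorate for small shifts
  and disappears on average.\<close>

lemma iterated_Weyl: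
  fixes G :: "nat \<Rightarrow> real \<Rightarrow> (real \<Rightarrow> real) \<Rightarrow> int \<Rightarrow> int \<Rightarrow> bool"
  assumes Z: "1 \<le> Z" "Z ^ (2 ^ m) \<le> N" and t0: "0 < t0" and C: "20 \<le> C"
    and pos: "\<And>j t g a b. j \<le> m \<Longrightarrow> G j t g a b \<Longrightarrow> 0 < t \<and> real_of_int (b - a + 1) \<le> N"
    and step: "\<And>j t g a b q. j < m \<Longrightarrow> G j t g a b \<Longrightarrow> a \<le> b \<Longrightarrow> 1 \<le> q \<Longrightarrow> real q \<le> Z ^ (2 ^ Suc j) \<Longrightarrow>
      int q \<le> b - a \<Longrightarrow> G (Suc j) (t * real q) (\<lambda>u. g (u + real q) - g u) a (b - int q)"
    and final: "\<And>t g a b. G m t g a b \<Longrightarrow> a \<le> b \<Longrightarrow> norm (esum g a b) \<le>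
      C * (N / Z ^ (2 ^ m)) * (1 + sqrt (t0 * Z ^ (2 ^ Suc m - 2) / t))"
    and G0: "G 0 t0 g a b"
  shows "norm (esum g a b) \<le> 2 * C * (N / Z)"
proof -
  \<comment> \<open>Because 2 + 4 + ... + 2 ^ j = 2 ^ (j + 1) - 2, this is the largest value that
    \<open>t\<close> can have after \<open>j\<close> steps.\<close>
  define T where "T j = t0 * Z ^ (2 ^ Suc j - 2)" for j
  have Tpos: "0 < T j" for j using t0 Z by (simp add: T_def)
  have N0: "0 < N" using Z one_le_power[of Z "2 ^ m"] by linarith
  have T_Suc: "T (Suc j) = T j * Z ^ (2 ^ Suc j)" for j
  proof -
    have "(2::nat) ^ Suc (Suc j) - 2 = (2 ^ Suc j - 2) + 2 ^ Suc j" by simp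
    then show ?thesis unfolding T_def by (simp only: power_add mult.assoc)
  qed
  \<comment> \<open>Downward induction from \<open>m\<close>. A step takes a square root, which
    turns the saving Z ^ (2 ^ (j + 1)) into Z ^ (2 ^ j) and keeps the shape of the bound.\<close>
  have main: "norm (esum g a b) \<le> C * (N / Z ^ (2 ^ j)) * (1 + sqrt (T j / t))"
    if "j \<le> m" "G j t g a b" "a \<le> b" for j t g a b
    using that
  proof (induction j arbitrary: t g a b rule: inc_induct)
    case base
    then show ?case using final[of t g a b] by (simp only: T_def)
  next
    case (step j)
    define Zj where "Zj = Z ^ (2 ^ Suc j)"
    have Zj: "1 \<le> Zj" "Zj \<le> N"
    proof -
      show "1 \<le> Zj" using Z by (simp add: Zj_def one_le_power)
      have "Zj \<le> Z ^ (2 ^ m)"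
        unfolding Zj_def using Z step.hyps by (intro power_increasing power_increasing) auto
      then show "Zj \<le> N" using Z by simp
    qed
    have tp: "0 < t" and len: "real_of_int (b - a + 1) \<le> N"
      using pos[of j t g a b] step by auto
    define Q where "Q = nat \<lfloor>Zj\<rfloor>"
    have Q: "1 \<le> Q" "real Q \<le> Zj" "Zj \<le> 2 * real Q"
    proof -
      have fl: "1 \<le> \<lfloor>Zj\<rfloor>" using Zj by (simp add: le_floor_iff)
      then have "real Q = of_int \<lfloor>Zj\<rfloor>" by (simp add: Q_def)
      moreover have "of_int \<lfloor>Zj\<rfloor> \<le> Zj" "Zj < of_int \<lfloor>Zj\<rfloor> + 1" "1 \<le> real_of_int \<lfloor>Zj\<rfloor>"
        using fl by linarith+
      ultimately show "1 \<le> Q" "real Q \<le> Zj" "Zj \<le> 2 * real Q" by linarith+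
    qed
    define s where "s = sqrt (T j / t)"
    have s0: "0 \<le> s" using Tpos[of j] tp by (simp add: s_def)
    have each: "norm (esum (\<lambda>u. g (u + real q) - g u) a (b - int q)) \<le> C * (N / Zj) * (1 + s * sqrt Zj * (1 / sqrt q))"
      if q: "q \<in> {1..<Q}" for q
    proof (cases "int q \<le> b - a")
      case True
      have "norm (esum (\<lambda>u. g (u + real q) - g u) a (b - int q))
          \<le> C * (N / Z ^ (2 ^ Suc j)) * (1 + sqrt (T (Suc j) / (t * real q)))"
      proof (rule step.IH)
        show "G (Suc j) (t * real q) (\<lambda>u. g (u + real q) - g u) a (b - int q)"
          using q True step Q by (intro assms(6)) (auto simp: Zj_def)
      qed (use True in auto)
      also have "sqrt (T (Suc j) / (t * real q)) = s * sqrt Zj * (1 / sqrt q)"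
        by (simp add: T_Suc s_def Zj_def real_sqrt_divide real_sqrt_mult)
      finally show ?thesis by (simp add: Zj_def)
    next
      case False
      then show ?thesis using C N0 Zj s0 by simp
    qed
    have "(\<Sum>q=1..<Q. norm (esum (\<lambda>u. g (u + real q) - g u) a (b - int q)))
        \<le> (\<Sum>q=1..<Q. C * (N / Zj) * (1 + s * sqrt Zj * (1 / sqrt q)))"
      by (rule sum_mono) (rule each)
    also have "\<dots> = C * (N / Zj) * (real (Q - 1) + s * sqrt Zj * (\<Sum>q=1..<Q. 1 / sqrt q))"
    proof -
      have "(\<Sum>q=1..<Q. 1 + s * sqrt Zj * (1 / sqrt q)) = real (Q - 1) + s * sqrt Zj * (\<Sum>q=1..<Q. 1 / sqrt q)"
        by (simp only: sum.distrib sum_distrib_left[symmetric] sum_constant card_atLeastLessThan mult_1_right)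
      then show ?thesis by (simp only: sum_distrib_left[symmetric])
    qed
    also have "\<dots> \<le> C * (N / Zj) * (Zj + s * sqrt Zj * (2 * sqrt Zj))"
    proof -
      have "{1..<Q} = {1..Q-1}" using Q by auto
      then have "(\<Sum>q=1..<Q. 1 / sqrt (real q)) \<le> 2 * sqrt (real (Q - 1))"
        using sum_inverse_sqrt_le[of "Q - 1"] by simp
      also have "\<dots> \<le> 2 * sqrt Zj" using Q by simp
      finally show ?thesis
        using C N0 Zj s0 Q by (intro mult_left_mono add_mono mult_nonneg_nonneg) auto
    qed
    also have "\<dots> = C * N * (1 + 2 * s)"
      using Zj by (simp add: field_simps)
    finally have sum_le: "(\<Sum>q=1..<Q. norm (esum (\<lambda>u. g (u + real q) - g u) a (b - int q))) \<le> C * N * (1 + 2 * s)" .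
    have "(norm (esum g a b))\<^sup>2 \<le> (of_int (b - a + 1) + real Q) / real Q *
        (of_int (b - a + 1) + 2 * (\<Sum>q=1..<Q. norm (esum (\<lambda>u. g (u + real q) - g u) a (b - int q))))"
      by (rule Weyl_van_der_Corput) (use step Q in auto)
    also have "\<dots> \<le> (2 * N) / (Zj / 2) * (N + 2 * (C * N * (1 + 2 * s)))"
      using len Q Zj sum_le step.prems
      by (intro mult_mono frac_le add_mono mult_left_mono add_nonneg_nonneg mult_nonneg_nonneg sum_nonneg divide_nonneg_nonneg) auto
    also have "\<dots> = N\<^sup>2 / Zj * (4 + 8 * C + 16 * C * s)"
      using Zj by (simp add: field_simps power2_eq_square)
    \<comment> \<open>Here \<open>20 \<le> C\<close> lets the constant reproduce itself, so that it
      does not grow with the number of steps.\<close>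
    also have "\<dots> \<le> N\<^sup>2 / Zj * (C * (1 + s))\<^sup>2"
    proof (rule mult_left_mono)
      have "4 + 8 * C + 16 * C * s \<le> C * C + 2 * (C * C) * s"
      proof (rule add_mono)
        show "4 + 8 * C \<le> C * C" using C mult_right_mono[of 20 C C] by linarith
        have "16 * C \<le> 2 * (C * C)" using C mult_right_mono[of 20 C C] by linarith
        then show "16 * C * s \<le> 2 * (C * C) * s" using s0 by (rule mult_right_mono)
      qed
      also have "\<dots> \<le> (C * (1 + s))\<^sup>2"
        using s0 C by (simp add: power2_eq_square algebra_simps)
      finally show "4 + 8 * C + 16 * C * s \<le> (C * (1 + s))\<^sup>2" .
    qed (use Zj in simp)
    also have "\<dots> = (C * (N / Z ^ (2 ^ j)) * (1 + s))\<^sup>2"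
      by (simp add: Zj_def power_mult_distrib power_divide mult.commute[of 2] power_mult)
    finally show ?case
      unfolding s_def[symmetric] using C N0 Z s0 by (intro power2_le_imp_le[of "norm _"]) auto
  qed
  show ?thesis
  proof (cases "a \<le> b")
    case True
    show ?thesis using main[OF _ G0 True] t0 by (simp add: T_def mult_ac)
  next
    case False
    then show ?thesis using C N0 Z by simp
  qed
qed

subsection \<open>Sums of fractional parts\<close>

definition psi :: "real \<Rightarrow> real" where
  "psi x = frac x - 1/2"

lemma abs_psi_le: "\<bar>psi x\<bar> \<le> 1/2"
  using frac_ge_0[of x] frac_lt_1[of x] unfolding psi_def abs_le_iff by linarith

text \<open>Reflection and translation permute the residues. The smoothing kernel below runs over a
  period centred at 0, the Fourier coefficients over the residues from 0 on.\<close>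

lemma sum_int_periodic:
  fixes F :: "int \<Rightarrow> 'a::comm_monoid_add"
  assumes M: "0 < M" and per: "\<And>n. F (n mod M) = F n"
  shows "(\<Sum>s\<in>{p..<p + M}. F (c - s)) = (\<Sum>r\<in>{0..<M}. F r)"
proof -
  have "(\<Sum>r\<in>{0..<M}. F r) = (\<Sum>s\<in>{p..<p + M}. F ((c - s) mod M))"
  proof (rule sum.reindex_bij_betw[symmetric])
    show "bij_betw (\<lambda>s. (c - s) mod M) {p..<p + M} {0..<M}"
    proof (rule bij_betw_byWitness[where f' = "\<lambda>r. p + (c - r - p) mod M"])
      show "\<forall>s\<in>{p..<p + M}. p + (c - (c - s) mod M - p) mod M = s"
      proof
        fix s assume s: "s \<in> {p..<p + M}"
        have "(c - (c - s) mod M - p) mod M = (c - p - (c - s) mod M) mod M"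
          by (rule arg_cong[where f = "\<lambda>x. x mod M"]) simp
        also have "\<dots> = (c - p - (c - s)) mod M" by (rule mod_diff_right_eq)
        also have "\<dots> = (s - p) mod M"
          by (rule arg_cong[where f = "\<lambda>x. x mod M"]) simp
        also
        have "\<dots> = s - p" using s by (intro mod_pos_pos_trivial) auto
        finally show "p + (c - (c - s) mod M - p) mod M = s" by simp
      qed
      show "\<forall>r\<in>{0..<M}. (c - (p + (c - r - p) mod M)) mod M = r"
      proof
        fix r assume r: "r \<in> {0..<M}"
        have "(c - (p + (c - r - p) mod M)) mod M = (c - p - (c - r - p) mod M) mod M"
          by (rule arg_cong[where f = "\<lambda>x. x mod M"]) simp
        also have "\<dots> = (c - p - (c - r - p)) mod M" by (rule mod_diff_right_eq)
        also have "\<dots> = r mod M"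
          by (rule arg_cong[where f = "\<lambda>x. x mod M"]) simp
        also have "\<dots> = r" using r by simp
        finally show "(c - (p + (c - r - p) mod M)) mod M = r" .
      qed
    qed (use M in \<open>auto simp: pos_mod_bound\<close>)
  qed
  then show ?thesis by (simp add: per)
qed

lemma sum_int_atLeast0: "(\<Sum>r\<in>{0..<int M}. F r) = (\<Sum>r<M. F (int r))"
proof -
  have "{0..<int M} = int ` {..<M}"
    by (simp add: lessThan_atLeast0 image_int_atLeastLessThan)
  then show ?thesis by (simp add: sum.reindex)
qed

text \<open>This evaluates the Fourier coefficients of the sawtooth on a cyclic group.\<close>

lemma sum_index_power_root_unity:
  fixes z :: complex
  assumes "z ^ M = 1" "z \<noteq> 1"
  shows "(\<Sum>r<M. of_nat r * z ^ r) = of_nat M / (z - 1)"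
proof -
  have "(z - 1) * (\<Sum>r<n. of_nat r * z ^ r) = of_nat n * z ^ n - z * (\<Sum>r<n. z ^ r)" for n
    by (induction n) (simp_all add: algebra_simps)
  from this[of M] have "(z - 1) * (\<Sum>r<M. of_nat r * z ^ r) = of_nat M"
    using assms by (simp add: geometric_sum)
  then show ?thesis using assms by (simp add: field_simps)
qed

lemma sum_inverse_squares_le:
  assumes "1 \<le> w"
  shows "(\<Sum>s\<in>{w<..n}. 1 / (real s)\<^sup>2) \<le> 1 / real w"
proof -
  have "(\<Sum>s\<in>{w<..n}. 1 / (real s)\<^sup>2) \<le> 1 / real w - 1 / real n" if "w \<le> n" for n
    using that
  proof (induction n rule: dec_induct)
    case (step n)
    have "{w<..Suc n} = insert (Suc n) {w<..n}" using step by auto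
    moreover have "1 / (real (Suc n))\<^sup>2 \<le> 1 / real n - 1 / real (Suc n)"
    proof -
      have n: "0 < real n" using step assms by simp
      have "1 / (real (Suc n))\<^sup>2 \<le> 1 / (real n * real (Suc n))"
        using n by (intro divide_left_mono) (auto simp: power2_eq_square)
      also have "\<dots> = 1 / real n - 1 / real (Suc n)" using n by (simp add: field_simps)
      finally show ?thesis .
    qed
    ultimately show ?case using step by simp
  qed simp
  from this[of n] show ?thesis by (cases "w \<le> n") (auto intro: order_trans)
qed

text \<open>A one-sided smoothing argument on the cyclic group of order \<open>M = 2 * H\<^sup>2\<close>: since \<open>\<psi>\<close> increases
  at most linearly, a large value of the sum persists on an interval of shifts to one side, on which
  the Fejer kernel of degree \<open>H\<close> has most of its mass.\<close>

lemma sum_psi_le_exponential_sums: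
  fixes x :: "'a \<Rightarrow> real"
  assumes fin: "finite A" and H: "1 \<le> H"
  shows "\<bar>\<Sum>i\<in>A. psi (x i)\<bar> \<le> 13 * (real (card A) / real H) +
    (\<Sum>h=1..<H. norm (\<Sum>i\<in>A. ee (real h * x i)) / real h)"
proof -
  \<comment> \<open>With \<open>M = 2 * H\<^sup>2\<close> and \<open>w = 4 * H\<close> the kernel
    mass outside [-w, w] is at most M / (8 * H ^ 2) = 1/4, while the sawtooth changes over 2 * w
    steps in its controlled direction by at most 2 * w / M = 4 / H per term.\<close>
  define M where "M = 2 * H\<^sup>2"
  define w where "w = 4 * H"
  define N where "N = real (card A)"
  have Mpos: "0 < M" using H by (simp add: M_def)
  have N0: "0 \<le> N" by (simp add: N_def)
  define P where "P n = of_int (n mod int M) / real M - 1/2" for n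
  define m where "m i = \<lfloor>real M * x i\<rfloor>" for i
  define D where "D j = (\<Sum>i\<in>A. P (m i + j))" for j
  have Pper: "P (n mod int M) = P n" for n by (simp add: P_def)
  have Dper: "D (n mod int M) = D n" for n
    unfolding D_def P_def by (simp add: mod_add_right_eq)
  \<comment> \<open>The one-sided control: when the argument decreases, a jump of the sawtooth goes
    upwards, so only the linear decrease u / M remains.\<close>
  have Psub: "P n - real u / real M \<le> P (n - int u)" for n u
  proof -
    have "((n - int u) mod int M + int u) mod int M \<le> (n - int u) mod int M + int u"
      using Mpos by (intro zmod_le_nonneg_dividend) simp
    then have "n mod int M \<le> (n - int u) mod int M + int u" by (simp add: mod_add_left_eq)
    then have "real_of_int (n mod int M) \<le> of_int ((n - int u) mod int M) + real u" by linarith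
    from divide_right_mono[OF this, of "real M"] show ?thesis by (simp add: P_def add_divide_distrib)
  qed
  have Dsub: "D n - real u * N / real M \<le> D (n - int u)" for n u
  proof -
    have "D n - real u * N / real M = (\<Sum>i\<in>A. P (m i + n) - real u / real M)"
      by (simp add: D_def sum_subtractf N_def)
    also have "\<dots> \<le> D (n - int u)" unfolding D_def
      by (intro sum_mono) (metis Psub add_diff_eq)
    finally show ?thesis .
  qed
  have Pdiff: "\<bar>psi (x i) - P (m i)\<bar> \<le> 1 / real M" for i
  proof -
    define k where "k = \<lfloor>x i\<rfloor>"
    have mb: "of_int (m i) \<le> real M * x i" "real M * x i < of_int (m i) + 1"
      by (auto simp: m_def)
    have k: "of_int k \<le> x i" "x i < of_int k + 1" by (auto simp: k_def)
    have "of_int (int M * k) \<le> real M * x i" using k Mpos by simp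
    then have k1: "int M * k \<le> m i" unfolding m_def by (simp add: le_floor_iff)
    have "real M * x i < of_int (int M * k + int M)"
      using mult_strict_left_mono[OF k(2), of "real M"] Mpos by (simp add: algebra_simps)
    then have k2: "m i < int M * k + int M" unfolding m_def by (simp add: floor_less_iff)
    have "m i mod int M = m i - int M * k"
    proof -
      have "m i mod int M = (m i - int M * k) mod int M"
        using mod_mult_self2[of "m i" "int M" "- k"] by simp
      also have "\<dots> = m i - int M * k" using k1 k2 by (intro mod_pos_pos_trivial) auto
      finally show ?thesis .
    qed
    then have "psi (x i) - P (m i) = (real M * x i - of_int (m i)) / real M"
      using Mpos by (simp add: psi_def P_def frac_def k_def diff_divide_distrib)
    then have "\<bar>psi (x i) - P (m i)\<bar> = (real M * x i - of_int (m i)) / real M"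
      using mb Mpos by simp
    also have "\<dots> \<le> 1 / real M" using mb by (intro divide_right_mono) auto
    finally show ?thesis .
  qed
  \<comment> \<open>The Fejer kernel of degree \<open>H\<close> on the residues mod
    \<open>M\<close>, normalised to be a probability weight on the full period \<open>I\<close> (see
    \<open>K1\<close>).\<close>
  define K where "K s = (norm (\<Sum>i<H. ee (of_int (int i * s) / real M)))\<^sup>2 / (real M * real H)" for s :: int
  define I where "I = {- int (H\<^sup>2)..<- int (H\<^sup>2) + int M}"
  define S where "S h = norm (\<Sum>i\<in>A. ee (of_int (int h * m i) / real M))" for h
  \<comment> \<open>The normalised modulus of a Fourier coefficient of the discrete sawtooth
    \<open>P\<close>. For 1 <= h < H it equals 1 / (M * |1 - z|) for a root of unity z, hence is at
    most 1 / (4 * h).\<close>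
  define c where "c h = norm (\<Sum>r<M. of_real (P (int r)) * ee (- (of_int (h * int r)) / real M)) / real M" for h :: int
  have cabs: "c (- h) = c h" for h
  proof -
    have "(\<Sum>r<M. of_real (P (int r)) * ee (- (of_int (- h * int r)) / real M))
        = cnj (\<Sum>r<M. of_real (P (int r)) * ee (- (of_int (h * int r)) / real M))"
      by (simp add: cnj_ee)
    then show ?thesis unfolding c_def by (metis complex_mod_cnj)
  qed
  have root: "ee (- (of_int h) / real M) ^ M = 1" for h
    using Mpos ee_of_int[of "- h"] by (simp add: ee_power del: ee_of_int)
  have rnz: "4 * real_of_int h / real M \<le> norm (1 - ee (- (of_int h) / real M))" if "1 \<le> h" "h < int H" for h
  proof -
    have "2 * real_of_int h \<le> real M"
    proof -
      have "h \<le> int H ^ 2" using that by (smt (verit) power2_eq_square mult_less_cancel_left1 self_le_power)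
      then have "2 * h \<le> int M" by (simp add: M_def)
      then show ?thesis by linarith
    qed
    then have "\<bar>- (of_int h) / real M\<bar> \<le> 1/2" using that Mpos by (simp add: field_simps)
    from norm_one_minus_ee_ge[OF this] show ?thesis using that Mpos by (simp add: abs_mult)
  qed
  have nz: "ee (- (of_int h) / real M) \<noteq> 1" if "1 \<le> h" "h < int H" for h
    using rnz[OF that] that Mpos by (auto simp: field_simps)
  have ch: "c (int h) \<le> 1 / (4 * real h)" if "1 \<le> h" "h < H" for h
  proof -
    define z where "z = ee (- (of_int (int h)) / real M)"
    have z: "z ^ M = 1" "z \<noteq> 1" unfolding z_def using root[of "int h"] nz[of "int h"] that by auto
    have "(\<Sum>r<M. of_real (P (int r)) * ee (- (of_int (int h * int r)) / real M))
        = (\<Sum>r<M. (of_nat r / of_nat M - 1/2) * z ^ r)"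
      by (intro sum.cong refl) (auto simp: P_def z_def ee_power mult_ac)
    also have "\<dots> = (\<Sum>r<M. of_nat r * z ^ r) / of_nat M - (\<Sum>r<M. z ^ r) / 2"
      by (simp add: sum_subtractf sum_divide_distrib left_diff_distrib)
    also have "\<dots> = 1 / (z - 1)"
      using z Mpos by (simp add: sum_index_power_root_unity geometric_sum)
    finally have "c (int h) = 1 / (norm (1 - z) * real M)"
      by (simp add: c_def norm_divide norm_minus_commute)
    also have "\<dots> \<le> 1 / (4 * real h)"
    proof -
      have "4 * real h / real M \<le> norm (1 - z)" using rnz[of "int h"] that by (simp add: z_def)
      then have "4 * real h \<le> norm (1 - z) * real M" using Mpos by (simp add: pos_divide_le_eq)
      then show ?thesis using that by (intro frac_le) auto
    qed
    finally show ?thesis .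
  qed
  have c0: "c 0 \<le> 1 / (2 * real M)"
  proof -
    have g: "(\<Sum>r<n. of_nat r) = (of_nat n * (of_nat n - 1) / 2 :: complex)" for n
      by (induction n) (auto simp: field_simps)
    have "(\<Sum>r<M. of_real (P (int r)) :: complex) = (\<Sum>r<M. of_nat r) / of_nat M - of_nat M / 2"
      by (simp add: P_def sum_subtractf sum_divide_distrib)
    also have "\<dots> = - 1 / 2" unfolding g using Mpos by (simp add: field_simps)
    finally have "(\<Sum>r<M. of_real (P (int r)) :: complex) = - 1 / 2" .
    then show ?thesis by (simp add: c_def norm_divide)
  qed
  have eper: "ee (- (of_int (h * (n mod int M))) / real M) = ee (- (of_int (h * n)) / real M)" for h n
  proof -
    have e: "h * (n mod int M) = h * n - int M * (h * (n div int M))"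
      by (simp add: minus_mult_div_eq_mod[symmetric] algebra_simps)
    have "- (of_int (h * (n mod int M))) / real M = - (of_int (h * n)) / real M + of_int (h * (n div int M))"
      unfolding e of_int_diff of_int_mult[of "int M"] using Mpos by (simp add: field_simps)
    then show ?thesis by (simp only: ee_add_int)
  qed
  have conv: "norm (\<Sum>s\<in>I. of_real (D (j - s)) * ee (of_int (h * s) / real M))
      = real M * c h * S (nat \<bar>h\<bar>)" for j h
  proof -
    have "(\<Sum>s\<in>I. of_real (P (k - s)) * ee (of_int (h * s) / real M))
        = ee (of_int (h * k) / real M) * (\<Sum>r<M. of_real (P (int r)) * ee (- (of_int (h * int r)) / real M))" for k
    proof -
      define F where "F n = of_real (P n) * ee (- (of_int (h * n)) / real M)" for n
      have Fper: "F (n mod int M) = F n" for n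
        unfolding F_def Pper eper ..
      have "(\<Sum>s\<in>I. of_real (P (k - s)) * ee (of_int (h * s) / real M))
          = (\<Sum>s\<in>I. ee (of_int (h * k) / real M) * F (k - s))"
        by (intro sum.cong refl) (simp add: F_def ee_add[symmetric] algebra_simps diff_divide_distrib add_divide_distrib)
      also have "\<dots> = ee (of_int (h * k) / real M) * (\<Sum>r\<in>{0..<int M}. F r)"
        using sum_int_periodic[where M = "int M" and F = F and p = "- int (H\<^sup>2)" and c = k] Fper Mpos
        unfolding I_def sum_distrib_left[symmetric] by simp
      finally show ?thesis by (simp add: sum_int_atLeast0 F_def)
    qed
    note inner = this
    have "(\<Sum>s\<in>I. of_real (D (j - s)) * ee (of_int (h * s) / real M))
        = (\<Sum>i\<in>A. \<Sum>s\<in>I. of_real (P ((m i + j) - s)) * ee (of_int (h * s) / real M))"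
      by (subst sum.swap) (simp add: D_def sum_distrib_right add_diff_eq)
    also have "\<dots> = (\<Sum>i\<in>A. ee (of_int (h * m i) / real M) * (ee (of_int (h * j) / real M) *
        (\<Sum>r<M. of_real (P (int r)) * ee (- (of_int (h * int r)) / real M))))"
      unfolding inner
      by (intro sum.cong refl) (simp only: ee_add[symmetric] mult.assoc[symmetric] distrib_left of_int_add add_divide_distrib)
    also have "\<dots> = (\<Sum>i\<in>A. ee (of_int (h * m i) / real M)) * (ee (of_int (h * j) / real M) *
        (\<Sum>r<M. of_real (P (int r)) * ee (- (of_int (h * int r)) / real M)))"
      by (rule sum_distrib_right[symmetric])
    finally have e: "norm (\<Sum>s\<in>I. of_real (D (j - s)) * ee (of_int (h * s) / real M)) =
        norm (\<Sum>i\<in>A. ee (of_int (h * m i) / real M)) * (c h * real M)"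
      using Mpos by (simp add: norm_mult c_def)
    have "norm (\<Sum>i\<in>A. ee (of_int (h * m i) / real M)) = S (nat \<bar>h\<bar>)"
    proof (cases "0 \<le> h")
      case False
      then have "(\<Sum>i\<in>A. ee (of_int (h * m i) / real M)) = cnj (\<Sum>i\<in>A. ee (of_int (int (nat \<bar>h\<bar>) * m i) / real M))"
        by (simp add: cnj_ee)
      then show ?thesis unfolding S_def by (metis complex_mod_cnj)
    qed (simp add: S_def)
    with e show ?thesis by (simp only: mult_ac)
  qed
  have Kexp: "of_real (K s) = (\<Sum>i<H. \<Sum>j<H. ee (of_int ((int i - int j) * s) / real M)) / (of_nat M * of_nat H)" for s
  proof -
    have "complex_of_real (K s) = (\<Sum>i<H. ee (of_int (int i * s) / real M)) * cnj (\<Sum>i<H. ee (of_int (int i * s) / real M)) / (of_nat M * of_nat H)"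
      by (simp only: K_def of_real_divide complex_norm_square of_real_mult of_real_of_nat_eq)
    also have "(\<Sum>i<H. ee (of_int (int i * s) / real M)) * cnj (\<Sum>i<H. ee (of_int (int i * s) / real M))
        = (\<Sum>i<H. \<Sum>j<H. ee (of_int ((int i - int j) * s) / real M))"
      by (simp add: sum_product cnj_ee flip: ee_add)
         (simp add: left_diff_distrib diff_divide_distrib)
    finally show ?thesis .
  qed
  have K0: "0 \<le> K s" for s by (simp add: K_def)
  have swap: "(\<Sum>s\<in>I. of_real (F s) * of_real (K s)) = (\<Sum>i<H. \<Sum>j<H. \<Sum>s\<in>I. of_real (F s) * ee (of_int ((int i - int j) * s) / real M)) / (of_nat M * of_nat H)" for F
  proof -
    have "(\<Sum>s\<in>I. complex_of_real (F s) * of_real (K s)) = (\<Sum>s\<in>I. \<Sum>i<H. \<Sum>j<H. of_real (F s) * ee (of_int ((int i - int j) * s) / real M)) / (of_nat M * of_nat H)"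
      by (simp add: Kexp sum_distrib_left sum_divide_distrib)
    also have "(\<Sum>s\<in>I. \<Sum>i<H. \<Sum>j<H. of_real (F s) * ee (of_int ((int i - int j) * s) / real M))
        = (\<Sum>i<H. \<Sum>j<H. \<Sum>s\<in>I. of_real (F s) * ee (of_int ((int i - int j) * s) / real M))"
      by (subst sum.swap, intro sum.cong[OF refl]) (rule sum.swap)
    finally show ?thesis .
  qed
  have K1: "(\<Sum>s\<in>I. K s) = 1"
  proof -
    have z0: "(\<Sum>s\<in>I. ee (of_int (h * s) / real M)) = (if h = 0 then of_nat M else 0)"
      if "\<bar>h\<bar> < int H" for h
    proof (cases "h = 0")
      case False
      define F where "F n = ee (- (of_int (h * n)) / real M)" for n
      have Fper: "F (n mod int M) = F n" for n
        unfolding F_def eper ..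
      have "(\<Sum>s\<in>I. ee (of_int (h * s) / real M)) = (\<Sum>s\<in>I. F (0 - s))"
        by (simp add: F_def)
      also have "\<dots> = (\<Sum>r<M. F (int r))"
        using sum_int_periodic[where M = "int M" and F = F and p = "- int (H\<^sup>2)" and c = 0] Fper Mpos unfolding I_def sum_int_atLeast0 by simp
      also have "\<dots> = (\<Sum>r<M. ee (- (of_int h) / real M) ^ r)"
        by (simp add: F_def ee_power mult_ac)
      also have "\<dots> = 0"
      proof -
        have "ee (- (of_int h) / real M) \<noteq> 1"
        proof (cases "0 < h")
          case True
          then show ?thesis using nz[of h] that by simp
        next
          case neg: False
          then have "ee (- (of_int (- h)) / real M) \<noteq> 1" using nz[of "- h"] that False by simp
          moreover have "ee (- (of_int (- h)) / real M) = cnj (ee (- (of_int h) / real M))"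
            by (simp add: cnj_ee)
          ultimately show ?thesis by auto
        qed
        then show ?thesis using root[of h] by (simp add: geometric_sum)
      qed
      finally show ?thesis using False by simp
    qed (simp add: I_def)
    have "complex_of_real (\<Sum>s\<in>I. K s) = (\<Sum>s\<in>I. of_real ((\<lambda>_. 1) s) * of_real (K s))" by simp
    also have "\<dots> = (\<Sum>i<H. \<Sum>j<H. (if int i - int j = 0 then of_nat M else 0)) / (of_nat M * of_nat H)"
      unfolding swap by (intro arg_cong[of _ _ "\<lambda>x. x / _"] sum.cong refl) (subst z0[symmetric], auto)
    also have "\<dots> = 1" using Mpos H by (simp add: sum.delta)
    finally show ?thesis by (metis of_real_1 of_real_eq_iff)
  qed
  define R where "R = c 0 * S 0 + 2 * (\<Sum>h=1..<H. c (int h) * S h)"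
  have smooth: "\<bar>\<Sum>s\<in>I. D (j - s) * K s\<bar> \<le> R" for j
  proof -
    have c0': "0 \<le> c h" for h by (simp add: c_def)
    have "\<bar>\<Sum>s\<in>I. D (j - s) * K s\<bar> = norm (\<Sum>s\<in>I. complex_of_real (D (j - s)) * of_real (K s))"
      by (simp flip: of_real_mult of_real_sum)
    also have "\<dots> = norm (\<Sum>i<H. \<Sum>k<H. \<Sum>s\<in>I. of_real (D (j - s)) * ee (of_int ((int i - int k) * s) / real M)) / (real M * real H)"
      unfolding swap by (simp add: norm_divide norm_mult)
    also have "\<dots> \<le> (\<Sum>i<H. \<Sum>k<H. real M * (c (int (nat \<bar>int i - int k\<bar>)) * S (nat \<bar>int i - int k\<bar>))) / (real M * real H)"
    proof (rule divide_right_mono, rule order_trans[OF norm_sum], rule sum_mono,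
        rule order_trans[OF norm_sum], rule sum_mono)
      fix i k
      have "c (int i - int k) = c (int (nat \<bar>int i - int k\<bar>))"
        using cabs[of "int i - int k"] by (auto simp: abs_if)
      then show "norm (\<Sum>s\<in>I. complex_of_real (D (j - s)) * ee (of_int ((int i - int k) * s) / real M))
          \<le> real M * (c (int (nat \<bar>int i - int k\<bar>)) * S (nat \<bar>int i - int k\<bar>))"
        unfolding conv by simp
    qed simp
    also have "\<dots> = (\<Sum>i<H. \<Sum>k<H. c (int (nat \<bar>int i - int k\<bar>)) * S (nat \<bar>int i - int k\<bar>)) / real H"
      using Mpos by (simp flip: sum_distrib_left)
    also have "\<dots> \<le> real H * R / real H"
      unfolding R_def
      using sum_diff_indices_le[of "\<lambda>h. c (int h) * S h" H] c0'
      by (intro divide_right_mono) (auto simp: S_def)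
    also have "\<dots> = R" using H by simp
    finally show ?thesis .
  qed
  define \<tau> where "\<tau> = (\<Sum>s\<in>{s\<in>I. int w < \<bar>s\<bar>}. K s)"
  have tail: "\<tau> \<le> 1/4"
  proof -
    have Kb: "K s \<le> real M / (4 * real H) * (1 / (real (nat \<bar>s\<bar>))\<^sup>2)" if s: "s \<in> I" "s \<noteq> 0" for s
    proof -
      have "\<bar>real_of_int s / real M\<bar> \<le> 1/2"
      proof -
        have "2 * \<bar>s\<bar> \<le> int M" using s by (auto simp: I_def M_def)
        then have "2 * \<bar>real_of_int s\<bar> \<le> real M" by linarith
        then show ?thesis using Mpos by (simp add: field_simps)
      qed
      from norm_one_minus_ee_ge[OF this]
      have lb: "4 * \<bar>real_of_int s\<bar> / real M \<le> norm (1 - ee (of_int s / real M))" using Mpos by simp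
      have pos: "0 < 4 * \<bar>real_of_int s\<bar> / real M" using s Mpos by simp
      then have ne: "ee (of_int s / real M) \<noteq> 1" using lb by auto
      have "(\<Sum>i<H. ee (of_int (int i * s) / real M)) = (\<Sum>i<H. ee (of_int s / real M) ^ i)"
        by (simp add: ee_power)
      also have "\<dots> = (ee (of_int s / real M) ^ H - 1) / (ee (of_int s / real M) - 1)"
        using ne by (rule geometric_sum)
      finally have "norm (\<Sum>i<H. ee (of_int (int i * s) / real M)) = norm (ee (of_int s / real M) ^ H - 1) / norm (1 - ee (of_int s / real M))"
        by (simp add: norm_divide norm_minus_commute)
      also have "\<dots> \<le> 2 / (4 * \<bar>real_of_int s\<bar> / real M)"
      proof (rule frac_le)
        show "norm (ee (of_int s / real M) ^ H - 1) \<le> 2"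
          using norm_triangle_ineq4[of "ee (of_int s / real M) ^ H" 1] by (simp add: norm_power)
      qed (use lb pos in auto)
      finally have "(norm (\<Sum>i<H. ee (of_int (int i * s) / real M)))\<^sup>2 \<le> (2 / (4 * \<bar>real_of_int s\<bar> / real M))\<^sup>2"
        by (intro power_mono) auto
      then have "K s \<le> (2 / (4 * \<bar>real_of_int s\<bar> / real M))\<^sup>2 / (real M * real H)"
        unfolding K_def by (intro divide_right_mono) auto
      also have "\<dots> = real M / (4 * real H) * (1 / (real (nat \<bar>s\<bar>))\<^sup>2)"
        using Mpos H s by (simp add: field_simps power2_eq_square)
      finally show ?thesis .
    qed
    define U where "U = {w<..M}"
    have "\<tau> \<le> (\<Sum>s\<in>{s\<in>I. int w < \<bar>s\<bar>}. real M / (4 * real H) * (1 / (real (nat \<bar>s\<bar>))\<^sup>2))"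
      unfolding \<tau>_def by (intro sum_mono Kb) auto
    also have "\<dots> \<le> (\<Sum>s\<in>int ` U \<union> (\<lambda>n. - int n) ` U. real M / (4 * real H) * (1 / (real (nat \<bar>s\<bar>))\<^sup>2))"
    proof (rule sum_mono2)
      show "{s \<in> I. int w < \<bar>s\<bar>} \<subseteq> int ` U \<union> (\<lambda>n. - int n) ` U"
      proof
        fix s assume s: "s \<in> {s \<in> I. int w < \<bar>s\<bar>}"
        then have "\<bar>s\<bar> \<le> int M" by (auto simp: I_def M_def)
        then have "nat \<bar>s\<bar> \<in> U" using s by (auto simp: U_def)
        moreover have "s = int (nat \<bar>s\<bar>) \<or> s = - int (nat \<bar>s\<bar>)" by auto
        ultimately show "s \<in> int ` U \<union> (\<lambda>n. - int n) ` U" by blast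
      qed
    qed (auto simp: U_def)
    also have "\<dots> = 2 * (real M / (4 * real H) * (\<Sum>n\<in>U. 1 / (real n)\<^sup>2))"
    proof (subst sum.union_disjoint)
      show "int ` U \<inter> (\<lambda>n. - int n) ` U = {}" by (auto simp: U_def)
    qed (auto simp: U_def sum.reindex inj_on_def sum_distrib_left)
    also have "\<dots> \<le> 2 * (real M / (4 * real H) * (1 / real w))"
      unfolding U_def using H by (intro mult_left_mono sum_inverse_squares_le) (auto simp: w_def)
    also have "\<dots> = 1/4" using H by (simp add: M_def w_def field_simps power2_eq_square)
    finally show ?thesis .
  qed
  define \<beta> where "\<beta> = 2 * real w * N / real M"
  have b0: "0 \<le> \<beta>" using N0 by (simp add: \<beta>_def)
  define Dm where "Dm = Max ((\<lambda>j. \<bar>D j\<bar>) ` {0..<int M})"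
  have Dm: "\<bar>D j\<bar> \<le> Dm" for j
  proof -
    have "\<bar>D j\<bar> = \<bar>D (j mod int M)\<bar>" by (simp only: Dper)
    also have "\<dots> \<le> Dm" unfolding Dm_def using Mpos by (intro Max_ge) auto
    finally show ?thesis .
  qed
  have Dm0: "0 \<le> Dm" using Dm[of 0] by linarith
  have "Dm \<in> (\<lambda>j. \<bar>D j\<bar>) ` {0..<int M}"
    unfolding Dm_def using Mpos by (intro Max_in) auto
  then obtain j0 where j0: "Dm = \<bar>D j0\<bar>" by auto
  \<comment> \<open>If \<open>F\<close> is almost maximal on [-w, w] and at least -Dm elsewhere,
    then its mean is at least Dm * (1 - 2 * \<tau>) - \<beta>, and \<tau> <= 1/4.\<close>
  have core: "Dm / 2 - \<beta> \<le> (\<Sum>s\<in>I. F s * K s)"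
    if F1: "\<And>s. s \<in> I \<Longrightarrow> \<bar>s\<bar> \<le> int w \<Longrightarrow> Dm - \<beta> \<le> F s" and F2: "\<And>s. - Dm \<le> F s" for F
  proof -
    have fI: "finite I" by (simp add: I_def)
    have "(\<Sum>s\<in>I. F s * K s) = (\<Sum>s\<in>{s\<in>I. int w < \<bar>s\<bar>}. F s * K s) + (\<Sum>s\<in>{s\<in>I. \<not> int w < \<bar>s\<bar>}. F s * K s)"
      using fI by (subst sum.union_disjoint[symmetric]) (auto intro!: sum.cong)
    moreover have "(\<Sum>s\<in>{s\<in>I. int w < \<bar>s\<bar>}. - Dm * K s) \<le> (\<Sum>s\<in>{s\<in>I. int w < \<bar>s\<bar>}. F s * K s)"
      by (intro sum_mono mult_right_mono F2 K0)
    moreover have "(\<Sum>s\<in>{s\<in>I. int w < \<bar>s\<bar>}. - Dm * K s) = - Dm * \<tau>"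
      by (simp add: \<tau>_def sum_distrib_left sum_negf)
    moreover have "(\<Sum>s\<in>{s\<in>I. \<not> int w < \<bar>s\<bar>}. (Dm - \<beta>) * K s) \<le> (\<Sum>s\<in>{s\<in>I. \<not> int w < \<bar>s\<bar>}. F s * K s)"
      by (intro sum_mono mult_right_mono F1 K0) auto
    moreover have "(\<Sum>s\<in>{s\<in>I. \<not> int w < \<bar>s\<bar>}. (Dm - \<beta>) * K s) = (Dm - \<beta>) * (1 - \<tau>)"
    proof -
      have "\<tau> + (\<Sum>s\<in>{s\<in>I. \<not> int w < \<bar>s\<bar>}. K s) = 1"
        unfolding K1[symmetric] \<tau>_def using fI by (subst sum.union_disjoint[symmetric]) (auto intro!: sum.cong)
      then show ?thesis by (simp flip: sum_distrib_left)
    qed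
    ultimately have "- Dm * \<tau> + (Dm - \<beta>) * (1 - \<tau>) \<le> (\<Sum>s\<in>I. F s * K s)" by linarith
    moreover have "Dm * \<tau> \<le> Dm * (1/4)" using tail Dm0 by (rule mult_left_mono)
    moreover have "0 \<le> \<beta> * \<tau>" unfolding \<tau>_def by (intro mult_nonneg_nonneg b0 sum_nonneg K0)
    ultimately show ?thesis by (simp add: algebra_simps)
  qed
  \<comment> \<open>A large positive value of \<open>D\<close> persists to its left and a large
    negative value to its right. The kernel is therefore centred at \<open>j0 - w\<close> or
    \<open>j0 + w\<close>, so that its bulk covers 2 * w steps on the good side.\<close>
  have DmR: "Dm \<le> 2 * R + 2 * \<beta>"
  proof (cases "0 \<le> D j0")
    case True
    have "Dm / 2 - \<beta> \<le> (\<Sum>s\<in>I. D ((j0 - int w) - s) * K s)"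
    proof (rule core)
      fix s assume s: "s \<in> I" "\<bar>s\<bar> \<le> int w"
      have e: "j0 - int (nat (int w + s)) = j0 - int w - s" using s by simp
      have "D j0 - real (nat (int w + s)) * N / real M \<le> D (j0 - int w - s)"
        unfolding e[symmetric] by (rule Dsub)
      moreover have "real (nat (int w + s)) * N / real M \<le> \<beta>"
        unfolding \<beta>_def using s N0 by (intro divide_right_mono mult_right_mono) auto
      moreover have "Dm = D j0" using True j0 by simp
      ultimately show "Dm - \<beta> \<le> D (j0 - int w - s)" by linarith
    qed (use Dm in \<open>metis abs_le_iff minus_le_iff\<close>)
    then show ?thesis using smooth[of "j0 - int w"] by linarith
  next
    case False
    have "Dm / 2 - \<beta> \<le> (\<Sum>s\<in>I. - D ((j0 + int w) - s) * K s)"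
    proof (rule core)
      fix s assume s: "s \<in> I" "\<bar>s\<bar> \<le> int w"
      have e: "j0 + int w - s - int (nat (int w - s)) = j0" using s by simp
      have "D (j0 + int w - s) - real (nat (int w - s)) * N / real M \<le> D j0"
        using Dsub[of "j0 + int w - s" "nat (int w - s)"] unfolding e .
      moreover have "real (nat (int w - s)) * N / real M \<le> \<beta>"
        unfolding \<beta>_def using s N0 by (intro divide_right_mono mult_right_mono) auto
      moreover have "Dm = - D j0" using False j0 by simp
      ultimately show "Dm - \<beta> \<le> - D (j0 + int w - s)" by linarith
    qed (use Dm in \<open>simp add: abs_le_iff\<close>)
    also have "(\<Sum>s\<in>I. - D ((j0 + int w) - s) * K s) = - (\<Sum>s\<in>I. D ((j0 + int w) - s) * K s)"
      by (simp add: sum_negf)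
    finally show ?thesis using smooth[of "j0 + int w"] by linarith
  qed
  \<comment> \<open>Returning from the rounded points \<open>m i / M\<close> to \<open>x i\<close>
    costs at most 2 * pi * h / M per term.\<close>
  have Sh: "S h \<le> norm (\<Sum>i\<in>A. ee (real h * x i)) + N * (2 * pi * real h / real M)" for h
  proof -
    have "norm ((\<Sum>i\<in>A. ee (of_int (int h * m i) / real M)) - (\<Sum>i\<in>A. ee (real h * x i)))
        \<le> (\<Sum>i\<in>A. 2 * pi * real h / real M)"
      unfolding sum_subtractf[symmetric]
    proof (intro order_trans[OF norm_sum] sum_mono)
      fix i
      have "of_int (m i) \<le> real M * x i" "real M * x i < of_int (m i) + 1" by (auto simp: m_def)
      then have ab: "\<bar>of_int (m i) - real M * x i\<bar> \<le> 1" by linarith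
      have "of_int (m i) / real M - x i = (of_int (m i) - real M * x i) / real M"
        using Mpos by (simp add: diff_divide_distrib)
      then have "\<bar>of_int (m i) / real M - x i\<bar> = \<bar>of_int (m i) - real M * x i\<bar> / real M"
        by (simp only: abs_divide abs_of_nat)
      also have "\<dots> \<le> 1 / real M" using ab by (intro divide_right_mono) auto
      finally have "\<bar>of_int (m i) / real M - x i\<bar> \<le> 1 / real M" .
      then have "real h * \<bar>of_int (m i) / real M - x i\<bar> \<le> real h * (1 / real M)" by (rule mult_left_mono) simp
      moreover have "of_int (int h * m i) / real M - real h * x i = real h * (of_int (m i) / real M - x i)"
        by (simp add: right_diff_distrib)
      ultimately have le: "\<bar>of_int (int h * m i) / real M - real h * x i\<bar> \<le> real h / real M"
        by (simp only: abs_mult abs_of_nat times_divide_eq_right mult_1_right)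
      have "norm (ee (of_int (int h * m i) / real M) - ee (real h * x i)) \<le> 2 * pi * \<bar>of_int (int h * m i) / real M - real h * x i\<bar>"
        by (rule norm_ee_diff_le)
      also have "\<dots> \<le> 2 * pi * (real h / real M)" using le by (intro mult_left_mono) auto
      finally show "norm (ee (of_int (int h * m i) / real M) - ee (real h * x i)) \<le> 2 * pi * real h / real M" by simp
    qed
    then have "norm ((\<Sum>i\<in>A. ee (of_int (int h * m i) / real M)) - (\<Sum>i\<in>A. ee (real h * x i))) \<le> N * (2 * pi * real h / real M)"
      by (simp add: N_def)
    then show ?thesis unfolding S_def by (rule order_trans[OF norm_triangle_sub add_left_mono])
  qed
  have "2 * R \<le> N / real M + (\<Sum>h=1..<H. norm (\<Sum>i\<in>A. ee (real h * x i)) / real h) + 4 * (N / real H)"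
  proof -
    have "c 0 * S 0 \<le> 1 / (2 * real M) * N"
      using c0 N0 by (intro mult_mono) (auto simp: S_def N_def)
    moreover have "(\<Sum>h=1..<H. c (int h) * S h) \<le> (\<Sum>h=1..<H. 1/4 * (norm (\<Sum>i\<in>A. ee (real h * x i)) / real h) + N * (2 * pi / (4 * real M)))"
    proof (rule sum_mono)
      fix h assume h: "h \<in> {1..<H}"
      have "c (int h) * S h \<le> 1 / (4 * real h) * (norm (\<Sum>i\<in>A. ee (real h * x i)) + N * (2 * pi * real h / real M))"
        using ch[of h] Sh[of h] h N0 by (intro mult_mono) (auto simp: S_def)
      also have "\<dots> = 1/4 * (norm (\<Sum>i\<in>A. ee (real h * x i)) / real h) + N * (2 * pi / (4 * real M))"
        using h Mpos by (simp add: field_simps)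
      finally show "c (int h) * S h \<le> \<dots>" .
    qed
    moreover have "(\<Sum>h=1..<H. 1/4 * (norm (\<Sum>i\<in>A. ee (real h * x i)) / real h) + N * (2 * pi / (4 * real M)))
        = 1/4 * (\<Sum>h=1..<H. norm (\<Sum>i\<in>A. ee (real h * x i)) / real h) + real (H - 1) * (N * (2 * pi / (4 * real M)))"
      by (simp add: sum.distrib sum_distrib_left)
    moreover have "real (H - 1) * (N * (2 * pi / (4 * real M))) \<le> N / real H"
    proof -
      have "real (H - 1) * (N * (2 * pi / (4 * real M))) \<le> real H * (N * (2 * 4 / (4 * real M)))"
        using N0 pi_less_4 by (intro mult_mono mult_left_mono divide_right_mono) auto
      also have "\<dots> = N / real H" using H by (simp add: M_def field_simps power2_eq_square)
      finally show ?thesis .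
    qed
    moreover have "0 \<le> (\<Sum>h=1..<H. norm (\<Sum>i\<in>A. ee (real h * x i)) / real h)" by (intro sum_nonneg) auto
    moreover have "0 \<le> N / real H" using N0 by simp
    ultimately show ?thesis unfolding R_def by simp
  qed
  moreover have "\<beta> = 4 * (N / real H)" using H by (simp add: \<beta>_def M_def w_def field_simps power2_eq_square)
  moreover have "\<bar>\<Sum>i\<in>A. psi (x i)\<bar> \<le> Dm + N / real M"
  proof -
    have "\<bar>(\<Sum>i\<in>A. psi (x i)) - D 0\<bar> \<le> (\<Sum>i\<in>A. 1 / real M)"
      unfolding D_def sum_subtractf[symmetric] by (intro order_trans[OF sum_abs] sum_mono) (simp add: Pdiff)
    then show ?thesis using Dm[of 0] by (simp add: N_def)
  qed
  moreover have "N / real M \<le> 1/2 * (N / real H)"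
  proof -
    have "N / real M \<le> N / (2 * real H)"
      using H N0 self_le_power[of "real H" 2] by (intro divide_left_mono) (auto simp: M_def)
    then show ?thesis by simp
  qed
  \<comment> \<open>13 = 4 + 8 + 1: the contributions of \<open>2 * R\<close>, of
    \<open>2 * \<beta>\<close>, and of two rounding terms \<open>N / M\<close>.\<close>
  ultimately have "\<bar>\<Sum>i\<in>A. psi (x i)\<bar> \<le> 13 * (N / real H) + (\<Sum>h=1..<H. norm (\<Sum>i\<in>A. ee (real h * x i)) / real h)"
    using DmR by linarith
  then show ?thesis by (simp add: N_def)
qed

text \<open>The successive derivatives are an explicit family, so that scaling and differencing can
  be applied to the whole chain at once and the induction over Weyl steps merely shortens
  it.\<close>

definition derivs :: "nat \<Rightarrow> (nat \<Rightarrow> real \<Rightarrow> real) \<Rightarrow> real set \<Rightarrow> bool" where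
  "derivs k D A \<longleftrightarrow> (\<forall>i<k. \<forall>u\<in>A. (D i has_real_derivative D (Suc i) u) (at u))"

lemma derivsD: "derivs k D A \<Longrightarrow> i < k \<Longrightarrow> u \<in> A \<Longrightarrow> (D i has_real_derivative D (Suc i) u) (at u)"
  by (simp add: derivs_def)

lemma derivs_cmult: "derivs k D A \<Longrightarrow> derivs k (\<lambda>i u. h * D i u) A"
  unfolding derivs_def by (auto intro!: DERIV_cmult)

lemma derivs_difference:
  assumes "derivs k D {a..b}" and "0 \<le> q"
  shows "derivs k (\<lambda>i u. D i (u + q) - D i u) {a..b - q}"
  unfolding derivs_def
proof (intro allI impI ballI)
  fix i u assume "i < k" "u \<in> {a..b - q}"
  then have "(D i has_real_derivative D (Suc i) (u + q)) (at (u + q))"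
    and 2: "(D i has_real_derivative D (Suc i) u) (at u)"
    using assms by (auto intro!: derivsD)
  then have "((\<lambda>u. D i (u + q)) has_real_derivative D (Suc i) (u + q)) (at u)"
    by (simp add: DERIV_shift)
  then show "((\<lambda>u. D i (u + q) - D i u) has_real_derivative D (Suc i) (u + q) - D (Suc i) u) (at u)"
    using 2 by (rule DERIV_diff)
qed

text \<open>After k - 2 Weyl steps with shift product t the second derivative has size t *
  \<Lambda>, and the second derivative test applies with the saving W = Z ^ (2 ^ (k - 2)). The
  hypothesis \<open>main\<close> makes its first term at most N / W for the largest t. The
  hypothesis \<open>sec\<close> bounds its second term for the largest t; for smaller t the loss is
  the factor sqrt (T / t) permitted by \<open>iterated_Weyl\<close>.\<close>

lemma exp_sum_derivative_test:
  assumes k: "2 \<le> k" and c: "1 \<le> c"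
    and D: "derivs k D {real_of_int a..real_of_int b}"
    and bd: "\<And>u. u \<in> {real_of_int a..real_of_int b} \<Longrightarrow> \<Lambda> \<le> D k u \<and> D k u \<le> c * \<Lambda>"
    and L: "0 < \<Lambda>" and Z: "1 \<le> Z" and N: "0 \<le> N" "real_of_int (b - a + 1) \<le> N"
    and main: "\<Lambda> * Z ^ (2 ^ k - 2) \<le> 1" and sec: "Z\<^sup>2 \<le> N\<^sup>2 * \<Lambda>"
  shows "norm (esum (D 0) a b) \<le> 40 * c * (N / Z)"
proof -
  define m where "m = k - 2"
  define W where "W = Z ^ (2 ^ m)"
  define T where "T = Z ^ (2 ^ Suc m - 2)"
  have km: "k = Suc (Suc m)" using k by (simp add: m_def)
  have W1: "1 \<le> W" and T1: "1 \<le> T" using Z by (simp_all add: W_def T_def one_le_power)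
  have WT: "W\<^sup>2 = T * Z\<^sup>2"
  proof -
    have "(2::nat) ^ m * 2 = (2 ^ Suc m - 2) + 2"
      unfolding power_Suc using one_le_power[of "2::nat" m] by linarith
    then show ?thesis unfolding W_def T_def by (metis power_add power_mult)
  qed
  have kT: "Z ^ (2 ^ k - 2) = T * W\<^sup>2"
  proof -
    have "(2::nat) ^ k - 2 = (2 ^ Suc m - 2) + 2 ^ m * 2" by (simp add: km)
    then show ?thesis unfolding W_def T_def by (metis power_add power_mult)
  qed
  have N0: "0 < N"
    using sec Z N one_le_power[of Z 2] by (cases "N = 0") auto
  have WN: "W \<le> N"
  proof -
    have "W\<^sup>2 * W\<^sup>2 = T * W\<^sup>2 * Z\<^sup>2" using WT by simp
    also have "\<dots> \<le> T * W\<^sup>2 * (N\<^sup>2 * \<Lambda>)" using sec T1 by (intro mult_left_mono) auto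
    also have "\<dots> = N\<^sup>2 * (\<Lambda> * Z ^ (2 ^ k - 2))" by (simp add: kT)
    also have "\<dots> \<le> N\<^sup>2 * 1" using main by (intro mult_left_mono) auto
    finally have "W\<^sup>2 * W\<^sup>2 \<le> N\<^sup>2" by simp
    moreover have "W\<^sup>2 * 1 \<le> W\<^sup>2 * W\<^sup>2" using W1 by (intro mult_left_mono one_le_power) auto
    ultimately have "W\<^sup>2 \<le> N\<^sup>2" by simp
    then show ?thesis using N(1) by (rule power2_le_imp_le)
  qed
  define G where "G j t g a' b' \<longleftrightarrow> (\<exists>D'. g = D' 0 \<and> derivs (k - j) D' {real_of_int a'..real_of_int b'} \<and>
      (\<forall>u\<in>{real_of_int a'..real_of_int b'}. t * \<Lambda> \<le> D' (k - j) u \<and> D' (k - j) u \<le> c * (t * \<Lambda>)) \<and>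
      real_of_int (b' - a' + 1) \<le> N \<and> 1 \<le> t \<and> t \<le> Z ^ (2 ^ Suc j - 2))" for j t g a' b'
  have "norm (esum (D 0) a b) \<le> 2 * (20 * c) * (N / Z)"
  proof (rule iterated_Weyl[where G = G and m = m and ?t0.0 = 1])
    show "G 0 1 (D 0) a b"
      unfolding G_def using D bd N by (intro exI[of _ D]) auto
  next
    fix j t g a' b' and q :: nat
    assume j: "j < m" and G: "G j t g a' b'" and ab: "a' \<le> b'" and q: "1 \<le> q" "real q \<le> Z ^ (2 ^ Suc j)"
      and qb: "int q \<le> b' - a'"
    from G obtain D' where D': "g = D' 0" "derivs (k - j) D' {real_of_int a'..real_of_int b'}"
      "\<And>u. u \<in> {real_of_int a'..real_of_int b'} \<Longrightarrow> t * \<Lambda> \<le> D' (k - j) u \<and> D' (k - j) u \<le> c * (t * \<Lambda>)"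
      "real_of_int (b' - a' + 1) \<le> N" "1 \<le> t" "t \<le> Z ^ (2 ^ Suc j - 2)"
      unfolding G_def by blast
    define k' where "k' = k - Suc j"
    have kk: "k - j = Suc k'" using j by (simp add: k'_def km)
    show "G (Suc j) (t * real q) (\<lambda>u. g (u + real q) - g u) a' (b' - int q)"
      unfolding G_def
    proof (intro exI[of _ "\<lambda>i u. D' i (u + real q) - D' i u"] conjI ballI)
      have "derivs (k - j) (\<lambda>i u. D' i (u + real q) - D' i u) {real_of_int a'..real_of_int b' - real q}"
        using D'(2) by (intro derivs_difference) auto
      then show "derivs (k - Suc j) (\<lambda>i u. D' i (u + real q) - D' i u) {real_of_int a'..real_of_int (b' - int q)}"
        unfolding derivs_def by auto
    next
      fix u assume u: "u \<in> {real_of_int a'..real_of_int (b' - int q)}"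
      have dv: "(D' k' has_real_derivative D' (Suc k') v) (at v)" if "v \<in> {u..u + real q}" for v
        using u that by (intro derivsD[OF D'(2)]) (auto simp: kk)
      have bv: "t * \<Lambda> \<le> D' (Suc k') v \<and> D' (Suc k') v \<le> c * (t * \<Lambda>)" if "v \<in> {u..u + real q}" for v
        using D'(3)[of v] u that by (simp add: kk)
      have "t * \<Lambda> * (u + real q - u) \<le> D' k' (u + real q) - D' k' u"
        by (rule deriv_ge_imp_diff_ge[OF dv]) (use bv in auto)
      then show "t * real q * \<Lambda> \<le> D' (k - Suc j) (u + real q) - D' (k - Suc j) u"
        by (simp add: k'_def mult_ac)
      have "D' k' (u + real q) - D' k' u \<le> c * (t * \<Lambda>) * (u + real q - u)"
        by (rule deriv_le_imp_diff_le[OF dv]) (use bv in auto)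
      then show "D' (k - Suc j) (u + real q) - D' (k - Suc j) u \<le> c * (t * real q * \<Lambda>)"
        by (simp add: k'_def mult_ac)
    next
      show "1 \<le> t * real q" using D'(5) q mult_mono[of 1 t 1 "real q"] by simp
      have "t * real q \<le> Z ^ (2 ^ Suc j - 2) * Z ^ (2 ^ Suc j)"
        using D'(5,6) q by (intro mult_mono) auto
      also have "\<dots> = Z ^ (2 ^ Suc (Suc j) - 2)"
      proof -
        have "(2::nat) ^ Suc (Suc j) - 2 = (2 ^ Suc j - 2) + 2 ^ Suc j" by simp
        then show ?thesis by (metis power_add)
      qed
      finally show "t * real q \<le> Z ^ (2 ^ Suc (Suc j) - 2)" .
    qed (use D' q in auto)
  next
    fix t g a' b' assume G: "G m t g a' b'" and ab: "a' \<le> b'"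
    then obtain D' where D': "g = D' 0" "derivs 2 D' {real_of_int a'..real_of_int b'}"
      "\<And>u. u \<in> {real_of_int a'..real_of_int b'} \<Longrightarrow> t * \<Lambda> \<le> D' 2 u \<and> D' 2 u \<le> c * (t * \<Lambda>)"
      "real_of_int (b' - a' + 1) \<le> N" "1 \<le> t" "t \<le> T"
      unfolding G_def T_def by (auto simp: km numeral_2_eq_2)
    define l where "l = t * \<Lambda>"
    have l0: "0 < l" using D'(5) L by (simp add: l_def)
    have "norm (esum g a' b') \<le> 10 * c * (N * sqrt l + 1 / sqrt l)"
      unfolding D'(1)
    proof (rule second_derivative_test[where ?g1.0 = "D' 1" and ?g2.0 = "D' 2"])
      fix u assume u: "u \<in> {real_of_int a'..real_of_int b'}"
      show "(D' 0 has_real_derivative D' 1 u) (at u)" using derivsD[OF D'(2) _ u, of 0] by simp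
      show "(D' 1 has_real_derivative D' 2 u) (at u)" using derivsD[OF D'(2) _ u, of 1] by (simp add: numeral_2_eq_2)
      show "l \<le> D' 2 u" "D' 2 u \<le> c * l" using D'(3)[OF u] by (auto simp: l_def)
    qed (use l0 c D' N in auto)
    also have "\<dots> \<le> 20 * c * (N / W * (1 + sqrt (T / t)))"
    proof -
      have "N * sqrt l \<le> N / W"
      proof -
        have "l * W\<^sup>2 \<le> T * \<Lambda> * W\<^sup>2"
          unfolding l_def using D'(6) L by (intro mult_right_mono) auto
        also have "\<dots> \<le> 1" using main by (simp add: kT mult_ac)
        finally have "(sqrt l * W)\<^sup>2 \<le> 1\<^sup>2" using l0 by (simp add: power_mult_distrib)
        then have "sqrt l * W \<le> 1" by (rule power2_le_imp_le) simp
        then have "sqrt l \<le> 1 / W" using W1 by (simp add: field_simps)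
        then show ?thesis using N by (simp add: mult_left_mono[of "sqrt l" "1 / W" N, simplified])
      qed
      moreover have "1 / sqrt l \<le> N / W * sqrt (T / t)"
      proof -
        have "W\<^sup>2 \<le> (N * sqrt (T * \<Lambda>))\<^sup>2"
        proof -
          have "W\<^sup>2 \<le> T * (N\<^sup>2 * \<Lambda>)" unfolding WT using sec T1 by (intro mult_left_mono) auto
          also have "\<dots> = (N * sqrt (T * \<Lambda>))\<^sup>2" using T1 L by (simp add: power_mult_distrib)
          finally show ?thesis .
        qed
        then have "W \<le> N * sqrt (T * \<Lambda>)" by (rule power2_le_imp_le) (use N T1 L in simp)
        then have "W / sqrt l \<le> N * sqrt (T * \<Lambda>) / sqrt l" using l0 by (intro divide_right_mono) auto
        also have "\<dots> = N * sqrt (T / t)"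
          using L by (simp add: l_def real_sqrt_mult real_sqrt_divide)
        finally show ?thesis using W1 by (simp add: field_simps)
      qed
      ultimately have "N * sqrt l + 1 / sqrt l \<le> N / W * (1 + sqrt (T / t))"
        by (simp add: ring_distribs)
      moreover have "0 \<le> N / W * (1 + sqrt (T / t))" using N W1 T1 D'(5) by simp
      ultimately have "10 * c * (N * sqrt l + 1 / sqrt l) \<le> 10 * c * (N / W * (1 + sqrt (T / t)))"
        using c by (intro mult_left_mono) auto
      also have "\<dots> \<le> 20 * c * (N / W * (1 + sqrt (T / t)))"
        using c N W1 T1 D'(5) by (intro mult_right_mono) auto
      finally show ?thesis .
    qed
    finally show "norm (esum g a' b') \<le> 20 * c * (N / Z ^ (2 ^ m)) * (1 + sqrt (1 * Z ^ (2 ^ Suc m - 2) / t))"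
      unfolding W_def T_def by (simp only: mult.assoc mult_1)
  qed (use Z WN c in \<open>auto simp: W_def G_def\<close>)
  then show ?thesis by simp
qed

lemma harm_le_ln: "1 \<le> n \<Longrightarrow> harm n \<le> 1 + ln (real n)"
  using decseq_harm_diff_ln[THEN decseqD, of 0 "n - 1"] by (simp add: harm_expand)

lemma sum_psi_le:
  assumes Z: "1 \<le> Z" and fin: "finite A" and B: "0 \<le> B"
    and bd: "\<And>h. 1 \<le> h \<Longrightarrow> real h \<le> Z \<Longrightarrow> norm (\<Sum>i\<in>A. ee (real h * x i)) \<le> B"
  shows "\<bar>\<Sum>i\<in>A. psi (x i)\<bar> \<le> 26 * (real (card A) / Z) + B * (1 + ln Z)"
proof -
  define H where "H = nat \<lfloor>Z\<rfloor>"
  have fl: "1 \<le> \<lfloor>Z\<rfloor>" using Z by (simp add: le_floor_iff)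
  then have "real H = of_int \<lfloor>Z\<rfloor>" by (simp add: H_def)
  moreover have "of_int \<lfloor>Z\<rfloor> \<le> Z" "Z < of_int \<lfloor>Z\<rfloor> + 1" "1 \<le> real_of_int \<lfloor>Z\<rfloor>"
    using fl by linarith+
  ultimately have H: "1 \<le> H" "real H \<le> Z" "Z \<le> 2 * real H" by linarith+
  have "\<bar>\<Sum>i\<in>A. psi (x i)\<bar> \<le> 13 * (real (card A) / real H) +
      (\<Sum>h=1..<H. norm (\<Sum>i\<in>A. ee (real h * x i)) / real h)"
    by (rule sum_psi_le_exponential_sums) (use fin H in auto)
  also have "\<dots> \<le> 13 * (real (card A) / (Z / 2)) + B * harm H"
  proof (rule add_mono)
    show "13 * (real (card A) / real H) \<le> 13 * (real (card A) / (Z / 2))"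
      using H Z by (intro mult_left_mono divide_left_mono) auto
    have "(\<Sum>h=1..<H. norm (\<Sum>i\<in>A. ee (real h * x i)) / real h) \<le> (\<Sum>h=1..<H. B * inverse (real h))"
      unfolding divide_inverse using H by (intro sum_mono mult_right_mono bd) auto
    also have "\<dots> \<le> (\<Sum>h=1..H. B * inverse (real h))"
      using B by (intro sum_mono2) auto
    finally show "(\<Sum>h=1..<H. norm (\<Sum>i\<in>A. ee (real h * x i)) / real h) \<le> B * harm H"
      by (simp add: harm_def sum_distrib_left)
  qed
  also have "harm H \<le> 1 + ln (real H)" using H by (intro harm_le_ln)
  also have "ln (real H) \<le> ln Z" using H by simp
  finally show ?thesis using B by (simp add: mult_left_mono)
qed

text \<open>The frequencies run up to \<open>Z\<close>, and frequency \<open>h\<close> multiplies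
  the derivative by \<open>h\<close>. This raises the exponent in \<open>main\<close> from 2 ^ k - 2
  to 2 ^ k - 1; the condition \<open>sec\<close> is most restrictive at h = 1. The sign
  \<open>sg\<close> is immaterial because conjugation preserves the modulus of an exponential
  sum.\<close>

lemma psi_derivative_test:
  assumes sg: "sg = 1 \<or> sg = - 1" and k: "2 \<le> k" and c: "1 \<le> c"
    and D: "derivs k D {real_of_int a..real_of_int b}"
    and bd: "\<And>u. u \<in> {real_of_int a..real_of_int b} \<Longrightarrow> \<Lambda> \<le> sg * D k u \<and> sg * D k u \<le> c * \<Lambda>"
    and L: "0 < \<Lambda>" and Z: "1 \<le> Z" and N: "0 \<le> N" "real_of_int (b - a + 1) \<le> N"
    and main: "\<Lambda> * Z ^ (2 ^ k - 1) \<le> 1" and sec: "Z\<^sup>2 \<le> N\<^sup>2 * \<Lambda>"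
  shows "\<bar>\<Sum>n\<in>{a..b}. psi (D 0 (of_int n))\<bar> \<le> 66 * c * (N / Z) * (1 + ln Z)"
proof -
  have "\<bar>\<Sum>n\<in>{a..b}. psi (D 0 (of_int n))\<bar> \<le> 26 * (real (card {a..b}) / Z) + 40 * c * (N / Z) * (1 + ln Z)"
  proof (rule sum_psi_le[OF Z])
    fix h :: nat assume h: "1 \<le> h" "real h \<le> Z"
    have "norm (esum (\<lambda>u. real h * (sg * D 0 u)) a b) \<le> 40 * c * (N / Z)"
    proof (rule exp_sum_derivative_test[where D = "\<lambda>i u. real h * (sg * D i u)" and \<Lambda> = "real h * \<Lambda>" and k = k])
      show "real h * \<Lambda> * Z ^ (2 ^ k - 2) \<le> 1"
      proof -
        have "real h * \<Lambda> * Z ^ (2 ^ k - 2) \<le> Z * \<Lambda> * Z ^ (2 ^ k - 2)"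
          using h L Z by (intro mult_right_mono) auto
        also have "\<dots> = \<Lambda> * Z ^ Suc (2 ^ k - 2)" by simp
        also have "Suc (2 ^ k - 2) = (2::nat) ^ k - 1"
          using k power_increasing[of 2 k "2::nat"] by simp
        finally show ?thesis using main by simp
      qed
      have "N\<^sup>2 * \<Lambda> * 1 \<le> N\<^sup>2 * \<Lambda> * real h" using h L by (intro mult_left_mono) auto
      then show "Z\<^sup>2 \<le> N\<^sup>2 * (real h * \<Lambda>)" using sec by (simp add: mult_ac)
      fix u assume u: "u \<in> {real_of_int a..real_of_int b}"
      show "real h * \<Lambda> \<le> real h * (sg * D k u) \<and> real h * (sg * D k u) \<le> c * (real h * \<Lambda>)"
      proof
        show "real h * \<Lambda> \<le> real h * (sg * D k u)" using bd[OF u] by (intro mult_left_mono) auto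
        have "real h * (sg * D k u) \<le> real h * (c * \<Lambda>)" using bd[OF u] by (intro mult_left_mono) auto
        then show "real h * (sg * D k u) \<le> c * (real h * \<Lambda>)" by (simp only: mult_ac)
      qed
    qed (use k c D L Z N h in \<open>auto intro: derivs_cmult\<close>)
    moreover have "norm (esum (\<lambda>u. real h * (sg * D 0 u)) a b) = norm (esum (\<lambda>u. real h * D 0 u) a b)"
      using sg norm_esum_uminus[of "\<lambda>u. real h * D 0 u" a b] by auto
    ultimately show "norm (\<Sum>n\<in>{a..b}. ee (real h * D 0 (of_int n))) \<le> 40 * c * (N / Z)"
      by (simp add: esum_def)
  qed (use c N Z in auto)
  also have "\<dots> \<le> 26 * (c * (N / Z) * (1 + ln Z)) + 40 * c * (N / Z) * (1 + ln Z)"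
  proof (rule add_right_mono, rule mult_left_mono)
    have "real (card {a..b}) \<le> N" using N by (cases "a \<le> b") auto
    then have "real (card {a..b}) / Z \<le> N / Z" using Z by (intro divide_right_mono) auto
    also have "\<dots> \<le> c * (N / Z)" using c N Z mult_right_mono[of 1 c "N / Z"] by simp
    also have "\<dots> \<le> c * (N / Z) * (1 + ln Z)"
      using c N Z mult_left_mono[of 1 "1 + ln Z" "c * (N / Z)"] by simp
    finally show "real (card {a..b}) / Z \<le> c * (N / Z) * (1 + ln Z)" .
  qed simp
  also have "\<dots> = 66 * c * (N / Z) * (1 + ln Z)"
    by (simp only: mult.assoc) (simp only: distrib_right[symmetric], simp)
  finally show ?thesis .
qed

subsection \<open>Stationary phase\<close>

definition fresnel :: "real \<Rightarrow> complex" where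
  "fresnel L = integral {-L..L} (\<lambda>z. ee (z\<^sup>2 / 2))"

lemma continuous_on_ee [continuous_intros]:
  "continuous_on A f \<Longrightarrow> continuous_on A (\<lambda>x. ee (f x))"
  unfolding ee_def cis_conv_exp by (intro continuous_intros) auto

lemma has_vector_derivative_ee [derivative_intros]:
  assumes "(f has_real_derivative f') (at x within A)"
  shows "((\<lambda>x. ee (f x)) has_vector_derivative (2 * pi * f') *\<^sub>R (\<i> * ee (f x))) (at x within A)"
proof -
  have "((\<lambda>x. exp (\<i> * of_real (2 * pi * f x))) has_vector_derivative
      (2 * pi * f') *\<^sub>R (\<i> * exp (\<i> * of_real (2 * pi * f x)))) (at x within A)"
  proof -
    have "((\<lambda>x. 2 * pi * f x) has_real_derivative 2 * pi * f') (at x within A)"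
      by (rule DERIV_cmult[OF assms])
    note d = has_vector_derivative_of_real[OF this]
    have "((\<lambda>z. exp (\<i> * z)) has_field_derivative exp (\<i> * z) * \<i>) (at z within S)" for z S
      by (auto intro!: derivative_eq_intros)
    from field_vector_diff_chain_within[OF d this] show ?thesis
      by (simp only: o_def scaleR_conv_of_real mult_ac)
  qed
  then show ?thesis by (simp add: ee_def cis_conv_exp)
qed

text \<open>Integration by parts against 1 / z on [1, L] leaves an integrand of size z ^ (-2), so
  the bound is uniform in \<open>L\<close>. The interval [-1, 1] is trivial and the left half is the
  reflection of the right one.\<close>

lemma norm_fresnel_le:
  assumes "1 \<le> L"
  shows "norm (fresnel L) \<le> 5"
proof -
  let ?f = "\<lambda>z::real. ee (z\<^sup>2 / 2)"
  have int: "?f integrable_on {a..b}" for a b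
    by (intro integrable_continuous_real continuous_intros) auto
  define F where "F z = - \<i> * ee (z\<^sup>2 / 2) * of_real (1 / (2 * pi * z))" for z :: real
  define R where "R z = - \<i> * ee (z\<^sup>2 / 2) * of_real (1 / (2 * pi * z\<^sup>2))" for z :: real
  have dF: "(F has_vector_derivative ?f z - R z) (at z within {1..L})" if "z \<in> {1..L}" for z
  proof -
    have z: "z \<noteq> 0" using that by auto
    have d1: "((\<lambda>z. ee (z\<^sup>2 / 2)) has_vector_derivative (2 * pi * z) *\<^sub>R (\<i> * ee (z\<^sup>2 / 2))) (at z within {1..L})"
      by (rule has_vector_derivative_ee) (auto intro!: derivative_eq_intros)
    have "((\<lambda>z. 1 / (2 * pi * z)) has_real_derivative - 1 / (2 * pi * z\<^sup>2)) (at z within {1..L})"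
      using z by (auto intro!: derivative_eq_intros simp: power2_eq_square field_simps)
    then have d2: "((\<lambda>z. complex_of_real (1 / (2 * pi * z))) has_vector_derivative of_real (- 1 / (2 * pi * z\<^sup>2))) (at z within {1..L})"
      by (rule has_vector_derivative_of_real)
    have "((\<lambda>z. ee (z\<^sup>2 / 2) * of_real (1 / (2 * pi * z))) has_vector_derivative
        ee (z\<^sup>2 / 2) * of_real (- 1 / (2 * pi * z\<^sup>2)) + (2 * pi * z) *\<^sub>R (\<i> * ee (z\<^sup>2 / 2)) * of_real (1 / (2 * pi * z))) (at z within {1..L})"
      by (rule has_vector_derivative_mult[OF d1 d2])
    from has_vector_derivative_mult_right[OF this, of "- \<i>"]
    have "((\<lambda>z. - \<i> * (ee (z\<^sup>2 / 2) * of_real (1 / (2 * pi * z)))) has_vector_derivative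
        - \<i> * (ee (z\<^sup>2 / 2) * of_real (- 1 / (2 * pi * z\<^sup>2)) + (2 * pi * z) *\<^sub>R (\<i> * ee (z\<^sup>2 / 2)) * of_real (1 / (2 * pi * z)))) (at z within {1..L})" .
    moreover have "- \<i> * (ee (z\<^sup>2 / 2) * of_real (- 1 / (2 * pi * z\<^sup>2)) + (2 * pi * z) *\<^sub>R (\<i> * ee (z\<^sup>2 / 2)) * of_real (1 / (2 * pi * z))) = ?f z - R z"
      using z by (simp add: R_def scaleR_conv_of_real field_simps)
    ultimately show ?thesis by (simp add: F_def[abs_def] mult.assoc)
  qed
  have FTC: "((\<lambda>z. ?f z - R z) has_integral F L - F 1) {1..L}"
    using dF by (intro fundamental_theorem_of_calculus assms) auto
  have Rint: "R integrable_on {1..L}"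
    unfolding R_def by (intro integrable_continuous_real continuous_intros) auto
  have Rb: "norm (integral {1..L} R) \<le> 1"
  proof -
    have "((\<lambda>z. 1 / (2 * pi) * (1 / z\<^sup>2)) has_integral (1 / (2 * pi) * (- 1 / L) - 1 / (2 * pi) * (- 1 / 1))) {1..L}"
      using assms
      by (intro fundamental_theorem_of_calculus)
         (auto intro!: derivative_eq_intros simp: power2_eq_square field_simps simp flip: has_real_derivative_iff_has_vector_derivative)
    note I = this
    have "norm (integral {1..L} R) \<le> integral {1..L} (\<lambda>z. 1 / (2 * pi) * (1 / z\<^sup>2))"
      using Rint has_integral_integrable[OF I]
      by (rule integral_norm_bound_integral) (auto simp: R_def norm_mult norm_divide norm_power)
    also have "\<dots> = 1 / (2 * pi) * (1 - 1 / L)"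
      unfolding integral_unique[OF I] by (simp add: right_diff_distrib)
    also have "\<dots> \<le> 1 * 1"
      using assms pi_gt3 by (intro mult_mono) (auto simp: field_simps)
    finally show ?thesis by simp
  qed
  have Fb: "norm (F z) \<le> 1/6" if "1 \<le> z" for z
  proof -
    have "norm (F z) = 1 / (2 * pi * z)"
      using that by (simp add: F_def norm_mult norm_divide)
    also have "\<dots> \<le> 1 / (2 * 3 * 1)"
      using that pi_gt3 by (intro divide_left_mono mult_mono) auto
    finally show ?thesis by simp
  qed
  have b1: "norm (integral {1..L} ?f) \<le> 4/3"
  proof -
    have "integral {1..L} ?f = (F L - F 1) + integral {1..L} R"
      using integral_add[OF has_integral_integrable[OF FTC] Rint] integral_unique[OF FTC] by simp
    also have "norm \<dots> \<le> norm (F L) + norm (F 1) + norm (integral {1..L} R)" by norm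
    also have "\<dots> \<le> 4/3" using Fb[of L] Fb[of 1] Rb assms by simp
    finally show ?thesis .
  qed
  have b2: "norm (integral {-L..-1} ?f) \<le> 4/3"
  proof -
    have "integral {-L..-1} (\<lambda>x. ?f (- x)) = integral {1..L} ?f" by (rule Henstock_Kurzweil_Integration.integral_reflect_real[where a = 1 and b = L and f = ?f])
    then show ?thesis using b1 by (simp only: power2_minus)
  qed
  have b0: "norm (integral {-1..1} ?f) \<le> 1 * (1 - (-1))"
    by (rule integral_bound) (auto intro!: continuous_intros)
  have "integral {-L..L} ?f = integral {-L..-1} ?f + integral {-1..L} ?f"
    using assms by (intro Henstock_Kurzweil_Integration.integral_combine[symmetric] int) auto
  also have "integral {-1..L} ?f = integral {-1..1} ?f + integral {1..L} ?f"
    using assms by (intro Henstock_Kurzweil_Integration.integral_combine[symmetric] int) auto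
  finally have "fresnel L = integral {-L..-1} ?f + (integral {-1..1} ?f + integral {1..L} ?f)"
    by (simp add: fresnel_def)
  moreover have "norm (integral {-L..-1} ?f + (integral {-1..1} ?f + integral {1..L} ?f))
      \<le> norm (integral {-L..-1} ?f) + (norm (integral {-1..1} ?f) + norm (integral {1..L} ?f))"
    by (intro order_trans[OF norm_triangle_ineq] add_mono order_refl norm_triangle_ineq)
  ultimately show ?thesis using b0 b1 b2 by simp
qed

text \<open>Each unit interval contributes at most the Lipschitz constant. The summand 3 pays for
  the last integer and the two incomplete end intervals, each at most 1.\<close>

lemma sum_minus_integral_le:
  fixes F :: "real \<Rightarrow> complex"
  assumes AB: "A \<le> B" and M: "0 \<le> M"
    and lip: "\<And>u w. u \<in> {A..B} \<Longrightarrow> w \<in> {A..B} \<Longrightarrow> norm (F u - F w) \<le> M * \<bar>u - w\<bar>"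
    and cont: "continuous_on {A..B} F"
    and bd: "\<And>u. u \<in> {A..B} \<Longrightarrow> norm (F u) \<le> 1"
  shows "norm ((\<Sum>n\<in>{\<lceil>A\<rceil>..\<lfloor>B\<rfloor>}. F (of_int n)) - integral {A..B} F) \<le> M * (B - A) + 3"
proof -
  define p where "p = \<lceil>A\<rceil>"
  define q where "q = \<lfloor>B\<rfloor>"
  have p: "A \<le> of_int p" "of_int p < A + 1" and q: "of_int q \<le> B" "B < of_int q + 1"
    by (auto simp: p_def q_def) linarith+
  have int: "F integrable_on {u..w}" if "A \<le> u" "w \<le> B" for u w
    using that by (intro integrable_continuous_real continuous_on_subset[OF cont]) auto
  have small: "norm (integral {u..w} F) \<le> w - u" if "A \<le> u" "u \<le> w" "w \<le> B" for u w
    using integral_bound[of u w F 1] that continuous_on_subset[OF cont, of "{u..w}"] bd by auto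
  show ?thesis
  proof (cases "p \<le> q")
    case False
    then have "of_int q + 1 \<le> real_of_int p" by linarith
    then have "B - A < 2" using p q by linarith
    moreover have "norm (integral {A..B} F) \<le> B - A" using small[of A B] AB by simp
    moreover have "0 \<le> M * (B - A)" using M AB by simp
    ultimately show ?thesis using False by (simp add: p_def q_def)
  next
    case True
    have step: "norm (F (of_int n) - integral {of_int n..of_int n + 1} F) \<le> M" if "p \<le> n" "n < q" for n
    proof -
      have r: "A \<le> of_int n" "of_int n + 1 \<le> B"
        using that p q by (smt (verit) of_int_le_iff of_int_add of_int_1)+
      have "F (of_int n) - integral {of_int n..of_int n + 1} F = integral {of_int n..of_int n + 1} (\<lambda>u. F (of_int n) - F u)"
        by (subst Henstock_Kurzweil_Integration.integral_diff) (use int[OF r] in auto)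
      also have "norm \<dots> \<le> M * (of_int n + 1 - of_int n)"
      proof (rule integral_bound)
        show "continuous_on {of_int n..of_int n + 1} (\<lambda>u. F (of_int n) - F u)"
          using r by (intro continuous_intros continuous_on_subset[OF cont]) auto
        fix u assume u: "u \<in> {real_of_int n..of_int n + 1}"
        have "norm (F (of_int n) - F u) \<le> M * \<bar>of_int n - u\<bar>" using u r by (intro lip) auto
        also have "\<dots> \<le> M * 1" using u M by (intro mult_left_mono) auto
        finally show "norm (F (of_int n) - F u) \<le> M" by simp
      qed simp
      finally show ?thesis by simp
    qed
    have "norm ((\<Sum>n\<in>{p..<p + int k}. F (of_int n)) - integral {of_int p..of_int (p + int k)} F) \<le> M * real k"
      if "p + int k \<le> q" for k
      using that
    proof (induction k)
      case (Suc k)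
      define n where "n = p + int k"
      have n: "p \<le> n" "n < q" using Suc.prems by (auto simp: n_def)
      have "{p..<p + int (Suc k)} = insert n {p..<n}" by (auto simp: n_def)
      then have e1: "(\<Sum>n\<in>{p..<p + int (Suc k)}. F (of_int n)) = F (of_int n) + (\<Sum>n\<in>{p..<n}. F (of_int n))" by simp
      have r: "A \<le> of_int p" "of_int n + 1 \<le> B"
        using n p q by (smt (verit) of_int_le_iff of_int_add of_int_1)+
      have e2: "integral {of_int p..of_int (p + int (Suc k))} F = integral {of_int p..of_int n} F + integral {of_int n..of_int n + 1} F"
        using Henstock_Kurzweil_Integration.integral_combine[of "of_int p" "of_int n" "of_int n + 1" F] int[of "of_int p" "of_int n + 1"] n r
        by (simp add: n_def add_ac)
      have "norm ((F (of_int n) - integral {of_int n..of_int n + 1} F) + ((\<Sum>n\<in>{p..<n}. F (of_int n)) - integral {of_int p..of_int n} F))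
          \<le> M + M * real k"
        using step[OF n] Suc by (intro order_trans[OF norm_triangle_ineq] add_mono) (auto simp: n_def)
      then show ?case unfolding e1 e2 by (simp add: algebra_simps)
    qed simp
    from this[of "nat (q - p)"] True
    have main: "norm ((\<Sum>n\<in>{p..<q}. F (of_int n)) - integral {of_int p..of_int q} F) \<le> M * of_int (q - p)"
      by simp
    have pq: "real_of_int p \<le> of_int q" using True by simp
    have "{p..q} = insert q {p..<q}" using True by auto
    then have s: "(\<Sum>n\<in>{p..q}. F (of_int n)) = F (of_int q) + (\<Sum>n\<in>{p..<q}. F (of_int n))" by simp
    have "integral {A..B} F = integral {A..of_int p} F + integral {of_int p..B} F"
      using p q pq by (intro Henstock_Kurzweil_Integration.integral_combine[symmetric] int) auto
    also have "integral {of_int p..B} F = integral {of_int p..of_int q} F + integral {of_int q..B} F"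
      using p q pq by (intro Henstock_Kurzweil_Integration.integral_combine[symmetric] int) auto
    finally have i: "integral {A..B} F = integral {A..of_int p} F + (integral {of_int p..of_int q} F + integral {of_int q..B} F)" .
    have "(\<Sum>n\<in>{p..q}. F (of_int n)) - integral {A..B} F =
       ((\<Sum>n\<in>{p..<q}. F (of_int n)) - integral {of_int p..of_int q} F) + F (of_int q) - integral {A..of_int p} F - integral {of_int q..B} F"
      unfolding s i by simp
    also have "norm \<dots> \<le> norm ((\<Sum>n\<in>{p..<q}. F (of_int n)) - integral {of_int p..of_int q} F) + norm (F (of_int q))
        + norm (integral {A..of_int p} F) + norm (integral {of_int q..B} F)"
      by (intro order_trans[OF norm_triangle_ineq4] order_trans[OF norm_triangle_ineq] add_mono order_refl norm_triangle_ineq4)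
    also have "\<dots> \<le> M * of_int (q - p) + 1 + 1 + 1"
      using main small[of A "of_int p"] small[of "of_int q" B] p q pq bd[of "of_int q"]
      by (intro add_mono) auto
    also have "M * of_int (q - p) \<le> M * (B - A)"
      using p q M by (intro mult_left_mono) auto
    finally show ?thesis by (simp add: p_def q_def)
  qed
qed

text \<open>Near a stationary point the phase is quadratic up to \<delta> and up to an integral
  linear term, which \<open>ee\<close> ignores. The substitution z = (u - x0) / \<mu> produces \<mu>
  * fresnel L. At most 3 * L * \<mu> integers are affected by \<delta>, each by at most 2 * pi *
  \<delta>. The term 16 * L ^ 2 is the Lipschitz constant 2 * pi * L / \<mu> times the length 2 * L
  * \<mu>, plus 3.\<close>

lemma window_sum:
  assumes mu: "0 < \<mu>" and L: "1 \<le> L" and Lmu: "1 \<le> L * \<mu>" and del: "0 \<le> \<delta>"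
    and g: "\<And>n. \<bar>of_int n - x0\<bar> \<le> L * \<mu> \<Longrightarrow> \<bar>g (of_int n) - (of_int (k * n) + \<phi> + (of_int n - x0)\<^sup>2 / (2 * \<mu>\<^sup>2))\<bar> \<le> \<delta>"
  shows "norm (esum g \<lceil>x0 - L * \<mu>\<rceil> \<lfloor>x0 + L * \<mu>\<rfloor> - of_real \<mu> * ee \<phi> * fresnel L) \<le> 21 * (L * \<mu>) * \<delta> + 16 * L\<^sup>2"
proof -
  define A where "A = x0 - L * \<mu>"
  define B where "B = x0 + L * \<mu>"
  define F where "F u = ee ((u - x0)\<^sup>2 / (2 * \<mu>\<^sup>2))" for u :: real
  define I where "I = {\<lceil>A\<rceil>..\<lfloor>B\<rfloor>}"
  have AB: "A \<le> B" using L mu by (simp add: A_def B_def)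
  have mem: "\<bar>of_int n - x0\<bar> \<le> L * \<mu>" if "n \<in> I" for n
    using that by (auto simp: I_def A_def B_def abs_le_iff ceiling_le_iff le_floor_iff)
  have card: "real (card I) \<le> 3 * (L * \<mu>)"
  proof (cases "\<lceil>A\<rceil> \<le> \<lfloor>B\<rfloor>")
    case True
    then have "real (card I) = of_int (\<lfloor>B\<rfloor> - \<lceil>A\<rceil> + 1)" by (simp add: I_def)
    also have "\<dots> \<le> B - A + 1" by linarith
    also have "\<dots> \<le> 3 * (L * \<mu>)" using Lmu by (simp add: A_def B_def)
    finally show ?thesis .
  qed (use Lmu in \<open>auto simp: I_def\<close>)
  have "norm (F u - F w) \<le> 2 * pi * L / \<mu> * \<bar>u - w\<bar>" if "u \<in> {A..B}" "w \<in> {A..B}" for u w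
  proof -
    have "norm (F u - F w) \<le> 2 * pi * \<bar>(u - x0)\<^sup>2 / (2 * \<mu>\<^sup>2) - (w - x0)\<^sup>2 / (2 * \<mu>\<^sup>2)\<bar>"
      unfolding F_def by (rule norm_ee_diff_le)
    also have "(u - x0)\<^sup>2 / (2 * \<mu>\<^sup>2) - (w - x0)\<^sup>2 / (2 * \<mu>\<^sup>2) = ((u - x0) + (w - x0)) / (2 * \<mu>\<^sup>2) * (u - w)"
    proof -
      have "(u - x0)\<^sup>2 - (w - x0)\<^sup>2 = ((u - x0) + (w - x0)) * (u - w)"
        by (simp add: power2_eq_square algebra_simps)
      then show ?thesis by (simp only: diff_divide_distrib[symmetric] times_divide_eq_left)
    qed
    also have "\<bar>\<dots>\<bar> = \<bar>(u - x0) + (w - x0)\<bar> / (2 * \<mu>\<^sup>2) * \<bar>u - w\<bar>"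
      by (simp add: abs_mult)
    also have "\<dots> \<le> (2 * (L * \<mu>)) / (2 * \<mu>\<^sup>2) * \<bar>u - w\<bar>"
      using that by (intro mult_right_mono divide_right_mono) (auto simp: A_def B_def)
    also have "\<dots> = L / \<mu> * \<bar>u - w\<bar>" using mu by (simp add: power2_eq_square)
    finally show ?thesis by (simp add: mult_left_mono)
  qed
  then have R: "norm ((\<Sum>n\<in>I. F (of_int n)) - integral {A..B} F) \<le> 2 * pi * L / \<mu> * (B - A) + 3"
    unfolding I_def using AB L mu
    by (intro sum_minus_integral_le) (auto simp: F_def intro!: continuous_intros)
  have sc: "integral {A..B} F = of_real \<mu> * fresnel L"
  proof -
    have "((\<lambda>z. ee (z\<^sup>2 / 2)) has_integral fresnel L) (cbox (-L) L)"
      unfolding fresnel_def by (auto intro!: integrable_integral integrable_continuous_real continuous_intros)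
    then have "((\<lambda>u. ee (((1 / \<mu>) *\<^sub>R u + (- x0 / \<mu>))\<^sup>2 / 2)) has_integral fresnel L /\<^sub>R (1 / \<mu>) ^ DIM(real))
        (cbox ((- L - (- x0 / \<mu>)) /\<^sub>R (1 / \<mu>)) ((L - (- x0 / \<mu>)) /\<^sub>R (1 / \<mu>)))"
      by (rule has_integral_affinity') (use mu in auto)
    moreover have "(- L - (- x0 / \<mu>)) /\<^sub>R (1 / \<mu>) = A" "(L - (- x0 / \<mu>)) /\<^sub>R (1 / \<mu>) = B"
      using mu by (auto simp: A_def B_def field_simps)
    moreover have "fresnel L /\<^sub>R (1 / \<mu>) ^ DIM(real) = of_real \<mu> * fresnel L"
      by (simp add: scaleR_conv_of_real)
    moreover have "(\<lambda>u. ee (((1 / \<mu>) *\<^sub>R u + (- x0 / \<mu>))\<^sup>2 / 2)) = F"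
    proof
      fix u
      have "(1 / \<mu>) *\<^sub>R u + (- x0 / \<mu>) = (u - x0) / \<mu>" by (simp add: diff_divide_distrib)
      then show "ee (((1 / \<mu>) *\<^sub>R u + (- x0 / \<mu>))\<^sup>2 / 2) = F u"
        by (simp only: F_def power_divide divide_divide_eq_left mult.commute)
    qed
    ultimately have "(F has_integral of_real \<mu> * fresnel L) {A..B}" by simp
    then show ?thesis by (rule integral_unique)
  qed
  have S: "norm (esum g \<lceil>A\<rceil> \<lfloor>B\<rfloor> - ee \<phi> * (\<Sum>n\<in>I. F (of_int n))) \<le> 21 * (L * \<mu>) * \<delta>"
  proof -
    have "esum g \<lceil>A\<rceil> \<lfloor>B\<rfloor> - ee \<phi> * (\<Sum>n\<in>I. F (of_int n)) = (\<Sum>n\<in>I. ee (g (of_int n)) - ee (of_int (k * n) + \<phi> + (of_int n - x0)\<^sup>2 / (2 * \<mu>\<^sup>2)))"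
      unfolding esum_def I_def sum_subtractf sum_distrib_left F_def by (simp only: ee_add ee_of_int mult_1)
    also have "norm \<dots> \<le> (\<Sum>n\<in>I. 2 * pi * \<delta>)"
    proof (intro order_trans[OF norm_sum] sum_mono)
      fix n assume n: "n \<in> I"
      show "norm (ee (g (of_int n)) - ee (of_int (k * n) + \<phi> + (of_int n - x0)\<^sup>2 / (2 * \<mu>\<^sup>2))) \<le> 2 * pi * \<delta>"
        using g[OF mem[OF n]] by (intro order_trans[OF norm_ee_diff_le] mult_left_mono) auto
    qed
    also have "\<dots> = real (card I) * (2 * pi * \<delta>)" by simp
    also have "\<dots> \<le> 3 * (L * \<mu>) * (7 * \<delta>)"
    proof (rule mult_mono)
      show "2 * pi * \<delta> \<le> 7 * \<delta>" using del pi_approx by (intro mult_right_mono) auto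
    qed (use card L mu del in auto)
    finally show ?thesis by simp
  qed
  have "esum g \<lceil>A\<rceil> \<lfloor>B\<rfloor> - of_real \<mu> * ee \<phi> * fresnel L =
      (esum g \<lceil>A\<rceil> \<lfloor>B\<rfloor> - ee \<phi> * (\<Sum>n\<in>I. F (of_int n))) + ee \<phi> * ((\<Sum>n\<in>I. F (of_int n)) - integral {A..B} F)"
    by (simp add: sc algebra_simps)
  also have "norm \<dots> \<le> 21 * (L * \<mu>) * \<delta> + (2 * pi * L / \<mu> * (B - A) + 3)"
    using S R by (intro order_trans[OF norm_triangle_ineq] add_mono) (auto simp: norm_mult)
  also have "2 * pi * L / \<mu> * (B - A) + 3 \<le> 16 * L\<^sup>2"
  proof -
    have "2 * pi * L / \<mu> * (B - A) = 4 * pi * L\<^sup>2"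
      using mu by (simp add: A_def B_def power2_eq_square)
    also have "\<dots> \<le> 13 * L\<^sup>2" using pi_approx by (intro mult_right_mono) auto
    finally show ?thesis using one_le_power[OF L, of 2] by linarith
  qed
  finally show ?thesis by (simp add: A_def B_def)
qed

text \<open>Abel summation. The induction adds summands on the left and leaves the offset
  \<open>v\<close> free, because removing the weight of the leftmost term changes the offset of the
  remaining ones.\<close>

lemma norm_sum_mono_weights_le:
  fixes z :: "int \<Rightarrow> complex" and w :: "int \<Rightarrow> real"
  assumes mono: "\<And>i j. k1 \<le> i \<Longrightarrow> i \<le> j \<Longrightarrow> j \<le> k2 \<Longrightarrow> w i \<le> w j"
    and bd: "\<And>j. k1 \<le> j \<Longrightarrow> j \<le> k2 \<Longrightarrow> norm (\<Sum>k\<in>{j..k2}. z k) \<le> B"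
    and le: "k1 \<le> k2" and v: "v \<le> w k1"
  shows "norm (\<Sum>k\<in>{k1..k2}. of_real (w k - v) * z k) \<le> (w k2 - v) * B"
proof -
  have "norm (\<Sum>k\<in>{k2 - int n..k2}. of_real (w k - v) * z k) \<le> (w k2 - v) * B"
    if "k1 \<le> k2 - int n" "v \<le> w (k2 - int n)" for n v
    using that
  proof (induction n arbitrary: v)
    case 0
    then show ?case using bd[of k2] le by (simp add: norm_mult mult_left_mono del: of_real_diff)
  next
    case (Suc n)
    define j where "j = k2 - int (Suc n)"
    have j: "k1 \<le> j" "j + 1 = k2 - int n" "j \<le> k2" "v \<le> w j" using Suc.prems by (auto simp: j_def)
    have ins: "{j..k2} = insert j {j + 1..k2}" using j by auto
    have "(\<Sum>k\<in>{j..k2}. of_real (w k - v) * z k) = (\<Sum>k\<in>{j..k2}. of_real (w j - v) * z k + of_real (w k - w j) * z k)"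
      by (intro sum.cong refl) (simp add: algebra_simps)
    also have "\<dots> = of_real (w j - v) * (\<Sum>k\<in>{j..k2}. z k) + (\<Sum>k\<in>{j..k2}. of_real (w k - w j) * z k)"
      by (simp add: sum.distrib sum_distrib_left)
    also have "(\<Sum>k\<in>{j..k2}. of_real (w k - w j) * z k) = (\<Sum>k\<in>{j + 1..k2}. of_real (w k - w j) * z k)"
      unfolding ins by simp
    also have "norm (of_real (w j - v) * (\<Sum>k\<in>{j..k2}. z k) + (\<Sum>k\<in>{j + 1..k2}. of_real (w k - w j) * z k))
        \<le> (w j - v) * B + (w k2 - w j) * B"
    proof (intro order_trans[OF norm_triangle_ineq] add_mono)
      show "norm (of_real (w j - v) * (\<Sum>k\<in>{j..k2}. z k)) \<le> (w j - v) * B"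
        using bd[OF j(1,3)] j(4) by (simp add: norm_mult mult_left_mono del: of_real_diff)
      show "norm (\<Sum>k\<in>{j + 1..k2}. of_real (w k - w j) * z k) \<le> (w k2 - w j) * B"
        unfolding j(2) using Suc.prems j mono[of j "j + 1"] by (intro Suc.IH) auto
    qed
    finally show ?case by (simp add: j_def algebra_simps)
  qed
  from this[of "nat (k2 - k1)"] show ?thesis using le v by simp
qed

lemma Taylor2_bound:
  fixes g g1 g2 :: "real \<Rightarrow> real"
  assumes d1: "\<And>u. u \<in> {A..B} \<Longrightarrow> (g has_real_derivative g1 u) (at u)"
    and d2: "\<And>u. u \<in> {A..B} \<Longrightarrow> (g1 has_real_derivative g2 u) (at u)"
    and lip: "\<And>u w. u \<in> {A..B} \<Longrightarrow> w \<in> {A..B} \<Longrightarrow> \<bar>g2 u - g2 w\<bar> \<le> \<rho> * \<bar>u - w\<bar>"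
    and rho: "0 \<le> \<rho>" and x: "x \<in> {A..B}" "x0 \<in> {A..B}" and r: "\<bar>x - x0\<bar> \<le> r"
  shows "\<bar>g x - (g x0 + g1 x0 * (x - x0) + g2 x0 * (x - x0)\<^sup>2 / 2)\<bar> \<le> \<rho> * r ^ 3"
proof -
  have r0: "0 \<le> r" using r by linarith
  define S where "S = closed_segment x0 x"
  have S: "convex S" "x0 \<in> S" "x \<in> S" by (auto simp: S_def)
  have Sm: "u \<in> {A..B}" "\<bar>u - x0\<bar> \<le> r" if "u \<in> S" for u
    using that x r by (auto simp: S_def closed_segment_eq_real_ivl split: if_splits)
  define h where "h u = g u - (g x0 + g1 x0 * (u - x0) + g2 x0 * (u - x0)\<^sup>2 / 2)" for u
  define h1 where "h1 u = g1 u - g1 x0 - g2 x0 * (u - x0)" for u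
  have dh: "(h has_real_derivative h1 u) (at u within S)" if "u \<in> S" for u
    unfolding h_def h1_def
    by (rule derivative_eq_intros has_field_derivative_at_within[OF d1[OF Sm(1)[OF that]]] refl | simp)+
  have dh1: "(h1 has_real_derivative g2 u - g2 x0) (at u within S)" if "u \<in> S" for u
    unfolding h1_def
    by (rule derivative_eq_intros has_field_derivative_at_within[OF d2[OF Sm(1)[OF that]]] refl | simp)+
  have b1: "norm (h1 u) \<le> \<rho> * r * r" if u: "u \<in> S" for u
  proof -
    have "norm (h1 u - h1 x0) \<le> \<rho> * r * norm (u - x0)"
    proof (rule field_differentiable_bound[OF S(1) dh1 _ u S(2)])
      fix z assume "z \<in> S"
      then show "norm (g2 z - g2 x0) \<le> \<rho> * r"
        using lip[of z x0] Sm[of z] x rho by (auto intro: order_trans mult_left_mono)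
    qed auto
    also have "\<dots> \<le> \<rho> * r * r" using Sm(2)[OF u] rho r0 by (intro mult_left_mono) auto
    finally show ?thesis by (simp add: h1_def)
  qed
  have "norm (h x - h x0) \<le> \<rho> * r * r * norm (x - x0)"
    by (rule field_differentiable_bound[OF S(1) dh _ S(3) S(2)]) (use b1 in auto)
  also have "\<dots> \<le> \<rho> * r * r * r" using r rho r0 by (intro mult_left_mono) auto
  finally show ?thesis by (simp add: h_def power3_eq_cube mult.assoc)
qed

text \<open>Only an upper bound with a power-saving error term is needed, so the stationary phase
  integrals are never evaluated: around each stationary point \<open>p k\<close> (where \<open>g1 (p k) = k\<close>) the sum over
  the window of half-width \<open>L / sqrt (g2 (p k))\<close> is a fixed constant \<open>fresnel L\<close> times the main
  term, and the Kusmin--Landau inequality disposes of the integers between the windows.\<close>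

lemma B_process:
  assumes d1: "\<And>u. u \<in> {real_of_int a..real_of_int b} \<Longrightarrow> (g has_real_derivative g1 u) (at u)"
    and d2: "\<And>u. u \<in> {real_of_int a..real_of_int b} \<Longrightarrow> (g1 has_real_derivative g2 u) (at u)"
    and ab: "a \<le> b" and lam: "0 < lam" and c: "1 \<le> c"
    and lo: "\<And>u. u \<in> {real_of_int a..real_of_int b} \<Longrightarrow> lam \<le> g2 u"
    and hi: "\<And>u. u \<in> {real_of_int a..real_of_int b} \<Longrightarrow> g2 u \<le> c * lam"
    and anti: "\<And>u w. real_of_int a \<le> u \<Longrightarrow> u \<le> w \<Longrightarrow> w \<le> real_of_int b \<Longrightarrow> g2 w \<le> g2 u"
    and lip: "\<And>u w. u \<in> {real_of_int a..real_of_int b} \<Longrightarrow> w \<in> {real_of_int a..real_of_int b} \<Longrightarrow> \<bar>g2 u - g2 w\<bar> \<le> \<rho> * \<bar>u - w\<bar>"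
    and rho: "0 \<le> \<rho>" and L: "1 \<le> L" and small: "4 * c * L * sqrt lam \<le> 1"
    and p: "\<And>v. g1 (of_int a) \<le> v \<Longrightarrow> v \<le> g1 (of_int b) \<Longrightarrow> p v \<in> {real_of_int a..real_of_int b} \<and> g1 (p v) = v"
    and dual: "\<And>k1 k2. g1 (of_int a) < of_int k1 \<Longrightarrow> of_int k2 < g1 (of_int b) \<Longrightarrow> k1 \<le> k2 \<Longrightarrow>
      norm (esum (\<lambda>v. g (p v) - v * p v) k1 k2) \<le> Bd"
    and N: "real_of_int (b - a + 1) \<le> N" and Bd: "0 \<le> Bd"
  shows "norm (esum g a b) \<le> 5 * Bd / sqrt lam
      + (c * lam * N + 2) * (21 * \<rho> * L ^ 4 / lam\<^sup>2 + 16 * L\<^sup>2 + 4 * c / (L * sqrt lam)) + 60 * c / sqrt lam"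
proof -
  define s where "s = sqrt lam"
  have s: "0 < s" "s * s = lam" using lam by (auto simp: s_def)
  have s4: "4 * (c * (L * s)) \<le> 1" using small by (simp add: s_def mult_ac)
  have cL: "1 \<le> c * L" using c L mult_mono[of 1 c 1 L] by simp
  have s14: "s \<le> 1/4"
  proof -
    have "1 * s \<le> (c * L) * s" using cL s by (intro mult_right_mono) auto
    then have "s \<le> c * (L * s)" by (simp only: mult_1 mult.assoc)
    then show ?thesis using s4 by linarith
  qed
  \<comment> \<open>Windows have half-width at least L / (c * s) and \<open>g1\<close> grows at rate
    at least \<open>lam = s * s\<close>. Hence between the windows \<open>g1\<close> stays at
    distance at least \<theta> from the integers, as Kusmin--Landau requires.\<close>
  define \<theta> where "\<theta> = L * s / c"
  have th: "0 < \<theta>" "\<theta> \<le> 1/4"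
  proof -
    show "0 < \<theta>" using L s c by (simp add: \<theta>_def)
    have "\<theta> \<le> L * s" unfolding \<theta>_def using c L s by (simp add: pos_divide_le_eq mult_left_mono[of 1 c "L * s", simplified])
    also have "\<dots> \<le> c * (L * s)" using c L s mult_right_mono[of 1 c "L * s"] by simp
    finally show "\<theta> \<le> 1/4" using s4 by simp
  qed
  have g1m: "lam * (w - u) \<le> g1 w - g1 u" "g1 w - g1 u \<le> c * lam * (w - u)"
    if "real_of_int a \<le> u" "u \<le> w" "w \<le> real_of_int b" for u w
    using that by (auto intro!: deriv_ge_imp_diff_ge[of u w g1 g2] deriv_le_imp_diff_le[of u w g1 g2] d2 lo hi)
  have mono: "g1 u \<le> g1 w" if "real_of_int a \<le> u" "u \<le> w" "w \<le> real_of_int b" for u w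
    using g1m(1)[OF that] lam that mult_nonneg_nonneg[of lam "w - u"] by linarith
  have g1abs: "\<bar>g1 u - g1 w\<bar> \<le> c * lam * \<bar>u - w\<bar>" "lam * \<bar>u - w\<bar> \<le> \<bar>g1 u - g1 w\<bar>"
    if "u \<in> {real_of_int a..real_of_int b}" "w \<in> {real_of_int a..real_of_int b}" for u w
    using that g1m[of u w] g1m[of w u] mono[of u w] mono[of w u] by (cases "u \<le> w"; auto)+
  \<comment> \<open>The integer nearest to \<open>g1 n\<close>; class \<open>k\<close> gathers the
    integers around the stationary point \<open>p k\<close>.\<close>
  define \<kappa> where "\<kappa> n = \<lfloor>g1 (of_int n) + 1/2\<rfloor>" for n :: int
  have kb: "of_int (\<kappa> n) - 1/2 \<le> g1 (of_int n)" "g1 (of_int n) < of_int (\<kappa> n) + 1/2" for n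
    unfolding \<kappa>_def by linarith+
  have kmono: "\<kappa> m \<le> \<kappa> n" if "a \<le> m" "m \<le> n" "n \<le> b" for m n
    unfolding \<kappa>_def using mono[of m n] that by (intro floor_mono) auto
  define cls where "cls k = {n\<in>{a..b}. \<kappa> n = k}" for k
  define f where "f n = ee (g (of_int n))" for n :: int
  define E where "E = 21 * \<rho> * L ^ 4 / lam\<^sup>2 + 16 * L\<^sup>2 + 4 * c / (L * s)"
  have E0: "0 \<le> E" using rho lam L c s by (simp add: E_def)
  \<comment> \<open>On a window \<open>g1\<close> moves by at most 1/4 to either side, so this
    margin keeps the whole window inside [a, b]. Only the classes of the two end points can fail
    it.\<close>
  define inn where "inn k \<longleftrightarrow> g1 (of_int a) + 1/4 \<le> of_int k \<and> of_int k \<le> g1 (of_int b) - 1/4" for k :: int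
  define \<mu> where "\<mu> k = 1 / sqrt (g2 (p (of_int k)))" for k :: int
  define \<phi> where "\<phi> k = g (p (of_int k)) - of_int k * p (of_int k)" for k :: int
  have pk: "p (of_int k) \<in> {real_of_int a..real_of_int b}" "g1 (p (of_int k)) = of_int k" if "inn k" for k
    using p[of "of_int k"] that by (auto simp: inn_def)
  have mu: "0 < \<mu> k" "\<mu> k \<le> 1 / s" "1 \<le> c * s * \<mu> k" "g2 (p (of_int k)) = 1 / (\<mu> k)\<^sup>2" if "inn k" for k
  proof -
    have g2: "lam \<le> g2 (p (of_int k))" "g2 (p (of_int k)) \<le> c * lam" using lo hi pk[OF that] by auto
    then have "0 < g2 (p (of_int k))" using lam by linarith
    then show "0 < \<mu> k" and "g2 (p (of_int k)) = 1 / (\<mu> k)\<^sup>2" by (simp_all add: \<mu>_def power_divide)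
    show "\<mu> k \<le> 1 / s" unfolding \<mu>_def s_def using g2 lam by (intro divide_left_mono) auto
    have "sqrt (g2 (p (of_int k))) \<le> sqrt (c\<^sup>2 * lam)"
      using g2(2) c lam self_le_power[OF c, of 2] by (intro real_sqrt_le_mono order_trans[OF g2(2)] mult_right_mono) auto
    also have "\<dots> = c * s" using c by (simp add: s_def real_sqrt_mult)
    finally show "1 \<le> c * s * \<mu> k" using \<open>0 < g2 (p (of_int k))\<close> by (simp add: \<mu>_def field_simps)
  qed
  have convex_cls: "\<exists>i j. {n\<in>cls k. P n} = {i..j}"
    if P: "\<And>x y z. a \<le> x \<Longrightarrow> x \<le> y \<Longrightarrow> y \<le> z \<Longrightarrow> z \<le> b \<Longrightarrow> P x \<Longrightarrow> P z \<Longrightarrow> P y" for k P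
  proof -
    have "finite {n\<in>cls k. P n}" by (rule finite_subset[of _ "{a..b}"]) (auto simp: cls_def)
    then show ?thesis
    proof (rule convex_int_set)
      fix x y z assume H: "x \<in> {n\<in>cls k. P n}" "z \<in> {n\<in>cls k. P n}" "x \<le> y" "y \<le> z"
      then have r: "a \<le> x" "z \<le> b" "\<kappa> x = k" "\<kappa> z = k" "P x" "P z" by (auto simp: cls_def)
      then have "\<kappa> x \<le> \<kappa> y" "\<kappa> y \<le> \<kappa> z" using kmono[of x y] kmono[of y z] H by linarith+
      then have "\<kappa> y = k" using r by linarith
      moreover have "P y" using P[of x y z] r H by blast
      ultimately show "y \<in> {n\<in>cls k. P n}" using r H by (simp add: cls_def)
    qed blast
  qed
  have KL: "norm (sum f {i..j}) \<le> 2 / \<theta>"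
    if ij: "\<And>n. n \<in> {i..j} \<Longrightarrow> n \<in> {a..b} \<and> of_int k + \<theta> \<le> g1 (of_int n) \<and> g1 (of_int n) \<le> of_int k + 1 - \<theta>" for i j k
  proof (cases "i \<le> j")
    case True
    have ends: "i \<in> {a..b}" "j \<in> {a..b}" "of_int k + \<theta> \<le> g1 (of_int i)" "g1 (of_int j) \<le> of_int k + 1 - \<theta>"
      using ij[of i] ij[of j] True by auto
    have rng: "real_of_int a \<le> u" "u \<le> real_of_int b" if "u \<in> {real_of_int i..real_of_int j}" for u
      using that ends by auto
    have lohi: "of_int k + \<theta> \<le> g1 u \<and> g1 u \<le> of_int k + 1 - \<theta>" if u: "u \<in> {real_of_int i..real_of_int j}" for u
      using mono[of "of_int i" u] mono[of u "of_int j"] u rng[OF u] ends by auto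
    have "norm (esum g i j) \<le> 2 / \<theta>"
    proof (rule Kusmin_Landau)
      show "(g has_real_derivative g1 u) (at u)" if "u \<in> {real_of_int i..real_of_int j}" for u
        using rng[OF that] by (intro d1) auto
      show "g1 u \<le> g1 w" if "real_of_int i \<le> u" "u \<le> w" "w \<le> real_of_int j" for u w
        using that rng[of u] rng[of w] by (intro mono) auto
    qed (use lohi th in auto)
    then show ?thesis by (simp add: esum_def f_def)
  qed (use th in auto)
  have interior: "norm (sum f (cls k) - of_real (\<mu> k) * ee (\<phi> k) * fresnel L) \<le> E" if k: "inn k" for k
  proof -
    define x0 where "x0 = p (of_int k)"
    define r where "r = L * \<mu> k"
    note m = mu[OF k]
    have r0: "0 < r" using m L by (simp add: r_def)
    have rs: "r \<le> L / s" unfolding r_def using m(2) L mult_left_mono[of "\<mu> k" "1 / s" L] by simp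
    have x0: "x0 \<in> {real_of_int a..real_of_int b}" "g1 x0 = of_int k" using pk[OF k] by (auto simp: x0_def)
    have clr: "c * lam * r \<le> 1/4"
    proof -
      have "c * lam * r \<le> c * lam * (L / s)" using rs c lam by (intro mult_left_mono) auto
      also have "\<dots> = c * (L * s)" using s by (simp add: s(2)[symmetric])
      finally show ?thesis using s4 by simp
    qed
    have ltr: "\<theta> \<le> lam * r"
    proof -
      have "\<theta> * 1 \<le> \<theta> * (c * s * \<mu> k)" using m(3) th by (intro mult_left_mono) auto
      also have "\<dots> = lam * r" using c by (simp add: \<theta>_def r_def s(2)[symmetric])
      finally show ?thesis by simp
    qed
    have r1: "1 \<le> L * \<mu> k"
    proof -
      have "1 \<le> c * s * \<mu> k" by (rule m(3))
      also have "\<dots> \<le> 1 * \<mu> k"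
      proof (rule mult_right_mono)
        have "1 * s \<le> L * s" using L s by (intro mult_right_mono) auto
        then have "c * s \<le> c * (L * s)" using c by (intro mult_left_mono) auto
        then show "c * s \<le> 1" using s4 by linarith
      qed (use m in auto)
      also have "\<dots> \<le> L * \<mu> k" using L m by (intro mult_right_mono) auto
      finally show ?thesis .
    qed
    have inA: "real_of_int a \<le> x0 - r" 
    proof -
      have "1/4 \<le> g1 x0 - g1 (of_int a)" using k x0 by (simp add: inn_def)
      also have "\<dots> \<le> c * lam * (x0 - of_int a)" using x0 by (intro g1m) auto
      finally have "c * lam * r \<le> c * lam * (x0 - of_int a)" using clr by linarith
      then have "r \<le> x0 - of_int a" using c lam by (simp add: mult_le_cancel_left_pos)
      then show ?thesis by simp
    qed
    have inB: "x0 + r \<le> real_of_int b"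
    proof -
      have "1/4 \<le> g1 (of_int b) - g1 x0" using k x0 by (simp add: inn_def)
      also have "\<dots> \<le> c * lam * (of_int b - x0)" using x0 by (intro g1m) auto
      finally have "c * lam * r \<le> c * lam * (of_int b - x0)" using clr by linarith
      then have "r \<le> of_int b - x0" using c lam by (simp add: mult_le_cancel_left_pos)
      then show ?thesis by simp
    qed
    define W where "W = {\<lceil>x0 - r\<rceil>..\<lfloor>x0 + r\<rfloor>}"
    have Wiff: "n \<in> W \<longleftrightarrow> \<bar>of_int n - x0\<bar> \<le> r" for n
      unfolding W_def by (auto simp: abs_le_iff ceiling_le_iff le_floor_iff)
    have Wab: "n \<in> {a..b}" if "n \<in> W" for n
    proof -
      have "real_of_int a \<le> of_int n" "of_int n \<le> real_of_int b" using that inA inB unfolding Wiff by linarith+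
      then show ?thesis by simp
    qed
    have Wcls: "n \<in> cls k" if n: "n \<in> W" for n
    proof -
      have "\<bar>g1 (of_int n) - g1 x0\<bar> \<le> c * lam * \<bar>of_int n - x0\<bar>" using Wab[OF n] x0 by (intro g1abs) auto
      also have "\<dots> \<le> c * lam * r" using n c lam unfolding Wiff by (intro mult_left_mono) auto
      finally have "\<bar>g1 (of_int n) - of_int k\<bar> \<le> 1/4" using clr x0 by simp
      then have "\<kappa> n = k" unfolding \<kappa>_def by linarith
      then show ?thesis using Wab[OF n] by (simp add: cls_def)
    qed
    define Lft where "Lft = {n\<in>cls k. of_int n < x0 - r}"
    define Rgt where "Rgt = {n\<in>cls k. x0 + r < of_int n}"
    obtain i j where Lij: "Lft = {i..j}"
      using convex_cls[of "\<lambda>n. of_int n < x0 - r" k] unfolding Lft_def by auto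
    obtain i' j' where Rij: "Rgt = {i'..j'}"
      using convex_cls[of "\<lambda>n. x0 + r < of_int n" k] unfolding Rgt_def by auto
    have Lb: "norm (sum f Lft) \<le> 2 / \<theta>" unfolding Lij
    proof (rule KL[of _ _ "k - 1"])
      fix n assume "n \<in> {i..j}"
      then have "n \<in> Lft" by (simp only: Lij)
      then have n: "n \<in> {a..b}" "\<kappa> n = k" "of_int n < x0 - r" by (auto simp: Lft_def cls_def)
      have "lam * r \<le> lam * (x0 - of_int n)" using n lam by (intro mult_left_mono) auto
      also have "\<dots> \<le> g1 x0 - g1 (of_int n)" using n x0 r0 by (intro g1m) auto
      finally have "g1 (of_int n) \<le> of_int k - \<theta>" using ltr x0 by simp
      then show "n \<in> {a..b} \<and> of_int (k - 1) + \<theta> \<le> g1 (of_int n) \<and> g1 (of_int n) \<le> of_int (k - 1) + 1 - \<theta>"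
        using n kb(1)[of n] th by simp
    qed
    have Rb: "norm (sum f Rgt) \<le> 2 / \<theta>" unfolding Rij
    proof (rule KL[of _ _ k])
      fix n assume "n \<in> {i'..j'}"
      then have "n \<in> Rgt" by (simp only: Rij)
      then have n: "n \<in> {a..b}" "\<kappa> n = k" "x0 + r < of_int n" by (auto simp: Rgt_def cls_def)
      have "lam * r \<le> lam * (of_int n - x0)" using n lam by (intro mult_left_mono) auto
      also have "\<dots> \<le> g1 (of_int n) - g1 x0" using n x0 r0 by (intro g1m) auto
      finally have "of_int k + \<theta> \<le> g1 (of_int n)" using ltr x0 by simp
      then show "n \<in> {a..b} \<and> of_int k + \<theta> \<le> g1 (of_int n) \<and> g1 (of_int n) \<le> of_int k + 1 - \<theta>"
        using n kb(2)[of n] th by simp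
    qed
    have fin: "finite W" "finite Lft" "finite Rgt" by (auto simp: W_def Lij Rij)
    have "cls k = (W \<union> Lft) \<union> Rgt"
    proof (intro equalityI subsetI)
      fix n assume "n \<in> cls k"
      then show "n \<in> (W \<union> Lft) \<union> Rgt" unfolding Un_iff Wiff by (auto simp: Lft_def Rgt_def abs_le_iff)
    qed (auto simp: Lft_def Rgt_def Wcls)
    moreover have "W \<inter> Lft = {}" "(W \<union> Lft) \<inter> Rgt = {}"
      using r0 Wiff by (fastforce simp: Lft_def Rgt_def)+
    ultimately have dec: "sum f (cls k) = sum f W + sum f Lft + sum f Rgt"
      using fin by (simp add: sum.union_disjoint)
    have win: "norm (esum g \<lceil>x0 - L * \<mu> k\<rceil> \<lfloor>x0 + L * \<mu> k\<rfloor> - of_real (\<mu> k) * ee (\<phi> k) * fresnel L)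
        \<le> 21 * (L * \<mu> k) * (\<rho> * r ^ 3) + 16 * L\<^sup>2"
    proof (rule window_sum[where k = k])
      fix n :: int assume n: "\<bar>of_int n - x0\<bar> \<le> L * \<mu> k"
      then have "n \<in> W" by (simp add: Wiff r_def)
      from Wab[OF this] have "\<bar>g (of_int n) - (g x0 + g1 x0 * (of_int n - x0) + g2 x0 * (of_int n - x0)\<^sup>2 / 2)\<bar> \<le> \<rho> * r ^ 3"
        using n x0 rho by (intro Taylor2_bound[where A = "of_int a" and B = "of_int b"] d1 d2 lip) (auto simp: r_def)
      moreover have "g x0 + g1 x0 * (of_int n - x0) + g2 x0 * (of_int n - x0)\<^sup>2 / 2
          = of_int (k * n) + \<phi> k + (of_int n - x0)\<^sup>2 / (2 * (\<mu> k)\<^sup>2)"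
        using m(4) x0(2) by (simp add: \<phi>_def x0_def algebra_simps)
      ultimately show "\<bar>g (of_int n) - (of_int (k * n) + \<phi> k + (of_int n - x0)\<^sup>2 / (2 * (\<mu> k)\<^sup>2))\<bar> \<le> \<rho> * r ^ 3"
        by simp
    qed (use m L r1 rho r0 in auto)
    have "sum f (cls k) - of_real (\<mu> k) * ee (\<phi> k) * fresnel L
        = (esum g \<lceil>x0 - L * \<mu> k\<rceil> \<lfloor>x0 + L * \<mu> k\<rfloor> - of_real (\<mu> k) * ee (\<phi> k) * fresnel L) + sum f Lft + sum f Rgt"
      unfolding dec by (simp add: W_def r_def esum_def f_def)
    also have "norm \<dots> \<le> (21 * (L * \<mu> k) * (\<rho> * r ^ 3) + 16 * L\<^sup>2) + 2 / \<theta> + 2 / \<theta>"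
      by (intro order_trans[OF norm_triangle_ineq] add_mono win Lb Rb)
    also have "21 * (L * \<mu> k) * (\<rho> * r ^ 3) = 21 * \<rho> * r ^ 4"
      by (simp add: r_def power3_eq_cube power4_eq_xxxx)
    also have "21 * \<rho> * r ^ 4 \<le> 21 * \<rho> * (L / s) ^ 4"
      using rs r0 rho by (intro mult_left_mono power_mono) auto
    also have "(L / s) ^ 4 = L ^ 4 / lam\<^sup>2"
      by (simp add: power_divide s(2)[symmetric] power4_eq_xxxx power2_eq_square)
    also have "21 * \<rho> * (L ^ 4 / lam\<^sup>2) + 16 * L\<^sup>2 + 2 / \<theta> + 2 / \<theta> = E"
      by (simp add: E_def \<theta>_def)
    finally show ?thesis by simp
  qed
  \<comment> \<open>A crude bound for the two end classes: within a class \<open>g1\<close> varies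
    by at most 1, so the class has at most 1 / lam + 1 elements and the second derivative test gives
    O(1 / s).\<close>
  have any: "norm (sum f (cls k)) \<le> 30 * c / s" for k
  proof -
    obtain i j where ij: "cls k = {i..j}" using convex_cls[of "\<lambda>_. True" k] by auto
    show ?thesis
    proof (cases "i \<le> j")
      case True
      then have "i \<in> cls k" "j \<in> cls k" by (auto simp: ij)
      then have m: "a \<le> i" "j \<le> b" "\<kappa> i = k" "\<kappa> j = k" by (auto simp: cls_def)
      have "lam * (of_int j - of_int i) \<le> g1 (of_int j) - g1 (of_int i)" using m True by (intro g1m) auto
      also have "\<dots> \<le> 1" using kb(1)[of i] kb(2)[of j] m by simp
      finally have len: "of_int (j - i + 1) \<le> 1 / lam + 1" using lam by (simp add: field_simps)
      have "norm (esum g i j) \<le> 10 * c * ((1 / lam + 1) * sqrt lam + 1 / sqrt lam)"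
        by (rule second_derivative_test[of i j g g1 g2 lam c]) (use m len lam c in \<open>auto intro!: d1 d2 lo hi\<close>)
      also have "(1 / lam + 1) * sqrt lam + 1 / sqrt lam = 2 / s + s"
        using s by (simp add: s_def[symmetric] s(2)[symmetric] field_simps)
      also have "10 * c * (2 / s + s) \<le> 10 * c * (3 / s)"
      proof (intro mult_left_mono)
        have "s * s \<le> 1" using s14 s mult_mono[of s 1 s 1] by simp
        then have "s \<le> 1 / s" using s by (simp add: field_simps)
        then show "2 / s + s \<le> 3 / s" by simp
      qed (use c in auto)
      finally show ?thesis by (simp add: ij esum_def f_def)
    qed (use c s in \<open>auto simp: ij\<close>)
  qed
  define I where "I = {k\<in>{\<kappa> a..\<kappa> b}. inn k}"
  define J where "J = {k\<in>{\<kappa> a..\<kappa> b}. \<not> inn k}"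
  have fIJ: "finite I" "finite J"
    by (rule finite_subset[of _ "{\<kappa> a..\<kappa> b}"]; force simp: I_def J_def)+
  have Jsub: "J \<subseteq> {\<kappa> a, \<kappa> b}"
  proof
    fix k assume "k \<in> J"
    then have k: "\<kappa> a \<le> k" "k \<le> \<kappa> b" "\<not> inn k" by (auto simp: J_def)
    then consider "of_int k < g1 (of_int a) + 1/4" | "g1 (of_int b) - 1/4 < of_int k" by (auto simp: inn_def)
    then have "k = \<kappa> a \<or> k = \<kappa> b"
    proof cases
      case 1
      have "of_int k < real_of_int (\<kappa> a + 1)" using 1 kb(2)[of a] by simp
      then show ?thesis using k by linarith
    next
      case 2
      have "real_of_int (\<kappa> b - 1) < of_int k" using 2 kb(1)[of b] by simp
      then show ?thesis using k by linarith
    qed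
    then show "k \<in> {\<kappa> a, \<kappa> b}" by simp
  qed
  have total: "esum g a b = (\<Sum>k\<in>I. sum f (cls k)) + (\<Sum>k\<in>J. sum f (cls k))"
  proof -
    have "esum g a b = (\<Sum>k\<in>{\<kappa> a..\<kappa> b}. sum f (cls k))"
      unfolding esum_def f_def cls_def using kmono by (intro sum.group[symmetric]) auto
    also have "{\<kappa> a..\<kappa> b} = I \<union> J" by (auto simp: I_def J_def)
    also have "(\<Sum>k\<in>I \<union> J. sum f (cls k)) = (\<Sum>k\<in>I. sum f (cls k)) + (\<Sum>k\<in>J. sum f (cls k))"
      by (rule sum.union_disjoint) (auto simp: fIJ, auto simp: I_def J_def)
    finally show ?thesis .
  qed
  have Jb: "norm (\<Sum>k\<in>J. sum f (cls k)) \<le> 60 * c / s"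
  proof -
    have "norm (\<Sum>k\<in>J. sum f (cls k)) \<le> (\<Sum>k\<in>J. 30 * c / s)"
      by (intro order_trans[OF norm_sum] sum_mono any)
    also have "\<dots> = real (card J) * (30 * c / s)" by simp
    also have "\<dots> \<le> 2 * (30 * c / s)"
    proof (rule mult_right_mono)
      have "card J \<le> card {\<kappa> a, \<kappa> b}" using Jsub by (intro card_mono) auto
      also have "\<dots> \<le> 2" by (simp add: card_insert_if)
      finally show "real (card J) \<le> 2" by simp
    qed (use c s in auto)
    finally show ?thesis by simp
  qed
  have cardI: "real (card I) \<le> c * lam * N + 2"
  proof -
    have "real (card I) \<le> real (card {\<kappa> a..\<kappa> b})" by (intro of_nat_mono card_mono) (auto simp: I_def)
    also have "\<dots> = of_int (\<kappa> b - \<kappa> a + 1)" using kmono[of a b] ab by simp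
    also have "\<dots> \<le> g1 (of_int b) - g1 (of_int a) + 2" using kb(1)[of b] kb(2)[of a] by simp
    also have "g1 (of_int b) - g1 (of_int a) \<le> c * lam * (of_int b - of_int a)" using ab by (intro g1m) auto
    also have "c * lam * (of_int b - of_int a) \<le> c * lam * N" using N c lam by (intro mult_left_mono) auto
    finally show ?thesis by simp
  qed
  have Ib: "norm (\<Sum>k\<in>I. of_real (\<mu> k) * ee (\<phi> k)) \<le> Bd / s"
  proof (cases "I = {}")
    case True
    then show ?thesis using Bd s by simp
  next
    case False
    have "\<exists>k1 k2. I = {k1..k2}"
      by (rule convex_int_set[OF fIJ(1)]) (auto simp: I_def inn_def)
    then obtain k1 k2 where I: "I = {k1..k2}" by blast
    then have k12: "k1 \<le> k2" using False by simp
    have im: "inn k" if "k1 \<le> k" "k \<le> k2" for k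
    proof -
      have "k \<in> I" unfolding I using that by simp
      then show ?thesis by (simp add: I_def)
    qed
    \<comment> \<open>\<open>p\<close> increases and \<open>g2\<close> decreases, so the weights
      \<mu> increase with \<open>k\<close>. Abel summation then needs only tails of the unweighted
      dual sum, and the largest weight is at most 1 / s.\<close>
    have "norm (\<Sum>k\<in>{k1..k2}. of_real (\<mu> k - 0) * ee (\<phi> k)) \<le> (\<mu> k2 - 0) * Bd"
    proof (rule norm_sum_mono_weights_le)
      fix i j assume ij: "k1 \<le> i" "i \<le> j" "j \<le> k2"
      have i: "inn i" and j: "inn j" using im ij by auto
      have "p (of_int i) \<le> p (of_int j)"
      proof (rule ccontr)
        assume "\<not> p (of_int i) \<le> p (of_int j)"
        then have lt: "p (of_int j) < p (of_int i)" by simp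
        have "0 < lam * (p (of_int i) - p (of_int j))" using lt lam by simp
        also have "\<dots> \<le> g1 (p (of_int i)) - g1 (p (of_int j))"
          using pk[OF i] pk[OF j] lt by (intro g1m) auto
        also have "\<dots> \<le> 0" using pk[OF i] pk[OF j] ij by simp
        finally show False by simp
      qed
      then have "g2 (p (of_int j)) \<le> g2 (p (of_int i))"
        using pk[OF i] pk[OF j] by (intro anti) auto
      moreover have "0 < g2 (p (of_int j))" using lo[OF pk(1)[OF j]] lam by simp
      ultimately show "\<mu> i \<le> \<mu> j" unfolding \<mu>_def by (intro divide_left_mono) auto
    next
      fix j assume j: "k1 \<le> j" "j \<le> k2"
      have "inn j" "inn k2" using im j k12 by auto
      then have "norm (esum (\<lambda>v. g (p v) - v * p v) j k2) \<le> Bd"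
        using j by (intro dual) (auto simp: inn_def)
      then show "norm (\<Sum>k\<in>{j..k2}. ee (\<phi> k)) \<le> Bd" by (simp add: esum_def \<phi>_def)
    next
      show "0 \<le> \<mu> k1" using mu(1)[OF im[of k1]] k12 by simp
    qed (rule k12)
    also have "\<dots> \<le> 1 / s * Bd" using mu(2)[OF im[of k2]] k12 Bd by (intro mult_right_mono) auto
    finally show ?thesis by (simp add: I)
  qed
  have "(\<Sum>k\<in>I. sum f (cls k)) = (\<Sum>k\<in>I. sum f (cls k) - of_real (\<mu> k) * ee (\<phi> k) * fresnel L) + (\<Sum>k\<in>I. of_real (\<mu> k) * ee (\<phi> k)) * fresnel L"
    by (simp add: sum_subtractf sum_distrib_right)
  also have "norm \<dots> \<le> (c * lam * N + 2) * E + Bd / s * 5"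
  proof (intro order_trans[OF norm_triangle_ineq] add_mono)
    have "norm (\<Sum>k\<in>I. sum f (cls k) - of_real (\<mu> k) * ee (\<phi> k) * fresnel L) \<le> (\<Sum>k\<in>I. E)"
      by (intro order_trans[OF norm_sum] sum_mono interior) (auto simp: I_def)
    also have "\<dots> \<le> (c * lam * N + 2) * E" using cardI E0 by (simp add: mult_right_mono)
    finally show "norm (\<Sum>k\<in>I. sum f (cls k) - of_real (\<mu> k) * ee (\<phi> k) * fresnel L) \<le> (c * lam * N + 2) * E" .
    show "norm ((\<Sum>k\<in>I. of_real (\<mu> k) * ee (\<phi> k)) * fresnel L) \<le> Bd / s * 5"
      unfolding norm_mult using Ib norm_fresnel_le[OF L] Bd s by (intro mult_mono) auto
  qed
  finally have "norm (\<Sum>k\<in>I. sum f (cls k)) \<le> (c * lam * N + 2) * E + Bd / s * 5" .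
  then have "norm (esum g a b) \<le> ((c * lam * N + 2) * E + Bd / s * 5) + 60 * c / s"
    unfolding total using Jb by (intro order_trans[OF norm_triangle_ineq] add_mono)
  then show ?thesis by (simp add: E_def s_def mult.commute)
qed

subsection \<open>Perturbed monomials\<close>

definition nbhd :: "real \<Rightarrow> complex set" where
  "nbhd \<rho> = (\<Union>u\<in>{1..2::real}. ball (of_real u) \<rho>)"

text \<open>Closeness in supremum norm on a complex domain survives differentiation at the price of
  a smaller radius, so one number \<delta> controls every derivative. Being real on the axis is part
  of the predicate because products and quotients are later rewritten through real parts.\<close>

definition near :: "real \<Rightarrow> real \<Rightarrow> (complex \<Rightarrow> complex) \<Rightarrow> (complex \<Rightarrow> complex) \<Rightarrow> bool" where
  "near \<rho> \<delta> F M \<longleftrightarrow> F holomorphic_on nbhd \<rho> \<and> (\<forall>t. complex_of_real t \<in> nbhd \<rho> \<longrightarrow> F (of_real t) \<in> \<real>) \<and>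
     (\<forall>w\<in>nbhd \<rho>. norm (F w - M w) \<le> \<delta>)"

text \<open>With a natural exponent the function is holomorphic away from 0 without a choice of
  branch, and the family is closed under differentiation.\<close>

definition ipow :: "real \<Rightarrow> nat \<Rightarrow> complex \<Rightarrow> complex" where
  "ipow D n w = of_real D / w ^ n"

lemma open_nbhd [simp]: "open (nbhd \<rho>)"
  unfolding nbhd_def by auto

lemma nbhd_mono: "\<rho>' \<le> \<rho> \<Longrightarrow> w \<in> nbhd \<rho>' \<Longrightarrow> w \<in> nbhd \<rho>"
  by (force simp: nbhd_def)

lemma of_real_in_nbhd: "0 < \<rho> \<Longrightarrow> 1 \<le> t \<Longrightarrow> t \<le> 2 \<Longrightarrow> complex_of_real t \<in> nbhd \<rho>"
  by (auto simp: nbhd_def intro!: bexI[of _ t])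

lemma nbhd_ball: "w \<in> nbhd \<rho>' \<Longrightarrow> \<rho>' + r \<le> \<rho> \<Longrightarrow> dist w z \<le> r \<Longrightarrow> z \<in> nbhd \<rho>"
  unfolding nbhd_def
  by (auto intro!: bexI) (metis add.commute add_less_le_mono dist_commute dist_triangle_lt order_less_le_trans)

lemma norm_nbhd:
  assumes "w \<in> nbhd \<rho>" "\<rho> \<le> 1/2"
  shows "1/2 \<le> norm w" "norm w \<le> 5/2"
proof -
  obtain u :: real where u: "1 \<le> u" "u \<le> 2" "norm (of_real u - w) < \<rho>"
    using assms by (auto simp: nbhd_def dist_norm)
  have nu: "norm (complex_of_real u) = u" using u by simp
  show "1/2 \<le> norm w" using norm_triangle_ineq2[of "of_real u" w] u assms(2) nu by linarith
  show "norm w \<le> 5/2" using norm_triangle_ineq2[of w "of_real u"] u assms(2) nu by (simp add: norm_minus_commute)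
qed

lemma nbhd_nonzero: "w \<in> nbhd \<rho> \<Longrightarrow> \<rho> \<le> 1/2 \<Longrightarrow> w \<noteq> 0"
  using norm_nbhd(1) by force

lemma ipow_has_derivative:
  assumes "w \<noteq> 0"
  shows "(ipow D n has_field_derivative ipow (- real n * D) (Suc n) w) (at w)"
proof (cases n)
  case 0
  then show ?thesis by (simp add: ipow_def[abs_def])
next
  case (Suc k)
  have "((\<lambda>w. of_real D / w ^ n) has_field_derivative - (of_real D * (of_nat n * w ^ (n - 1))) / (w ^ n * w ^ n)) (at w)"
    using assms by (auto intro!: derivative_eq_intros)
  moreover have "- (of_real D * (of_nat n * w ^ (n - 1))) / (w ^ n * w ^ n) = ipow (- real n * D) (Suc n) w"
    using assms Suc by (simp add: ipow_def field_simps)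
  ultimately show ?thesis by (simp add: ipow_def[abs_def])
qed

lemma deriv_ipow: "w \<noteq> 0 \<Longrightarrow> deriv (ipow D n) w = ipow (- real n * D) (Suc n) w"
  by (rule DERIV_imp_deriv) (rule ipow_has_derivative)

lemma ipow_holomorphic: "\<rho> \<le> 1/2 \<Longrightarrow> ipow D n holomorphic_on nbhd \<rho>"
  unfolding ipow_def[abs_def] by (intro holomorphic_intros) (auto dest: nbhd_nonzero)

lemma norm_ipow_le:
  assumes "w \<in> nbhd \<rho>" "\<rho> \<le> 1/2"
  shows "norm (ipow D n w) \<le> \<bar>D\<bar> * 2 ^ n"
proof -
  have "(1/2) ^ n \<le> norm w ^ n" using norm_nbhd(1)[OF assms] by (intro power_mono) auto
  then have "norm (ipow D n w) \<le> \<bar>D\<bar> / (1/2) ^ n"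
    unfolding ipow_def norm_divide norm_power by (intro frac_le) auto
  then show ?thesis by (simp add: power_one_over)
qed

lemma norm_ipow_ge:
  assumes "w \<in> nbhd \<rho>" "\<rho> \<le> 1/2"
  shows "\<bar>D\<bar> / (5/2) ^ n \<le> norm (ipow D n w)"
proof -
  have "norm w ^ n \<le> (5/2) ^ n" using norm_nbhd(2)[OF assms] by (intro power_mono) auto
  moreover have "0 < norm w ^ n" using nbhd_nonzero[OF assms] by simp
  ultimately show ?thesis unfolding ipow_def norm_divide norm_power by (intro frac_le) auto
qed

lemma has_field_derivative_deriv_nbhd:
  "F holomorphic_on nbhd \<rho> \<Longrightarrow> w \<in> nbhd \<rho> \<Longrightarrow> (F has_field_derivative deriv F w) (at w)"
  by (rule holomorphic_derivI[of _ "nbhd \<rho>"]) auto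

lemma has_real_derivative_Re:
  assumes "(F has_field_derivative F') (at (complex_of_real t))"
  shows "((\<lambda>t. Re (F (of_real t))) has_real_derivative Re F') (at t)"
    and "((\<lambda>t. Im (F (of_real t))) has_real_derivative Im F') (at t)"
proof -
  have "((\<lambda>t. F (of_real t)) has_vector_derivative F') (at t)"
    using has_vector_derivative_real_field[of F F' t UNIV] assms by simp
  from bounded_linear.has_vector_derivative[OF bounded_linear_Re this]
    bounded_linear.has_vector_derivative[OF bounded_linear_Im this]
  show "((\<lambda>t. Re (F (of_real t))) has_real_derivative Re F') (at t)"
    "((\<lambda>t. Im (F (of_real t))) has_real_derivative Im F') (at t)"
    by (simp_all add: has_real_derivative_iff_has_vector_derivative)
qed

lemma deriv_real_on_reals:
  assumes hol: "F holomorphic_on nbhd \<rho>" and re: "\<And>t. complex_of_real t \<in> nbhd \<rho> \<Longrightarrow> F (of_real t) \<in> \<real>"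
    and t: "complex_of_real t \<in> nbhd \<rho>"
  shows "deriv F (of_real t) \<in> \<real>"
proof -
  have d: "((\<lambda>t. Im (F (of_real t))) has_real_derivative Im (deriv F (of_real t))) (at t)"
    by (rule has_real_derivative_Re) (rule has_field_derivative_deriv_nbhd[OF hol t])
  have op: "open (complex_of_real -` nbhd \<rho>)"
    by (intro open_vimage) (auto intro!: continuous_intros)
  have "((\<lambda>t. 0) has_real_derivative Im (deriv F (of_real t))) (at t)"
    by (rule has_field_derivative_transform_within_open[OF d op])
       (use t re in \<open>auto simp: complex_is_Real_iff\<close>)
  then have "Im (deriv F (of_real t)) = 0" by (rule DERIV_unique) simp
  then show ?thesis by (simp add: complex_is_Real_iff)
qed

text \<open>Cauchy's estimate for \<open>F - M\<close> on discs of radius (\<rho> - \<rho>') / 2;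
  halving keeps the closed discs inside the larger neighbourhood.\<close>

lemma near_deriv:
  assumes F: "near \<rho> \<delta> F M" and M: "M holomorphic_on nbhd \<rho>" and rho: "0 < \<rho>'" "\<rho>' < \<rho>"
  shows "near \<rho>' (2 * \<delta> / (\<rho> - \<rho>')) (deriv F) (deriv M)"
proof -
  have hol: "F holomorphic_on nbhd \<rho>" and re: "\<And>t. complex_of_real t \<in> nbhd \<rho> \<Longrightarrow> F (of_real t) \<in> \<real>"
    and cl: "\<And>w. w \<in> nbhd \<rho> \<Longrightarrow> norm (F w - M w) \<le> \<delta>" using F by (auto simp: near_def)
  have sub: "nbhd \<rho>' \<subseteq> nbhd \<rho>" by (rule subsetI, rule nbhd_mono[of \<rho>' \<rho>]) (use rho in auto)
  have "norm (deriv F w - deriv M w) \<le> 2 * \<delta> / (\<rho> - \<rho>')" if w: "w \<in> nbhd \<rho>'" for w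
  proof -
    define r where "r = (\<rho> - \<rho>') / 2"
    have r: "0 < r" "\<rho>' + r \<le> \<rho>" using rho by (auto simp: r_def field_simps)
    have cb: "cball w r \<subseteq> nbhd \<rho>" using nbhd_ball[OF w r(2)] by auto
    have holE: "(\<lambda>z. F z - M z) holomorphic_on nbhd \<rho>" by (intro holomorphic_intros hol M)
    have "norm ((deriv ^^ 1) (\<lambda>z. F z - M z) w) \<le> fact 1 * \<delta> / r ^ 1"
    proof (rule Cauchy_inequality)
      show "(\<lambda>z. F z - M z) holomorphic_on ball w r" using holE cb ball_subset_cball by (blast intro: holomorphic_on_subset)
      show "continuous_on (cball w r) (\<lambda>z. F z - M z)" using holE cb by (blast intro: holomorphic_on_imp_continuous_on holomorphic_on_subset)
      fix x assume "cmod (w - x) = r"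
      then have "x \<in> cball w r" by (simp add: dist_norm)
      then show "cmod (F x - M x) \<le> \<delta>" using cb by (intro cl) auto
    qed (rule r)
    moreover have "deriv (\<lambda>z. F z - M z) w = deriv F w - deriv M w"
      using hol M sub w by (intro deriv_diff) (auto intro: holomorphic_on_imp_differentiable_at)
    ultimately show ?thesis using r(1) by (simp add: r_def mult.commute)
  qed
  moreover have "deriv F holomorphic_on nbhd \<rho>'"
    using holomorphic_deriv[OF hol open_nbhd] sub by (rule holomorphic_on_subset)
  ultimately show ?thesis using deriv_real_on_reals[OF hol re] sub by (auto simp: near_def)
qed

lemma near_mono: "near \<rho> \<delta> F M \<Longrightarrow> \<rho>' \<le> \<rho> \<Longrightarrow> \<delta> \<le> \<delta>' \<Longrightarrow> near \<rho>' \<delta>' F M"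
  unfolding near_def by (meson holomorphic_on_subset nbhd_mono order_trans subsetI)

lemma near_cong: "near \<rho> \<delta> F M \<Longrightarrow> (\<And>w. w \<in> nbhd \<rho> \<Longrightarrow> M w = M' w) \<Longrightarrow> near \<rho> \<delta> F M'"
  by (simp add: near_def)

lemma near_divide:
  assumes A: "near \<rho> \<delta>1 A A0" and B: "near \<rho> \<delta>2 B B0"
    and b: "\<And>w. w \<in> nbhd \<rho> \<Longrightarrow> \<beta> \<le> norm (B0 w)" "0 < \<beta>" "\<delta>2 \<le> \<beta> / 2"
    and a: "\<And>w. w \<in> nbhd \<rho> \<Longrightarrow> norm (A0 w) \<le> \<alpha>" and pos: "0 \<le> \<delta>1" "0 \<le> \<delta>2" "0 \<le> \<alpha>"
  shows "near \<rho> (2 * \<delta>1 / \<beta> + 2 * \<alpha> * \<delta>2 / \<beta>\<^sup>2) (\<lambda>w. A w / B w) (\<lambda>w. A0 w / B0 w)"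
proof -
  have Bb: "\<beta> / 2 \<le> norm (B w)" if w: "w \<in> nbhd \<rho>" for w
  proof -
    have "norm (B w - B0 w) \<le> \<delta>2" using B w by (auto simp: near_def)
    then show ?thesis using b(1)[OF w] b(3) norm_triangle_ineq2[of "B0 w" "B w"] by (simp add: norm_minus_commute)
  qed
  have nz: "B w \<noteq> 0" "B0 w \<noteq> 0" if "w \<in> nbhd \<rho>" for w
    using Bb[OF that] b(1)[OF that] b(2) by auto
  have "norm (A w / B w - A0 w / B0 w) \<le> 2 * \<delta>1 / \<beta> + 2 * \<alpha> * \<delta>2 / \<beta>\<^sup>2" if w: "w \<in> nbhd \<rho>" for w
  proof -
    have dA: "norm (A w - A0 w) \<le> \<delta>1" and dB: "norm (B w - B0 w) \<le> \<delta>2"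
      using A B w by (auto simp: near_def)
    have "A w / B w - A0 w / B0 w = (A w - A0 w) / B w - A0 w * (B w - B0 w) / (B w * B0 w)"
      using nz[OF w] by (simp add: field_simps)
    also have "norm \<dots> \<le> norm ((A w - A0 w) / B w) + norm (A0 w * (B w - B0 w) / (B w * B0 w))"
      by (rule norm_triangle_ineq4)
    also have "\<dots> \<le> \<delta>1 / (\<beta> / 2) + \<alpha> * \<delta>2 / (\<beta> / 2 * \<beta>)"
      unfolding norm_divide norm_mult using dA dB Bb[OF w] b a[OF w] w pos
      by (intro add_mono frac_le mult_mono) auto
    also have "\<dots> = 2 * \<delta>1 / \<beta> + 2 * \<alpha> * \<delta>2 / \<beta>\<^sup>2"
      by (simp add: power2_eq_square mult_ac)
    finally show ?thesis .
  qed
  moreover have "(\<lambda>w. A w / B w) holomorphic_on nbhd \<rho>"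
    using A B nz by (intro holomorphic_intros) (auto simp: near_def)
  ultimately show ?thesis using A B by (auto simp: near_def intro!: Reals_divide)
qed

text \<open>With F = M + E, the quotient of E is at most the supremum of E' on the neighbourhood of
  radius 3 * \<rho> / 4, and the quotient of M differs from M' by at most \<open>h\<close> times the
  bound for M''. Thus differencing acts on perturbed monomials like differentiation.\<close>

lemma near_difference_quotient:
  assumes F: "near \<rho> \<delta> F M" and M: "M holomorphic_on nbhd \<rho>" and rho: "0 < \<rho>" and d: "0 \<le> \<delta>"
    and B: "\<And>w. w \<in> nbhd \<rho> \<Longrightarrow> norm (deriv (deriv M) w) \<le> B" and B0: "0 \<le> B"
    and h: "0 < h" "h \<le> \<rho> / 4"
  shows "near (\<rho> / 2) (8 * \<delta> / \<rho> + B * h) (\<lambda>w. (F (w + of_real h) - F w) / of_real h) (deriv M)"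
proof -
  have hol: "F holomorphic_on nbhd \<rho>" and re: "\<And>t. complex_of_real t \<in> nbhd \<rho> \<Longrightarrow> F (of_real t) \<in> \<real>"
    and cl: "\<And>w. w \<in> nbhd \<rho> \<Longrightarrow> norm (F w - M w) \<le> \<delta>" using F by (auto simp: near_def)
  have sub: "nbhd (\<rho>/2) \<subseteq> nbhd \<rho>" by (rule subsetI, rule nbhd_mono[of "\<rho>/2" \<rho>]) (use rho in auto)
  have plus: "w + of_real h \<in> nbhd \<rho>" if "w \<in> nbhd (\<rho>/2)" for w
    by (rule nbhd_ball[OF that, of "\<rho>/4"]) (use h rho in \<open>auto simp: dist_norm\<close>)
  have hol': "(\<lambda>w. F (w + of_real h)) holomorphic_on nbhd (\<rho>/2)"
  proof -
    have "F \<circ> (\<lambda>w. w + of_real h) holomorphic_on nbhd (\<rho>/2)"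
      by (rule holomorphic_on_compose_gen[OF _ hol]) (use plus in \<open>auto intro!: holomorphic_intros\<close>)
    then show ?thesis by (simp add: o_def)
  qed
  have dE: "near (3 * \<rho> / 4) (2 * \<delta> / (\<rho> - 3 * \<rho> / 4)) (deriv F) (deriv M)"
    by (rule near_deriv[OF F M]) (use rho in auto)
  have "norm ((F (w + of_real h) - F w) / of_real h - deriv M w) \<le> 8 * \<delta> / \<rho> + B * h" if w: "w \<in> nbhd (\<rho>/2)" for w
  proof -
    obtain u where u: "u \<in> {1..2}" "w \<in> ball (of_real u) (\<rho>/2)" using w by (auto simp: nbhd_def)
    define S where "S = ball (complex_of_real u) (3 * \<rho> / 4)"
    have S34: "S \<subseteq> nbhd (3 * \<rho> / 4)" using u by (auto simp: S_def nbhd_def)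
    have S1: "S \<subseteq> nbhd \<rho>" by (rule order_trans[OF S34], rule subsetI, rule nbhd_mono[of "3 * \<rho> / 4" \<rho>]) (use rho in auto)
    have cS: "convex S" by (simp add: S_def)
    have wS: "w \<in> S" using u rho by (simp add: S_def)
    have whS: "w + of_real h \<in> S"
    proof -
      have "dist (of_real u) (w + of_real h) \<le> dist (of_real u) w + dist w (w + of_real h)" by (rule dist_triangle)
      then show ?thesis using u h rho by (simp add: S_def dist_norm)
    qed
    define E where "E z = F z - M z" for z
    define H where "H z = M z - deriv M w * z" for z
    have nh: "norm (w + of_real h - w) = h" using h by simp
    have "norm (E (w + of_real h) - E w) \<le> (2 * \<delta> / (\<rho> - 3 * \<rho> / 4)) * norm (w + of_real h - w)"
    proof (rule field_differentiable_bound[OF cS _ _ whS wS])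
      fix z assume z: "z \<in> S"
      have zr: "z \<in> nbhd \<rho>" using z S1 by blast
      have "(F has_field_derivative deriv F z) (at z within S)" "(M has_field_derivative deriv M z) (at z within S)"
        by (rule has_field_derivative_at_within, rule has_field_derivative_deriv_nbhd[OF _ zr], fact)+
      then show "(E has_field_derivative deriv F z - deriv M z) (at z within S)"
        unfolding E_def by (rule DERIV_diff)
      show "norm (deriv F z - deriv M z) \<le> 2 * \<delta> / (\<rho> - 3 * \<rho> / 4)"
        using dE z S34 by (auto simp: near_def)
    qed
    also have "\<dots> = 8 * \<delta> / \<rho> * h" using rho nh by (simp add: field_simps)
    finally have e1: "norm (E (w + of_real h) - E w) \<le> 8 * \<delta> / \<rho> * h" .
    have "norm (H (w + of_real h) - H w) \<le> (B * h) * norm (w + of_real h - w)"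
    proof (rule field_differentiable_bound)
      show "convex (closed_segment w (w + of_real h))" by simp
      fix z assume z: "z \<in> closed_segment w (w + of_real h)"
      have zS: "z \<in> S" using z wS whS cS by (meson closed_segment_subset subsetD)
      have "(M has_field_derivative deriv M z) (at z within closed_segment w (w + of_real h))"
        by (rule has_field_derivative_at_within, rule has_field_derivative_deriv_nbhd[OF M]) (use zS S1 in blast)
      then show "(H has_field_derivative deriv M z - deriv M w) (at z within closed_segment w (w + of_real h))"
        unfolding H_def by (auto intro!: derivative_eq_intros)
      have "norm (deriv M z - deriv M w) \<le> B * norm (z - w)"
      proof (rule field_differentiable_bound[OF cS _ _ zS wS])
        fix y assume y: "y \<in> S"
        show "(deriv M has_field_derivative deriv (deriv M) y) (at y within S)"
          by (rule has_field_derivative_at_within, rule has_field_derivative_deriv_nbhd[OF holomorphic_deriv[OF M open_nbhd]])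
             (use y S1 in blast)
        show "norm (deriv (deriv M) y) \<le> B" using y S1 by (intro B) auto
      qed
      also have "norm (z - w) \<le> h"
      proof -
        have "norm (z - w) \<le> norm (w + of_real h - w)"
          using z by (metis segment_bound(1) norm_minus_commute)
        then show ?thesis using nh by simp
      qed
      finally show "norm (deriv M z - deriv M w) \<le> B * h" using B0 by (simp add: mult_left_mono)
    qed auto
    then have e2: "norm (H (w + of_real h) - H w) \<le> B * h * h" by (simp only: nh)
    have "of_real h * ((F (w + of_real h) - F w) / of_real h - deriv M w) = (E (w + of_real h) - E w) + (H (w + of_real h) - H w)"
      using h by (simp add: E_def H_def field_simps)
    then have "h * norm ((F (w + of_real h) - F w) / of_real h - deriv M w) \<le> 8 * \<delta> / \<rho> * h + B * h * h"
      using norm_triangle_mono[OF e1 e2] h by (metis abs_of_pos norm_mult norm_of_real)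
    also have "\<dots> = h * (8 * \<delta> / \<rho> + B * h)" by (simp add: algebra_simps)
    finally show ?thesis using h by (simp only: mult_le_cancel_left_pos)
  qed
  moreover have "(\<lambda>w. (F (w + of_real h) - F w) / of_real h) holomorphic_on nbhd (\<rho>/2)"
    using h by (intro holomorphic_intros hol' holomorphic_on_subset[OF hol sub]) auto
  moreover have "(F (of_real t + of_real h) - F (of_real t)) / of_real h \<in> \<real>" if "complex_of_real t \<in> nbhd (\<rho>/2)" for t
    using re[of "t + h"] re[of t] plus[OF that] that sub by (auto intro!: Reals_divide Reals_diff)
  ultimately show ?thesis by (auto simp: near_def)
qed

text \<open>The falling factorial of -b: the \<open>j\<close>-th derivative of w ^ (-b) is
  \<open>falling_coeff b j / w ^ (b + j)\<close>.\<close>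

primrec falling_coeff :: "nat \<Rightarrow> nat \<Rightarrow> real" where
  "falling_coeff b 0 = 1"
| "falling_coeff b (Suc j) = - real (b + j) * falling_coeff b j"

lemma falling_coeff_sign: "1 \<le> b \<Longrightarrow> 0 < (-1) ^ j * falling_coeff b j"
proof (induction j)
  case (Suc j)
  have "(-1) ^ Suc j * falling_coeff b (Suc j) = real (b + j) * ((-1) ^ j * falling_coeff b j)" by (simp add: algebra_simps)
  then show ?case using Suc by simp
qed simp

text \<open>The radius halves in each step and the error stays proportional to the bound
  \<open>e\<close> for the relative shifts. It starts at zero because the undifferenced phase is an
  exact monomial.\<close>

lemma near_iterated_differences:
  obtains K :: "nat \<Rightarrow> real" where "K 0 = 0" "\<And>j. 0 \<le> K j"
    "\<And>j e h F. near ((1/2) ^ Suc j) (K j * e) F (ipow (falling_coeff b j) (b + j)) \<Longrightarrow> 0 < h \<Longrightarrow> h \<le> e \<Longrightarrow>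
       e \<le> (1/2) ^ Suc j / 4 \<Longrightarrow>
       near ((1/2) ^ Suc (Suc j)) (K (Suc j) * e) (\<lambda>w. (F (w + of_real h) - F w) / of_real h)
         (ipow (falling_coeff b (Suc j)) (b + Suc j))"
proof -
  define Bd where "Bd j = \<bar>falling_coeff b (Suc (Suc j))\<bar> * 2 ^ (b + Suc (Suc j))" for j
  define K where "K = rec_nat 0 (\<lambda>j x. 8 * x / (1/2) ^ Suc j + Bd j)"
  have K0: "K 0 = 0" and KS: "\<And>j. K (Suc j) = 8 * K j / (1/2) ^ Suc j + Bd j" by (auto simp: K_def)
  have Kpos: "0 \<le> K j" for j by (induction j) (auto simp: K0 KS Bd_def)
  show ?thesis
  proof (rule that[of K])
    fix j e h F
    assume F: "near ((1/2) ^ Suc j) (K j * e) F (ipow (falling_coeff b j) (b + j))" and h: "0 < h" "h \<le> e"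
      and e: "e \<le> (1/2) ^ Suc j / 4"
    define \<rho> :: real where "\<rho> = (1/2) ^ Suc j"
    have rho: "0 < \<rho>" "\<rho> \<le> 1/2" by (auto simp: \<rho>_def power_le_one)
    define M where "M = ipow (falling_coeff b j) (b + j)"
    have d1: "deriv M w = ipow (falling_coeff b (Suc j)) (b + Suc j) w" if "w \<noteq> 0" for w
      using deriv_ipow[OF that, of "falling_coeff b j" "b + j"] unfolding M_def falling_coeff.simps by (simp only: add_Suc_right)
    have d2: "deriv (deriv M) w = ipow (falling_coeff b (Suc (Suc j))) (b + Suc (Suc j)) w" if w: "w \<in> nbhd \<rho>" for w
    proof -
      have "eventually (\<lambda>z. deriv M z = ipow (falling_coeff b (Suc j)) (b + Suc j) z) (nhds w)"
        using eventually_nhds_in_open[OF open_nbhd w] by eventually_elim (rule d1, rule nbhd_nonzero[OF _ rho(2)])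
      then have "deriv (deriv M) w = deriv (ipow (falling_coeff b (Suc j)) (b + Suc j)) w"
        by (rule deriv_cong_ev) simp
      also have "\<dots> = ipow (- real (b + Suc j) * falling_coeff b (Suc j)) (Suc (b + Suc j)) w"
        by (rule deriv_ipow[OF nbhd_nonzero[OF w rho(2)]])
      finally show ?thesis by (simp only: falling_coeff.simps(2)[of b "Suc j"] add_Suc_right)
    qed
    have "near (\<rho> / 2) (8 * (K j * e) / \<rho> + Bd j * h) (\<lambda>w. (F (w + of_real h) - F w) / of_real h) (deriv M)"
    proof (rule near_difference_quotient)
      show "near \<rho> (K j * e) F M" using F by (simp only: \<rho>_def M_def)
      show "M holomorphic_on nbhd \<rho>" unfolding M_def by (rule ipow_holomorphic[OF rho(2)])
      show "norm (deriv (deriv M) w) \<le> Bd j" if "w \<in> nbhd \<rho>" for w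
        unfolding d2[OF that] Bd_def by (rule norm_ipow_le[OF that rho(2)])
    qed (use rho h e Kpos[of j] in \<open>auto simp: \<rho>_def Bd_def\<close>)
    then have "near (\<rho> / 2) (K (Suc j) * e) (\<lambda>w. (F (w + of_real h) - F w) / of_real h) (deriv M)"
    proof (rule near_mono)
      have "Bd j * h \<le> Bd j * e" using h by (intro mult_left_mono) (auto simp: Bd_def)
      then show "8 * (K j * e) / \<rho> + Bd j * h \<le> K (Suc j) * e"
        unfolding KS \<rho>_def[symmetric] by (simp add: algebra_simps)
    qed simp
    then have "near (\<rho> / 2) (K (Suc j) * e) (\<lambda>w. (F (w + of_real h) - F w) / of_real h) (ipow (falling_coeff b (Suc j)) (b + Suc j))"
    proof (rule near_cong)
      fix w assume "w \<in> nbhd (\<rho> / 2)"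
      then show "deriv M w = ipow (falling_coeff b (Suc j)) (b + Suc j) w"
        using rho by (intro d1) (auto dest!: nbhd_nonzero)
    qed
    then show "near ((1/2) ^ Suc (Suc j)) (K (Suc j) * e) (\<lambda>w. (F (w + of_real h) - F w) / of_real h)
         (ipow (falling_coeff b (Suc j)) (b + Suc j))" by (simp add: \<rho>_def)
  qed (use K0 Kpos in auto)
qed

section \<open>Derivatives of the Legendre transform\<close>

primrec legendre_iter :: "(complex \<Rightarrow> complex) \<Rightarrow> nat \<Rightarrow> complex \<Rightarrow> complex" where
  "legendre_iter G 0 = (\<lambda>w. w)"
| "legendre_iter G (Suc i) = (\<lambda>w. deriv (legendre_iter G i) w / deriv (deriv G) w)"

text \<open>If \<open>P\<close> is the inverse function of the derivative \<open>G'\<close> then \<open>legendre_iter G i\<close> evaluated at \<open>P y\<close> is the \<open>i\<close>-th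
  derivative of \<open>P\<close>. For a monomial \<open>G\<close> these functions are monomials with positive coefficients.\<close>

lemma near_legendre_iter:
  assumes D: "0 < D" and n: "1 \<le> n" and rho: "0 < \<rho>" "\<rho> \<le> 1/2"
  shows "\<exists>e p. 0 < e \<and> (\<forall>\<epsilon>>0. \<exists>\<delta>>0. \<forall>G. near \<rho> \<delta> G (ipow D n) \<longrightarrow>
     near (\<rho> / 2 ^ (Suc i)) \<epsilon> (legendre_iter G i) (\<lambda>w. of_real e * w ^ Suc p))"
proof (induction i)
  case 0
  show ?case
  proof (rule exI[of _ 1], rule exI[of _ 0], intro conjI allI impI)
    fix \<epsilon> :: real assume "0 < \<epsilon>"
    then show "\<exists>\<delta>>0. \<forall>G. near \<rho> \<delta> G (ipow D n) \<longrightarrow> near (\<rho> / 2 ^ Suc 0) \<epsilon> (legendre_iter G 0) (\<lambda>w. of_real 1 * w ^ Suc 0)"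
      by (intro exI[of _ 1]) (auto simp: near_def)
  qed simp
next
  case (Suc i)
  obtain e p where e: "0 < e" and IH: "\<And>\<epsilon>. 0 < \<epsilon> \<Longrightarrow> \<exists>\<delta>>0. \<forall>G. near \<rho> \<delta> G (ipow D n) \<longrightarrow>
     near (\<rho> / 2 ^ (Suc i)) \<epsilon> (legendre_iter G i) (\<lambda>w. of_real e * w ^ Suc p)" using Suc.IH by blast
  define E where "E = real n * real (Suc n) * D"
  have E: "0 < E" using D n by (simp add: E_def)
  define e' where "e' = e * real (Suc p) / E"
  define r1 where "r1 = \<rho> / 2 ^ Suc i"
  define r2 where "r2 = \<rho> / 2 ^ Suc (Suc i)"
  have r: "0 < r2" "r2 < r1" "r1 \<le> \<rho> / 2" "r1 - r2 = r2" "r2 \<le> 1/2" "r1 \<le> 1/2" "r2 \<le> \<rho> / 4"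
  proof -
    define X where "X = \<rho> / 2 ^ i"
    have "\<rho> / 2 ^ i \<le> \<rho> / 1" using rho by (intro divide_left_mono) auto
    then have X: "0 < X" "X \<le> \<rho>" using rho by (auto simp: X_def)
    have "r1 = X / 2" "r2 = X / 4" by (simp_all add: r1_def r2_def X_def)
    then show "0 < r2" "r2 < r1" "r1 \<le> \<rho> / 2" "r1 - r2 = r2" "r2 \<le> 1/2" "r1 \<le> 1/2" "r2 \<le> \<rho> / 4"
      using X rho by simp_all
  qed
  define \<beta> where "\<beta> = E / (5/2) ^ (n + 2)"
  have beta: "0 < \<beta>" using E by (simp add: \<beta>_def)
  define \<alpha> where "\<alpha> = e * real (Suc p) * (5/2) ^ p"
  have alpha: "0 \<le> \<alpha>" using e by (simp add: \<alpha>_def)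
  show ?case
  \<comment> \<open>The derivative e * (p + 1) * w ^ p, divided by the second derivative E / w ^ (n
    + 2) of the monomial, is e' * w ^ (p + n + 2).\<close>
  proof (rule exI[of _ e'], rule exI[of _ "p + n + 1"], intro conjI allI impI)
    show "0 < e'" using e E by (simp add: e'_def)
    fix \<epsilon> :: real assume eps: "0 < \<epsilon>"
    \<comment> \<open>The choices of \<epsilon>1 and \<epsilon>2 make each of the two error terms of
      \<open>near_divide\<close> at most \<epsilon> / 2; \<epsilon>2 <= \<beta> / 2 also keeps the
      denominator away from zero.\<close>
    define \<epsilon>1 where "\<epsilon>1 = \<epsilon> * \<beta> * r2 / 8"
    have eps1: "0 < \<epsilon>1" using eps beta r by (simp add: \<epsilon>1_def)
    obtain \<delta>1 where d1: "0 < \<delta>1" and near1: "\<And>G. near \<rho> \<delta>1 G (ipow D n) \<Longrightarrow>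
        near r1 \<epsilon>1 (legendre_iter G i) (\<lambda>w. of_real e * w ^ Suc p)"
      using IH[OF eps1] unfolding r1_def by blast
    define \<epsilon>2 where "\<epsilon>2 = min (\<beta> / 2) (\<epsilon> * \<beta>\<^sup>2 / (4 * (\<alpha> + 1)))"
    have eps2: "0 < \<epsilon>2" "\<epsilon>2 \<le> \<beta> / 2" "\<epsilon>2 \<le> \<epsilon> * \<beta>\<^sup>2 / (4 * (\<alpha> + 1))"
    proof -
      have "0 < \<epsilon> * \<beta>\<^sup>2 / (4 * (\<alpha> + 1))" using eps beta alpha by simp
      then show "0 < \<epsilon>2" using beta unfolding \<epsilon>2_def by (simp only: min_less_iff_conj half_gt_zero)
    qed (simp_all only: \<epsilon>2_def min.cobounded1 min.cobounded2)
    define \<delta>2 where "\<delta>2 = \<epsilon>2 * \<rho>\<^sup>2 / 32"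
    have d2: "0 < \<delta>2" using eps2 rho by (simp add: \<delta>2_def)
    show "\<exists>\<delta>>0. \<forall>G. near \<rho> \<delta> G (ipow D n) \<longrightarrow>
       near (\<rho> / 2 ^ Suc (Suc i)) \<epsilon> (legendre_iter G (Suc i)) (\<lambda>w. of_real e' * w ^ Suc (p + n + 1))"
    proof (intro exI[of _ "min \<delta>1 \<delta>2"] conjI allI impI)
      show "0 < min \<delta>1 \<delta>2" using d1 d2 by simp
      fix G assume G: "near \<rho> (min \<delta>1 \<delta>2) G (ipow D n)"
      have G1: "near \<rho> \<delta>1 G (ipow D n)" and G2: "near \<rho> \<delta>2 G (ipow D n)"
        by (rule near_mono[OF G]; simp)+
      have A1: "near r2 (2 * \<epsilon>1 / (r1 - r2)) (deriv (legendre_iter G i)) (deriv (\<lambda>w. of_real e * w ^ Suc p))"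
        by (rule near_deriv[OF near1[OF G1]]) (use r in \<open>auto intro!: holomorphic_intros\<close>)
      have A2: "deriv (\<lambda>w. complex_of_real e * w ^ Suc p) w = of_real (e * real (Suc p)) * w ^ p" for w
      proof (rule DERIV_imp_deriv)
        show "((\<lambda>w. complex_of_real e * w ^ Suc p) has_field_derivative of_real (e * real (Suc p)) * w ^ p) (at w)"
          by (rule derivative_eq_intros refl | simp)+
      qed
      have A: "near r2 (2 * \<epsilon>1 / r2) (deriv (legendre_iter G i)) (\<lambda>w. of_real (e * real (Suc p)) * w ^ p)"
        by (rule near_cong[OF A1[unfolded r(4)] A2])
      have B1: "near (\<rho>/2) (2 * \<delta>2 / (\<rho> - \<rho>/2)) (deriv G) (deriv (ipow D n))"
        by (rule near_deriv[OF G2 ipow_holomorphic]) (use rho in auto)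
      have B2: "near (\<rho>/2) (2 * \<delta>2 / (\<rho> - \<rho>/2)) (deriv G) (ipow (- real n * D) (Suc n))"
      proof (rule near_cong[OF B1])
        fix w assume "w \<in> nbhd (\<rho>/2)"
        then have "w \<noteq> 0" using rho by (auto dest: nbhd_nonzero)
        then show "deriv (ipow D n) w = ipow (- real n * D) (Suc n) w" by (rule deriv_ipow)
      qed
      have B3: "near (\<rho>/4) (2 * (2 * \<delta>2 / (\<rho> - \<rho>/2)) / (\<rho>/2 - \<rho>/4)) (deriv (deriv G)) (deriv (ipow (- real n * D) (Suc n)))"
        by (rule near_deriv[OF B2 ipow_holomorphic]) (use rho in auto)
      have eps_eq: "2 * (2 * \<delta>2 / (\<rho> - \<rho>/2)) / (\<rho>/2 - \<rho>/4) = \<epsilon>2"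
        using rho by (simp add: \<delta>2_def field_simps power2_eq_square)
      have "near (\<rho>/4) \<epsilon>2 (deriv (deriv G)) (ipow E (n + 2))"
      proof (rule near_cong[OF B3[unfolded eps_eq]])
        fix w assume w: "w \<in> nbhd (\<rho>/4)"
        then have "w \<noteq> 0" using rho by (auto dest: nbhd_nonzero)
        then show "deriv (ipow (- real n * D) (Suc n)) w = ipow E (n + 2) w"
          by (simp add: deriv_ipow E_def algebra_simps)
      qed
      then have B: "near r2 \<epsilon>2 (deriv (deriv G)) (ipow E (n + 2))"
        by (rule near_mono) (use r in auto)
      have "near r2 (2 * (2 * \<epsilon>1 / r2) / \<beta> + 2 * \<alpha> * \<epsilon>2 / \<beta>\<^sup>2)
          (\<lambda>w. deriv (legendre_iter G i) w / deriv (deriv G) w)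
          (\<lambda>w. of_real (e * real (Suc p)) * w ^ p / ipow E (n + 2) w)"
      proof (rule near_divide[OF A B])
        fix w assume w: "w \<in> nbhd r2"
        show "\<beta> \<le> norm (ipow E (n + 2) w)"
          using norm_ipow_ge[OF w r(5), of E "n + 2"] E by (simp add: \<beta>_def)
        have "norm w ^ p \<le> (5/2) ^ p" using norm_nbhd(2)[OF w r(5)] by (intro power_mono) auto
        then show "norm (of_real (e * real (Suc p)) * w ^ p) \<le> \<alpha>"
          unfolding \<alpha>_def norm_mult norm_power norm_of_real using e by (intro mult_mono) auto
      qed (use beta eps1 eps2 alpha r in auto)
      then have "near r2 \<epsilon> (legendre_iter G (Suc i)) (\<lambda>w. of_real (e * real (Suc p)) * w ^ p / ipow E (n + 2) w)"
      proof (simp only: legendre_iter.simps, elim near_mono)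
        have "2 * (2 * \<epsilon>1 / r2) / \<beta> = \<epsilon> / 2" using beta r by (simp add: \<epsilon>1_def)
        moreover have "2 * \<alpha> * \<epsilon>2 / \<beta>\<^sup>2 \<le> \<epsilon> / 2"
        proof -
          have "2 * \<alpha> * \<epsilon>2 \<le> 2 * \<alpha> * (\<epsilon> * \<beta>\<^sup>2 / (4 * (\<alpha> + 1)))" using eps2 alpha by (intro mult_left_mono) auto
          also have "\<dots> = \<epsilon> * \<beta>\<^sup>2 / 2 * (\<alpha> / (\<alpha> + 1))" using alpha by (simp add: field_simps)
          also have "\<dots> \<le> \<epsilon> * \<beta>\<^sup>2 / 2 * 1" using alpha eps by (intro mult_left_mono) auto
          finally show ?thesis using beta by (simp add: field_simps)
        qed
        ultimately show "2 * (2 * \<epsilon>1 / r2) / \<beta> + 2 * \<alpha> * \<epsilon>2 / \<beta>\<^sup>2 \<le> \<epsilon>" by linarith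
      qed simp
      then have "near r2 \<epsilon> (legendre_iter G (Suc i)) (\<lambda>w. of_real e' * w ^ Suc (p + n + 1))"
      proof (rule near_cong)
        fix w assume w: "w \<in> nbhd r2"
        then have "w \<noteq> 0" using nbhd_nonzero r(5) by blast
        moreover have "of_real (e * real (Suc p)) = of_real e' * complex_of_real E" using E by (simp add: e'_def)
        ultimately show "of_real (e * real (Suc p)) * w ^ p / ipow E (n + 2) w = of_real e' * w ^ Suc (p + n + 1)"
          using E by (simp add: ipow_def power_add field_simps)
      qed
      then show "near (\<rho> / 2 ^ Suc (Suc i)) \<epsilon> (legendre_iter G (Suc i)) (\<lambda>w. of_real e' * w ^ Suc (p + n + 1))"
        by (simp only: r2_def)
    qed
  qed
qed

section \<open>Exponential sums with a phase close to a monomial\<close>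

lemma near_real_part:
  assumes F: "near \<rho> \<delta> F M" and rho: "0 < \<rho>" and t: "1 \<le> t" "t \<le> (2::real)"
  shows "\<bar>Re (F (of_real t)) - Re (M (of_real t))\<bar> \<le> \<delta>"
    and "((\<lambda>t. Re (F (of_real t))) has_real_derivative Re (deriv F (of_real t))) (at t)"
    and "F (of_real t) = of_real (Re (F (of_real t)))"
proof -
  have m: "complex_of_real t \<in> nbhd \<rho>" using rho t by (rule of_real_in_nbhd)
  have "norm (F (of_real t) - M (of_real t)) \<le> \<delta>" using F m by (auto simp: near_def)
  then show "\<bar>Re (F (of_real t)) - Re (M (of_real t))\<bar> \<le> \<delta>"
    using abs_Re_le_cmod[of "F (of_real t) - M (of_real t)"] by simp
  show "((\<lambda>t. Re (F (of_real t))) has_real_derivative Re (deriv F (of_real t))) (at t)"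
    by (rule has_real_derivative_Re, rule has_field_derivative_deriv_nbhd[OF _ m]) (use F in \<open>auto simp: near_def\<close>)
  show "F (of_real t) = of_real (Re (F (of_real t)))"
    using F m by (auto simp: near_def of_real_Re)
qed

lemma Re_ipow: "Re (ipow D n (of_real t)) = D / t ^ n"
  by (simp add: ipow_def flip: of_real_power of_real_divide)

text \<open>Collects what stationary phase and the dual derivative test require at real points, with
  one constant \<open>c\<close> for all \<open>G\<close> close enough to the monomial. The sign of
  the third derivative makes the second one monotone, which the weights of the dual sum rely on. The
  last clause is the recursion behind the derivatives of the inverse function of G'.\<close>

lemma near_ipow_properties:
  assumes D: "0 < D" and n: "1 \<le> n" and rho: "0 < \<rho>" "\<rho> \<le> 1/2"
  obtains \<delta> c where "0 < \<delta>" "1 \<le> c"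
    "\<And>G t. near \<rho> \<delta> G (ipow D n) \<Longrightarrow> 1 \<le> t \<Longrightarrow> t \<le> 2 \<Longrightarrow>
      ((\<lambda>t. Re (G (of_real t))) has_real_derivative Re (deriv G (of_real t))) (at t) \<and>
      ((\<lambda>t. Re (deriv G (of_real t))) has_real_derivative Re (deriv (deriv G) (of_real t))) (at t) \<and>
      ((\<lambda>t. Re (deriv (deriv G) (of_real t))) has_real_derivative Re (deriv (deriv (deriv G)) (of_real t))) (at t) \<and>
      1 / c \<le> Re (deriv (deriv G) (of_real t)) \<and> Re (deriv (deriv G) (of_real t)) \<le> c \<and>
      - c \<le> Re (deriv (deriv (deriv G)) (of_real t)) \<and> Re (deriv (deriv (deriv G)) (of_real t)) \<le> 0 \<and>
      (\<forall>i\<le>S. 1 / c \<le> Re (legendre_iter G i (of_real t)) \<and> Re (legendre_iter G i (of_real t)) \<le> c \<and>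
         ((\<lambda>t. Re (legendre_iter G i (of_real t))) has_real_derivative
            Re (deriv (deriv G) (of_real t)) * Re (legendre_iter G (Suc i) (of_real t))) (at t))"
proof -
  define E where "E = real n * real (Suc n) * D"
  define E3 where "E3 = real (n + 2) * E"
  have E: "0 < E" "0 < E3" using D n by (auto simp: E_def E3_def)
  \<comment> \<open>On [1, 2] the second derivative of the monomial is at least E / 2 ^ (n + 2),
    twice the first bound, and the third is at most -E3 / 2 ^ (n + 3). An error \<delta>2 therefore
    changes neither sign.\<close>
  define \<delta>2 where "\<delta>2 = min (E / 2 ^ (n + 3)) (E3 / 2 ^ (n + 3)) "
  have d2: "0 < \<delta>2" using E by (simp add: \<delta>2_def)
  \<comment> \<open>Three Cauchy estimates with radii \<rho>, \<rho> / 2, \<rho> / 4, \<rho> / 8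
    multiply the error by 512 / \<rho> ^ 3.\<close>
  define \<delta>0 where "\<delta>0 = \<delta>2 * \<rho> ^ 3 / 1024"
  have d0: "0 < \<delta>0" using d2 rho by (simp add: \<delta>0_def)
  have "\<exists>c \<delta>. 1 \<le> c \<and> 0 < \<delta> \<and> (\<forall>G. near \<rho> \<delta> G (ipow D n) \<longrightarrow> (\<exists>M. near (\<rho> / 2 ^ Suc i) 1 (legendre_iter G i) M) \<and>
      (\<forall>t. 1 \<le> t \<and> t \<le> 2 \<longrightarrow> 1 / c \<le> Re (legendre_iter G i (of_real t)) \<and> Re (legendre_iter G i (of_real t)) \<le> c))" for i
  proof -
    obtain e p where e: "0 < e" and ex: "\<And>\<epsilon>. 0 < \<epsilon> \<Longrightarrow> \<exists>\<delta>>0. \<forall>G. near \<rho> \<delta> G (ipow D n) \<longrightarrow>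
       near (\<rho> / 2 ^ (Suc i)) \<epsilon> (legendre_iter G i) (\<lambda>w. of_real e * w ^ Suc p)"
      using near_legendre_iter[OF D n rho, of i] by blast
    have "0 < min 1 (e / 2)" using e by simp
    from ex[OF this] obtain \<delta> where del: "0 < \<delta>" "\<And>G. near \<rho> \<delta> G (ipow D n) \<Longrightarrow>
       near (\<rho> / 2 ^ (Suc i)) (min 1 (e / 2)) (legendre_iter G i) (\<lambda>w. of_real e * w ^ Suc p)" by blast
    define c where "c = max 1 (max (2 / e) (e * 2 ^ Suc p + e))"
    have c: "1 \<le> c" "2 / e \<le> c" "e * 2 ^ Suc p + e \<le> c" by (auto simp: c_def)
    have "1 / c \<le> Re (legendre_iter G i (of_real t)) \<and> Re (legendre_iter G i (of_real t)) \<le> c"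
      if G: "near \<rho> \<delta> G (ipow D n)" and t: "1 \<le> t" "t \<le> 2" for G t
    proof -
      have "\<bar>Re (legendre_iter G i (of_real t)) - Re (of_real e * of_real t ^ Suc p)\<bar> \<le> min 1 (e / 2)"
        by (rule near_real_part(1)[OF del(2)[OF G] _ t]) (use rho in simp)
      moreover have "Re (of_real e * of_real t ^ Suc p) = e * t ^ Suc p"
        by (simp flip: of_real_power of_real_mult del: power_Suc)
      ultimately have "\<bar>Re (legendre_iter G i (of_real t)) - e * t ^ Suc p\<bar> \<le> e / 2" by simp
      moreover have "e * 1 \<le> e * t ^ Suc p" using e t by (intro mult_left_mono one_le_power) auto
      moreover have "e * t ^ Suc p \<le> e * 2 ^ Suc p" using e t by (intro mult_left_mono power_mono) auto
      moreover have "1 / c \<le> e / 2" using c e by (simp add: field_simps)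
      ultimately show ?thesis using c e unfolding abs_le_iff by linarith
    qed
    moreover have "\<exists>M. near (\<rho> / 2 ^ Suc i) 1 (legendre_iter G i) M" if G: "near \<rho> \<delta> G (ipow D n)" for G
      using near_mono[OF del(2)[OF G], of "\<rho> / 2 ^ Suc i" 1] by auto
    ultimately show ?thesis using c(1) del(1) by blast
  qed
  then obtain ci \<delta>i where i: "\<And>i. 1 \<le> ci i" "\<And>i. 0 < \<delta>i i"
    "\<And>i G. near \<rho> (\<delta>i i) G (ipow D n) \<Longrightarrow> \<exists>M. near (\<rho> / 2 ^ Suc i) 1 (legendre_iter G i) M"
    "\<And>i G t. near \<rho> (\<delta>i i) G (ipow D n) \<Longrightarrow> 1 \<le> t \<Longrightarrow> t \<le> 2 \<Longrightarrow> 1 / ci i \<le> Re (legendre_iter G i (of_real t)) \<and> Re (legendre_iter G i (of_real t)) \<le> ci i"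
    by metis
  define \<delta> where "\<delta> = min \<delta>0 (Min (\<delta>i ` {..Suc S}))"
  have del: "0 < \<delta>" "\<delta> \<le> \<delta>0" "\<And>i. i \<le> Suc S \<Longrightarrow> \<delta> \<le> \<delta>i i"
    using d0 i(2) by (auto simp: \<delta>_def min.coboundedI2)
  define c where "c = Max (insert (1 + 2 ^ (n + 4) / E) (insert (2 * E) (insert (2 * E3) (ci ` {..Suc S}))))"
  have cb: "1 + 2 ^ (n + 4) / E \<le> c" "2 * E \<le> c" "2 * E3 \<le> c" "\<And>i. i \<le> Suc S \<Longrightarrow> ci i \<le> c"
    unfolding c_def by (intro Max_ge; simp)+
  have c1: "1 \<le> c" using cb(1) E by (smt (verit) divide_nonneg_pos zero_le_power)
  show ?thesis
  proof (rule that[OF del(1) c1])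
    fix G t assume G: "near \<rho> \<delta> G (ipow D n)" and t: "1 \<le> t" "t \<le> (2::real)"
    have G0: "near \<rho> \<delta>0 G (ipow D n)" by (rule near_mono[OF G]) (use del in auto)
    have "near (\<rho>/2) (2 * \<delta>0 / (\<rho> - \<rho>/2)) (deriv G) (deriv (ipow D n))"
      by (rule near_deriv[OF G0 ipow_holomorphic]) (use rho in auto)
    then have n1: "near (\<rho>/2) (2 * \<delta>0 / (\<rho> - \<rho>/2)) (deriv G) (ipow (- real n * D) (Suc n))"
    proof (rule near_cong)
      fix w assume "w \<in> nbhd (\<rho>/2)"
      then have "w \<noteq> 0" using rho by (auto dest: nbhd_nonzero)
      then show "deriv (ipow D n) w = ipow (- real n * D) (Suc n) w" by (rule deriv_ipow)
    qed
    have "near (\<rho>/4) (2 * (2 * \<delta>0 / (\<rho> - \<rho>/2)) / (\<rho>/2 - \<rho>/4)) (deriv (deriv G)) (deriv (ipow (- real n * D) (Suc n)))"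
      by (rule near_deriv[OF n1 ipow_holomorphic]) (use rho in auto)
    then have n2: "near (\<rho>/4) (2 * (2 * \<delta>0 / (\<rho> - \<rho>/2)) / (\<rho>/2 - \<rho>/4)) (deriv (deriv G)) (ipow E (n + 2))"
    proof (rule near_cong)
      fix w assume w: "w \<in> nbhd (\<rho>/4)"
      then have "w \<noteq> 0" using rho by (auto dest: nbhd_nonzero)
      then show "deriv (ipow (- real n * D) (Suc n)) w = ipow E (n + 2) w"
        by (simp add: deriv_ipow E_def algebra_simps)
    qed
    have "near (\<rho>/8) (2 * (2 * (2 * \<delta>0 / (\<rho> - \<rho>/2)) / (\<rho>/2 - \<rho>/4)) / (\<rho>/4 - \<rho>/8)) (deriv (deriv (deriv G))) (deriv (ipow E (n + 2)))"
      by (rule near_deriv[OF n2 ipow_holomorphic]) (use rho in auto)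
    then have n3: "near (\<rho>/8) (2 * (2 * (2 * \<delta>0 / (\<rho> - \<rho>/2)) / (\<rho>/2 - \<rho>/4)) / (\<rho>/4 - \<rho>/8)) (deriv (deriv (deriv G))) (ipow (- E3) (n + 3))"
    proof (rule near_cong)
      fix w assume w: "w \<in> nbhd (\<rho>/8)"
      then have "w \<noteq> 0" using rho by (auto dest: nbhd_nonzero)
      then show "deriv (ipow E (n + 2)) w = ipow (- E3) (n + 3) w"
        by (simp add: deriv_ipow E3_def eval_nat_numeral algebra_simps)
    qed
    have e2: "2 * (2 * \<delta>0 / (\<rho> - \<rho>/2)) / (\<rho>/2 - \<rho>/4) \<le> \<delta>2"
    proof -
      have "2 * (2 * \<delta>0 / (\<rho> - \<rho>/2)) / (\<rho>/2 - \<rho>/4) = \<delta>2 * \<rho> / 32"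
        using rho by (simp add: \<delta>0_def field_simps power3_eq_cube)
      also have "\<dots> \<le> \<delta>2 * 32 / 32" using rho d2 by (intro divide_right_mono mult_left_mono) auto
      finally show ?thesis by simp
    qed
    have e3: "2 * (2 * (2 * \<delta>0 / (\<rho> - \<rho>/2)) / (\<rho>/2 - \<rho>/4)) / (\<rho>/4 - \<rho>/8) \<le> \<delta>2"
    proof -
      have "2 * (2 * (2 * \<delta>0 / (\<rho> - \<rho>/2)) / (\<rho>/2 - \<rho>/4)) / (\<rho>/4 - \<rho>/8) = \<delta>2 / 2"
        using rho by (simp add: \<delta>0_def field_simps power3_eq_cube)
      then show ?thesis using d2 by simp
    qed
    have b2: "\<bar>Re (deriv (deriv G) (of_real t)) - E / t ^ (n + 2)\<bar> \<le> \<delta>2"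
      using near_real_part(1)[OF n2 _ t] rho e2 by (simp only: Re_ipow) linarith
    have b3: "\<bar>Re (deriv (deriv (deriv G)) (of_real t)) - (- E3) / t ^ (n + 3)\<bar> \<le> \<delta>2"
      using near_real_part(1)[OF n3 _ t] rho e3 by (simp only: Re_ipow) linarith
    have tp: "1 \<le> t ^ k" "t ^ k \<le> 2 ^ k" for k using t by (auto intro: one_le_power power_mono)
    have l2: "E / 2 ^ (n + 2) \<le> E / t ^ (n + 2)" "E / t ^ (n + 2) \<le> E / 1"
      using tp[of "n + 2"] E by (intro divide_left_mono; simp)+
    have l3: "E3 / 2 ^ (n + 3) \<le> E3 / t ^ (n + 3)" "E3 / t ^ (n + 3) \<le> E3 / 1"
      using tp[of "n + 3"] E by (intro divide_left_mono; simp)+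
    have m2: "\<delta>2 \<le> E / 2 ^ (n + 3)" "\<delta>2 \<le> E3 / 2 ^ (n + 3)" by (auto simp: \<delta>2_def)
    have h2: "E / 2 ^ (n + 2) = 2 * (E / 2 ^ (n + 3))" by (simp add: eval_nat_numeral)
    have sm: "E / 2 ^ (n + 3) \<le> E" "E3 / 2 ^ (n + 3) \<le> E3"
      using E by (simp_all add: divide_le_eq)
    have c2: "1 / c \<le> E / 2 ^ (n + 3)"
    proof -
      have "2 ^ (n + 3) / E \<le> 2 ^ (n + 4) / E" using E by (intro divide_right_mono) auto
      then have "2 ^ (n + 3) / E \<le> c" using cb(1) by linarith
      then have "1 / c \<le> 1 / (2 ^ (n + 3) / E)" using E c1 by (intro divide_left_mono) (auto intro!: mult_pos_pos divide_pos_pos)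
      then show ?thesis by simp
    qed
    have A2: "1 / c \<le> Re (deriv (deriv G) (of_real t))" "Re (deriv (deriv G) (of_real t)) \<le> c"
      using b2 l2 m2 h2 sm c2 cb(2) unfolding abs_le_iff by linarith+
    have A3: "- c \<le> Re (deriv (deriv (deriv G)) (of_real t))" "Re (deriv (deriv (deriv G)) (of_real t)) \<le> 0"
      using b3 l3 m2 sm cb(3) E unfolding abs_le_iff minus_divide_left[symmetric] by linarith+
    have Gi: "near \<rho> (\<delta>i k) G (ipow D n)" if "k \<le> Suc S" for k
      by (rule near_mono[OF G]) (use del(3)[OF that] in auto)
    have L: "1 / c \<le> Re (legendre_iter G k (of_real t)) \<and> Re (legendre_iter G k (of_real t)) \<le> c" if k: "k \<le> Suc S" for k
    proof -
      have "1 / c \<le> 1 / ci k" using cb(4)[OF k] i(1)[of k] c1 by (intro divide_left_mono) (auto intro!: mult_pos_pos)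
      then show ?thesis using i(4)[OF Gi[OF k] t] cb(4)[OF k] by linarith
    qed
    have LD: "((\<lambda>t. Re (legendre_iter G k (of_real t))) has_real_derivative
            Re (deriv (deriv G) (of_real t)) * Re (legendre_iter G (Suc k) (of_real t))) (at t)" if k: "k \<le> S" for k
    proof -
      obtain M where M: "near (\<rho> / 2 ^ Suc k) 1 (legendre_iter G k) M" using i(3)[OF Gi[of k]] k by auto
      obtain M' where M': "near (\<rho> / 2 ^ Suc (Suc k)) 1 (legendre_iter G (Suc k)) M'" using i(3)[OF Gi[of "Suc k"]] k by auto
      have "((\<lambda>t. Re (legendre_iter G k (of_real t))) has_real_derivative Re (deriv (legendre_iter G k) (of_real t))) (at t)"
        by (rule near_real_part(2)[OF M _ t]) (use rho in simp)
      moreover have e1: "deriv (legendre_iter G k) (of_real t) = deriv (deriv G) (of_real t) * legendre_iter G (Suc k) (of_real t)"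
      proof -
        have "deriv (deriv G) (of_real t) \<noteq> 0"
        proof
          assume "deriv (deriv G) (of_real t) = 0"
          then have "1 / c \<le> 0" using A2 by simp
          then show False using c1 by (simp add: divide_le_0_iff)
        qed
        then show ?thesis by simp
      qed
      have e2: "deriv (deriv G) (of_real t) * legendre_iter G (Suc k) (of_real t)
          = of_real (Re (deriv (deriv G) (of_real t)) * Re (legendre_iter G (Suc k) (of_real t)))"
        using near_real_part(3)[OF n2 _ t] near_real_part(3)[OF M' _ t] rho by (simp del: legendre_iter.simps)
      ultimately show ?thesis unfolding e1 e2 Re_complex_of_real by blast
    qed
    show "((\<lambda>t. Re (G (of_real t))) has_real_derivative Re (deriv G (of_real t))) (at t) \<and>
      ((\<lambda>t. Re (deriv G (of_real t))) has_real_derivative Re (deriv (deriv G) (of_real t))) (at t) \<and>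
      ((\<lambda>t. Re (deriv (deriv G) (of_real t))) has_real_derivative Re (deriv (deriv (deriv G)) (of_real t))) (at t) \<and>
      1 / c \<le> Re (deriv (deriv G) (of_real t)) \<and> Re (deriv (deriv G) (of_real t)) \<le> c \<and>
      - c \<le> Re (deriv (deriv (deriv G)) (of_real t)) \<and> Re (deriv (deriv (deriv G)) (of_real t)) \<le> 0 \<and>
      (\<forall>i\<le>S. 1 / c \<le> Re (legendre_iter G i (of_real t)) \<and> Re (legendre_iter G i (of_real t)) \<le> c \<and>
         ((\<lambda>t. Re (legendre_iter G i (of_real t))) has_real_derivative
            Re (deriv (deriv G) (of_real t)) * Re (legendre_iter G (Suc i) (of_real t))) (at t))"
    proof (intro conjI allI impI)
      show "((\<lambda>t. Re (G (of_real t))) has_real_derivative Re (deriv G (of_real t))) (at t)"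
        by (rule near_real_part(2)[OF G0 _ t]) (use rho in simp)
      show "((\<lambda>t. Re (deriv G (of_real t))) has_real_derivative Re (deriv (deriv G) (of_real t))) (at t)"
        by (rule near_real_part(2)[OF n1 _ t]) (use rho in simp)
      show "((\<lambda>t. Re (deriv (deriv G) (of_real t))) has_real_derivative Re (deriv (deriv (deriv G)) (of_real t))) (at t)"
        by (rule near_real_part(2)[OF n2 _ t]) (use rho in simp)
    qed (use A2 A3 L LD in auto)
  qed
qed

text \<open>Let l = A / N ^ 2 be the size of the second derivative, V = A / N the length of the dual
  sum and \<open>W\<close> the desired saving. In the second part L = W * sqrt l is both the window
  parameter of stationary phase and the saving demanded of the dual sum: the dual bound V / L
  divided by sqrt l is exactly N / W. The \<open>s\<close>-th derivative of the dual phase has size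
  N / V ^ (s - 1), so the two conditions involving \<open>s\<close> are those of the derivative test
  of order \<open>s\<close> with saving L. The condition W ^ 3 * l ^ 2 <= 1 controls the errors made
  in the windows.\<close>

lemma B_range_exp_sum:
  assumes D: "0 < D" and n: "1 \<le> n" and rho: "0 < \<rho>" "\<rho> \<le> 1/2"
  obtains \<delta> C where "0 < \<delta>" "1 \<le> C"
    "\<And>G A N a b. near \<rho> \<delta> G (ipow D n) \<Longrightarrow> 0 < A \<Longrightarrow> 0 < N \<Longrightarrow> N \<le> real_of_int a \<Longrightarrow> real_of_int b \<le> 2 * N \<Longrightarrow>
       real_of_int (b - a + 1) \<le> N \<Longrightarrow>
       norm (esum (\<lambda>u. A * Re (G (of_real (u / N)))) a b) \<le> C * (N * sqrt (A / N\<^sup>2) + 1 / sqrt (A / N\<^sup>2))"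
    "\<And>G A N a b W s. near \<rho> \<delta> G (ipow D n) \<Longrightarrow> 0 < A \<Longrightarrow> 1 \<le> N \<Longrightarrow> N \<le> real_of_int a \<Longrightarrow> real_of_int b \<le> 2 * N \<Longrightarrow>
       real_of_int (b - a + 1) \<le> N \<Longrightarrow> 1 \<le> W \<Longrightarrow> 1 \<le> W * sqrt (A / N\<^sup>2) \<Longrightarrow> W ^ 3 * (A / N\<^sup>2)\<^sup>2 \<le> 1 \<Longrightarrow> W\<^sup>2 \<le> N \<Longrightarrow>
       3 \<le> s \<Longrightarrow> s \<le> S \<Longrightarrow> (W * sqrt (A / N\<^sup>2)) ^ (2 ^ s - 2) * N \<le> (A / N) ^ (s - 1) \<Longrightarrow>
       (W * sqrt (A / N\<^sup>2))\<^sup>2 * (A / N) ^ (s - 3) \<le> N \<Longrightarrow>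
       norm (esum (\<lambda>u. A * Re (G (of_real (u / N)))) a b) \<le> C * (N / W)"
proof -
  obtain \<delta> c where del: "0 < \<delta>" and c: "1 \<le> c" and
    GP: "\<And>G t. near \<rho> \<delta> G (ipow D n) \<Longrightarrow> 1 \<le> t \<Longrightarrow> t \<le> 2 \<Longrightarrow>
      ((\<lambda>t. Re (G (of_real t))) has_real_derivative Re (deriv G (of_real t))) (at t) \<and>
      ((\<lambda>t. Re (deriv G (of_real t))) has_real_derivative Re (deriv (deriv G) (of_real t))) (at t) \<and>
      ((\<lambda>t. Re (deriv (deriv G) (of_real t))) has_real_derivative Re (deriv (deriv (deriv G)) (of_real t))) (at t) \<and>
      1 / c \<le> Re (deriv (deriv G) (of_real t)) \<and> Re (deriv (deriv G) (of_real t)) \<le> c \<and>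
      - c \<le> Re (deriv (deriv (deriv G)) (of_real t)) \<and> Re (deriv (deriv (deriv G)) (of_real t)) \<le> 0 \<and>
      (\<forall>i\<le>S. 1 / c \<le> Re (legendre_iter G i (of_real t)) \<and> Re (legendre_iter G i (of_real t)) \<le> c \<and>
         ((\<lambda>t. Re (legendre_iter G i (of_real t))) has_real_derivative
            Re (deriv (deriv G) (of_real t)) * Re (legendre_iter G (Suc i) (of_real t))) (at t))"
    using near_ipow_properties[OF D n rho, where S = S] by blast
  define C where "C = 10000 * c ^ 8"
  have cpow: "1 \<le> c ^ k" for k using c by simp
  have C1: "1 \<le> C" using cpow[of 8] by (simp add: C_def)
  have cle: "c ^ i \<le> c ^ j" if "i \<le> j" for i j using c that by (rule power_increasing[rotated])
  show ?thesis
  proof (rule that[OF del C1])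
    fix G :: "complex \<Rightarrow> complex" and A N :: real and a b :: int
    assume G: "near \<rho> \<delta> G (ipow D n)" and A: "0 < A" and N: "0 < N" "N \<le> real_of_int a" "real_of_int b \<le> 2 * N" "real_of_int (b - a + 1) \<le> N"
    define g g1 g2 where "g u = A * Re (G (of_real (u / N)))" and "g1 u = A / N * Re (deriv G (of_real (u / N)))"
      and "g2 u = A / N\<^sup>2 * Re (deriv (deriv G) (of_real (u / N)))" for u :: real
    have t: "1 \<le> u / N" "u / N \<le> 2" if "u \<in> {real_of_int a..real_of_int b}" for u
      using that N by (auto simp: field_simps)
    have sc: "((\<lambda>u. K * f (u / N)) has_real_derivative K / N * f') (at u)" if "(f has_real_derivative f') (at (u / N))" for K f f' u
      using DERIV_cmult[OF DERIV_chain2[OF that DERIV_cdivide[OF DERIV_ident, of N]], of K] by simp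
    have "norm (esum g a b) \<le> 10 * c\<^sup>2 * (N * sqrt (A / N\<^sup>2 / c) + 1 / sqrt (A / N\<^sup>2 / c))"
    proof (rule second_derivative_test)
      fix u assume u: "u \<in> {real_of_int a..real_of_int b}"
      note P = GP[OF G t[OF u]]
      show "(g has_real_derivative g1 u) (at u)" unfolding g_def g1_def using P by (intro sc) blast
      have "((\<lambda>u. A / N * Re (deriv G (of_real (u / N)))) has_real_derivative A / N / N * Re (deriv (deriv G) (of_real (u / N)))) (at u)"
        using P by (intro sc) blast
      then show "(g1 has_real_derivative g2 u) (at u)" unfolding g1_def g2_def by (simp add: power2_eq_square)
      have "A / N\<^sup>2 * (1 / c) \<le> g2 u" unfolding g2_def using P A N by (intro mult_left_mono) auto
      then show "A / N\<^sup>2 / c \<le> g2 u" by simp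
      have "g2 u \<le> A / N\<^sup>2 * c" unfolding g2_def using P A N by (intro mult_left_mono) auto
      also have "\<dots> = c\<^sup>2 * (A / N\<^sup>2 / c)" using c by (simp add: power2_eq_square)
      finally show "g2 u \<le> c\<^sup>2 * (A / N\<^sup>2 / c)" .
    qed (use A N c cpow[of 2] in auto)
    also have "\<dots> \<le> 10 * c\<^sup>2 * (c * (N * sqrt (A / N\<^sup>2) + 1 / sqrt (A / N\<^sup>2)))"
    proof (intro mult_left_mono)
      define l where "l = sqrt (A / N\<^sup>2)"
      have l: "0 < l" using A N by (simp add: l_def)
      have sq: "sqrt (A / N\<^sup>2 / c) = l / sqrt c" unfolding l_def by (rule real_sqrt_divide)
      have sc1: "1 \<le> sqrt c" "sqrt c \<le> c" using c real_sqrt_le_mono[of 1 c] by (auto simp: real_le_lsqrt self_le_power[of c 2])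
      have "N * (l / sqrt c) \<le> N * (c * l)"
      proof (intro mult_left_mono)
        have "l / sqrt c \<le> l / 1" using sc1 l by (intro divide_left_mono) auto
        also have "\<dots> \<le> c * l" using c l by simp
        finally show "l / sqrt c \<le> c * l" .
      qed (use N in auto)
      moreover have "1 / (l / sqrt c) \<le> c * (1 / l)"
        using sc1 l by (simp add: divide_right_mono)
      ultimately show "N * sqrt (A / N\<^sup>2 / c) + 1 / sqrt (A / N\<^sup>2 / c) \<le> c * (N * sqrt (A / N\<^sup>2) + 1 / sqrt (A / N\<^sup>2))"
        unfolding sq l_def[symmetric] by (simp add: ring_distribs mult_ac)
    qed (use c in auto)
    also have "\<dots> = 10 * c ^ 3 * (N * sqrt (A / N\<^sup>2) + 1 / sqrt (A / N\<^sup>2))" by (simp add: power3_eq_cube power2_eq_square)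
    also have "\<dots> \<le> C * (N * sqrt (A / N\<^sup>2) + 1 / sqrt (A / N\<^sup>2))"
      using cle[of 3 8] cpow[of 8] A N by (intro mult_right_mono) (auto simp: C_def)
    finally show "norm (esum (\<lambda>u. A * Re (G (of_real (u / N)))) a b) \<le> C * (N * sqrt (A / N\<^sup>2) + 1 / sqrt (A / N\<^sup>2))"
      by (simp only: g_def[abs_def])
  next
    fix G :: "complex \<Rightarrow> complex" and A N W :: real and a b :: int and s :: nat
    assume G: "near \<rho> \<delta> G (ipow D n)" and A: "0 < A" and N: "1 \<le> N" "N \<le> real_of_int a" "real_of_int b \<le> 2 * N" "real_of_int (b - a + 1) \<le> N"
      and W: "1 \<le> W" and L1: "1 \<le> W * sqrt (A / N\<^sup>2)" and W3: "W ^ 3 * (A / N\<^sup>2)\<^sup>2 \<le> 1" and WN: "W\<^sup>2 \<le> N"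
      and s: "3 \<le> s" "s \<le> S" and main: "(W * sqrt (A / N\<^sup>2)) ^ (2 ^ s - 2) * N \<le> (A / N) ^ (s - 1)"
      and sec: "(W * sqrt (A / N\<^sup>2))\<^sup>2 * (A / N) ^ (s - 3) \<le> N"
    define g where "g u = A * Re (G (of_real (u / N)))" for u :: real
    define l where "l = A / N\<^sup>2"
    define L where "L = W * sqrt l"
    define V where "V = A / N"
    have l0: "0 < l" using A N by (simp add: l_def)
    have L1': "1 \<le> L" using L1 by (simp add: L_def l_def)
    have V0: "0 < V" using A N by (simp add: V_def)
    have VN: "V = N * l" using N by (simp add: V_def l_def power2_eq_square)
    have "norm (esum g a b) \<le> C * (N / W)"
    proof (cases "a \<le> b")
      case False
      then show ?thesis using C1 N W by simp
    next
      case ab: True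
      show ?thesis
      \<comment> \<open>A bounded saving is trivial. Otherwise W ^ 3 * l ^ 2 <= 1 has the factor 16
        * c ^ 6 to spare, which yields the smallness condition of \<open>B_process\<close> with its
        constants.\<close>
      proof (cases "W \<le> 16 * c ^ 6")
        case True
        have "norm (esum g a b) \<le> N" using norm_esum_le[OF ab, of g] N by linarith
        also have "\<dots> = W * (N / W)" using W by simp
        also have "\<dots> \<le> C * (N / W)"
        proof (rule mult_right_mono)
          have "16 * c ^ 6 \<le> C" using cle[of 6 8] cpow[of 8] by (simp add: C_def)
          then show "W \<le> C" using True by simp
        qed (use N W in auto)
        finally show ?thesis .
      next
        case Wbig: False
        have Wl: "4 * c ^ 3 * (W * l) \<le> 1"
        proof -
          have "(4 * c ^ 3 * (W * l))\<^sup>2 = 16 * c ^ 6 * (W\<^sup>2 * l\<^sup>2)"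
            by (simp add: power_mult_distrib flip: power_mult)
          also have "\<dots> \<le> W * (W\<^sup>2 * l\<^sup>2)" using Wbig by (intro mult_right_mono) auto
          also have "\<dots> = W ^ 3 * l\<^sup>2" by (simp add: power3_eq_cube power2_eq_square)
          also have "\<dots> \<le> 1\<^sup>2" using W3 by (simp add: l_def)
          finally show ?thesis by (rule power2_le_imp_le) simp
        qed
        have WL: "W * l = L * sqrt l" using l0 by (simp add: L_def)
        have V1: "1 \<le> V"
        proof -
          have "1 \<le> L\<^sup>2" using L1' by simp
          also have "L\<^sup>2 = W\<^sup>2 * l" using l0 by (simp add: L_def power_mult_distrib)
          also have "\<dots> \<le> N * l" using WN l0 by (intro mult_right_mono) auto
          finally show ?thesis by (simp add: VN)
        qed
        define g1 where "g1 u = V * Re (deriv G (of_real (u / N)))" for u :: real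
        define g2 where "g2 u = l * Re (deriv (deriv G) (of_real (u / N)))" for u :: real
        define g3 where "g3 u = l / N * Re (deriv (deriv (deriv G)) (of_real (u / N)))" for u :: real
        define I where "I = {real_of_int a..real_of_int b}"
        have t: "1 \<le> u / N" "u / N \<le> 2" if "u \<in> I" for u
          using that N by (auto simp: field_simps I_def)
        have sc: "((\<lambda>u. K * f (u / N)) has_real_derivative K / N * f') (at u)" if "(f has_real_derivative f') (at (u / N))" for K f f' u
          using DERIV_cmult[OF DERIV_chain2[OF that DERIV_cdivide[OF DERIV_ident, of N]], of K] by simp
        have VlN: "V / N = l" by (simp add: V_def l_def power2_eq_square)
        have d1: "(g has_real_derivative g1 u) (at u)" if u: "u \<in> I" for u
          unfolding g_def g1_def V_def using GP[OF G t[OF u]] by (intro sc) blast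
        have d2: "(g1 has_real_derivative g2 u) (at u)" if u: "u \<in> I" for u
          unfolding g1_def g2_def VlN[symmetric] using GP[OF G t[OF u]] by (intro sc) blast
        have d3: "(g2 has_real_derivative g3 u) (at u)" if u: "u \<in> I" for u
          unfolding g2_def g3_def using GP[OF G t[OF u]] by (intro sc) blast
        have g2b: "l / c \<le> g2 u" "g2 u \<le> c\<^sup>2 * (l / c)" "0 < g2 u" if u: "u \<in> I" for u
        proof -
          note P = GP[OF G t[OF u]]
          have "l * (1 / c) \<le> g2 u" unfolding g2_def using P l0 by (intro mult_left_mono) auto
          then show "l / c \<le> g2 u" by simp
          moreover have "0 < l / c" using l0 c by simp
          ultimately show "0 < g2 u" by linarith
          have "g2 u \<le> l * c" unfolding g2_def using P l0 by (intro mult_left_mono) auto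
          also have "\<dots> = c\<^sup>2 * (l / c)" using c by (simp add: power2_eq_square)
          finally show "g2 u \<le> c\<^sup>2 * (l / c)" .
        qed
        have g3b: "- (c * l / N) \<le> g3 u" "g3 u \<le> 0" if u: "u \<in> I" for u
        proof -
          note P = GP[OF G t[OF u]]
          have "l / N * (- c) \<le> g3 u" unfolding g3_def using P l0 N by (intro mult_left_mono) auto
          then show "- (c * l / N) \<le> g3 u" by (simp add: mult.commute)
          show "g3 u \<le> 0" unfolding g3_def using P l0 N by (intro mult_nonneg_nonpos) auto
        qed
        have g1m: "l / c * (w - u) \<le> g1 w - g1 u" "g1 w - g1 u \<le> c\<^sup>2 * (l / c) * (w - u)"
          if "u \<in> I" "w \<in> I" "u \<le> w" for u w
        proof -
          have mem: "z \<in> I" if "z \<in> {u..w}" for z using that \<open>u \<in> I\<close> \<open>w \<in> I\<close> by (auto simp: I_def)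
          show "l / c * (w - u) \<le> g1 w - g1 u"
            by (rule deriv_ge_imp_diff_ge[of u w g1 g2]) (use mem d2 g2b that in auto)
          show "g1 w - g1 u \<le> c\<^sup>2 * (l / c) * (w - u)"
            by (rule deriv_le_imp_diff_le[of u w g1 g2]) (use mem d2 g2b that in auto)
        qed
        have g1s: "g1 u < g1 w" if "u \<in> I" "w \<in> I" "u < w" for u w
        proof -
          have "0 < l / c * (w - u)" using l0 c that by simp
          then show ?thesis using g1m(1)[of u w] that by linarith
        qed
        define p where "p = inv_into I g1"
        have inj: "inj_on g1 I" by (rule linorder_inj_onI') (use g1s in force)
        have p1: "p (g1 u) = u" if "u \<in> I" for u unfolding p_def using inj that by (rule inv_into_f_f)
        have pI: "p v \<in> I" "g1 (p v) = v" if v: "g1 (of_int a) \<le> v" "v \<le> g1 (of_int b)" for v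
        proof -
          have "\<exists>u\<ge>of_int a. u \<le> of_int b \<and> g1 u = v"
            by (rule IVT) (use v ab d2 in \<open>auto simp: I_def intro: DERIV_isCont\<close>)
          then have "v \<in> g1 ` I" by (auto simp: I_def)
          then show "p v \<in> I" "g1 (p v) = v" unfolding p_def by (rule inv_into_into, rule f_inv_into_f)
        qed
        have pin: "of_int a < p v" "p v < of_int b" if v: "g1 (of_int a) < v" "v < g1 (of_int b)" for v
        proof -
          have "p v \<noteq> of_int a" "p v \<noteq> of_int b" using pI(2)[of v] v by auto
          then show "of_int a < p v" "p v < of_int b" using pI(1)[of v] v by (auto simp: I_def)
        qed
        have dp: "(p has_real_derivative inverse (g2 (p v))) (at v)" if v: "g1 (of_int a) < v" "v < g1 (of_int b)" for v
        proof (rule DERIV_inverse_function[where f = g1 and a = "g1 (of_int a)" and b = "g1 (of_int b)"])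
          have pv: "p v \<in> I" "g1 (p v) = v" using pI v by auto
          show "(g1 has_real_derivative g2 (p v)) (at (p v))" by (rule d2[OF pv(1)])
          show "g2 (p v) \<noteq> 0" using g2b(3)[OF pv(1)] by simp
          have "isCont p (g1 (p v))"
            by (rule isCont_inverse_function2[where a = "of_int a" and b = "of_int b"])
               (use pin[OF v] p1 d2 in \<open>auto simp: I_def intro: DERIV_isCont\<close>)
          then show "isCont p v" using pv by simp
        qed (use v pI in auto)
        define leg where "leg i x = Re (legendre_iter G i (complex_of_real x))" for i x
        \<comment> \<open>The derivative of g (p v) - v * p v is -p v, since g1 (p v) = v. The sign
          is reversed so that all derivatives from the first on are those of \<open>p\<close> and
          hence positive; \<open>legendre_iter\<close> gives them after rescaling by N and
          V.\<close>
        define Dd where "Dd i v = (case i of 0 \<Rightarrow> - (g (p v) - v * p v) | Suc k \<Rightarrow> N / V ^ k * leg k (p v / N))" for i v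
        have Nn: "N \<noteq> 0" "V \<noteq> 0" "l \<noteq> 0" using N V0 l0 by auto
        have dDd: "(Dd i has_real_derivative Dd (Suc i) v) (at v)"
          if v: "g1 (of_int a) < v" "v < g1 (of_int b)" and i: "i < S" for i v
        proof -
          have pv: "p v \<in> I" "g1 (p v) = v" using pI v by auto
          note P = GP[OF G t[OF pv(1)]]
          show ?thesis
          proof (cases i)
            case 0
            have dg: "((\<lambda>v. g (p v)) has_real_derivative g1 (p v) * inverse (g2 (p v))) (at v)"
              by (rule DERIV_chain2[OF d1[OF pv(1)] dp[OF v]])
            have "((\<lambda>v. - (g (p v) - v * p v)) has_real_derivative
                - (g1 (p v) * inverse (g2 (p v)) - (1 * p v + inverse (g2 (p v)) * v))) (at v)"
              by (intro DERIV_minus DERIV_diff dg DERIV_mult DERIV_ident dp[OF v])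
            moreover have "Dd 0 = (\<lambda>v. - (g (p v) - v * p v))" by (simp add: Dd_def fun_eq_iff)
            moreover have "Dd (Suc 0) v = p v" using Nn by (simp add: Dd_def leg_def)
            ultimately show ?thesis using 0 pv(2) by (simp add: mult.commute)
          next
            case (Suc k)
            have "(leg k has_real_derivative Re (deriv (deriv G) (of_real (p v / N))) * leg (Suc k) (p v / N)) (at (p v / N))"
              unfolding leg_def[abs_def] using P i Suc by (simp del: legendre_iter.simps)
            then have "((\<lambda>v. N / V ^ k * leg k (p v / N)) has_real_derivative
                N / V ^ k * ((Re (deriv (deriv G) (of_real (p v / N))) * leg (Suc k) (p v / N)) * (inverse (g2 (p v)) / N))) (at v)"
              by (intro DERIV_cmult DERIV_chain2[where g = "\<lambda>v. p v / N"] DERIV_cdivide dp[OF v])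
            moreover have "N / V ^ k * ((Re (deriv (deriv G) (of_real (p v / N))) * leg (Suc k) (p v / N)) * (inverse (g2 (p v)) / N))
                = N / V ^ Suc k * leg (Suc k) (p v / N)"
            proof -
              define h where "h = Re (deriv (deriv G) (of_real (p v / N)))"
              have "g2 (p v) = l * h" by (simp add: g2_def h_def)
              moreover have "h \<noteq> 0" using g2b(3)[OF pv(1)] calculation by auto
              ultimately show ?thesis unfolding h_def[symmetric] using Nn VN by (simp add: field_simps)
            qed
            moreover have "Dd (Suc k) = (\<lambda>v. N / V ^ k * leg k (p v / N))" by (simp add: Dd_def fun_eq_iff)
            ultimately show ?thesis using Suc by (simp add: Dd_def)
          qed
        qed
        obtain s' where s': "s = Suc s'" "2 \<le> s'" using s by (cases s) auto
        \<comment> \<open>The derivative test of order \<open>s\<close> for a sum of length at most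
          2 * c * V with saving \<open>L\<close>.\<close>
        define Bd where "Bd = 40 * c\<^sup>2 * (2 * c * V / L)"
        have dual: "norm (esum (\<lambda>v. g (p v) - v * p v) k1 k2) \<le> Bd"
          if k1: "g1 (of_int a) < of_int k1" and k2: "of_int k2 < g1 (of_int b)" and k12: "k1 \<le> k2" for k1 k2
        proof -
          have rng: "g1 (of_int a) < v" "v < g1 (of_int b)" if "v \<in> {real_of_int k1..real_of_int k2}" for v
            using that k1 k2 by auto
          have "norm (esum (Dd 0) k1 k2) \<le> 40 * c\<^sup>2 * (2 * c * V / L)"
          proof (rule exp_sum_derivative_test[where k = s and \<Lambda> = "N / V ^ s' / c"])
            show "derivs s Dd {real_of_int k1..real_of_int k2}"
              unfolding derivs_def using dDd rng s by auto
            show "N / V ^ s' / c \<le> Dd s v \<and> Dd s v \<le> c\<^sup>2 * (N / V ^ s' / c)" if v: "v \<in> {real_of_int k1..real_of_int k2}" for v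
            proof -
              have pv: "p v \<in> I" using pI rng[OF v] by auto
              have le: "1 / c \<le> leg s' (p v / N)" "leg s' (p v / N) \<le> c"
                using GP[OF G t[OF pv]] s s' by (auto simp: leg_def)
              have Ds: "Dd s v = N / V ^ s' * leg s' (p v / N)" by (simp add: Dd_def s')
              have NV: "0 \<le> N / V ^ s'" using N V0 by simp
              have "N / V ^ s' * (1 / c) \<le> Dd s v" "Dd s v \<le> N / V ^ s' * c"
                unfolding Ds by (rule mult_left_mono[OF le(1) NV], rule mult_left_mono[OF le(2) NV])
              moreover have "N / V ^ s' / c = N / V ^ s' * (1 / c)" "c\<^sup>2 * (N / V ^ s' / c) = N / V ^ s' * c"
                using c by (simp_all add: power2_eq_square)
              ultimately show ?thesis by (simp only:)
            qed
            show "0 < N / V ^ s' / c" using N V0 c by simp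
            have "real_of_int (k2 - k1 + 1) \<le> (g1 (of_int b) - g1 (of_int a)) + 1" using k1 k2 by simp
            also have "g1 (of_int b) - g1 (of_int a) \<le> c\<^sup>2 * (l / c) * (of_int b - of_int a)"
              using ab by (intro g1m) (auto simp: I_def)
            also have "\<dots> \<le> c\<^sup>2 * (l / c) * N" using N c l0 by (intro mult_left_mono) auto
            also have "\<dots> = c * V" using c by (simp add: VN power2_eq_square)
            also have "c * V + 1 \<le> c * V + c * V"
            proof -
              have "1 * 1 \<le> c * V" using c V1 by (intro mult_mono) auto
              then show ?thesis by linarith
            qed
            finally show "real_of_int (k2 - k1 + 1) \<le> 2 * c * V" by (simp add: algebra_simps)
            have mn: "L ^ (2 ^ s - 2) * N \<le> V ^ s'" using main by (simp add: L_def l_def V_def s')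
            have "N / V ^ s' / c * L ^ (2 ^ s - 2) = L ^ (2 ^ s - 2) * N / V ^ s' / c" by simp
            also have "\<dots> \<le> V ^ s' / V ^ s' / c"
              using V0 c by (intro divide_right_mono mn) auto
            also have "\<dots> \<le> 1" using V0 c by simp
            finally show "N / V ^ s' / c * L ^ (2 ^ s - 2) \<le> 1" .
            have sc': "L\<^sup>2 * V ^ (s' - 2) \<le> N" using sec by (simp add: L_def l_def V_def s' numeral_3_eq_3 numeral_2_eq_2)
            have Vs: "V ^ s' = V\<^sup>2 * V ^ (s' - 2)" by (metis le_add_diff_inverse power_add s'(2))
            have "V\<^sup>2 * (L\<^sup>2 * V ^ (s' - 2)) \<le> V\<^sup>2 * N" using sc' by (intro mult_left_mono) auto
            then have "L\<^sup>2 * V ^ s' \<le> V\<^sup>2 * N" unfolding Vs by (simp only: mult_ac)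
            then have "L\<^sup>2 \<le> V\<^sup>2 * N / V ^ s'" using V0 by (simp add: pos_le_divide_eq)
            also have "\<dots> \<le> 4 * c * (V\<^sup>2 * N / V ^ s')" using c V0 N by (simp add: mult_right_mono[of 1 "4 * c" "V\<^sup>2 * N / V ^ s'", simplified])
            also have "\<dots> = (2 * c * V)\<^sup>2 * (N / V ^ s' / c)" using c by (simp add: power2_eq_square)
            finally show "L\<^sup>2 \<le> (2 * c * V)\<^sup>2 * (N / V ^ s' / c)" .
          qed (use s c cpow[of 2] L1' V0 in auto)
          moreover have "Dd 0 = (\<lambda>v. - (g (p v) - v * p v))" by (simp add: Dd_def fun_eq_iff)
          ultimately show ?thesis using norm_esum_uminus[of "\<lambda>v. g (p v) - v * p v" k1 k2] by (simp add: Bd_def)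
        qed
        have lc0: "0 < l / c" using l0 c by simp
        have "norm (esum g a b) \<le> 5 * Bd / sqrt (l / c)
            + (c\<^sup>2 * (l / c) * N + 2) * (21 * (c * l / N) * L ^ 4 / (l / c)\<^sup>2 + 16 * L\<^sup>2 + 4 * c\<^sup>2 / (L * sqrt (l / c))) + 60 * c\<^sup>2 / sqrt (l / c)"
        proof (rule B_process[where g = g and ?g1.0 = g1 and ?g2.0 = g2 and p = p])
          show "g2 w \<le> g2 u" if "real_of_int a \<le> u" "u \<le> w" "w \<le> real_of_int b" for u w
          proof -
            have "g2 w - g2 u \<le> 0 * (w - u)"
              by (rule deriv_le_imp_diff_le[of u w g2 g3]) (use that d3 g3b in \<open>auto simp: I_def\<close>)
            then show ?thesis by simp
          qed
          note anti = this
          show "\<bar>g2 u - g2 w\<bar> \<le> c * l / N * \<bar>u - w\<bar>" if uw: "u \<in> {real_of_int a..real_of_int b}" "w \<in> {real_of_int a..real_of_int b}" for u w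
          proof -
            have *: "\<bar>g2 u - g2 w\<bar> \<le> c * l / N * \<bar>u - w\<bar>" if "u \<in> I" "w \<in> I" "u \<le> w" for u w
            proof -
              have "- (c * l / N) * (w - u) \<le> g2 w - g2 u"
                by (rule deriv_ge_imp_diff_ge[of u w g2 g3]) (use that d3 g3b in \<open>auto simp: I_def\<close>)
              moreover have "g2 w \<le> g2 u" using that by (intro anti) (auto simp: I_def)
              ultimately show ?thesis using that by simp
            qed
            show ?thesis using *[of u w] *[of w u] uw by (cases "u \<le> w") (auto simp: I_def abs_minus_commute)
          qed
          show "4 * c\<^sup>2 * L * sqrt (l / c) \<le> 1"
          proof -
            have "sqrt (l / c) \<le> sqrt l" using l0 c by (intro real_sqrt_le_mono) (simp add: pos_divide_le_eq)
            then have "4 * c\<^sup>2 * L * sqrt (l / c) \<le> 4 * c\<^sup>2 * L * sqrt l" using c L1' by (intro mult_left_mono) auto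
            also have "\<dots> = 4 * c\<^sup>2 * (W * l)" by (simp add: WL)
            also have "\<dots> \<le> 4 * c ^ 3 * (W * l)" using cle[of 2 3] W l0 by (intro mult_right_mono) auto
            also have "\<dots> \<le> 1" by (rule Wl)
            finally show ?thesis .
          qed
          show "norm (esum (\<lambda>v. g (p v) - v * p v) k1 k2) \<le> Bd"
            if "g1 (of_int a) < of_int k1" "of_int k2 < g1 (of_int b)" "k1 \<le> k2" for k1 k2
            by (rule dual[OF that])
          show "p v \<in> {real_of_int a..real_of_int b} \<and> g1 (p v) = v" if "g1 (of_int a) \<le> v" "v \<le> g1 (of_int b)" for v
            using pI[OF that] by (simp add: I_def)
        qed (use d1 d2 g2b ab lc0 cpow[of 2] L1' N c l0 V0 in \<open>auto simp: I_def Bd_def\<close>)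
        \<comment> \<open>The dual bound and the Kusmin--Landau error are N / W up to constants,
          because V / (L * sqrt l) = N / W. The window errors use W ^ 3 * l ^ 2 <= 1, and what
          remains is O(W), where W <= N / W.\<close>
        also have "\<dots> \<le> C * (N / W)"
        proof -
          define Q where "Q = N / W"
          have Q0: "0 < Q" using N W by (simp add: Q_def)
          have WQ: "W \<le> Q" using WN W by (simp add: Q_def pos_le_divide_eq power2_eq_square)
          define z where "z = sqrt l"
          have z: "0 < z" "l = z * z" using l0 by (auto simp: z_def)
          have isq: "1 / sqrt (l / c) \<le> c / z"
          proof -
            have "1 / sqrt (l / c) = sqrt c / z" using c by (simp add: z_def real_sqrt_divide)
            also have "sqrt c \<le> c" using c by (auto simp: real_le_lsqrt self_le_power[of c 2])
            finally show ?thesis using z by (simp add: divide_right_mono)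
          qed
          have zW: "1 / z \<le> W" using L1' z by (simp add: L_def z_def[symmetric] field_simps)
          have t1: "5 * Bd / sqrt (l / c) \<le> 400 * c ^ 4 * Q"
          proof -
            have "5 * Bd / sqrt (l / c) = 5 * Bd * (1 / sqrt (l / c))" by simp
            also have "\<dots> \<le> 5 * Bd * (c / z)" using isq c V0 L1' by (intro mult_left_mono) (auto simp: Bd_def)
            also have "\<dots> = 400 * c ^ 4 * Q"
              using z W c by (simp add: Bd_def Q_def VN L_def z_def[symmetric] power2_eq_square power4_eq_xxxx field_simps)
            finally show ?thesis .
          qed
          have cnt: "c\<^sup>2 * (l / c) * N + 2 \<le> 3 * c * V"
          proof -
            have eq: "c\<^sup>2 * (l / c) * N = c * V" "3 * c * V = 3 * (c * V)"
              using c by (simp_all add: VN power2_eq_square)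
            have "1 * 1 \<le> c * V" using c V1 by (intro mult_mono) auto
            then show ?thesis unfolding eq by linarith
          qed
          have u1: "V * (21 * (c * l / N) * L ^ 4 / (l / c)\<^sup>2) \<le> 21 * c ^ 3 * Q"
          proof -
            have "V * (21 * (c * l / N) * L ^ 4 / (l / c)\<^sup>2) = 21 * c ^ 3 * (W * (W ^ 3 * l\<^sup>2))"
              using Nn c z by (simp add: VN L_def power_mult_distrib power_divide z_def[symmetric] power2_eq_square power3_eq_cube power4_eq_xxxx field_simps)
            also have "\<dots> \<le> 21 * c ^ 3 * (W * 1)" using W3 W c by (intro mult_left_mono) (auto simp: l_def)
            also have "\<dots> \<le> 21 * c ^ 3 * Q" using WQ c by (intro mult_left_mono) auto
            finally show ?thesis .
          qed
          have u2: "V * (16 * L\<^sup>2) \<le> 16 * Q"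
          proof -
            have "V * (16 * L\<^sup>2) = 16 * (N / W * (W ^ 3 * l\<^sup>2))"
              using W z by (simp add: VN L_def power_mult_distrib z_def[symmetric] power2_eq_square power3_eq_cube)
            also have "\<dots> \<le> 16 * (N / W * 1)" using W3 W N by (intro mult_left_mono) (auto simp: l_def)
            finally show ?thesis by (simp add: Q_def)
          qed
          have u3: "V * (4 * c\<^sup>2 / (L * sqrt (l / c))) \<le> 4 * c ^ 3 * Q"
          proof -
            have "V * (4 * c\<^sup>2 / (L * sqrt (l / c))) = (V * (4 * c\<^sup>2 / L)) * (1 / sqrt (l / c))" by simp
            also have "\<dots> \<le> (V * (4 * c\<^sup>2 / L)) * (c / z)" using isq V0 L1' by (intro mult_left_mono) auto
            also have "\<dots> = 4 * c ^ 3 * Q"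
              using z W by (simp add: Q_def VN L_def z_def[symmetric] power2_eq_square power3_eq_cube field_simps)
            finally show ?thesis .
          qed
          define X where "X = 21 * (c * l / N) * L ^ 4 / (l / c)\<^sup>2 + 16 * L\<^sup>2 + 4 * c\<^sup>2 / (L * sqrt (l / c))"
          have X0: "0 \<le> X" using c l0 N L1' by (simp add: X_def)
          have t2: "(c\<^sup>2 * (l / c) * N + 2) * X \<le> 123 * c ^ 4 * Q"
          proof -
            have "(c\<^sup>2 * (l / c) * N + 2) * X \<le> 3 * c * V * X" by (intro mult_right_mono cnt X0)
            also have "\<dots> = 3 * c * (V * X)" by simp
            also have "V * X \<le> 21 * c ^ 3 * Q + 16 * Q + 4 * c ^ 3 * Q"
              unfolding X_def distrib_left using u1 u2 u3 by linarith
            also have "21 * c ^ 3 * Q + 16 * Q + 4 * c ^ 3 * Q \<le> 41 * c ^ 3 * Q"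
            proof -
              have "1 * Q \<le> c ^ 3 * Q" using cpow[of 3] Q0 by (intro mult_right_mono) auto
              then show ?thesis by linarith
            qed
            finally show ?thesis using c by (simp add: power3_eq_cube power4_eq_xxxx mult_left_mono mult_ac)
          qed
          have t3: "60 * c\<^sup>2 / sqrt (l / c) \<le> 60 * c ^ 3 * Q"
          proof -
            have "60 * c\<^sup>2 / sqrt (l / c) = 60 * c\<^sup>2 * (1 / sqrt (l / c))" by simp
            also have "\<dots> \<le> 60 * c\<^sup>2 * (c / z)" using isq by (intro mult_left_mono) auto
            also have "\<dots> = 60 * c ^ 3 * (1 / z)" by (simp add: power2_eq_square power3_eq_cube)
            also have "\<dots> \<le> 60 * c ^ 3 * Q" using zW WQ c by (intro mult_left_mono) auto
            finally show ?thesis .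
          qed
          have "400 * c ^ 4 * Q + 123 * c ^ 4 * Q + 60 * c ^ 3 * Q \<le> C * Q"
          proof -
            have "400 * c ^ 4 + 123 * c ^ 4 + 60 * c ^ 3 \<le> C"
              unfolding C_def using cle[of 4 8] cle[of 3 8] cpow[of 8] by linarith
            from mult_right_mono[OF this, of Q] Q0 show ?thesis by (simp only: distrib_right)
          qed
          then show ?thesis using t1 t2 t3 unfolding X_def Q_def by linarith
        qed
        finally show ?thesis .
      qed
    qed
    then show "norm (esum (\<lambda>u. A * Re (G (of_real (u / N)))) a b) \<le> C * (N / W)"
      by (simp only: g_def[abs_def])
  qed
qed

text \<open>The hypothesis on \<open>t\<close> concerns the products of \<open>h\<close> and the shifts: either the second derivative test
  gives the required saving \<open>W\<close> directly, or stationary phase followed by a derivative test of some order \<open>s\<close> does.\<close>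

lemma B_range_psi_sum:
  fixes b m S :: nat
  assumes b: "1 \<le> b"
  obtains C where "1 \<le> C"
    "\<And>X N Z lo hi. 1 \<le> N \<Longrightarrow> 0 < X \<Longrightarrow> 1 \<le> Z \<Longrightarrow> N \<le> real_of_int lo \<Longrightarrow> real_of_int hi \<le> 2 * N \<Longrightarrow>
       real_of_int (hi - lo + 1) \<le> N \<Longrightarrow> (Z ^ (2 ^ m))\<^sup>2 \<le> N \<Longrightarrow> Z\<^sup>2 \<le> N\<^sup>2 * (X / N ^ (m + 2)) \<Longrightarrow>
       (\<And>t. 1 \<le> t \<Longrightarrow> t \<le> Z ^ (2 ^ Suc m - 1) \<Longrightarrow> 1 < Z ^ (2 ^ m) * sqrt (t * (X / N ^ (m + 2))) \<Longrightarrow>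
         (Z ^ (2 ^ m)) ^ 3 * (t * (X / N ^ (m + 2)))\<^sup>2 \<le> 1 \<and>
         (\<exists>s. 3 \<le> s \<and> s \<le> S \<and> (Z ^ (2 ^ m) * sqrt (t * (X / N ^ (m + 2)))) ^ (2 ^ s - 2) * N \<le> (N * (t * (X / N ^ (m + 2)))) ^ (s - 1) \<and>
            (Z ^ (2 ^ m) * sqrt (t * (X / N ^ (m + 2))))\<^sup>2 * (N * (t * (X / N ^ (m + 2)))) ^ (s - 3) \<le> N)) \<Longrightarrow>
       \<bar>\<Sum>n\<in>{lo..hi}. psi (X * (N / of_int n) ^ b)\<bar> \<le> C * (N / Z) * (1 + ln Z)"
proof -
  \<comment> \<open>Each differencing step changes the sign of the leading coefficient.
    Multiplication by \<open>sg\<close> makes the coefficient \<open>D\<close> of the differenced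
    phase positive, and conjugation makes this harmless.\<close>
  define sg where "sg = (-1 :: real) ^ m"
  have sg: "sg = 1 \<or> sg = - 1" by (cases "even m") (auto simp: sg_def)
  define D where "D = sg * falling_coeff b m"
  have D: "0 < D" using falling_coeff_sign[OF b, of m] by (simp add: D_def sg_def)
  define \<rho> :: real where "\<rho> = (1/2) ^ Suc m"
  have rho: "0 < \<rho>" "\<rho> \<le> 1/2" by (auto simp: \<rho>_def power_le_one)
  have bm: "1 \<le> b + m" using b by simp
  obtain \<delta> C0 where del: "0 < \<delta>" and C0: "1 \<le> C0" and
    sdt: "\<And>G A N a b'. near \<rho> \<delta> G (ipow D (b + m)) \<Longrightarrow> 0 < A \<Longrightarrow> 0 < N \<Longrightarrow> N \<le> real_of_int a \<Longrightarrow> real_of_int b' \<le> 2 * N \<Longrightarrow>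
       real_of_int (b' - a + 1) \<le> N \<Longrightarrow>
       norm (esum (\<lambda>u. A * Re (G (of_real (u / N)))) a b') \<le> C0 * (N * sqrt (A / N\<^sup>2) + 1 / sqrt (A / N\<^sup>2))" and
    Bp: "\<And>G A N a b' W s. near \<rho> \<delta> G (ipow D (b + m)) \<Longrightarrow> 0 < A \<Longrightarrow> 1 \<le> N \<Longrightarrow> N \<le> real_of_int a \<Longrightarrow> real_of_int b' \<le> 2 * N \<Longrightarrow>
       real_of_int (b' - a + 1) \<le> N \<Longrightarrow> 1 \<le> W \<Longrightarrow> 1 \<le> W * sqrt (A / N\<^sup>2) \<Longrightarrow> W ^ 3 * (A / N\<^sup>2)\<^sup>2 \<le> 1 \<Longrightarrow> W\<^sup>2 \<le> N \<Longrightarrow>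
       3 \<le> s \<Longrightarrow> s \<le> S \<Longrightarrow> (W * sqrt (A / N\<^sup>2)) ^ (2 ^ s - 2) * N \<le> (A / N) ^ (s - 1) \<Longrightarrow>
       (W * sqrt (A / N\<^sup>2))\<^sup>2 * (A / N) ^ (s - 3) \<le> N \<Longrightarrow>
       norm (esum (\<lambda>u. A * Re (G (of_real (u / N)))) a b') \<le> C0 * (N / W)"
    using B_range_exp_sum[OF D bm rho, where S = S] by blast
  obtain K :: "nat \<Rightarrow> real" where K0: "K 0 = 0" and Kpos: "\<And>j. 0 \<le> K j" and
    Kstep: "\<And>j e h F. near ((1/2) ^ Suc j) (K j * e) F (ipow (falling_coeff b j) (b + j)) \<Longrightarrow> 0 < h \<Longrightarrow> h \<le> e \<Longrightarrow>
       e \<le> (1/2) ^ Suc j / 4 \<Longrightarrow>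
       near ((1/2) ^ Suc (Suc j)) (K (Suc j) * e) (\<lambda>w. (F (w + of_real h) - F w) / of_real h)
         (ipow (falling_coeff b (Suc j)) (b + Suc j))"
    using near_iterated_differences[of b] by blast
  \<comment> \<open>As long as all relative shifts are at most \<open>e0\<close>, the phase after
    \<open>m\<close> differences is still within \<delta> of its monomial.\<close>
  define e0 where "e0 = min (\<rho> / 4) (\<delta> / (K m + 1))"
  have e0: "0 < e0" "e0 \<le> \<rho> / 4" "K m * e0 \<le> \<delta>"
  proof -
    have k1: "0 < K m + 1" using Kpos[of m] by linarith
    show "0 < e0" unfolding e0_def using rho del k1 by simp
    show "e0 \<le> \<rho> / 4" unfolding e0_def by (rule min.cobounded1)
    have "K m * e0 \<le> (K m + 1) * (\<delta> / (K m + 1))"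
      unfolding e0_def using Kpos[of m] del k1 rho by (intro mult_mono min.cobounded2) auto
    then show "K m * e0 \<le> \<delta>" using k1 by simp
  qed
  define C1 where "C1 = max 20 C0"
  define C where "C = 1 / e0 + 26 + 2 * C1"
  have C: "1 \<le> C" "1 / e0 \<le> C" "26 + 2 * C1 \<le> C" "0 < C1" using e0 C0 by (auto simp: C_def C1_def)
  show ?thesis
  proof (rule that[OF C(1)])
    fix X N Z :: real and lo hi :: int
    assume N: "1 \<le> N" and X: "0 < X" and Z: "1 \<le> Z" and lo: "N \<le> real_of_int lo" and hi: "real_of_int hi \<le> 2 * N"
      and len: "real_of_int (hi - lo + 1) \<le> N" and WN: "(Z ^ (2 ^ m))\<^sup>2 \<le> N" and sec: "Z\<^sup>2 \<le> N\<^sup>2 * (X / N ^ (m + 2))"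
      and cond: "\<And>t. 1 \<le> t \<Longrightarrow> t \<le> Z ^ (2 ^ Suc m - 1) \<Longrightarrow> 1 < Z ^ (2 ^ m) * sqrt (t * (X / N ^ (m + 2))) \<Longrightarrow>
         (Z ^ (2 ^ m)) ^ 3 * (t * (X / N ^ (m + 2)))\<^sup>2 \<le> 1 \<and>
         (\<exists>s. 3 \<le> s \<and> s \<le> S \<and> (Z ^ (2 ^ m) * sqrt (t * (X / N ^ (m + 2)))) ^ (2 ^ s - 2) * N \<le> (N * (t * (X / N ^ (m + 2)))) ^ (s - 1) \<and>
            (Z ^ (2 ^ m) * sqrt (t * (X / N ^ (m + 2))))\<^sup>2 * (N * (t * (X / N ^ (m + 2)))) ^ (s - 3) \<le> N)"
    define W where "W = Z ^ (2 ^ m)"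
    define \<Lambda> where "\<Lambda> = X / N ^ (m + 2)"
    have W1: "1 \<le> W" using Z by (simp add: W_def one_le_power)
    have ZW: "Z \<le> W" unfolding W_def using Z by (intro self_le_power) auto
    have L0: "0 < \<Lambda>" using X N by (simp add: \<Lambda>_def)
    have WsN: "W \<le> sqrt N" using WN W1 by (simp add: W_def real_le_rsqrt)
    have lnZ: "0 \<le> ln Z" using Z by simp
    show "\<bar>\<Sum>n\<in>{lo..hi}. psi (X * (N / of_int n) ^ b)\<bar> \<le> C * (N / Z) * (1 + ln Z)"
    \<comment> \<open>The shifts are at most W <= sqrt N, so the relative shifts are at most 1 /
      sqrt N. If this is not small, then N and with it Z are bounded, and the trivial estimate
      suffices.\<close>
    proof (cases "1 / sqrt N \<le> e0")
      case False
      have card: "real (card {lo..hi}) \<le> N" using len N by (cases "lo \<le> hi") auto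
      have "\<bar>\<Sum>n\<in>{lo..hi}. psi (X * (N / of_int n) ^ b)\<bar> \<le> (\<Sum>n\<in>{lo..hi}. 1/2)"
        by (intro order_trans[OF sum_abs] sum_mono abs_psi_le)
      also have "\<dots> \<le> N" using card N by simp
      also have "\<dots> = Z * (N / Z)" using Z by simp
      also have "\<dots> \<le> C * (N / Z)"
      proof (rule mult_right_mono)
        have "Z \<le> sqrt N" using ZW WsN by linarith
        also have "\<dots> \<le> 1 / e0" using False e0(1) N by (simp add: field_simps)
        finally show "Z \<le> C" using C by linarith
      qed (use N Z in auto)
      also have "\<dots> \<le> C * (N / Z) * (1 + ln Z)"
        using C N Z lnZ mult_left_mono[of 1 "1 + ln Z" "C * (N / Z)"] by simp
      finally show ?thesis .
    next
      case big: True
      define e where "e = 1 / sqrt N"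
      have e: "0 < e" "e \<le> e0" using N big by (auto simp: e_def)
      have ej: "e \<le> (1/2) ^ Suc j / 4" if "j \<le> m" for j
      proof -
        have "\<rho> \<le> (1/2) ^ Suc j" unfolding \<rho>_def using that by (intro power_decreasing) auto
        then show ?thesis using e e0 by linarith
      qed
      have expsum: "norm (esum (\<lambda>u. real h * (X * (N / u) ^ b)) lo hi) \<le> 2 * C1 * (N / Z)"
        if h: "1 \<le> h" "real h \<le> Z" for h :: nat
      proof -
        define f where "f u = real h * X / N ^ 0 * Re (ipow 1 b (of_real (u / N)))" for u :: real
        define T where "T = real h * Z ^ (2 ^ Suc m - 2)"
        \<comment> \<open>\<open>t\<close> is \<open>h\<close> times the product of the shifts.
          Dividing each difference by its relative shift q / N keeps \<open>F\<close> close to a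
          derivative of the monomial and moves the shifts into the factor t * X / N ^ j.\<close>
        define G where "G j t g a b' \<longleftrightarrow> (\<exists>F. near ((1/2) ^ Suc j) (K j * e) F (ipow (falling_coeff b j) (b + j)) \<and>
            g = (\<lambda>u. t * X / N ^ j * Re (F (of_real (u / N)))) \<and> N \<le> real_of_int a \<and> real_of_int b' \<le> 2 * N \<and>
            real_of_int (b' - a + 1) \<le> N \<and> real h \<le> t \<and> t \<le> real h * Z ^ (2 ^ Suc j - 2))" for j t g a b'
        have "norm (esum f lo hi) \<le> 2 * C1 * (N / Z)"
        proof (rule iterated_Weyl[where G = G and m = m and ?t0.0 = "real h"])
          show "G 0 (real h) f lo hi" unfolding G_def
          proof (intro exI[of _ "ipow 1 b"] conjI)
            show "near ((1/2) ^ Suc 0) (K 0 * e) (ipow 1 b) (ipow (falling_coeff b 0) (b + 0))"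
              unfolding near_def using ipow_holomorphic[of "1/2" 1 b] by (auto simp: K0 ipow_def)
          qed (use lo hi len h in \<open>auto simp: f_def\<close>)
          show "Z ^ (2 ^ m) \<le> N"
          proof -
            have "W * 1 \<le> W * W" using W1 by (intro mult_left_mono) auto
            then show ?thesis using WN by (simp add: W_def power2_eq_square)
          qed
        next
          fix j t g a b' assume "j \<le> m" "G j t g a b'"
          then show "0 < t \<and> real_of_int (b' - a + 1) \<le> N" using h by (auto simp: G_def)
        next
          fix j t g a b' and q :: nat
          assume j: "j < m" and g: "G j t g a b'" and ab: "a \<le> b'" and q: "1 \<le> q" "real q \<le> Z ^ (2 ^ Suc j)" "int q \<le> b' - a"
          from g obtain F where F: "near ((1/2) ^ Suc j) (K j * e) F (ipow (falling_coeff b j) (b + j))"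
            "g = (\<lambda>u. t * X / N ^ j * Re (F (of_real (u / N))))" "N \<le> real_of_int a" "real_of_int b' \<le> 2 * N"
            "real_of_int (b' - a + 1) \<le> N" "real h \<le> t" "t \<le> real h * Z ^ (2 ^ Suc j - 2)" unfolding G_def by blast
          define \<eta> where "\<eta> = real q / N"
          have eta: "0 < \<eta>" "\<eta> \<le> e"
          proof -
            show "0 < \<eta>" using q N by (simp add: \<eta>_def)
            have "real q \<le> W" unfolding W_def
              by (rule order_trans[OF q(2)]) (rule power_increasing, rule power_increasing, use j Z in auto)
            then have "\<eta> \<le> sqrt N / N" unfolding \<eta>_def using WsN N by (intro divide_right_mono) auto
            also have "\<dots> = e" using N by (simp add: e_def real_div_sqrt field_simps)
            finally show "\<eta> \<le> e" .
          qed
          define F' where "F' w = (F (w + of_real \<eta>) - F w) / of_real \<eta>" for w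
          show "G (Suc j) (t * real q) (\<lambda>u. g (u + real q) - g u) a (b' - int q)"
            unfolding G_def
          proof (intro exI[of _ F'] conjI)
            show "near ((1/2) ^ Suc (Suc j)) (K (Suc j) * e) F' (ipow (falling_coeff b (Suc j)) (b + Suc j))"
              unfolding F'_def using j by (intro Kstep[OF F(1) eta] ej) simp
            show "(\<lambda>u. g (u + real q) - g u) = (\<lambda>u. t * real q * X / N ^ Suc j * Re (F' (of_real (u / N))))"
            proof
              fix u
              have w: "complex_of_real ((u + real q) / N) = of_real (u / N) + of_real \<eta>"
                by (simp add: \<eta>_def add_divide_distrib)
              have "Re (F' (of_real (u / N))) = (Re (F (of_real ((u + real q) / N))) - Re (F (of_real (u / N)))) / \<eta>"
                unfolding F'_def w by simp
              then have "t * real q * X / N ^ Suc j * Re (F' (of_real (u / N)))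
                  = t * X / N ^ j * (Re (F (of_real ((u + real q) / N))) - Re (F (of_real (u / N)))) * (real q / N / \<eta>)"
                by (simp add: mult_ac)
              also have "real q / N / \<eta> = 1" using eta(1) unfolding \<eta>_def[symmetric] by simp
              finally show "g (u + real q) - g u = t * real q * X / N ^ Suc j * Re (F' (of_real (u / N)))"
                unfolding F(2) by (simp add: right_diff_distrib)
            qed
            have "t * 1 \<le> t * real q" using q F(6) h by (intro mult_left_mono) auto
            then show "real h \<le> t * real q" using F(6) by simp
            have "t * real q \<le> real h * Z ^ (2 ^ Suc j - 2) * Z ^ (2 ^ Suc j)"
              using F(6,7) q h by (intro mult_mono) auto
            also have "\<dots> = real h * Z ^ (2 ^ Suc (Suc j) - 2)"
            proof -
              have "(2::nat) ^ Suc (Suc j) - 2 = (2 ^ Suc j - 2) + 2 ^ Suc j" by simp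
              then show ?thesis by (simp only: power_add mult.assoc)
            qed
            finally show "t * real q \<le> real h * Z ^ (2 ^ Suc (Suc j) - 2)" .
          qed (use F q in auto)
        next
          fix t g a b' assume g: "G m t g a b'" and ab: "a \<le> b'"
          from g obtain F where F: "near ((1/2) ^ Suc m) (K m * e) F (ipow (falling_coeff b m) (b + m))"
            "g = (\<lambda>u. t * X / N ^ m * Re (F (of_real (u / N))))" "N \<le> real_of_int a" "real_of_int b' \<le> 2 * N"
            "real_of_int (b' - a + 1) \<le> N" "real h \<le> t" "t \<le> T" unfolding G_def T_def by blast
          have t1: "1 \<le> t" using F(6) h by linarith
          define F' where "F' w = of_real sg * F w" for w
          have F': "near \<rho> \<delta> F' (ipow D (b + m))"
          proof -
            have "K m * e \<le> K m * e0" using e Kpos[of m] by (intro mult_left_mono) auto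
            then have n1: "near \<rho> \<delta> F (ipow (falling_coeff b m) (b + m))"
              using e0 by (intro near_mono[OF F(1)]) (auto simp: \<rho>_def)
            have "norm (F' w - ipow D (b + m) w) = norm (F w - ipow (falling_coeff b m) (b + m) w)" for w
            proof -
              have "F' w - ipow D (b + m) w = of_real sg * (F w - ipow (falling_coeff b m) (b + m) w)"
                by (simp add: F'_def ipow_def D_def algebra_simps)
              then show ?thesis using sg by (auto simp: norm_mult)
            qed
            then show ?thesis using n1 unfolding near_def F'_def by (auto intro!: holomorphic_intros)
          qed
          define A where "A = t * X / N ^ m"
          have A: "0 < A" using t1 X N by (simp add: A_def)
          have AN: "A / N\<^sup>2 = t * \<Lambda>" "A / N = N * (t * \<Lambda>)"
            using N by (simp_all add: A_def \<Lambda>_def power_add power2_eq_square)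
          have eqn: "norm (esum g a b') = norm (esum (\<lambda>u. A * Re (F' (of_real (u / N)))) a b')"
          proof -
            have "(\<lambda>u. A * Re (F' (of_real (u / N)))) = g \<or> (\<lambda>u. A * Re (F' (of_real (u / N)))) = (\<lambda>u. - g u)"
              using sg by (auto simp: F(2) A_def F'_def fun_eq_iff)
            then show ?thesis using norm_esum_uminus[of g a b'] by auto
          qed
          define y where "y = sqrt (T / t)"
          have y0: "0 \<le> y" using t1 h Z by (simp add: y_def T_def)
          have "norm (esum g a b') \<le> C0 * (N / W * (1 + y))"
          \<comment> \<open>If the window parameter W * sqrt (t * \<Lambda>) is at most 1, then the
            first term of the second derivative test is already at most N / W; its second term is
            absorbed by the factor 1 + y, which the iteration tolerates.\<close>
          proof (cases "1 < W * sqrt (t * \<Lambda>)")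
            case False
            have "norm (esum g a b') \<le> C0 * (N * sqrt (t * \<Lambda>) + 1 / sqrt (t * \<Lambda>))"
              unfolding eqn AN[symmetric] using sdt[OF F' A _ F(3,4,5)] N by simp
            also have "\<dots> \<le> C0 * (N / W * (1 + y))"
            proof (rule mult_left_mono)
              have "sqrt (t * \<Lambda>) \<le> 1 / W" using False W1 by (simp add: field_simps)
              then have "N * sqrt (t * \<Lambda>) \<le> N * (1 / W)" using N by (intro mult_left_mono) auto
              moreover have "1 / sqrt (t * \<Lambda>) \<le> N / W * y"
              proof -
                have WT: "W\<^sup>2 \<le> T * (N\<^sup>2 * \<Lambda>)"
                proof -
                  have "(2::nat) ^ m * 2 = (2 ^ Suc m - 2) + 2"
                    unfolding power_Suc using one_le_power[of "2::nat" m] by linarith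
                  then have "W\<^sup>2 = Z ^ (2 ^ Suc m - 2) * Z\<^sup>2" unfolding W_def by (metis power_add power_mult)
                  also have "\<dots> \<le> T * (N\<^sup>2 * \<Lambda>)"
                  proof (rule mult_mono)
                    have "1 * Z ^ (2 ^ Suc m - 2) \<le> T" unfolding T_def using h Z by (intro mult_right_mono) auto
                    then show "Z ^ (2 ^ Suc m - 2) \<le> T" by simp
                  qed (use sec Z h in \<open>auto simp: \<Lambda>_def T_def\<close>)
                  finally show ?thesis .
                qed
                have T0: "0 < T" using h Z by (simp add: T_def)
                have "W\<^sup>2 \<le> (N * sqrt (T * \<Lambda>))\<^sup>2" using WT T0 L0 by (simp add: power_mult_distrib mult_ac)
                then have "W \<le> N * sqrt (T * \<Lambda>)" by (rule power2_le_imp_le) (use N T0 L0 in simp)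
                then have "W / sqrt (t * \<Lambda>) \<le> N * sqrt (T * \<Lambda>) / sqrt (t * \<Lambda>)"
                  using t1 L0 by (intro divide_right_mono) auto
                also have "\<dots> = N * y" using L0 by (simp add: y_def real_sqrt_mult real_sqrt_divide)
                finally show ?thesis using W1 by (simp add: field_simps)
              qed
              ultimately show "N * sqrt (t * \<Lambda>) + 1 / sqrt (t * \<Lambda>) \<le> N / W * (1 + y)" by (simp add: distrib_left)
            qed (use C0 in simp)
            finally show ?thesis .
          next
            case True
            have "t \<le> Z ^ (2 ^ Suc m - 1)"
            proof -
              have "t \<le> Z * Z ^ (2 ^ Suc m - 2)" using F(7) h Z unfolding T_def by (meson mult_right_mono order_trans zero_le_power zero_le_one)
              also have "\<dots> = Z ^ Suc (2 ^ Suc m - 2)" by simp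
              also have "Suc (2 ^ Suc m - 2) = (2::nat) ^ Suc m - 1"
              proof -
                have "1 \<le> (2::nat) ^ m" by simp
                then show ?thesis unfolding power_Suc by linarith
              qed
              finally show ?thesis .
            qed
            from cond[OF t1 this] True obtain s where s: "W ^ 3 * (t * \<Lambda>)\<^sup>2 \<le> 1" "3 \<le> s" "s \<le> S"
              "(W * sqrt (t * \<Lambda>)) ^ (2 ^ s - 2) * N \<le> (N * (t * \<Lambda>)) ^ (s - 1)"
              "(W * sqrt (t * \<Lambda>))\<^sup>2 * (N * (t * \<Lambda>)) ^ (s - 3) \<le> N"
              unfolding W_def \<Lambda>_def by blast
            have "norm (esum g a b') \<le> C0 * (N / W)"
              unfolding eqn by (rule Bp[OF F' A N F(3,4,5) W1 _ _ _ s(2,3)]) (use True s WN in \<open>auto simp: AN W_def\<close>)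
            also have "\<dots> \<le> C0 * (N / W * (1 + y))"
              using C0 N W1 y0 by (intro mult_left_mono) (auto simp: mult_left_mono[of 1 "1 + y" "N / W", simplified])
            finally show ?thesis .
          qed
          also have "\<dots> \<le> C1 * (N / W * (1 + y))"
            using N W1 y0 by (intro mult_right_mono) (auto simp: C1_def)
          finally show "norm (esum g a b') \<le> C1 * (N / Z ^ (2 ^ m)) * (1 + sqrt (real h * Z ^ (2 ^ Suc m - 2) / t))"
            unfolding y_def T_def W_def by (simp only: mult.assoc)
        qed (use Z h in \<open>auto simp: C1_def\<close>)
        moreover have "esum f lo hi = esum (\<lambda>u. real h * (X * (N / u) ^ b)) lo hi"
          unfolding esum_def f_def Re_ipow by (simp add: power_divide mult.assoc)
        ultimately show ?thesis by simp
      qed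
      have "\<bar>\<Sum>n\<in>{lo..hi}. psi (X * (N / of_int n) ^ b)\<bar> \<le> 26 * (real (card {lo..hi}) / Z) + 2 * C1 * (N / Z) * (1 + ln Z)"
        by (rule sum_psi_le[OF Z]) (use expsum C N Z in \<open>auto simp: esum_def\<close>)
      also have "\<dots> \<le> 26 * ((N / Z) * (1 + ln Z)) + 2 * C1 * (N / Z) * (1 + ln Z)"
      proof (rule add_right_mono, rule mult_left_mono)
        have "real (card {lo..hi}) \<le> N" using len N by (cases "lo \<le> hi") auto
        then have "real (card {lo..hi}) / Z \<le> N / Z" using Z by (intro divide_right_mono) auto
        also have "\<dots> \<le> (N / Z) * (1 + ln Z)"
          using N Z lnZ mult_left_mono[of 1 "1 + ln Z" "N / Z"] by simp
        finally show "real (card {lo..hi}) / Z \<le> (N / Z) * (1 + ln Z)" .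
      qed simp
      also have "\<dots> = (26 + 2 * C1) * ((N / Z) * (1 + ln Z))" by (simp only: distrib_right mult.assoc)
      also have "\<dots> \<le> C * ((N / Z) * (1 + ln Z))"
        using C N Z lnZ by (intro mult_right_mono) auto
      finally show ?thesis by (simp only: mult.assoc)
    qed
  qed
qed

subsection \<open>Exponents\<close>

text \<open>Write \<open>N\<close> for the length of a dyadic block, \<open>N powr - y\<close> for the size of the \<open>r\<close>-th derivative of
  \<open>x / u ^ b\<close> on it, and \<open>N powr \<sigma>\<close> for the required saving. In \<open>B_ok\<close>, \<open>N powr - \<mu>\<close> is the size of the second
  derivative after \<open>r - 2\<close> differencing steps. The summand \<open>1 / (4 * b\<^sup>2)\<close> of \<open>\<sigma>\<close> in the lemmas below is
  slack that absorbs the factor \<open>1 + ln Z\<close> of the tests.\<close>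

definition test_ok :: "nat \<Rightarrow> nat \<Rightarrow> real \<Rightarrow> real \<Rightarrow> bool" where
  "test_ok r k y \<sigma> \<longleftrightarrow> (2 ^ k - 1) * \<sigma> \<le> y - (real r - real k) \<and> 2 * \<sigma> \<le> 2 - (y - (real r - real k))"

definition B_ok :: "nat \<Rightarrow> real \<Rightarrow> real \<Rightarrow> bool" where
  "B_ok r y \<sigma> \<longleftrightarrow> 2 ^ r * \<sigma> / 4 \<le> 1/2 \<and> 2 * \<sigma> \<le> 2 - y \<and>
     (\<forall>\<mu>. y - (2 ^ r / 2 - 1) * \<sigma> \<le> \<mu> \<longrightarrow> \<mu> \<le> 2 * (2 ^ r * \<sigma> / 4) \<longrightarrow>
        3 * (2 ^ r * \<sigma> / 4) \<le> 2 * \<mu> \<and>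
        (\<exists>s\<in>{3..r + 3}. (2 ^ s - 2) * (2 ^ r * \<sigma> / 4 - \<mu> / 2) + 1 \<le> (real s - 1) * (1 - \<mu>) \<and>
           2 * (2 ^ r * \<sigma> / 4 - \<mu> / 2) + (real s - 3) * (1 - \<mu>) \<le> 1))"

text \<open>For r <= 7 a single order \<open>s\<close> serves all \<mu> at a given y; in general
  \<open>s\<close> varies with \<mu>. Here \<open>2 ^ r * \<sigma> / 4\<close> is the exponent of W
  = Z ^ (2 ^ (r - 2)), and subtracting \<mu> / 2 from it gives the exponent of the window
  parameter.\<close>

lemma B_okI:
  assumes "2 ^ r * \<sigma> / 4 \<le> 1/2" "2 * \<sigma> \<le> 2 - y" "s \<in> {3..r + 3}"
    "\<And>\<mu>. y - (2 ^ r / 2 - 1) * \<sigma> \<le> \<mu> \<Longrightarrow> \<mu> \<le> 2 * (2 ^ r * \<sigma> / 4) \<Longrightarrow>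
        3 * (2 ^ r * \<sigma> / 4) \<le> 2 * \<mu> \<and> (2 ^ s - 2) * (2 ^ r * \<sigma> / 4 - \<mu> / 2) + 1 \<le> (real s - 1) * (1 - \<mu>) \<and>
           2 * (2 ^ r * \<sigma> / 4 - \<mu> / 2) + (real s - 3) * (1 - \<mu>) \<le> 1"
  shows "B_ok r y \<sigma>"
  unfolding B_ok_def
proof (intro conjI allI impI)
  fix \<mu> assume m: "y - (2 ^ r / 2 - 1) * \<sigma> \<le> \<mu>" "\<mu> \<le> 2 * (2 ^ r * \<sigma> / 4)"
  show "3 * (2 ^ r * \<sigma> / 4) \<le> 2 * \<mu>" using assms(4)[OF m] by (rule conjunct1)
  show "\<exists>s\<in>{3..r + 3}. (2 ^ s - 2) * (2 ^ r * \<sigma> / 4 - \<mu> / 2) + 1 \<le> (real s - 1) * (1 - \<mu>) \<and>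
           2 * (2 ^ r * \<sigma> / 4 - \<mu> / 2) + (real s - 3) * (1 - \<mu>) \<le> 1"
    by (rule bexI[OF _ assms(3)]) (rule conjunct2[OF assms(4)[OF m]])
qed (use assms(1,2) in auto)

text \<open>The numerals are the values of e0, E and 1 / (4 * b ^ 2) at r = 5. For fixed orders all
  conditions are linear in y and \<mu>, so the work lies in cut points at which both neighbouring
  methods succeed. The ranks 5, 6 and 7 are separate because the inequality 28 * r <= 2 ^ r behind
  the general argument starts at r = 8.\<close>

lemma exponents_5:
  assumes \<sigma>: "\<sigma> = (y + 6/22) / (37 + 6/22) + 1/4096" and y: "- (6/22) \<le> y" "y \<le> 4"
  shows "(\<exists>k\<in>{2..6}. test_ok 5 k y \<sigma>) \<or> B_ok 5 y \<sigma>"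
proof -
  consider "y \<le> 3/4" | "3/4 \<le> y" "y \<le> 28/25" | "28/25 \<le> y" "y \<le> 143/100" | "143/100 \<le> y" "y \<le> 187/100" | "187/100 \<le> y" "y \<le> 11/4" | "11/4 \<le> y" "y \<le> 15/4" | "15/4 \<le> y" by linarith
  then show ?thesis
  proof cases
    case 1
    then have "test_ok 5 6 y \<sigma>" using y by (auto simp: test_ok_def \<sigma> field_simps)
    then show ?thesis by (intro disjI1 bexI[of _ 6]) auto
  next
    case 2
    have "B_ok 5 y \<sigma>" by (rule B_okI[where s = 4]) (use 2 in \<open>auto simp: \<sigma> field_simps\<close>)+
    then show ?thesis ..
  next
    case 3
    have "B_ok 5 y \<sigma>" by (rule B_okI[where s = 5]) (use 3 in \<open>auto simp: \<sigma> field_simps\<close>)+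
    then show ?thesis ..
  next
    case 4
    then have "test_ok 5 5 y \<sigma>" using y by (auto simp: test_ok_def \<sigma> field_simps)
    then show ?thesis by (intro disjI1 bexI[of _ 5]) auto
  next
    case 5
    then have "test_ok 5 4 y \<sigma>" using y by (auto simp: test_ok_def \<sigma> field_simps)
    then show ?thesis by (intro disjI1 bexI[of _ 4]) auto
  next
    case 6
    then have "test_ok 5 3 y \<sigma>" using y by (auto simp: test_ok_def \<sigma> field_simps)
    then show ?thesis by (intro disjI1 bexI[of _ 3]) auto
  next
    case 7
    then have "test_ok 5 2 y \<sigma>" using y by (auto simp: test_ok_def \<sigma> field_simps)
    then show ?thesis by (intro disjI1 bexI[of _ 2]) auto
  qed
qed

lemma exponents_6:
  assumes \<sigma>: "\<sigma> = (y + 8/52) / (70 + 8/52) + 1/16384" and y: "- (8/52) \<le> y" "y \<le> 5"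
  shows "(\<exists>k\<in>{2..7}. test_ok 6 k y \<sigma>) \<or> B_ok 6 y \<sigma>"
proof -
  consider "y \<le> 3/4" | "3/4 \<le> y" "y \<le> 28/25" | "28/25 \<le> y" "y \<le> 143/100" | "143/100 \<le> y" "y \<le> 193/100" | "193/100 \<le> y" "y \<le> 11/4" | "11/4 \<le> y" "y \<le> 15/4" | "15/4 \<le> y" "y \<le> 19/4" | "19/4 \<le> y" by linarith
  then show ?thesis
  proof cases
    case 1
    then have "test_ok 6 7 y \<sigma>" using y by (auto simp: test_ok_def \<sigma> field_simps)
    then show ?thesis by (intro disjI1 bexI[of _ 7]) auto
  next
    case 2
    have "B_ok 6 y \<sigma>" by (rule B_okI[where s = 4]) (use 2 in \<open>auto simp: \<sigma> field_simps\<close>)+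
    then show ?thesis ..
  next
    case 3
    have "B_ok 6 y \<sigma>" by (rule B_okI[where s = 5]) (use 3 in \<open>auto simp: \<sigma> field_simps\<close>)+
    then show ?thesis ..
  next
    case 4
    then have "test_ok 6 6 y \<sigma>" using y by (auto simp: test_ok_def \<sigma> field_simps)
    then show ?thesis by (intro disjI1 bexI[of _ 6]) auto
  next
    case 5
    then have "test_ok 6 5 y \<sigma>" using y by (auto simp: test_ok_def \<sigma> field_simps)
    then show ?thesis by (intro disjI1 bexI[of _ 5]) auto
  next
    case 6
    then have "test_ok 6 4 y \<sigma>" using y by (auto simp: test_ok_def \<sigma> field_simps)
    then show ?thesis by (intro disjI1 bexI[of _ 4]) auto
  next
    case 7
    then have "test_ok 6 3 y \<sigma>" using y by (auto simp: test_ok_def \<sigma> field_simps)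
    then show ?thesis by (intro disjI1 bexI[of _ 3]) auto
  next
    case 8
    then have "test_ok 6 2 y \<sigma>" using y by (auto simp: test_ok_def \<sigma> field_simps)
    then show ?thesis by (intro disjI1 bexI[of _ 2]) auto
  qed
qed

lemma exponents_7:
  assumes \<sigma>: "\<sigma> = (y + 10/114) / (135 + 10/114) + 1/65536" and y: "- (10/114) \<le> y" "y \<le> 6"
  shows "(\<exists>k\<in>{2..8}. test_ok 7 k y \<sigma>) \<or> B_ok 7 y \<sigma>"
proof -
  consider "y \<le> 3/4" | "3/4 \<le> y" "y \<le> 28/25" | "28/25 \<le> y" "y \<le> 143/100" | "143/100 \<le> y" "y \<le> 196/100" | "196/100 \<le> y" "y \<le> 11/4" | "11/4 \<le> y" "y \<le> 15/4" | "15/4 \<le> y" "y \<le> 19/4" | "19/4 \<le> y" "y \<le> 23/4" | "23/4 \<le> y" by linarith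
  then show ?thesis
  proof cases
    case 1
    then have "test_ok 7 8 y \<sigma>" using y by (auto simp: test_ok_def \<sigma> field_simps)
    then show ?thesis by (intro disjI1 bexI[of _ 8]) auto
  next
    case 2
    have "B_ok 7 y \<sigma>" by (rule B_okI[where s = 4]) (use 2 in \<open>auto simp: \<sigma> field_simps\<close>)+
    then show ?thesis ..
  next
    case 3
    have "B_ok 7 y \<sigma>" by (rule B_okI[where s = 5]) (use 3 in \<open>auto simp: \<sigma> field_simps\<close>)+
    then show ?thesis ..
  next
    case 4
    then have "test_ok 7 7 y \<sigma>" using y by (auto simp: test_ok_def \<sigma> field_simps)
    then show ?thesis by (intro disjI1 bexI[of _ 7]) auto
  next
    case 5
    then have "test_ok 7 6 y \<sigma>" using y by (auto simp: test_ok_def \<sigma> field_simps)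
    then show ?thesis by (intro disjI1 bexI[of _ 6]) auto
  next
    case 6
    then have "test_ok 7 5 y \<sigma>" using y by (auto simp: test_ok_def \<sigma> field_simps)
    then show ?thesis by (intro disjI1 bexI[of _ 5]) auto
  next
    case 7
    then have "test_ok 7 4 y \<sigma>" using y by (auto simp: test_ok_def \<sigma> field_simps)
    then show ?thesis by (intro disjI1 bexI[of _ 4]) auto
  next
    case 8
    then have "test_ok 7 3 y \<sigma>" using y by (auto simp: test_ok_def \<sigma> field_simps)
    then show ?thesis by (intro disjI1 bexI[of _ 3]) auto
  next
    case 9
    then have "test_ok 7 2 y \<sigma>" using y by (auto simp: test_ok_def \<sigma> field_simps)
    then show ?thesis by (intro disjI1 bexI[of _ 2]) auto
  qed
qed

lemma two_power_ge:
  assumes "7 \<le> r"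
  shows "16 * (real r)\<^sup>2 \<le> 5 * 2 ^ r + 22 * real r" "18 * real r \<le> 2 ^ r"
proof -
  have "16 * (real r)\<^sup>2 \<le> 5 * 2 ^ r + 22 * real r \<and> 18 * real r \<le> 2 ^ r"
    using assms
  proof (induction r rule: dec_induct)
    case (step r)
    have r: "7 \<le> real r" using step.hyps by simp
    have f: "7 * real r \<le> (real r)\<^sup>2" using r by (simp add: power2_eq_square)
    have e: "(real (Suc r))\<^sup>2 = (real r)\<^sup>2 + 2 * real r + 1" "real (Suc r) = real r + 1"
      by (simp_all add: power2_eq_square algebra_simps)
    have "16 * (real (Suc r))\<^sup>2 \<le> 2 * (16 * (real r)\<^sup>2 - 22 * real r) + 22 * real (Suc r)"
    proof -
      have *: "16 * (z + 2 * x + 1) \<le> 2 * (16 * z - 22 * x) + 22 * (x + 1)" if "7 * x \<le> z" "7 \<le> x" for x z :: real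
        using that by (simp add: algebra_simps)
      show ?thesis unfolding e(1) unfolding e(2) using f r by (rule *)
    qed
    then show ?case using step.IH r by simp
  qed (auto simp: power2_eq_square)
  then show "16 * (real r)\<^sup>2 \<le> 5 * 2 ^ r + 22 * real r" "18 * real r \<le> 2 ^ r" by auto
qed

lemma two_power_ge_28: "8 \<le> r \<Longrightarrow> 28 * real r \<le> 2 ^ r"
proof (induction r rule: dec_induct)
  case (step r)
  then show ?case by simp
qed simp

text \<open>With r = s + p this compares a loss linear in r with the factor 2 ^ (r - s) that is left
  over when the dual test has order \<open>s\<close>.\<close>

lemma linear_le_two_power:
  assumes "3 \<le> s" "8 \<le> s + p"
  shows "real p + 73/10 - 11/10 * real s \<le> 15/16 * 2 ^ p"
proof -
  have large: "real p + 4 \<le> 15/16 * 2 ^ p" if "3 \<le> p"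
    using that by (induction p rule: dec_induct) auto
  consider "p = 0" | "p = 1" | "p = 2" | "3 \<le> p" by linarith
  then show ?thesis using assms large by cases auto
qed

lemma quarter_le_two_power: "2 \<le> j \<Longrightarrow> real j + 3/4 \<le> 3/4 * 2 ^ j"
  by (induction j rule: dec_induct) auto

text \<open>The main condition of the derivative test of order \<open>r\<close> is \<open>\<eta> \<le> 0\<close>. The orders used for increasing \<open>y\<close> are
  \<open>r + 1\<close>, stationary phase with \<open>s - 3 = floor ((1 - 2 * \<eta>') / \<kappa>)\<close>, \<open>r\<close>, \<open>r - 1\<close> and \<open>r - floor (y - 3/4)\<close>.\<close>

lemma exponents_general:
  fixes r :: nat and y :: real
  defines "b \<equiv> (2::real) ^ r"
  defines "e0 \<equiv> (2 * real r - 4) / (b - 2 * real r)"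
  assumes r: "8 \<le> r" and y: "- e0 \<le> y" "y \<le> real r - 1"
    and \<sigma>: "\<sigma> = (y + e0) / (b + real r + e0) + 1 / (4 * b\<^sup>2)"
  shows "(\<exists>k\<in>{2..r + 1}. test_ok r k y \<sigma>) \<or> B_ok r y \<sigma>"
proof -
  define R where "R = real r"
  define E where "E = b + R + e0"
  define t where "t = E / (4 * b\<^sup>2)"
  \<comment> \<open>Half the excess in the main condition of the order r test. It is also the
    largest possible exponent of the window parameter W * sqrt (t * \<Lambda>), attained at the
    largest t.\<close>
  define \<eta> where "\<eta> = (\<sigma> * (b - 1) - y) / 2"
  define Q where "Q = (R + 1) * (2 - y)"
  have R: "8 \<le> R" using r by (simp add: R_def)
  have bR: "28 * R \<le> b" using two_power_ge_28[OF r] by (simp add: b_def R_def)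
  have e0b: "e0 * (b - 2 * R) = 2 * R - 4" unfolding e0_def using bR R by (simp add: R_def)
  have e00: "0 \<le> e0" unfolding e0_def using bR R by (simp add: R_def)
  have Re0: "2 * R * e0 \<le> 5/4"
  proof -
    have "16 * R\<^sup>2 \<le> 5 * b + 22 * R" using two_power_ge(1)[of r] r by (simp add: b_def R_def)
    then have "2 * R * (2 * R - 4) \<le> 5/4 * (b - 2 * R)" by (simp add: power2_eq_square algebra_simps)
    then have "2 * R * e0 * (b - 2 * R) \<le> 5/4 * (b - 2 * R)" using e0b by (metis mult.assoc)
    then show ?thesis by (rule mult_right_le_imp_le) (use bR R in linarith)
  qed
  have e01: "e0 \<le> 1/8"
  proof -
    have "16 * e0 \<le> 2 * R * e0" using R e00 by (intro mult_right_mono) auto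
    then show ?thesis using Re0 by linarith
  qed
  have b0: "0 < b" and b224: "224 \<le> b" using bR R by linarith+
  have E0: "0 < E" and Eb: "b \<le> E" using b0 R e00 by (auto simp: E_def)
  have E104: "E \<le> 104/100 * b" unfolding E_def using bR e01 b224 by linarith
  have t0: "0 \<le> t" using E0 by (simp add: t_def)
  have tb: "t * (b - 1) \<le> 26/100"
  proof -
    have "t * (b - 1) \<le> t * b" using t0 by (intro mult_left_mono) auto
    also have "\<dots> = E / (4 * b)" using b0 by (simp add: t_def power2_eq_square)
    also have "\<dots> \<le> 26/100" using b0 E104 by (simp add: pos_divide_le_eq)
    finally show ?thesis .
  qed
  have sE: "\<sigma> * E = y + e0 + t"
  proof -
    have "\<sigma> = (y + e0) / E + 1 / (4 * b\<^sup>2)" unfolding \<sigma> E_def R_def ..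
    then have "\<sigma> * E = ((y + e0) / E + 1 / (4 * b\<^sup>2)) * E" by (simp only:)
    also have "\<dots> = y + e0 + t" using E0 by (simp only: distrib_right) (simp add: t_def)
    finally show ?thesis .
  qed
  have t1: "t \<le> 2/1000"
  proof -
    have "t * 200 \<le> t * (b - 1)" using t0 b224 by (intro mult_left_mono) auto
    then show ?thesis using tb by linarith
  qed
  have s0: "0 \<le> \<sigma>"
  proof -
    have "0 \<le> \<sigma> * E" unfolding sE using y t0 by linarith
    then show ?thesis using E0 by (simp add: zero_le_mult_iff)
  qed
  have y1: "-1/8 \<le> y" using y e01 by linarith
  \<comment> \<open>The definition of \<open>e0\<close> turns \<sigma> * (b - 1) * E - y * E into Q
    - 6 plus small terms: at most 5/4 from \<open>Re0\<close> and 26/100 from the slack in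
    \<sigma>.\<close>
  have eta: "2 * \<eta> * E \<le> Q - 448/100"
  proof -
    have "2 * \<eta> = \<sigma> * (b - 1) - y" by (simp add: \<eta>_def)
    then have "2 * \<eta> * E = (\<sigma> * (b - 1) - y) * E" by (simp only:)
    also have "\<dots> = \<sigma> * E * (b - 1) - y * E" by (simp add: algebra_simps)
    finally have "2 * \<eta> * E = \<sigma> * E * (b - 1) - y * E" .
    also have "\<dots> = Q - 6 + e0 * (2 * R - 1 - y) + t * (b - 1) + (e0 * (b - 2 * R) - (2 * R - 4))"
      unfolding sE Q_def by (simp add: E_def algebra_simps)
    also have "\<dots> \<le> Q - 6 + e0 * (2 * R) + t * (b - 1)"
    proof -
      have "e0 * (2 * R - 1 - y) \<le> e0 * (2 * R)" using e00 y1 by (intro mult_left_mono) auto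
      then show ?thesis using e0b by linarith
    qed
    also have "\<dots> \<le> Q - 448/100" 
    proof -
      have "e0 * (2 * R) = 2 * R * e0" by simp
      then show ?thesis using Re0 tb by linarith
    qed
    finally show ?thesis .
  qed
  have bs: "b * \<sigma> = y + 2 * \<eta> + \<sigma>"
  proof -
    have "2 * \<eta> = \<sigma> * (b - 1) - y" by (simp add: \<eta>_def)
    then show ?thesis by (simp add: algebra_simps)
  qed
  have sb: "\<sigma> * b \<le> y + e0 + t"
    using mult_left_mono[OF Eb s0] sE by linarith
  have two_k: "(2::real) ^ (r + 1) = 2 * b" by (simp add: b_def)
  \<comment> \<open>By \<open>eta\<close>, \<eta> is nonpositive as soon as Q <= 448/100, and the
    order r test takes over. It stops at 2 - 5 / b, which leaves room for its secondary condition 2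
    * \<sigma> <= 2 - y.\<close>
  consider "y \<le> 3/4" | "3/4 \<le> y" "448/100 \<le> Q" | "Q \<le> 448/100" "y \<le> 2 - 5 / b" | "2 - 5 / b \<le> y" "y \<le> 11/4" | "11/4 \<le> y"
    by linarith
  then show ?thesis
  proof cases
    case 1
    have sb1: "\<sigma> * 200 \<le> \<sigma> * b" using s0 b224 by (intro mult_left_mono) auto
    have s1: "\<sigma> \<le> 5/1000" using sb1 sb t1 e01 1 by linarith
    have "R * (2 - y) \<le> R * (17/8)" using R y1 by (intro mult_left_mono) auto
    then have Q1: "Q \<le> 17/8 * R + 17/8" using y1 by (simp add: Q_def algebra_simps)
    have eta1: "2 * \<eta> \<le> 9/100"
    proof (rule ccontr)
      assume "\<not> ?thesis"
      then have "9/100 * E \<le> 2 * \<eta> * E" using E0 by (intro mult_right_mono) auto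
      then show False using eta Q1 Eb bR R by linarith
    qed
    have "test_ok r (r + 1) y \<sigma>"
    proof -
      have "(2 * b - 1) * \<sigma> = 2 * (b * \<sigma>) - \<sigma>" by (simp add: algebra_simps)
      also have "\<dots> \<le> y + 1" unfolding bs distrib_left using eta1 s1 s0 1 by linarith
      finally have "(2 ^ (r + 1) - 1) * \<sigma> \<le> y - (real r - real (r + 1))" unfolding two_k by simp
      moreover have "2 * \<sigma> \<le> 2 - (y - (real r - real (r + 1)))" using s1 1 by simp
      ultimately show ?thesis unfolding test_ok_def ..
    qed
    moreover have "r + 1 \<in> {2..r + 1}" using r by auto
    ultimately show ?thesis by blast
  next
    case 2
    define q where "q = 2 - y"
    have Qq: "Q = (R + 1) * q" by (simp add: Q_def q_def)
    have q0: "0 < q"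
    proof (rule ccontr)
      assume "\<not> ?thesis"
      then have "(R + 1) * q \<le> (R + 1) * 0" using R by (intro mult_left_mono) auto
      then show False using 2 Qq by simp
    qed
    have Rq: "8 * q \<le> R * q" using R q0 by (intro mult_right_mono) auto
    have Qb: "28 * Q - 28 * q \<le> b * q" using mult_right_mono[OF bR, of q] q0 by (simp add: Qq algebra_simps)
    have Eq: "b * q \<le> E * q" using Eb q0 by (intro mult_right_mono) auto
    have etaq: "\<eta> \<le> 201/10000 * q"
    proof (rule ccontr)
      assume "\<not> ?thesis"
      then have "201/10000 * q * E \<le> \<eta> * E" using E0 by (intro mult_right_mono) auto
      then have "201/10000 * (E * q) \<le> \<eta> * E" by (simp add: mult_ac)
      moreover have "2 * (\<eta> * E) \<le> Q - 448/100" using eta by (simp only: mult.assoc)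
      moreover have "Q = R * q + q" by (simp add: Qq distrib_right)
      ultimately show False using Qb Rq Eq q0 by linarith
    qed
    have sq: "\<sigma> \<le> 2/100 * q"
    proof (rule ccontr)
      assume "\<not> ?thesis"
      then have "2/100 * q * b \<le> \<sigma> * b" using b0 by (intro mult_right_mono) auto
      then have "2/100 * (b * q) \<le> \<sigma> * b" by (simp add: mult_ac)
      moreover have "Q = R * q + q" by (simp add: Qq distrib_right)
      moreover have "y = 2 - q" by (simp add: q_def)
      ultimately show False using sb Qb Rq 2(2) t1 e01 q0 by linarith
    qed
    \<comment> \<open>The exponent of W equals (1 - \<kappa>0) / 2, so \<kappa>0 measures the
      distance of W from sqrt N. The length of the dual sum has exponent \<kappa> = \<kappa>0 + 2 *
      \<eta>'.\<close>
    define \<kappa>0 where "\<kappa>0 = q / 2 - \<eta> - \<sigma> / 2"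
    have k0: "15/32 * q \<le> \<kappa>0" unfolding \<kappa>0_def using etaq sq q0 by linarith
    have w: "2 ^ r * \<sigma> / 4 = (1 - \<kappa>0) / 2"
      unfolding b_def[symmetric] bs \<kappa>0_def q_def by (simp add: field_simps)
    have "B_ok r y \<sigma>"
      unfolding B_ok_def
    proof (intro conjI allI impI)
      show "2 ^ r * \<sigma> / 4 \<le> 1/2" unfolding w using k0 q0 by (simp add: field_simps)
      show "2 * \<sigma> \<le> 2 - y" using sq q0 unfolding q_def[symmetric] by linarith
      fix \<mu> assume mu: "y - (2 ^ r / 2 - 1) * \<sigma> \<le> \<mu>" "\<mu> \<le> 2 * (2 ^ r * \<sigma> / 4)"
      define \<eta>' where "\<eta>' = 2 ^ r * \<sigma> / 4 - \<mu> / 2"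
      define \<kappa> where "\<kappa> = 1 - \<mu>"
      have "y - (2 ^ r / 2 - 1) * \<sigma> = 2 * (2 ^ r * \<sigma> / 4) - 2 * \<eta>"
        unfolding b_def[symmetric] \<eta>_def by (simp add: field_simps)
      then have e': "0 \<le> \<eta>'" "\<eta>' \<le> \<eta>" using mu unfolding \<eta>'_def by linarith+
      have kk: "\<kappa> = \<kappa>0 + 2 * \<eta>'" unfolding \<kappa>_def \<eta>'_def w by (simp add: field_simps)
      have kap: "15/32 * q \<le> \<kappa>" "0 < \<kappa>" using kk k0 e' q0 by linarith+
      show "3 * (2 ^ r * \<sigma> / 4) \<le> 2 * \<mu>"
      proof -
        have "4 * (2 ^ r * \<sigma> / 4) = y + 2 * \<eta> + \<sigma>" using bs b_def by simp
        moreover have "q \<le> 5/4" using 2 by (simp add: q_def)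
        moreover have "2 * \<mu> = 4 * (2 ^ r * \<sigma> / 4) - 4 * \<eta>'" by (simp add: \<eta>'_def)
        ultimately show ?thesis using e' etaq 2 s0 by linarith
      qed
      \<comment> \<open>The largest \<open>n\<close> with n * \<kappa> <= 1 - 2 * \<eta>'. With s =
        n + 3 this inequality is the secondary condition of the dual test, and maximality of
        \<open>n\<close> reduces the main condition to 2 ^ s * \<eta>' <= \<kappa>.\<close>
      define n where "n = nat \<lfloor>(1 - 2 * \<eta>') / \<kappa>\<rfloor>"
      have q54: "q \<le> 5/4" using 2 by (simp add: q_def)
      have pos: "0 \<le> (1 - 2 * \<eta>') / \<kappa>" using kap e' etaq q54 by (intro divide_nonneg_pos) linarith+
      have n: "real n \<le> (1 - 2 * \<eta>') / \<kappa>" "(1 - 2 * \<eta>') / \<kappa> < real n + 1"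
        unfolding n_def using pos by linarith+
      have nk: "real n * \<kappa> \<le> 1 - 2 * \<eta>'" "1 - 2 * \<eta>' < (real n + 1) * \<kappa>"
        using n kap by (simp_all add: pos_le_divide_eq pos_divide_less_eq)
      define s where "s = n + 3"
      have nq: "real n * q \<le> 32/15"
      proof -
        have "real n * (15/32 * q) \<le> real n * \<kappa>" using kap by (intro mult_left_mono) auto
        then show ?thesis using nk e' by linarith
      qed
      have nQ: "real n * Q \<le> 32/15 * (R + 1)"
        using mult_left_mono[OF nq, of "R + 1"] R by (simp add: Qq mult_ac)
      have nR: "real n \<le> 477/1000 * (R + 1)"
        using mult_left_mono[of "448/100" Q "real n"] 2 nQ R by simp
      have sr: "s \<le> r"
      proof -
        have "real n + 3 < R + 1" using nR R by (simp add: distrib_left)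
        then have "n + 3 < r + 1" unfolding R_def by linarith
        then show ?thesis by (simp add: s_def)
      qed
      define p where "p = r - s"
      have p: "r = s + p" using sr by (simp add: p_def)
      \<comment> \<open>Since 448/100 = 21/10 * 32/15 and n * q <= 32/15, the bound for 2 * \<eta> *
        E becomes (R + 1 - 21/10 * n) * q. This is homogeneous in q like the lower bound 15/32 * q
        for \<kappa>, so q cancels and a comparison with 2 ^ (r - s) remains.\<close>
      have key: "2 ^ s * \<eta>' \<le> \<kappa>"
      proof -
        have l: "real p + 73/10 - 11/10 * real s \<le> 15/16 * 2 ^ p"
          using r p by (intro linear_le_two_power) (auto simp: s_def)
        have "real s = real n + 3" "R = real s + real p" using p by (simp_all add: R_def s_def)
        then have "R + 1 - 21/10 * real n \<le> 15/16 * 2 ^ p" using l by linarith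
        then have "2 ^ s * (R + 1 - 21/10 * real n) \<le> 2 ^ s * (15/16 * 2 ^ p)"
          by (intro mult_left_mono) auto
        also have "\<dots> = 15/16 * b" by (simp add: b_def p power_add)
        finally have l2: "2 ^ s * (R + 1 - 21/10 * real n) \<le> 15/16 * b" .
        have "2 ^ s * (2 * \<eta> * E) * (R + 1) \<le> 2 ^ s * (Q - 448/100) * (R + 1)"
          using eta R by (intro mult_right_mono mult_left_mono) auto
        also have "\<dots> = 2 ^ s * ((R + 1) * Q - 448/100 * (R + 1))" by (simp add: algebra_simps)
        also have "\<dots> \<le> 2 ^ s * ((R + 1) * Q - 21/10 * (real n * Q))"
        proof (intro mult_left_mono diff_left_mono)
          have "448/100 * (R + 1) = 21/10 * (32/15 * (R + 1))" by simp
          then show "21/10 * (real n * Q) \<le> 448/100 * (R + 1)" using nQ by linarith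
        qed simp
        also have "\<dots> = 2 ^ s * (R + 1 - 21/10 * real n) * Q" by (simp add: algebra_simps)
        also have "\<dots> \<le> 15/16 * b * Q" using l2 2 by (intro mult_right_mono) auto
        also have "\<dots> = (2 * b * (15/32 * q)) * (R + 1)" by (simp add: Qq)
        finally have "2 ^ s * (2 * \<eta> * E) * (R + 1) \<le> (2 * b * (15/32 * q)) * (R + 1)" .
        then have "2 ^ s * (2 * \<eta> * E) \<le> 2 * b * (15/32 * q)" by (rule mult_right_le_imp_le) (use R in linarith)
        also have "2 * b * (15/32 * q) \<le> 2 * E * \<kappa>" using kap Eb b0 q0 by (intro mult_mono) auto
        finally have "(2 ^ s * \<eta>) * (2 * E) \<le> \<kappa> * (2 * E)" by (simp add: mult_ac)
        then have "2 ^ s * \<eta> \<le> \<kappa>" by (rule mult_right_le_imp_le) (use E0 in linarith)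
        moreover have "2 ^ s * \<eta>' \<le> 2 ^ s * \<eta>" using e' by (intro mult_left_mono) auto
        ultimately show ?thesis by linarith
      qed
      have "(2 ^ s - 2) * \<eta>' + 1 \<le> (real s - 1) * \<kappa>"
        using key nk(2) by (simp add: s_def algebra_simps)
      moreover have "2 * \<eta>' + (real s - 3) * \<kappa> \<le> 1" using nk(1) by (simp add: s_def)
      moreover have "s \<in> {3..r + 3}" using sr by (auto simp: s_def)
      ultimately show "\<exists>s\<in>{3..r + 3}. (2 ^ s - 2) * (2 ^ r * \<sigma> / 4 - \<mu> / 2) + 1 \<le> (real s - 1) * (1 - \<mu>) \<and>
           2 * (2 ^ r * \<sigma> / 4 - \<mu> / 2) + (real s - 3) * (1 - \<mu>) \<le> 1"
        unfolding \<eta>'_def \<kappa>_def by blast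
    qed
    then show ?thesis ..
  next
    case 3
    have "2 * \<eta> * E \<le> 0" using eta 3 by linarith
    then have eta0: "2 * \<eta> \<le> 0" using E0 by (simp add: mult_le_0_iff)
    then have l: "(b - 1) * \<sigma> \<le> y" by (simp add: \<eta>_def mult.commute)
    have "2 * \<sigma> \<le> 2 - y"
    proof -
      have "2 * \<sigma> * (b - 1) = 2 * ((b - 1) * \<sigma>)" by simp
      also have "\<dots> \<le> 2 * y" using l by (intro mult_left_mono) auto
      also have "\<dots> \<le> 4 - 10 / b" using 3 by linarith
      also have "\<dots> \<le> 5 / b * (b - 1)" using b0 b224 by (simp add: field_simps)
      finally have "2 * \<sigma> * (b - 1) \<le> 5 / b * (b - 1)" .
      then have "2 * \<sigma> \<le> 5 / b" by (rule mult_right_le_imp_le) (use b224 in linarith)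
      then show ?thesis using 3 by linarith
    qed
    then have "test_ok r r y \<sigma>" using l by (simp add: test_ok_def b_def)
    moreover have "r \<in> {2..r + 1}" using r by auto
    ultimately show ?thesis by blast
  next
    case 4
    have b5: "5 / b \<le> 5/224" using b224 b0 by (simp add: field_simps)
    have q: "2 - y \<le> 5 / b" using 4 by linarith
    have "Q \<le> (R + 1) * (5 / b)" unfolding Q_def using R q by (intro mult_left_mono) auto
    also have "\<dots> \<le> 48/100" using b0 bR R by (simp add: field_simps)
    finally have eta4: "2 * \<eta> * E \<le> - 4" using eta by linarith
    have r1: "2 * 2 ^ (r - 1) = b" unfolding b_def using r by (metis One_nat_def Suc_pred diff_is_0_eq' less_numeral_extra(3) linorder_not_le not_gr_zero numeral_le_iff power_Suc zero_less_numeral le_trans)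
    have "(2 ^ (r - 1) - 1) * \<sigma> * 2 = 2 * 2 ^ (r - 1) * \<sigma> - 2 * \<sigma>" by (simp add: algebra_simps)
    also have "\<dots> = y + 2 * \<eta> - \<sigma>" unfolding r1 bs by simp
    also have "\<dots> \<le> (y - 1) * 2"
    proof -
      have "(2 * \<eta> - \<sigma>) * E \<le> (y - 2) * E"
      proof -
        have "(2 * \<eta> - \<sigma>) * E = 2 * \<eta> * E - \<sigma> * E" by (simp add: left_diff_distrib)
        also have "\<dots> \<le> - 4 - y" using eta4 sE e00 t0 by linarith
        also have "\<dots> \<le> - (5 / b) * E"
        proof -
          have "5 / b * E \<le> 5 / b * (104/100 * b)" using E104 b0 by (intro mult_left_mono) auto
          also have "\<dots> = 52/10" using b0 by simp
          finally show ?thesis using q b5 by simp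
        qed
        also have "\<dots> \<le> (y - 2) * E" using q E0 by (intro mult_right_mono) linarith+
        finally show ?thesis .
      qed
      then have "2 * \<eta> - \<sigma> \<le> y - 2" by (rule mult_right_le_imp_le) (rule E0)
      then show ?thesis unfolding left_diff_distrib by linarith
    qed
    finally have "(2 ^ (r - 1) - 1) * \<sigma> \<le> y - 1" by simp
    moreover have "2 * \<sigma> \<le> 3 - y"
    proof -
      have "\<sigma> * 200 \<le> \<sigma> * b" using s0 b224 by (intro mult_left_mono) auto
      then show ?thesis using sb t1 e01 4 by linarith
    qed
    ultimately have "test_ok r (r - 1) y \<sigma>" using r by (simp add: test_ok_def of_nat_diff)
    moreover have "r - 1 \<in> {2..r + 1}" using r by auto
    ultimately show ?thesis by blast
  next
    case 5
    define j where "j = nat \<lfloor>y - 3/4\<rfloor>"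
    have fl: "2 \<le> \<lfloor>y - 3/4\<rfloor>" using 5 by (simp add: le_floor_iff)
    have j: "2 \<le> j" "real j \<le> y - 3/4" "y - 3/4 < real j + 1"
      unfolding j_def using fl by linarith+
    have jr: "j + 2 \<le> r"
    proof -
      have "real j < real r - 1" using j y by linarith
      then show ?thesis by linarith
    qed
    have "Q \<le> (R + 1) * 0" unfolding Q_def using R 5 by (intro mult_left_mono) auto
    then have "Q \<le> 0" by simp
    then have "2 * \<eta> * E \<le> 0" using eta by linarith
    then have eta0: "2 * \<eta> \<le> 0" using E0 by (simp add: mult_le_0_iff)
    then have l: "(b - 1) * \<sigma> \<le> y" by (simp add: \<eta>_def mult.commute)
    have bj: "2 ^ (r - j) * 2 ^ j = b" unfolding b_def power_add[symmetric] using jr by simp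
    have "(2 ^ (r - j) - 1) * \<sigma> * 2 ^ j = (2 ^ (r - j) * 2 ^ j - 2 ^ j) * \<sigma>" by (simp add: algebra_simps)
    also have "\<dots> \<le> (b - 1) * \<sigma>" unfolding bj using s0 by (intro mult_right_mono) auto
    also have "\<dots> \<le> y" by (rule l)
    also have "\<dots> \<le> (y - real j) * 2 ^ j"
    proof -
      have "(real j + 3/4) * (2 ^ j - 1) \<le> y * (2 ^ j - 1)" using j by (intro mult_right_mono) auto
      moreover have "(real j + 3/4) * (2 ^ j - 1) = real j * 2 ^ j + 3/4 * 2 ^ j - real j - 3/4" by (simp add: field_simps)
      moreover have "y * (2 ^ j - 1) = y * 2 ^ j - y" by (simp add: right_diff_distrib)
      ultimately show ?thesis using quarter_le_two_power[OF j(1)] unfolding left_diff_distrib by linarith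
    qed
    finally have "(2 ^ (r - j) - 1) * \<sigma> \<le> y - real j" by simp
    moreover have "2 * \<sigma> \<le> 2 - (y - real j)"
    proof -
      have "\<sigma> * (27 * R) \<le> \<sigma> * (b - 1)" using s0 bR R by (intro mult_left_mono) auto
      also have "\<dots> \<le> R" using l y unfolding R_def by (simp add: mult.commute)
      finally have "(27 * \<sigma>) * R \<le> 1 * R" by simp
      then have "27 * \<sigma> \<le> 1" by (rule mult_right_le_imp_le) (use R in linarith)
      then show ?thesis using j by linarith
    qed
    ultimately have "test_ok r (r - j) y \<sigma>" using jr by (simp add: test_ok_def of_nat_diff)
    moreover have "r - j \<in> {2..r + 1}" using jr by auto
    ultimately show ?thesis by blast
  qed
qed

lemma exponents:
  fixes r :: nat and y :: real
  defines "b \<equiv> (2::real) ^ r"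
  defines "e0 \<equiv> (2 * real r - 4) / (b - 2 * real r)"
  assumes r: "5 \<le> r" and y: "- e0 \<le> y" "y \<le> real r - 1"
    and \<sigma>: "\<sigma> = (y + e0) / (b + real r + e0) + 1 / (4 * b\<^sup>2)"
  shows "(\<exists>k\<in>{2..r + 1}. test_ok r k y \<sigma>) \<or> B_ok r y \<sigma>"
proof -
  consider "r = 5" | "r = 6" | "r = 7" | "8 \<le> r" using r by linarith
  then show ?thesis
  proof cases
    case 1
    then show ?thesis using exponents_5[of \<sigma> y] y \<sigma> by (simp add: b_def e0_def)
  next
    case 2
    then show ?thesis using exponents_6[of \<sigma> y] y \<sigma> by (simp add: b_def e0_def)
  next
    case 3
    then show ?thesis using exponents_7[of \<sigma> y] y \<sigma> by (simp add: b_def e0_def)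
  next
    case 4
    then show ?thesis using exponents_general[of r y \<sigma>] y \<sigma> by (simp add: b_def e0_def)
  qed
qed

subsection \<open>The zeta function\<close>

text \<open>Writing \<open>E s = (s - 1) * \<zeta> s\<close>, the telescoping series of \<open>(n + 1) powr (1 - s) - n powr (1 - s)\<close> and the binomial
  expansion of its terms express \<open>E s\<close> by the values \<open>E (s + 1), E (s + 2), \<dots>\<close> and a series which
  converges in a larger half plane. This continues \<open>E\<close> to the left one strip at a time.\<close>

definition zser :: "complex \<Rightarrow> complex" where
  "zser s = (\<Sum>n. 1 / of_nat (Suc n) powr s)"

text \<open>The error at t = n + 2 of the Taylor polynomial of degree m of t ^ (1 - s) about t = n +
  1.\<close>

definition zrem :: "nat \<Rightarrow> complex \<Rightarrow> nat \<Rightarrow> complex" where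
  "zrem m s n = of_nat (Suc (Suc n)) powr (1 - s) -
     (\<Sum>k\<le>m. ((1 - s) gchoose k) * of_nat (Suc n) powr (1 - s - of_nat k))"

lemma norm_of_nat_Suc_powr: "norm (of_nat (Suc n) powr s) = real (Suc n) powr Re s"
  by (simp add: norm_powr_real_powr)

lemma zser_sums:
  assumes "1 < Re s"
  shows "(\<lambda>n. 1 / of_nat (Suc n) powr s) sums zser s"
proof -
  have "summable (\<lambda>n. norm (1 / of_nat (Suc n) powr s))"
  proof -
    have "summable (\<lambda>n. real n powr (- Re s))" using assms by (simp add: summable_real_powr_iff)
    then have "summable (\<lambda>n. real (Suc n) powr (- Re s))" by (subst summable_Suc_iff)
    then show ?thesis by (simp only: norm_divide norm_one norm_of_nat_Suc_powr powr_minus_divide)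
  qed
  then show ?thesis unfolding zser_def by (intro summable_sums) (rule summable_norm_cancel)
qed

text \<open>Taylor's theorem on the segment from n + 1 to n + 2. On it |z| is within a factor 2 of n
  + 1, which costs 2 powr |Re s + m| whatever the sign of the exponent.\<close>

lemma zrem_bound:
  "norm (zrem m s n) \<le> fact (Suc m) * norm ((1 - s) gchoose Suc m) * 2 powr \<bar>Re s + m\<bar> * real (Suc n) powr (- Re s - m) / fact m"
proof -
  define a where "a = 1 - s"
  define S where "S = closed_segment (of_nat (Suc n)) (complex_of_nat (Suc (Suc n)))"
  define f where "f k z = fact k * (a gchoose k) * z powr (a - of_nat k)" for k and z :: complex
  have S: "\<exists>t. z = complex_of_real t \<and> real (Suc n) \<le> t \<and> t \<le> real (Suc (Suc n))" if "z \<in> S" for z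
  proof -
    from that obtain u where u: "0 \<le> u" "u \<le> 1" "z = (1 - u) *\<^sub>R of_nat (Suc n) + u *\<^sub>R of_nat (Suc (Suc n))"
      unfolding S_def closed_segment_def by auto
    then have "z = of_real (real (Suc n) + u)" by (simp add: scaleR_conv_of_real algebra_simps)
    then show ?thesis using u by (intro exI[of _ "real (Suc n) + u"]) auto
  qed
  define B where "B = fact (Suc m) * norm (a gchoose Suc m) * (2 powr \<bar>Re s + m\<bar> * real (Suc n) powr (- Re s - m))"
  have "norm (f 0 (of_nat (Suc (Suc n))) - (\<Sum>k\<le>m. f k (of_nat (Suc n)) * (of_nat (Suc (Suc n)) - of_nat (Suc n)) ^ k / fact k))
      \<le> B * norm (complex_of_nat (Suc (Suc n)) - of_nat (Suc n)) ^ Suc m / fact m"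
  proof (rule complex_Taylor)
    show "convex S" by (simp add: S_def)
    fix k z assume z: "z \<in> S"
    obtain t where t: "z = of_real t" "real (Suc n) \<le> t" using S[OF z] by blast
    have znn: "z \<notin> \<real>\<^sub>\<le>\<^sub>0" using t by (auto simp: complex_nonpos_Reals_iff)
    have "((\<lambda>z. z powr (a - of_nat k)) has_field_derivative (a - of_nat k) * z powr (a - of_nat k - 1)) (at z)"
      by (rule has_field_derivative_powr[OF znn])
    from DERIV_cmult[OF this, of "fact k * (a gchoose k)"]
    have "(f k has_field_derivative fact k * (a gchoose k) * ((a - of_nat k) * z powr (a - of_nat k - 1))) (at z)"
      by (simp add: f_def[abs_def])
    moreover have "fact k * (a gchoose k) * ((a - of_nat k) * z powr (a - of_nat k - 1)) = f (Suc k) z"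
    proof -
      have "fact (Suc k) * (a gchoose Suc k) = fact k * (a gchoose k) * (a - of_nat k)"
        by (simp only: gbinomial_mult_fact prod.atLeast0_lessThan_Suc)
      then show ?thesis by (simp add: f_def mult.assoc diff_diff_eq add.commute)
    qed
    ultimately show "(f k has_field_derivative f (Suc k) z) (at z within S)"
      by (simp add: has_field_derivative_at_within)
  next
    fix z assume z: "z \<in> S"
    obtain t where t: "z = of_real t" "real (Suc n) \<le> t" "t \<le> real (Suc (Suc n))" using S[OF z] by blast
    have t0: "0 < t" using t by linarith
    have "norm (f (Suc m) z) = fact (Suc m) * norm (a gchoose Suc m) * t powr (- Re s - m)"
    proof -
      have "Re (a - of_nat (Suc m)) = - Re s - m" by (simp add: a_def)
      moreover have "norm (complex_of_real t powr (a - of_nat (Suc m))) = t powr Re (a - of_nat (Suc m))"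
        using t0 by (subst norm_powr_real_powr) auto
      ultimately have "norm (complex_of_real t powr (a - of_nat (Suc m))) = t powr (- Re s - m)" by (simp only:)
      then show ?thesis unfolding f_def norm_mult norm_fact t(1) by (simp only:)
    qed
    also have "t powr (- Re s - m) \<le> 2 powr \<bar>Re s + m\<bar> * real (Suc n) powr (- Re s - m)"
    proof -
      define q where "q = t / real (Suc n)"
      have q: "1 \<le> q" "q \<le> 2" using t by (auto simp: q_def field_simps)
      have "t powr (- Re s - m) = q powr (- Re s - m) * real (Suc n) powr (- Re s - m)"
        using q by (simp add: q_def powr_mult[symmetric])
      also have "q powr (- Re s - m) \<le> q powr \<bar>Re s + m\<bar>" using q by (intro powr_mono) auto
      also have "\<dots> \<le> 2 powr \<bar>Re s + m\<bar>" using q by (intro powr_mono2) auto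
      finally show ?thesis by (simp add: mult_right_mono)
    qed
    finally show "norm (f (Suc m) z) \<le> B" unfolding B_def by (simp add: mult_left_mono)
  qed (auto simp: S_def)
  moreover have "f 0 (of_nat (Suc (Suc n))) - (\<Sum>k\<le>m. f k (of_nat (Suc n)) * (of_nat (Suc (Suc n)) - of_nat (Suc n)) ^ k / fact k) = zrem m s n"
    by (simp add: zrem_def f_def a_def del: of_nat_Suc) simp
  ultimately show ?thesis by (simp add: B_def a_def mult_ac del: of_nat_Suc) simp
qed

lemma zrem_holomorphic: "(\<lambda>s. zrem m s n) holomorphic_on A"
  unfolding zrem_def gbinomial_prod_rev by (intro holomorphic_intros) auto

text \<open>By \<open>zrem_bound\<close> the terms are O(n ^ (-Re s - m)) locally uniformly in s,
  which is summable when Re s + m > 1; the Weierstrass test gives holomorphy.\<close>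

lemma zrem_sum_holomorphic:
  "(\<lambda>s. \<Sum>n. zrem m s n) holomorphic_on {s. 1 - real m < Re s}"
proof -
  have "\<exists>d h. 0 < d \<and> summable h \<and> (\<forall>\<^sub>F n in sequentially. \<forall>y\<in>ball s d \<inter> {s. 1 - real m < Re s}. norm (zrem m y n) \<le> h n)"
    if s: "s \<in> {s. 1 - real m < Re s}" for s
  proof -
    define d where "d = (Re s - (1 - real m)) / 2"
    have d: "0 < d" using s by (simp add: d_def)
    have cont: "continuous_on (cball s d) (\<lambda>y. fact (Suc m) * norm ((1 - y) gchoose Suc m) * 2 powr \<bar>Re y + m\<bar> / fact m)"
      unfolding gbinomial_prod_rev by (intro continuous_intros) (simp_all del: fact_Suc of_nat_Suc)
    obtain B where Bi: "\<forall>x\<in>(\<lambda>y. fact (Suc m) * norm ((1 - y) gchoose Suc m) * 2 powr \<bar>Re y + m\<bar> / fact m) ` cball s d. norm x \<le> B"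
      using compact_imp_bounded[OF compact_continuous_image[OF cont compact_cball]] unfolding bounded_iff by blast
    have B: "fact (Suc m) * norm ((1 - y) gchoose Suc m) * 2 powr \<bar>Re y + m\<bar> / fact m \<le> B" if "y \<in> cball s d" for y
      by (rule abs_le_D1[OF bspec[OF Bi imageI[OF that], unfolded real_norm_def]])
    have B0: "0 \<le> B" using B[of s] d by (auto intro: order_trans[rotated])
    define h where "h n = B * real (Suc n) powr (- 1 - d)" for n
    have "summable h"
    proof -
      have "summable (\<lambda>n. real n powr (- 1 - d))" using d by (simp add: summable_real_powr_iff)
      then have "summable (\<lambda>n. real (Suc n) powr (- 1 - d))" by (subst summable_Suc_iff)
      then show ?thesis unfolding h_def by (rule summable_mult)
    qed
    moreover have "norm (zrem m y n) \<le> h n" if y: "y \<in> ball s d" for y n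
    proof -
      have "\<bar>Re y - Re s\<bar> < d" using y abs_Re_le_cmod[of "y - s"] by (simp add: dist_norm norm_minus_commute)
      moreover have "Re s = 2 * d + (1 - real m)" unfolding d_def by (simp add: field_simps)
      ultimately have Re: "- Re y - m \<le> - 1 - d" unfolding abs_less_iff by linarith
      have "norm (zrem m y n) \<le> (fact (Suc m) * norm ((1 - y) gchoose Suc m) * 2 powr \<bar>Re y + m\<bar> / fact m) * real (Suc n) powr (- Re y - m)"
        using zrem_bound[of m y n] by (simp only: times_divide_eq_left mult_ac times_divide_eq_right)
      also have "\<dots> \<le> B * real (Suc n) powr (- 1 - d)"
        using B[of y] y Re B0 by (intro mult_mono powr_mono) auto
      finally show ?thesis by (simp add: h_def)
    qed
    ultimately show ?thesis using d by (intro exI[of _ d] exI[of _ h]) auto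
  qed
  note M = this
  obtain g g' where "\<forall>x\<in>{s. 1 - real m < Re s}. (\<lambda>n. zrem m x n) sums g x \<and> (\<lambda>n. deriv (\<lambda>s. zrem m s n) x) sums g' x \<and> (g has_field_derivative g' x) (at x)"
    using series_and_derivative_comparison_local[of "{s. 1 - real m < Re s}" "\<lambda>n s. zrem m s n" "\<lambda>n s. deriv (\<lambda>s. zrem m s n) s"]
      M holomorphic_derivI[OF zrem_holomorphic[of m _ UNIV] open_UNIV UNIV_I] open_halfspace_Re_gt by blast
  note g = this
  have "g holomorphic_on {s. 1 - real m < Re s}"
    using g by (auto simp: holomorphic_on_open open_halfspace_Re_gt)
  moreover have "g s = (\<Sum>n. zrem m s n)" if "s \<in> {s. 1 - real m < Re s}" for s
    using g that by (auto simp: sums_iff)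
  ultimately show ?thesis by (rule holomorphic_transform) 
qed

lemma zser_recursion:
  assumes s: "1 < Re s"
  shows "(s - 1) * zser s = 1 + (\<Sum>k=2..Suc m. ((1 - s) gchoose k) * zser (s + of_nat k - 1)) + (\<Sum>n. zrem (Suc m) s n)"
proof -
  define a where "a = 1 - s"
  define z where "z k = zser (s + of_nat k - 1)" for k
  have zs: "(\<lambda>n. of_nat (Suc n) powr (a - of_nat k)) sums z k" if "1 \<le> k" for k
  proof -
    have "1 < Re (s + of_nat k - 1)" using s that by simp
    from zser_sums[OF this] show ?thesis by (simp add: z_def a_def powr_minus_divide[symmetric] algebra_simps)
  qed
  have "(\<lambda>n. of_nat (Suc n) powr a) \<longlonglongrightarrow> 0"
  proof (rule tendsto_norm_zero_cancel)
    have "(\<lambda>n. real (Suc n) powr Re a) \<longlonglongrightarrow> 0"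
      using s by (intro tendsto_neg_powr filterlim_compose[OF filterlim_real_sequentially filterlim_Suc]) (auto simp: a_def)
    then show "(\<lambda>n. norm (of_nat (Suc n) powr a)) \<longlonglongrightarrow> 0" by (simp only: norm_of_nat_Suc_powr)
  qed
  from telescope_sums[OF this]
  have tel: "(\<lambda>n. of_nat (Suc (Suc n)) powr a - of_nat (Suc n) powr a) sums (- 1)" by simp
  have "(\<lambda>n. of_nat (Suc (Suc n)) powr a - of_nat (Suc n) powr a - (\<Sum>k=1..Suc m. (a gchoose k) * of_nat (Suc n) powr (a - of_nat k)))
      sums (- 1 - (\<Sum>k=1..Suc m. (a gchoose k) * z k))"
    by (intro sums_diff tel sums_sum sums_mult zs) auto
  moreover have "of_nat (Suc (Suc n)) powr a - of_nat (Suc n) powr a - (\<Sum>k=1..Suc m. (a gchoose k) * of_nat (Suc n) powr (a - of_nat k)) = zrem (Suc m) s n" for n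
  proof -
    have "{..Suc m} = insert 0 {1..Suc m}" by auto
    then show ?thesis by (simp add: zrem_def a_def del: of_nat_Suc sum.cl_ivl_Suc sum.atMost_Suc)
  qed
  ultimately have "(\<lambda>n. zrem (Suc m) s n) sums (- 1 - (\<Sum>k=1..Suc m. (a gchoose k) * z k))" by simp
  then have "(\<Sum>n. zrem (Suc m) s n) = - 1 - (\<Sum>k=1..Suc m. (a gchoose k) * z k)" by (rule sums_unique[symmetric])
  also have "(\<Sum>k=1..Suc m. (a gchoose k) * z k) = a * zser s + (\<Sum>k=2..Suc m. (a gchoose k) * z k)"
  proof -
    have "{1..Suc m} = insert 1 {2..Suc m}" by auto
    then show ?thesis by (simp add: z_def del: sum.cl_ivl_Suc)
  qed
  finally show ?thesis by (simp add: a_def z_def algebra_simps)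
qed

text \<open>The product (s - 1) * zser s is continued because it has no pole to carry along. With l
  = k - 1, the binomial coefficient of order k contains the factor 1 - s - l, which combines with
  zser (s + l) into -E (s + l). All arguments on the right are shifted by at least 1, and the
  remainder of order j + 2 converges for Re s > -j - 1, so each step gains one unit.\<close>

lemma zser_continuation_strip:
  "\<exists>E. E holomorphic_on {s. - real j < Re s} \<and> (\<forall>s. 1 < Re s \<longrightarrow> E s = (s - 1) * zser s)"
proof (induction j)
  case 0
  show ?case
  proof (intro exI[of _ "\<lambda>s. 1 + (\<Sum>n. zrem 1 s n)"] conjI allI impI)
    show "(\<lambda>s. 1 + (\<Sum>n. zrem 1 s n)) holomorphic_on {s. - real 0 < Re s}"
      using zrem_sum_holomorphic[of 1] by (intro holomorphic_intros) simp
    fix s :: complex assume "1 < Re s"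
    from zser_recursion[OF this, of 0] show "1 + (\<Sum>n. zrem 1 s n) = (s - 1) * zser s" by simp
  qed
next
  case (Suc j)
  then obtain E where E: "E holomorphic_on {s. - real j < Re s}" "\<And>s. 1 < Re s \<Longrightarrow> E s = (s - 1) * zser s" by blast
  define F where "F s = 1 - (\<Sum>k=2..Suc (Suc j). ((1 - s) gchoose (k - 1)) / of_nat k * E (s + of_nat (k - 1))) + (\<Sum>n. zrem (Suc (Suc j)) s n)" for s
  have "F holomorphic_on {s. - real (Suc j) < Re s}"
  proof -
    have "(\<lambda>s. E (s + of_nat (k - 1))) holomorphic_on {s. - real (Suc j) < Re s}" if "2 \<le> k" for k
    proof -
      have "E \<circ> (\<lambda>s. s + of_nat (k - 1)) holomorphic_on {s. - real (Suc j) < Re s}"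
        by (rule holomorphic_on_compose_gen[OF _ E(1)]) (use that in \<open>auto intro!: holomorphic_intros\<close>)
      then show ?thesis by (simp only: o_def)
    qed
    moreover have "(\<lambda>s. (1 - s) gchoose k) holomorphic_on A" for k A
      unfolding gbinomial_prod_rev by (intro holomorphic_intros) auto
    ultimately show ?thesis unfolding F_def
      using zrem_sum_holomorphic[of "Suc (Suc j)"] by (intro holomorphic_intros) auto
  qed
  moreover have "F s = (s - 1) * zser s" if s: "1 < Re s" for s
  proof -
    have "((1 - s) gchoose k) * zser (s + of_nat k - 1) = - (((1 - s) gchoose (k - 1)) / of_nat k * E (s + of_nat (k - 1)))"
      if k: "2 \<le> k" for k
    proof -
      obtain l where l: "k = Suc l" "1 \<le> l" using k by (cases k) auto
      have "E (s + of_nat l) = (s + of_nat l - 1) * zser (s + of_nat l)" using s by (intro E(2)) simp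
      moreover have "((1 - s) gchoose Suc l) = ((1 - s) gchoose l) * (1 - s - of_nat l) / of_nat (Suc l)"
        by (simp add: gbinomial_prod_rev prod.atLeast0_lessThan_Suc)
      moreover have "s + of_nat k - 1 = s + of_nat l" by (simp add: l)
      moreover have "g * (1 - s - of_nat l) / d * Y = - (g / d * ((s + of_nat l - 1) * Y))" for g d Y :: complex
      proof -
        have "1 - s - of_nat l = - (s + of_nat l - 1)" by simp
        then show ?thesis by (simp only: mult_minus_right mult_minus_left minus_divide_left[symmetric] times_divide_eq_left mult.assoc)
      qed
      moreover have "k - 1 = l" by (simp add: l)
      ultimately show ?thesis by (simp only: l(1))
    qed
    then show ?thesis unfolding zser_recursion[OF s, of "Suc j"] F_def by (simp add: sum_negf[symmetric] del: sum.cl_ivl_Suc)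
  qed
  ultimately show ?case by blast
qed

lemma holomorphic_identity:
  assumes "F holomorphic_on S" "G holomorphic_on S" "open S" "connected S"
    and "U \<subseteq> S" "open U" "\<xi> \<in> U" "\<And>z. z \<in> U \<Longrightarrow> F z = G z" and "w \<in> S"
  shows "F w = G w"
proof -
  have "F w - G w = 0"
  proof (rule analytic_continuation[of "\<lambda>z. F z - G z" S U \<xi>])
    show "\<xi> islimpt U" using assms(6,7) by (intro interior_limit_point) (simp add: interior_open)
  qed (use assms in \<open>auto intro!: holomorphic_intros\<close>)
  then show ?thesis by simp
qed

lemma holomorphic_eq_half_plane:
  assumes "F holomorphic_on {s. c < Re s}" "G holomorphic_on {s. c < Re s}"
    and "\<And>s. 1 < Re s \<Longrightarrow> F s = G s" and "c < Re s"
  shows "F s = G s"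
proof (rule holomorphic_identity[where F = F and G = G and S = "{s. c < Re s}" and U = "{s. max 1 c < Re s}" and \<xi> = "of_real (max 1 c + 1)"])
  show "open {s. c < Re s}" "open {s. max 1 c < Re s}" by (rule open_halfspace_Re_gt)+
  show "connected {s. c < Re s}" by (intro convex_connected convex_halfspace_Re_gt)
qed (use assms in auto)

lemma zser_continuation:
  "\<exists>E. E holomorphic_on UNIV \<and> (\<forall>s. 1 < Re s \<longrightarrow> E s = (s - 1) * zser s)"
proof -
  from zser_continuation_strip obtain E where
    E: "\<And>j. E j holomorphic_on {s. - real j < Re s}" "\<And>j s. 1 < Re s \<Longrightarrow> E j s = (s - 1) * zser s" by metis
  have agree: "E i s = E j s" if "i \<le> j" "- real i < Re s" for i j s
  proof (rule holomorphic_eq_half_plane[where F = "E i" and G = "E j" and c = "- real i"])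
    show "E j holomorphic_on {s. - real i < Re s}"
      using E(1)[of j] by (rule holomorphic_on_subset) (use that in auto)
  qed (use E that in auto)
  define F where "F s = E (nat \<lceil>\<bar>Re s\<bar>\<rceil> + 1) s" for s
  have FE: "F s = E j s" if "- real j < Re s" for j s
  proof -
    define i where "i = nat \<lceil>\<bar>Re s\<bar>\<rceil> + 1"
    have "\<bar>Re s\<bar> \<le> real (nat \<lceil>\<bar>Re s\<bar>\<rceil>)" by (rule real_nat_ceiling_ge)
    moreover have "real i = real (nat \<lceil>\<bar>Re s\<bar>\<rceil>) + 1" by (simp add: i_def)
    ultimately have "- real i < Re s" using abs_ge_minus_self[of "Re s"] by linarith
    note si = this
    have Fs: "F s = E i s" by (simp only: F_def i_def)
    show ?thesis
    proof (cases "i \<le> j")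
      case True
      from agree[OF this si] show ?thesis unfolding Fs .
    next
      case False
      then have "j \<le> i" by simp
      from agree[OF this that] show ?thesis unfolding Fs by simp
    qed
  qed
  have "F holomorphic_on UNIV"
  proof (rule holomorphic_onI)
    fix s :: complex
    obtain j :: nat where j: "- Re s < real j" using reals_Archimedean2 by blast
    have "E j field_differentiable (at s)"
      using E(1)[of j] j by (intro holomorphic_on_imp_differentiable_at[of _ "{s. - real j < Re s}"]) (auto simp: open_halfspace_Re_gt)
    moreover have "eventually (\<lambda>z. z \<in> {s. - real j < Re s}) (nhds s)"
      using j by (intro eventually_nhds_in_open) (auto simp: open_halfspace_Re_gt)
    then have "eventually (\<lambda>z. E j z = F z) (nhds s)" by eventually_elim (auto simp: FE)
    moreover obtain D where "(E j has_field_derivative D) (at s)"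
      using calculation(1) by (auto simp: field_differentiable_def)
    ultimately have "(F has_field_derivative D) (at s)"
      using DERIV_cong_ev[OF refl _ refl, of "E j" F s D] by simp
    then show "F field_differentiable (at s within UNIV)" by (auto simp: field_differentiable_def)
  qed
  moreover have "F s = (s - 1) * zser s" if "1 < Re s" for s
    using FE[of 0 s] E(2)[OF that] that by simp
  ultimately show ?thesis by blast
qed

text \<open>\<open>zeta\<close> is a definite description, so existence and uniqueness are both due.
  The quotient E s / (s - 1) provides the function, and the identity theorem on the connected
  punctured plane makes it unique.\<close>

lemma zeta_properties:
  "zeta holomorphic_on (- {1})" "1 < Re s \<Longrightarrow> zeta s = zser s"
proof -
  define Z where "Z f \<longleftrightarrow> f holomorphic_on (- {1}) \<and>
     (\<forall>s. Re s > 1 \<longrightarrow> (\<lambda>n. 1 / of_nat (Suc n) powr s) sums f s) \<and> f 1 = 0" for f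
  obtain E where E: "E holomorphic_on UNIV" "\<And>s. 1 < Re s \<Longrightarrow> E s = (s - 1) * zser s"
    using zser_continuation by blast
  define f where "f s = (if s = 1 then 0 else E s / (s - 1))" for s
  have "Z f" unfolding Z_def
  proof (intro conjI allI impI)
    have "(\<lambda>s. E s / (s - 1)) holomorphic_on (- {1})"
      by (intro holomorphic_intros holomorphic_on_subset[OF E(1)]) auto
    then show "f holomorphic_on (- {1})" by (rule holomorphic_transform) (auto simp: f_def)
    fix s :: complex assume s: "1 < Re s"
    then have "f s = zser s" using E(2)[OF s] by (auto simp: f_def)
    then show "(\<lambda>n. 1 / of_nat (Suc n) powr s) sums f s" using zser_sums[OF s] by simp
  qed (simp add: f_def)
  moreover have "g = f" if "Z g" for g
  proof
    fix s
    show "g s = f s"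
    proof (cases "s = 1")
      case False
      show ?thesis
      proof (rule holomorphic_identity[where F = g and G = f and S = "- {1}" and U = "{s. 1 < Re s}" and \<xi> = 2])
        show "connected (- {1::complex})" by (simp add: connected_punctured_universe)
        fix z assume "z \<in> {s. 1 < Re s}"
        then show "g z = f z" using that \<open>Z f\<close> unfolding Z_def by (auto dest: sums_unique2)
      qed (use that \<open>Z f\<close> False in \<open>auto simp: Z_def open_halfspace_Re_gt\<close>)
    qed (use that \<open>Z f\<close> in \<open>simp add: Z_def\<close>)
  qed
  ultimately have "Z (THE f. Z f)" by (rule theI)
  then have Zz: "Z zeta" by (simp add: zeta_def Z_def)
  show "zeta holomorphic_on (- {1})" using Zz by (simp add: Z_def)
  assume s: "1 < Re s"
  then have "(\<lambda>n. 1 / of_nat (Suc n) powr s) sums zeta s" using Zz by (simp add: Z_def)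
  then show "zeta s = zser s" using zser_sums[OF s] by (rule sums_unique2)
qed

text \<open>Serves the value at 1 / b, which lies outside the half plane of the Dirichlet
  series.\<close>

lemma zeta_right_half_plane:
  assumes "0 < Re s" "s \<noteq> 1"
  shows "(s - 1) * zeta s = 1 + (\<Sum>n. zrem 1 s n)"
proof -
  have "(\<lambda>s. (s - 1) * zeta s) holomorphic_on ({s. 0 < Re s} - {1})"
    by (intro holomorphic_intros holomorphic_on_subset[OF zeta_properties(1)]) auto
  have h1: "(\<lambda>s. (s - 1) * zeta s) holomorphic_on ({s. 0 < Re s} - {1})" by fact
  have h2: "(\<lambda>s. 1 + (\<Sum>n. zrem 1 s n)) holomorphic_on ({s. 0 < Re s} - {1})"
    using holomorphic_on_subset[OF zrem_sum_holomorphic[of 1], of "{s. 0 < Re s} - {1}"] by (intro holomorphic_intros) auto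
  have con: "connected ({s. 0 < Re s} - {1::complex})"
    by (rule connected_open_delete) (auto simp: open_halfspace_Re_gt intro!: convex_connected convex_halfspace_Re_gt)
  show ?thesis
  proof (rule holomorphic_identity[where F = "\<lambda>s. (s - 1) * zeta s" and G = "\<lambda>s. 1 + (\<Sum>n. zrem 1 s n)" and S = "{s. 0 < Re s} - {1}" and U = "{s. 1 < Re s}" and \<xi> = 2])
    fix z :: complex assume "z \<in> {s. 1 < Re s}"
    then have z: "1 < Re z" by simp
    show "(z - 1) * zeta z = 1 + (\<Sum>n. zrem 1 z n)"
      using zser_recursion[OF z, of 0] zeta_properties(2)[OF z] by simp
  qed (use assms h1 h2 con in \<open>auto simp: open_halfspace_Re_gt intro!: open_delete\<close>)
qed

text \<open>For real \<open>\<sigma> > 0\<close> the partial sums of the series of remainders telescope.\<close>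

lemma zeta_real_limit:
  fixes \<sigma> :: real
  assumes "0 < \<sigma>" "\<sigma> \<noteq> 1"
  shows "(\<lambda>M. (\<Sum>n=1..M. real n powr (- \<sigma>)) - real (Suc M) powr (1 - \<sigma>) / (1 - \<sigma>)) \<longlonglongrightarrow> Re (zeta (of_real \<sigma>))"
proof -
  define s where "s = complex_of_real \<sigma>"
  have s: "0 < Re s" "s \<noteq> 1" using assms by (auto simp: s_def)
  have summ: "summable (\<lambda>n. zrem 1 s n)"
  proof (rule summable_norm_cancel, rule summable_comparison_test)
    define B where "B = fact (Suc 1) * norm ((1 - s) gchoose Suc 1) * 2 powr \<bar>Re s + 1\<bar>"
    show "\<exists>N. \<forall>n\<ge>N. norm (norm (zrem 1 s n)) \<le> B * real (Suc n) powr (- Re s - 1)"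
      using zrem_bound[of 1 s] by (auto simp: B_def)
    have "summable (\<lambda>n. real n powr (- Re s - 1))" using s by (simp add: summable_real_powr_iff)
    then have "summable (\<lambda>n. real (Suc n) powr (- Re s - 1))" by (subst summable_Suc_iff)
    then show "summable (\<lambda>n. B * real (Suc n) powr (- Re s - 1))" by (rule summable_mult)
  qed
  have zr: "zrem 1 s n = of_real (real (Suc (Suc n)) powr (1 - \<sigma>) - real (Suc n) powr (1 - \<sigma>) - (1 - \<sigma>) * real (Suc n) powr (- \<sigma>))" for n
  proof -
    have "complex_of_nat (Suc k) powr of_real x = of_real (real (Suc k) powr x)" for k x
      by (metis of_nat_0_le_iff of_real_of_nat_eq powr_of_real)
    note * = this[of "Suc n" "1 - \<sigma>"] this[of n "1 - \<sigma>"] this[of n "- \<sigma>"]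
    show ?thesis
    proof -
      have "{..1::nat} = {0, 1}" by auto
      then have "zrem 1 s n = of_nat (Suc (Suc n)) powr (1 - s) - (of_nat (Suc n) powr (1 - s) + (1 - s) * of_nat (Suc n) powr (- s))"
        unfolding zrem_def by (simp del: of_nat_Suc add: of_nat_1[where 'a = complex, unfolded One_nat_def])
      moreover have "1 - s = of_real (1 - \<sigma>)" "- s = of_real (- \<sigma>)" by (simp_all add: s_def)
      ultimately show ?thesis using * by (simp only: of_real_diff of_real_mult of_real_add diff_diff_eq)
    qed
  qed
  have part: "1 + (\<Sum>n<M. zrem 1 s n) = (s - 1) * of_real ((\<Sum>n=1..M. real n powr (- \<sigma>)) - real (Suc M) powr (1 - \<sigma>) / (1 - \<sigma>))" for M
  proof -
    have "1 + (\<Sum>n<M. real (Suc (Suc n)) powr (1 - \<sigma>) - real (Suc n) powr (1 - \<sigma>) - (1 - \<sigma>) * real (Suc n) powr (- \<sigma>))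
        = real (Suc M) powr (1 - \<sigma>) - (1 - \<sigma>) * (\<Sum>n=1..M. real n powr (- \<sigma>))"
      by (induction M) (simp_all add: algebra_simps)
    also have "\<dots> = (\<sigma> - 1) * ((\<Sum>n=1..M. real n powr (- \<sigma>)) - real (Suc M) powr (1 - \<sigma>) / (1 - \<sigma>))"
      using assms by (simp add: field_simps)
    finally have "1 + (\<Sum>n<M. real (Suc (Suc n)) powr (1 - \<sigma>) - real (Suc n) powr (1 - \<sigma>) - (1 - \<sigma>) * real (Suc n) powr (- \<sigma>)) = \<dots>" .
    then have "complex_of_real (1 + (\<Sum>n<M. real (Suc (Suc n)) powr (1 - \<sigma>) - real (Suc n) powr (1 - \<sigma>) - (1 - \<sigma>) * real (Suc n) powr (- \<sigma>))) = of_real \<dots>"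
      by (rule arg_cong)
    then show ?thesis by (simp only: zr[unfolded s_def] of_real_add of_real_1 of_real_sum of_real_mult of_real_diff s_def)
  qed
  have "(\<lambda>M. 1 + (\<Sum>n<M. zrem 1 s n)) \<longlonglongrightarrow> 1 + (\<Sum>n. zrem 1 s n)"
    by (intro tendsto_intros summable_LIMSEQ summ)
  then have "(\<lambda>M. (1 + (\<Sum>n<M. zrem 1 s n)) / (s - 1)) \<longlonglongrightarrow> (1 + (\<Sum>n. zrem 1 s n)) / (s - 1)"
    by (intro tendsto_divide tendsto_const) (use s in auto)
  moreover have "(1 + (\<Sum>n. zrem 1 s n)) / (s - 1) = zeta s"
    using zeta_right_half_plane[OF s] s by (simp add: field_simps)
  moreover have "(1 + (\<Sum>n<M. zrem 1 s n)) / (s - 1) = of_real ((\<Sum>n=1..M. real n powr (- \<sigma>)) - real (Suc M) powr (1 - \<sigma>) / (1 - \<sigma>))" for M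
    unfolding part using s by simp
  ultimately have "(\<lambda>M. complex_of_real ((\<Sum>n=1..M. real n powr (- \<sigma>)) - real (Suc M) powr (1 - \<sigma>) / (1 - \<sigma>))) \<longlonglongrightarrow> zeta s"
    by simp
  from tendsto_Re[OF this] show ?thesis by (simp add: s_def)
qed

section \<open>Partial sums of the zeta series on the real axis\<close>

lemma DERIV_powr_shift:
  fixes m h a :: real
  assumes "0 < m + h"
  shows "((\<lambda>h. (m + h) powr a) has_real_derivative a * (m + h) powr (a - 1)) (at h)"
proof -
  have "((\<lambda>z. z powr a) has_real_derivative a * (h + m) powr (a - 1)) (at (h + m))"
    using assms by (intro has_real_derivative_powr) (simp add: add.commute)
  then have "((\<lambda>h. (h + m) powr a) has_real_derivative a * (h + m) powr (a - 1)) (at h)"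
    by (simp only: DERIV_shift)
  then show ?thesis by (simp only: add.commute)
qed

lemma powr_MVT:
  fixes a u v :: real
  assumes "0 < u" "u < v"
  obtains z where "u < z" "z < v" "v powr a - u powr a = (v - u) * (a * z powr (a - 1))"
proof -
  have "((\<lambda>t. t powr a) has_real_derivative a * t powr (a - 1)) (at t)" if "u \<le> t" for t
    using that assms by (intro has_real_derivative_powr) auto
  then show ?thesis
    using MVT2[of u v "\<lambda>t. t powr a" "\<lambda>t. a * t powr (a - 1)"] assms that by blast
qed

text \<open>The error of the trapezoidal rule for t ^ (-\<sigma>) on [m, m + h], as a function
  \<open>G\<close> of h, vanishes at h = 0. Three applications of the mean value theorem bring in
  the second derivative of t ^ (-\<sigma>); the constant is not the sharp one.\<close>

lemma powr_trapezoid: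
  fixes \<sigma> m :: real
  assumes \<sigma>: "0 < \<sigma>" "\<sigma> \<noteq> 1" and m: "0 < m"
  shows "\<bar>((m + 1) powr (1 - \<sigma>) - m powr (1 - \<sigma>)) / (1 - \<sigma>) - (m powr - \<sigma> + (m + 1) powr - \<sigma>) / 2\<bar>
      \<le> \<sigma> * (\<sigma> + 1) * m powr (- \<sigma> - 2)"
proof -
  define G where "G h = ((m + h) powr (1 - \<sigma>) - m powr (1 - \<sigma>)) / (1 - \<sigma>) - h * (m powr - \<sigma> + (m + h) powr - \<sigma>) / 2" for h
  define G' where "G' h = (m + h) powr - \<sigma> - ((m powr - \<sigma> + (m + h) powr - \<sigma>) + h * (- \<sigma> * (m + h) powr (- \<sigma> - 1))) / 2" for h
  have "(G has_real_derivative G' h) (at h)" if "0 \<le> h" for h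
  proof -
    have d1: "((\<lambda>h. (m + h) powr (1 - \<sigma>)) has_real_derivative (1 - \<sigma>) * (m + h) powr (1 - \<sigma> - 1)) (at h)"
      and d2: "((\<lambda>h. (m + h) powr - \<sigma>) has_real_derivative - \<sigma> * (m + h) powr (- \<sigma> - 1)) (at h)"
      by (rule DERIV_powr_shift, use that m in simp)+
    have "1 - \<sigma> - 1 = - \<sigma>" by simp
    then have "(1 - \<sigma>) * (m + h) powr (1 - \<sigma> - 1) / (1 - \<sigma>) = (m + h) powr - \<sigma>" using \<sigma> by simp
    moreover have "(G has_real_derivative ((1 - \<sigma>) * (m + h) powr (1 - \<sigma> - 1) - 0) / (1 - \<sigma>)
        - (1 * (m powr - \<sigma> + (m + h) powr - \<sigma>) + (0 + - \<sigma> * (m + h) powr (- \<sigma> - 1)) * h) / 2) (at h)"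
      unfolding G_def[abs_def]
      by (intro DERIV_diff DERIV_cdivide DERIV_mult DERIV_add d1 d2 DERIV_const DERIV_ident)
    ultimately show ?thesis unfolding G'_def by (simp only: diff_0_right add_0_left mult_1 mult.commute[of h])
  qed
  then obtain z where z: "0 < z" "z < 1" "G 1 - G 0 = (1 - 0) * G' z"
    using MVT2[of 0 1 G G'] by auto
  obtain \<xi> where xi: "m < \<xi>" "\<xi> < m + z" "(m + z) powr - \<sigma> - m powr - \<sigma> = (m + z - m) * (- \<sigma> * \<xi> powr (- \<sigma> - 1))"
    using powr_MVT[of m "m + z" "- \<sigma>"] m z by auto
  obtain \<theta> where th: "\<xi> < \<theta>" "\<theta> < m + z"
    "(m + z) powr (- \<sigma> - 1) - \<xi> powr (- \<sigma> - 1) = (m + z - \<xi>) * ((- \<sigma> - 1) * \<theta> powr (- \<sigma> - 1 - 1))"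
    using powr_MVT[of \<xi> "m + z" "- \<sigma> - 1"] m xi by auto
  have e: "- \<sigma> - 1 - 1 = - \<sigma> - 2" by simp
  have "G' z = ((m + z) powr - \<sigma> - m powr - \<sigma> + z * \<sigma> * (m + z) powr (- \<sigma> - 1)) / 2"
    unfolding G'_def by (simp add: field_simps)
  also have "\<dots> = z * \<sigma> * ((m + z) powr (- \<sigma> - 1) - \<xi> powr (- \<sigma> - 1)) / 2"
    unfolding xi(3) by (simp add: algebra_simps)
  also have "\<dots> = - (z * (m + z - \<xi>) / 2 * (\<sigma> * (\<sigma> + 1) * \<theta> powr (- \<sigma> - 2)))"
    unfolding th(3) e by (simp add: field_simps)
  finally have "\<bar>G' z\<bar> = z * (m + z - \<xi>) / 2 * (\<sigma> * (\<sigma> + 1) * \<theta> powr (- \<sigma> - 2))"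
    using z xi \<sigma> by simp
  also have "\<dots> \<le> 1 * (\<sigma> * (\<sigma> + 1) * m powr (- \<sigma> - 2))"
  proof (rule mult_mono)
    have "z * (m + z - \<xi>) \<le> 1 * 1" using z xi by (intro mult_mono) auto
    then show "z * (m + z - \<xi>) / 2 \<le> 1" by simp
    have "\<theta> powr (- \<sigma> - 2) \<le> m powr (- \<sigma> - 2)"
      using m \<sigma> xi th by (intro powr_mono2') auto
    then show "\<sigma> * (\<sigma> + 1) * \<theta> powr (- \<sigma> - 2) \<le> \<sigma> * (\<sigma> + 1) * m powr (- \<sigma> - 2)"
      using \<sigma> by (intro mult_left_mono) auto
  qed (use \<sigma> in auto)
  finally show ?thesis using z(3) by (simp add: G_def)
qed

text \<open>The corrected partial sums \<open>c\<close> tend to the zeta value, and by the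
  trapezoidal rule their increments are dominated by those of -K * v. Hence c + K * v decreases and
  c - K * v increases to the same limit, which therefore lies between them for every M.\<close>

lemma zeta_sum_approx:
  fixes \<sigma> :: real
  assumes \<sigma>: "0 < \<sigma>" "\<sigma> \<noteq> 1"
  obtains K where "0 \<le> K" "\<And>M. 1 \<le> M \<Longrightarrow>
    \<bar>(\<Sum>n=1..M. real n powr - \<sigma>) - real M powr (1 - \<sigma>) / (1 - \<sigma>) - real M powr - \<sigma> / 2 - Re (zeta (of_real \<sigma>))\<bar>
      \<le> K * real M powr (- \<sigma> - 1)"
proof -
  define c where "c M = (\<Sum>n=1..M. real n powr - \<sigma>) - real M powr (1 - \<sigma>) / (1 - \<sigma>) - real M powr - \<sigma> / 2" for M :: nat
  define v where "v M = real M powr (- \<sigma> - 1)" for M :: nat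
  \<comment> \<open>The factor 2 powr (\<sigma> + 2) compares m powr (-\<sigma> - 2) with its value
    at a point z < m + 1 <= 2 * m.\<close>
  define K where "K = \<sigma> * 2 powr (\<sigma> + 2)"
  have K0: "0 \<le> K" using \<sigma> by (simp add: K_def)
  have v0: "v \<longlonglongrightarrow> 0"
    unfolding v_def using \<sigma> by (intro tendsto_neg_powr filterlim_real_sequentially) auto
  have w0: "(\<lambda>M. real M powr - \<sigma>) \<longlonglongrightarrow> 0"
    using \<sigma> by (intro tendsto_neg_powr filterlim_real_sequentially) auto
  have lim: "c \<longlonglongrightarrow> Re (zeta (of_real \<sigma>))"
  proof -
    define d where "d M = (real (Suc M) powr (1 - \<sigma>) - real M powr (1 - \<sigma>)) / (1 - \<sigma>)" for M :: nat
    have "d \<longlonglongrightarrow> 0"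
    proof (rule Lim_null_comparison[OF _ w0])
      show "\<forall>\<^sub>F M in sequentially. norm (d M) \<le> real M powr - \<sigma>"
        using eventually_ge_at_top[of 1]
      proof eventually_elim
        case (elim M)
        then obtain z where z: "real M < z" "z < real M + 1"
          "(real M + 1) powr (1 - \<sigma>) - real M powr (1 - \<sigma>) = (real M + 1 - real M) * ((1 - \<sigma>) * z powr (1 - \<sigma> - 1))"
          using powr_MVT[of "real M" "real M + 1" "1 - \<sigma>"] by auto
        have "1 - \<sigma> - 1 = - \<sigma>" by simp
        then have "d M = z powr - \<sigma>" using z(3) \<sigma> by (simp add: d_def add.commute)
        also have "\<dots> \<le> real M powr - \<sigma>" using z elim \<sigma> by (intro powr_mono2') auto
        finally show ?case using \<open>d M = z powr - \<sigma>\<close> by simp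
      qed
    qed
    moreover have "c = (\<lambda>M. ((\<Sum>n=1..M. real n powr - \<sigma>) - real (Suc M) powr (1 - \<sigma>) / (1 - \<sigma>)) + d M - real M powr - \<sigma> / 2)"
      by (rule ext) (simp add: c_def d_def diff_divide_distrib)
    ultimately show ?thesis
      using tendsto_diff[OF tendsto_add[OF zeta_real_limit[OF \<sigma>] \<open>d \<longlonglongrightarrow> 0\<close>] tendsto_divide[OF w0 tendsto_const[of 2]]]
      by simp
  qed
  have step: "\<bar>c (Suc M) - c M\<bar> \<le> K * (v M - v (Suc M))" if M: "1 \<le> M" for M
  proof -
    define m where "m = real M"
    have m: "1 \<le> m" using M by (simp add: m_def)
    have "\<bar>c (Suc M) - c M\<bar> = \<bar>((m + 1) powr (1 - \<sigma>) - m powr (1 - \<sigma>)) / (1 - \<sigma>) - (m powr - \<sigma> + (m + 1) powr - \<sigma>) / 2\<bar>"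
      by (subst abs_minus_commute) (simp add: c_def m_def add.commute diff_divide_distrib add_divide_distrib)
    also have "\<dots> \<le> \<sigma> * (\<sigma> + 1) * m powr (- \<sigma> - 2)" using \<sigma> m by (intro powr_trapezoid) auto
    also have "\<dots> \<le> K * (v M - v (Suc M))"
    proof -
      obtain z where z: "m < z" "z < m + 1" "(m + 1) powr (- \<sigma> - 1) - m powr (- \<sigma> - 1) = (m + 1 - m) * ((- \<sigma> - 1) * z powr (- \<sigma> - 1 - 1))"
        using powr_MVT[of m "m + 1" "- \<sigma> - 1"] m by auto
      have e: "- \<sigma> - 1 - 1 = - \<sigma> - 2" by simp
      have "v M - v (Suc M) = (\<sigma> + 1) * z powr (- \<sigma> - 2)"
        using z(3) unfolding e by (simp add: v_def m_def add.commute algebra_simps)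
      moreover have "(2 * m) powr (- \<sigma> - 2) \<le> z powr (- \<sigma> - 2)"
        using z m \<sigma> by (intro powr_mono2') auto
      moreover have "2 powr (\<sigma> + 2) * (2 * m) powr (- \<sigma> - 2) = m powr (- \<sigma> - 2)"
      proof -
        have "2 powr (\<sigma> + 2) * (2::real) powr (- \<sigma> - 2) = 1" by (simp flip: powr_add)
        then show ?thesis using m by (simp add: powr_mult)
      qed
      ultimately show ?thesis unfolding K_def
        using \<sigma> mult_left_mono[of "(2 * m) powr (- \<sigma> - 2)" "z powr (- \<sigma> - 2)" "\<sigma> * (\<sigma> + 1) * 2 powr (\<sigma> + 2)"]
        by (simp add: mult_ac)
    qed
    finally show ?thesis .
  qed
  have "\<bar>c M - Re (zeta (of_real \<sigma>))\<bar> \<le> K * v M" if M: "1 \<le> M" for M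
  proof -
    have l: "(\<lambda>n. c (n + M)) \<longlonglongrightarrow> Re (zeta (of_real \<sigma>))" "(\<lambda>n. v (n + M)) \<longlonglongrightarrow> 0"
      using lim v0 by (auto intro: LIMSEQ_ignore_initial_segment)
    have s: "\<bar>c (Suc (n + M)) - c (n + M)\<bar> \<le> K * v (n + M) - K * v (Suc (n + M))" for n
      using step[of "n + M"] M by (simp add: right_diff_distrib)
    have "Re (zeta (of_real \<sigma>)) \<le> c (0 + M) + K * v (0 + M)"
    proof (rule decseq_ge[where X = "\<lambda>n. c (n + M) + K * v (n + M)" and n = 0])
      show "decseq (\<lambda>n. c (n + M) + K * v (n + M))"
      proof (rule decseq_SucI)
        show "c (Suc n + M) + K * v (Suc n + M) \<le> c (n + M) + K * v (n + M)" for n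
          using s[of n] by simp
      qed
      show "(\<lambda>n. c (n + M) + K * v (n + M)) \<longlonglongrightarrow> Re (zeta (of_real \<sigma>))"
        using tendsto_add[OF l(1) tendsto_mult_left[OF l(2), of K]] by simp
    qed
    moreover have "c (0 + M) - K * v (0 + M) \<le> Re (zeta (of_real \<sigma>))"
    proof (rule incseq_le[where X = "\<lambda>n. c (n + M) - K * v (n + M)" and n = 0])
      show "incseq (\<lambda>n. c (n + M) - K * v (n + M))"
      proof (rule incseq_SucI)
        show "c (n + M) - K * v (n + M) \<le> c (Suc n + M) - K * v (Suc n + M)" for n
          using s[of n] by simp
      qed
      show "(\<lambda>n. c (n + M) - K * v (n + M)) \<longlonglongrightarrow> Re (zeta (of_real \<sigma>))"
        using tendsto_diff[OF l(1) tendsto_mult_left[OF l(2), of K]] by simp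
    qed
    ultimately show ?thesis by simp
  qed
  then show ?thesis using that[OF K0] unfolding c_def v_def by blast
qed

subsection \<open>The hyperbola method\<close>

lemma sum_tau1:
  assumes b: "1 \<le> b"
  shows "(\<Sum>n | n \<ge> 1 \<and> real n \<le> x. real (tau1 b n)) = real (card {(d1, d2). 0 < d1 \<and> 0 < d2 \<and> real (d1 * d2 ^ b) \<le> x})"
proof -
  define I where "I = {n. n \<ge> 1 \<and> real n \<le> x}"
  define S where "S n = {(d1, d2). d1 > 0 \<and> d2 > 0 \<and> d1 * d2 ^ b = n}" for n :: nat
  have "I \<subseteq> {..nat \<lfloor>x\<rfloor>}"
    unfolding I_def by (auto simp: le_nat_floor)
  then have fI: "finite I" by (rule finite_subset) simp
  have fS: "finite (S n)" if "n \<in> I" for n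
  proof (rule finite_subset)
    show "S n \<subseteq> {..n} \<times> {..n}"
    proof
      fix p assume "p \<in> S n"
      then obtain d1 d2 where p: "p = (d1, d2)" "0 < d1" "0 < d2" "d1 * d2 ^ b = n" by (auto simp: S_def)
      have "d2 \<le> d2 ^ b" using p b by (intro self_le_power) auto
      moreover have "d1 \<le> d1 * d2 ^ b" "d2 ^ b \<le> d1 * d2 ^ b" using p by auto
      ultimately show "p \<in> {..n} \<times> {..n}" using p by auto
    qed
  qed simp
  have "(\<Sum>n\<in>I. real (tau1 b n)) = real (\<Sum>n\<in>I. card (S n))" by (simp add: tau1_def S_def)
  also have "(\<Sum>n\<in>I. card (S n)) = card (\<Union>n\<in>I. S n)"
    using fI fS by (intro card_UN_disjoint[symmetric]) (auto simp: S_def)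
  also have "(\<Union>n\<in>I. S n) = {(d1, d2). 0 < d1 \<and> 0 < d2 \<and> real (d1 * d2 ^ b) \<le> x}"
    unfolding S_def I_def by (auto simp: Suc_le_eq)
  finally show ?thesis unfolding I_def .
qed

lemma powr_inverse_power:
  fixes x :: real
  assumes "0 < x" "0 < n"
  shows "(x powr (1 / real n)) ^ n = x"
  using assms by (simp add: powr_powr flip: powr_realpow)

lemma le_powr_inverse_iff:
  fixes u d :: real
  assumes "0 < u" "0 \<le> d" "1 \<le> b"
  shows "d \<le> u powr (1 / real b) \<longleftrightarrow> d ^ b \<le> u"
proof -
  have "u = (u powr (1 / real b)) ^ b"
    using assms by (simp add: powr_inverse_power)
  then show ?thesis using power_mono_iff[of d "u powr (1 / real b)" b] assms by simp
qed

text \<open>Both variables are cut at the same height Y with Y ^ (b + 1) = x. A pair with both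
  entries above Y is outside the region, and every pair with both entries at most Y is inside, so
  the doubly counted part is a full square.\<close>

lemma card_hyperbola:
  fixes x :: real
  assumes b: "1 \<le> b" and x: "1 \<le> x" and M: "M = nat \<lfloor>x powr (1 / real (b + 1))\<rfloor>"
  shows "card {(d1, d2). 0 < d1 \<and> 0 < d2 \<and> real (d1 * d2 ^ b) \<le> x} + M\<^sup>2
    = (\<Sum>n=1..M. nat \<lfloor>x / real n ^ b\<rfloor>) + (\<Sum>n=1..M. nat \<lfloor>(x / real n) powr (1 / real b)\<rfloor>)"
proof -
  define Y where "Y = x powr (1 / real (b + 1))"
  define P where "P = {(d1, d2). 0 < d1 \<and> 0 < d2 \<and> real (d1 * d2 ^ b) \<le> x}"
  define A where "A = {(d1, d2). 0 < d1 \<and> 0 < d2 \<and> d2 \<le> M \<and> real (d1 * d2 ^ b) \<le> x}"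
  define B where "B = {(d1, d2). 0 < d1 \<and> d1 \<le> M \<and> 0 < d2 \<and> real (d1 * d2 ^ b) \<le> x}"
  have Y1: "1 \<le> Y" using x by (simp add: Y_def ge_one_powr_ge_zero)
  have "M = nat \<lfloor>Y\<rfloor>" unfolding M Y_def ..
  then have YM: "n \<le> M \<longleftrightarrow> real n \<le> Y" for n
    using Y1 by (simp add: le_nat_iff le_floor_iff)
  have xY: "x = Y * Y ^ b"
  proof -
    have "Y * Y ^ b = Y ^ (b + 1)" by simp
    also have "\<dots> = x" unfolding Y_def using x by (intro powr_inverse_power) auto
    finally show ?thesis ..
  qed
  have AB: "A \<union> B = P"
  proof -
    have "d2 \<le> M \<or> d1 \<le> M" if p: "real (d1 * d2 ^ b) \<le> x" for d1 d2
    proof (rule ccontr)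
      assume "\<not> ?thesis"
      then have d: "Y < real d1" "Y < real d2" by (auto simp: YM)
      have "Y * Y ^ b < real d1 * real d2 ^ b"
        using d Y1 b by (intro mult_strict_mono power_strict_mono) auto
      then show False using p by (simp flip: xY)
    qed
    then show ?thesis unfolding A_def B_def P_def by blast
  qed
  have ABi: "A \<inter> B = {1..M} \<times> {1..M}"
  proof -
    have "real (d1 * d2 ^ b) \<le> x" if "d1 \<le> M" "d2 \<le> M" for d1 d2
      unfolding xY using that Y1 by (simp add: YM) (intro mult_mono power_mono, auto)
    then show ?thesis unfolding A_def B_def by (auto simp: Suc_le_eq)
  qed
  have A: "A = (\<lambda>(m, n). (n, m)) ` (SIGMA m:{1..M}. {1..nat \<lfloor>x / real m ^ b\<rfloor>})"
  proof -
    have "d1 \<le> nat \<lfloor>x / real d2 ^ b\<rfloor> \<longleftrightarrow> real (d1 * d2 ^ b) \<le> x" if "0 < d2" for d1 d2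
      using that x by (simp add: le_nat_iff le_floor_iff pos_le_divide_eq)
    then show ?thesis unfolding A_def by (auto simp: Suc_le_eq image_iff)
  qed
  have B: "B = (SIGMA m:{1..M}. {1..nat \<lfloor>(x / real m) powr (1 / real b)\<rfloor>})"
  proof -
    have "d2 \<le> nat \<lfloor>(x / real d1) powr (1 / real b)\<rfloor> \<longleftrightarrow> real (d1 * d2 ^ b) \<le> x" if "0 < d1" for d1 d2
    proof -
      have "d2 \<le> nat \<lfloor>(x / real d1) powr (1 / real b)\<rfloor> \<longleftrightarrow> real d2 \<le> (x / real d1) powr (1 / real b)"
        by (simp add: le_nat_iff le_floor_iff)
      also have "\<dots> \<longleftrightarrow> real d2 ^ b \<le> x / real d1" using that x b by (intro le_powr_inverse_iff) auto
      finally show ?thesis using that by (simp add: pos_le_divide_eq mult.commute)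
    qed
    then show ?thesis unfolding B_def by (auto simp: Suc_le_eq)
  qed
  have cA: "card A = (\<Sum>n=1..M. nat \<lfloor>x / real n ^ b\<rfloor>)"
    unfolding A by (subst card_image) (auto simp: inj_on_def)
  have cB: "card B = (\<Sum>n=1..M. nat \<lfloor>(x / real n) powr (1 / real b)\<rfloor>)"
    unfolding B by simp
  have fin: "finite A" "finite B" unfolding A B by auto
  have "card A + card B = card P + M\<^sup>2"
    using card_Un_Int[OF fin] unfolding AB ABi by (simp add: card_cartesian_product power2_eq_square)
  then show ?thesis by (simp only: cA cB P_def)
qed

lemma powr_ratio_le:
  fixes Y t a :: real
  assumes "0 \<le> Y" "0 < t" "Y \<le> 2 * t" "0 \<le> a"
  shows "Y powr a * t powr - a \<le> 2 powr a"
proof -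
  have "Y powr a * t powr - a = (Y / t) powr a" using assms by (simp add: powr_divide powr_minus_divide)
  also have "\<dots> \<le> 2 powr a" using assms by (intro powr_mono2) (auto simp: pos_divide_le_eq)
  finally show ?thesis .
qed

text \<open>The reason why the two main terms of size Y ^ 2 cancel against the square of the
  hyperbola method.\<close>

lemma divide_complementary:
  fixes \<beta> c :: real
  assumes "1 < \<beta>"
  shows "c / (1 - \<beta>) + c / (1 - 1 / \<beta>) = c"
proof -
  have "c / (1 - \<beta>) = - (c / (\<beta> - 1))" by (metis divide_minus_right minus_diff_eq)
  moreover have "c / (1 - 1 / \<beta>) = c * \<beta> / (\<beta> - 1)" using assms by (simp add: field_simps)
  moreover have "c * \<beta> / (\<beta> - 1) - c / (\<beta> - 1) = c * (\<beta> - 1) / (\<beta> - 1)"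
    by (simp add: right_diff_distrib diff_divide_distrib)
  ultimately show ?thesis using assms by simp
qed

text \<open>The main terms of the two Euler--Maclaurin expansions add up to \<open>G + G'/2\<close> for a function \<open>G\<close> with a double zero at \<open>Y\<close>.\<close>

lemma hyperbola_main_terms:
  fixes \<beta> Y M :: real
  assumes \<beta>: "1 < \<beta>" and M: "1 \<le> M" "M \<le> Y" "Y \<le> M + 1"
  shows "\<bar>Y powr (\<beta> + 1) * (M powr (1 - \<beta>) / (1 - \<beta>) + M powr - \<beta> / 2)
      + Y powr (1 / \<beta> + 1) * (M powr (1 - 1 / \<beta>) / (1 - 1 / \<beta>) + M powr - (1 / \<beta>) / 2) - M - M\<^sup>2\<bar>
    \<le> 2 * (\<beta> * 2 powr (\<beta> + 1) + 1 / \<beta> * 2 powr (1 / \<beta> + 1) + 2)"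
proof (cases "M = Y")
  case True
  have p: "Y powr (\<beta> + 1) * Y powr (1 - \<beta>) = Y\<^sup>2" "Y powr (1 / \<beta> + 1) * Y powr (1 - 1 / \<beta>) = Y\<^sup>2"
    "Y powr (\<beta> + 1) * Y powr - \<beta> = Y" "Y powr (1 / \<beta> + 1) * Y powr - (1 / \<beta>) = Y"
    using M by (simp_all flip: powr_add)
  have "Y powr (\<beta> + 1) * (Y powr (1 - \<beta>) / (1 - \<beta>) + Y powr - \<beta> / 2)
      + Y powr (1 / \<beta> + 1) * (Y powr (1 - 1 / \<beta>) / (1 - 1 / \<beta>) + Y powr - (1 / \<beta>) / 2) - Y - Y\<^sup>2
     = Y\<^sup>2 / (1 - \<beta>) + Y / 2 + (Y\<^sup>2 / (1 - 1 / \<beta>) + Y / 2) - Y - Y\<^sup>2"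
    by (simp only: distrib_left times_divide_eq_right p)
  also have "\<dots> = 0" using divide_complementary[OF \<beta>, of "Y\<^sup>2"] by simp
  finally show ?thesis using \<beta> True by simp
next
  case False
  define C where "C = \<beta> * 2 powr (\<beta> + 1) + 1 / \<beta> * 2 powr (1 / \<beta> + 1) + 2"
  \<comment> \<open>\<open>H\<close> is the derivative of \<open>G\<close> and \<open>H'\<close>
    that of \<open>H\<close>. Both \<open>G\<close> and \<open>H\<close> vanish at Y, and Y - M <=
    1, so a bound for \<open>H'\<close> on [M, Y] passes to \<open>H\<close> and then to
    \<open>G\<close>.\<close>
  define G where "G t = Y powr (\<beta> + 1) * (t powr (1 - \<beta>) / (1 - \<beta>)) + Y powr (1 / \<beta> + 1) * (t powr (1 - 1 / \<beta>) / (1 - 1 / \<beta>)) - t\<^sup>2" for t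
  define H where "H t = Y powr (\<beta> + 1) * t powr - \<beta> + Y powr (1 / \<beta> + 1) * t powr - (1 / \<beta>) - 2 * t" for t
  define H' where "H' t = Y powr (\<beta> + 1) * (- \<beta> * t powr (- \<beta> - 1)) + Y powr (1 / \<beta> + 1) * (- (1 / \<beta>) * t powr (- (1 / \<beta>) - 1)) - 2" for t
  have MY: "M < Y" using M False by simp
  have p: "Y powr (\<beta> + 1) * Y powr (1 - \<beta>) = Y\<^sup>2" "Y powr (1 / \<beta> + 1) * Y powr (1 - 1 / \<beta>) = Y\<^sup>2"
    "Y powr (\<beta> + 1) * Y powr - \<beta> = Y" "Y powr (1 / \<beta> + 1) * Y powr - (1 / \<beta>) = Y"
    using M by (simp_all flip: powr_add)
  have GY: "G Y = 0"
    unfolding G_def times_divide_eq_right p using divide_complementary[OF \<beta>, of "Y\<^sup>2"] by simp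
  have HY: "H Y = 0" unfolding H_def p by simp
  have dp: "((\<lambda>t. t powr a) has_real_derivative a * t powr (a - 1)) (at t)" if "M \<le> t" for a t :: real
    using that M by (intro has_real_derivative_powr) auto
  have dG: "(G has_real_derivative H t) (at t)" if "M \<le> t" for t
  proof -
    have e: "a * t powr (a - 1) / a = t powr (a - 1)" if "a \<noteq> 0" for a using that by simp
    have "(1 - \<beta>) * t powr (1 - \<beta> - 1) / (1 - \<beta>) = t powr - \<beta>" using e[of "1 - \<beta>"] \<beta> by simp
    moreover have "(1 - 1 / \<beta>) * t powr (1 - 1 / \<beta> - 1) / (1 - 1 / \<beta>) = t powr - (1 / \<beta>)" using e[of "1 - 1 / \<beta>"] \<beta> by simp
    moreover have "(G has_real_derivative Y powr (\<beta> + 1) * ((1 - \<beta>) * t powr (1 - \<beta> - 1) / (1 - \<beta>))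
       + Y powr (1 / \<beta> + 1) * ((1 - 1 / \<beta>) * t powr (1 - 1 / \<beta> - 1) / (1 - 1 / \<beta>)) - 2 * t) (at t)"
      unfolding G_def[abs_def]
    proof (intro DERIV_diff DERIV_add DERIV_cmult DERIV_cdivide dp that)
      show "((\<lambda>t. t\<^sup>2) has_real_derivative 2 * t) (at t)" by (auto intro!: derivative_eq_intros)
    qed
    ultimately show ?thesis by (simp only: H_def)
  qed
  have dH: "(H has_real_derivative H' t) (at t)" if "M \<le> t" for t
    unfolding H_def[abs_def] H'_def
  proof (intro DERIV_diff DERIV_add DERIV_cmult dp that)
    show "((\<lambda>t. 2 * t) has_real_derivative 2) (at t)" by (auto intro!: derivative_eq_intros)
  qed
  have H'b: "\<bar>H' t\<bar> \<le> C" if t: "M \<le> t" for t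
  proof -
    have q: "Y powr a * t powr - a \<le> 2 powr a" if "0 \<le> a" for a
      using that t M by (intro powr_ratio_le) auto
    have "\<bar>H' t\<bar> = \<beta> * (Y powr (\<beta> + 1) * t powr - (\<beta> + 1)) + 1 / \<beta> * (Y powr (1 / \<beta> + 1) * t powr - (1 / \<beta> + 1)) + 2"
    proof -
      have "H' t = - (\<beta> * (Y powr (\<beta> + 1) * t powr - (\<beta> + 1)) + 1 / \<beta> * (Y powr (1 / \<beta> + 1) * t powr - (1 / \<beta> + 1)) + 2)"
        by (simp add: H'_def mult_ac)
      moreover have "0 \<le> \<beta> * (Y powr (\<beta> + 1) * t powr - (\<beta> + 1)) + 1 / \<beta> * (Y powr (1 / \<beta> + 1) * t powr - (1 / \<beta> + 1)) + 2"
        using \<beta> by simp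
      ultimately show ?thesis by linarith
    qed
    also have "\<dots> \<le> C" unfolding C_def
      using \<beta> q[of "\<beta> + 1"] q[of "1 / \<beta> + 1"] by (intro add_mono mult_left_mono) auto
    finally show ?thesis .
  qed
  have C0: "0 \<le> C" using H'b[of M] by linarith
  have Hb: "\<bar>H t\<bar> \<le> C" if t: "M \<le> t" "t \<le> Y" for t
  proof (cases "t = Y")
    case False
    then obtain z where z: "t < z" "z < Y" "H Y - H t = (Y - t) * H' z"
      using MVT2[of t Y H H'] dH t by (metis order_le_less order_trans)
    have e: "H t = - ((Y - t) * H' z)" using z HY by simp
    have "\<bar>H t\<bar> = (Y - t) * \<bar>H' z\<bar>" unfolding e abs_minus_cancel abs_mult using z by simp
    also have "\<dots> \<le> 1 * C" using z t M H'b[of z] by (intro mult_mono) auto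
    finally show ?thesis by simp
  qed (use HY C0 in simp)
  obtain z where z: "M < z" "z < Y" "G Y - G M = (Y - M) * H z"
    using MVT2[of M Y G H] dG MY by metis
  have e: "G M = - ((Y - M) * H z)" using z GY by simp
  have "\<bar>G M\<bar> = (Y - M) * \<bar>H z\<bar>" unfolding e abs_minus_cancel abs_mult using z by simp
  also have "\<dots> \<le> 1 * C" using z M Hb[of z] by (intro mult_mono) auto
  finally have "\<bar>G M\<bar> \<le> C" by simp
  moreover have "\<bar>H M\<bar> \<le> C" using Hb[of M] M by simp
  moreover have "Y powr (\<beta> + 1) * (M powr (1 - \<beta>) / (1 - \<beta>) + M powr - \<beta> / 2)
      + Y powr (1 / \<beta> + 1) * (M powr (1 - 1 / \<beta>) / (1 - 1 / \<beta>) + M powr - (1 / \<beta>) / 2) - M - M\<^sup>2 = G M + H M / 2"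
    by (simp add: G_def H_def distrib_left add_divide_distrib diff_divide_distrib)
  ultimately show ?thesis unfolding C_def[symmetric] by linarith
qed

lemma nat_floor_eq_psi: "0 \<le> v \<Longrightarrow> real (nat \<lfloor>v\<rfloor>) = v - psi v - 1/2"
  by (simp add: psi_def frac_def)

text \<open>Each floor is written as v - psi v - 1/2. The power sums over n are replaced by their
  zeta values, which cancel the main terms in \<open>Delta1\<close>, and by explicit terms, which
  cancel against each other and the square up to O(1).\<close>

lemma Delta1_hyperbola:
  assumes b: "2 \<le> b"
  obtains C where "\<And>x. 1 \<le> x \<Longrightarrow>
    \<bar>Delta1 b x + (\<Sum>n=1..nat \<lfloor>x powr (1 / real (b + 1))\<rfloor>. psi (x / real n ^ b))
       + (\<Sum>n=1..nat \<lfloor>x powr (1 / real (b + 1))\<rfloor>. psi ((x / real n) powr (1 / real b)))\<bar> \<le> C"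
proof -
  define \<beta> where "\<beta> = real b"
  have \<beta>: "2 \<le> \<beta>" using b by (simp add: \<beta>_def)
  have \<beta>': "0 < 1 / \<beta>" "1 / \<beta> \<noteq> 1" using \<beta> by auto
  obtain K1 where K1: "0 \<le> K1" "\<And>M. 1 \<le> M \<Longrightarrow>
    \<bar>(\<Sum>n=1..M. real n powr - \<beta>) - real M powr (1 - \<beta>) / (1 - \<beta>) - real M powr - \<beta> / 2 - Re (zeta (of_real \<beta>))\<bar>
      \<le> K1 * real M powr (- \<beta> - 1)"
    using zeta_sum_approx[of \<beta>] \<beta> by auto
  obtain K2 where K2: "0 \<le> K2" "\<And>M. 1 \<le> M \<Longrightarrow>
    \<bar>(\<Sum>n=1..M. real n powr - (1 / \<beta>)) - real M powr (1 - 1 / \<beta>) / (1 - 1 / \<beta>) - real M powr - (1 / \<beta>) / 2 - Re (zeta (of_real (1 / \<beta>)))\<bar>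
      \<le> K2 * real M powr (- (1 / \<beta>) - 1)"
    using zeta_sum_approx[of "1 / \<beta>"] \<beta>' by auto
  define C where "C = K1 * 2 powr (\<beta> + 1) + K2 * 2 powr (1 / \<beta> + 1)
     + 2 * (\<beta> * 2 powr (\<beta> + 1) + 1 / \<beta> * 2 powr (1 / \<beta> + 1) + 2)"
  show ?thesis
  proof (rule that[of C])
    fix x :: real assume x: "1 \<le> x"
    define Y where "Y = x powr (1 / real (b + 1))"
    define M where "M = nat \<lfloor>Y\<rfloor>"
    define m where "m = real M"
    have Y1: "1 \<le> Y" using x by (simp add: Y_def ge_one_powr_ge_zero)
    have mY: "m = of_int \<lfloor>Y\<rfloor>" using Y1 by (simp add: m_def M_def)
    have fl: "1 \<le> \<lfloor>Y\<rfloor>" using Y1 by (simp add: le_floor_iff)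
    have m: "1 \<le> m" "m \<le> Y" "Y \<le> m + 1"
      unfolding mY using fl by linarith+
    have M1: "1 \<le> M" using m(1) by (simp add: m_def)
    have xY: "x = Y powr (\<beta> + 1)"
    proof -
      have e: "1 / real (b + 1) * (\<beta> + 1) = 1" by (simp add: \<beta>_def add.commute)
      show ?thesis unfolding Y_def powr_powr e using x by simp
    qed
    have x\<beta>: "x powr (1 / \<beta>) = Y powr (1 / \<beta> + 1)" unfolding xY powr_powr using \<beta> by (simp add: field_simps)
    define S1 where "S1 = (\<Sum>n=1..M. real n powr - \<beta>)"
    define S2 where "S2 = (\<Sum>n=1..M. real n powr - (1 / \<beta>))"
    define p1 where "p1 = (\<Sum>n=1..M. psi (x / real n ^ b))"
    define p2 where "p2 = (\<Sum>n=1..M. psi ((x / real n) powr (1 / real b)))"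
    have t1: "(\<Sum>n=1..M. real (nat \<lfloor>x / real n ^ b\<rfloor>)) = x * S1 - p1 - m / 2"
    proof -
      have "real (nat \<lfloor>x / real n ^ b\<rfloor>) = x * real n powr - \<beta> - psi (x / real n ^ b) - 1/2" if "n \<in> {1..M}" for n
      proof -
        have "x / real n ^ b = x * real n powr - \<beta>" using that by (simp add: \<beta>_def powr_minus_divide powr_realpow)
        moreover have "0 \<le> x / real n ^ b" using x by simp
        ultimately show ?thesis using nat_floor_eq_psi[of "x / real n ^ b"] by linarith
      qed
      then have "(\<Sum>n=1..M. real (nat \<lfloor>x / real n ^ b\<rfloor>)) = (\<Sum>n=1..M. x * real n powr - \<beta> - psi (x / real n ^ b) - 1/2)"
        by (intro sum.cong refl)
      then show ?thesis by (simp add: sum_subtractf S1_def p1_def m_def sum_distrib_left)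
    qed
    have t2: "(\<Sum>n=1..M. real (nat \<lfloor>(x / real n) powr (1 / real b)\<rfloor>)) = x powr (1 / \<beta>) * S2 - p2 - m / 2"
    proof -
      have "real (nat \<lfloor>(x / real n) powr (1 / real b)\<rfloor>) = x powr (1 / \<beta>) * real n powr - (1 / \<beta>) - psi ((x / real n) powr (1 / real b)) - 1/2"
        if "n \<in> {1..M}" for n
      proof -
        have "(x / real n) powr (1 / real b) = x powr (1 / \<beta>) * real n powr - (1 / \<beta>)"
          using that x by (simp add: \<beta>_def powr_minus_divide powr_divide)
        then show ?thesis using nat_floor_eq_psi[of "(x / real n) powr (1 / real b)"] by simp
      qed
      then have "(\<Sum>n=1..M. real (nat \<lfloor>(x / real n) powr (1 / real b)\<rfloor>))
          = (\<Sum>n=1..M. x powr (1 / \<beta>) * real n powr - (1 / \<beta>) - psi ((x / real n) powr (1 / real b)) - 1/2)"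
        by (intro sum.cong refl)
      then show ?thesis by (simp add: sum_subtractf S2_def p2_def m_def sum_distrib_left)
    qed
    define cP where "cP = real (card {(d1, d2). 0 < d1 \<and> 0 < d2 \<and> real (d1 * d2 ^ b) \<le> x})"
    have "cP + m\<^sup>2 = (x * S1 - p1 - m / 2) + (x powr (1 / \<beta>) * S2 - p2 - m / 2)"
    proof -
      have "1 \<le> b" using b by simp
      from arg_cong[OF card_hyperbola[OF this x M_def[unfolded Y_def]], of real]
      show ?thesis unfolding t1[symmetric] t2[symmetric] unfolding cP_def m_def
        by (simp only: of_nat_add of_nat_sum of_nat_power)
    qed
    moreover have "Delta1 b x = cP - x * Re (zeta (of_real \<beta>)) - x powr (1 / \<beta>) * Re (zeta (of_real (1 / \<beta>)))"
      unfolding Delta1_def cP_def using b by (subst sum_tau1) (auto simp: \<beta>_def mult.commute)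
    \<comment> \<open>\<open>A\<close> and \<open>B\<close> are the weighted errors of the two zeta
      approximations. They are bounded because Y <= 2 * m makes x * m powr (-\<beta> - 1) and its
      analogue for 1 / \<beta> bounded. \<open>D\<close> collects the explicit terms.\<close>
    moreover define A where "A = x * (S1 - m powr (1 - \<beta>) / (1 - \<beta>) - m powr - \<beta> / 2 - Re (zeta (of_real \<beta>)))"
    moreover define B where "B = x powr (1 / \<beta>) * (S2 - m powr (1 - 1 / \<beta>) / (1 - 1 / \<beta>) - m powr - (1 / \<beta>) / 2 - Re (zeta (of_real (1 / \<beta>))))"
    moreover define D where "D = x * (m powr (1 - \<beta>) / (1 - \<beta>) + m powr - \<beta> / 2)
        + x powr (1 / \<beta>) * (m powr (1 - 1 / \<beta>) / (1 - 1 / \<beta>) + m powr - (1 / \<beta>) / 2) - m - m\<^sup>2"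
    ultimately have "Delta1 b x + p1 + p2 = A + B + D"
      by (simp only: distrib_left right_diff_distrib)
    moreover have "\<bar>A\<bar> \<le> K1 * 2 powr (\<beta> + 1)"
    proof -
      have "\<bar>A\<bar> \<le> x * (K1 * m powr (- \<beta> - 1))"
        using x mult_left_mono[OF K1(2)[OF M1], of x] unfolding A_def abs_mult S1_def m_def by simp
      also have "\<dots> = K1 * (Y powr (\<beta> + 1) * m powr - (\<beta> + 1))" unfolding xY by (simp add: mult_ac)
      also have "\<dots> \<le> K1 * 2 powr (\<beta> + 1)" using K1(1) m \<beta> by (intro mult_left_mono powr_ratio_le) auto
      finally show ?thesis .
    qed
    moreover have "\<bar>B\<bar> \<le> K2 * 2 powr (1 / \<beta> + 1)"
    proof -
      have "\<bar>B\<bar> \<le> x powr (1 / \<beta>) * (K2 * m powr (- (1 / \<beta>) - 1))"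
        using x mult_left_mono[OF K2(2)[OF M1], of "x powr (1 / \<beta>)"] unfolding B_def abs_mult S2_def m_def by simp
      also have "\<dots> = K2 * (Y powr (1 / \<beta> + 1) * m powr - (1 / \<beta> + 1))" unfolding x\<beta> by (simp add: mult_ac)
      also have "\<dots> \<le> K2 * 2 powr (1 / \<beta> + 1)" using K2(1) m \<beta> by (intro mult_left_mono powr_ratio_le) auto
      finally show ?thesis .
    qed
    moreover have "\<bar>D\<bar> \<le> 2 * (\<beta> * 2 powr (\<beta> + 1) + 1 / \<beta> * 2 powr (1 / \<beta> + 1) + 2)"
      unfolding D_def x\<beta> unfolding xY using \<beta> m by (intro hyperbola_main_terms) auto
    moreover have "\<bar>A + B + D\<bar> \<le> \<bar>A\<bar> + \<bar>B\<bar> + \<bar>D\<bar>" by linarith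
    ultimately have "\<bar>Delta1 b x + p1 + p2\<bar> \<le> C" unfolding C_def by linarith
    then show "\<bar>Delta1 b x + (\<Sum>n=1..nat \<lfloor>x powr (1 / real (b + 1))\<rfloor>. psi (x / real n ^ b))
       + (\<Sum>n=1..nat \<lfloor>x powr (1 / real (b + 1))\<rfloor>. psi ((x / real n) powr (1 / real b)))\<bar> \<le> C"
      unfolding p1_def p2_def M_def Y_def .
  qed
qed

subsection \<open>Dyadic blocks\<close>

lemma abs_sum_psi_trivial:
  fixes N :: real
  assumes "0 \<le> N" "real_of_int (hi - lo + 1) \<le> N"
  shows "\<bar>\<Sum>n\<in>{lo..hi}. psi (f n)\<bar> \<le> N"
proof -
  have "\<bar>\<Sum>n\<in>{lo..hi}. psi (f n)\<bar> \<le> (\<Sum>n\<in>{lo..hi}. 1)"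
  proof (rule order_trans[OF sum_abs sum_mono])
    show "\<bar>psi (f n)\<bar> \<le> 1" for n using abs_psi_le[of "f n"] by linarith
  qed
  also have "\<dots> \<le> N" using assms by (cases "lo \<le> hi") auto
  finally show ?thesis .
qed

text \<open>A form of the test for X * u ^ (-\<beta>) with hypotheses free of constants. Since
  \<beta> is real, it serves both exponents b and 1 / b.\<close>

lemma monomial_psi_test:
  fixes \<beta> :: real
  assumes \<beta>: "0 < \<beta>" and k: "2 \<le> k"
  obtains C where "0 \<le> C" "\<And>X N Z lo hi. 0 < X \<Longrightarrow> 1 \<le> N \<Longrightarrow> 1 \<le> Z \<Longrightarrow> N \<le> real_of_int lo \<Longrightarrow>
    real_of_int hi \<le> 2 * N \<Longrightarrow> real_of_int (hi - lo + 1) \<le> N \<Longrightarrow>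
    X * N powr (- \<beta> - real k) * Z ^ (2 ^ k - 1) \<le> 1 \<Longrightarrow> Z\<^sup>2 \<le> N\<^sup>2 * (X * N powr (- \<beta> - real k)) \<Longrightarrow>
    \<bar>\<Sum>n\<in>{lo..hi}. psi (X * of_int n powr - \<beta>)\<bar> \<le> C * (N / Z * (1 + ln Z))"
proof -
  define c where "c = 2 powr (\<beta> + real k)"
  define P where "P = pochhammer \<beta> k"
  define c1 where "c1 = P / c"
  \<comment> \<open>The constants of the derivative are absorbed by asking only for the saving
    \<kappa> * Z: \<kappa> <= 1 / c1 is for the main condition and \<kappa> <= c1 for the secondary
    one. If \<kappa> * Z < 1, the trivial bound is enough.\<close>
  define \<kappa> where "\<kappa> = min 1 (min (1 / c1) c1)"
  have c: "1 \<le> c" using \<beta> by (simp add: c_def ge_one_powr_ge_zero)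
  have P: "0 < P" unfolding P_def using \<beta> by (rule pochhammer_pos)
  have c1: "0 < c1" using c P by (simp add: c1_def)
  have kap: "0 < \<kappa>" "\<kappa> \<le> 1" "\<kappa> \<le> 1 / c1" "\<kappa> \<le> c1" using c1 by (auto simp: \<kappa>_def)
  define C where "C = 66 * c / \<kappa>"
  have C: "1 \<le> C * \<kappa>" "0 \<le> C" using c kap by (auto simp: C_def)
  show ?thesis
  proof (rule that[OF C(2)])
    fix X N Z :: real and lo hi :: int
    assume X: "0 < X" and N: "1 \<le> N" and Z: "1 \<le> Z" and lo: "N \<le> real_of_int lo" and hi: "real_of_int hi \<le> 2 * N"
      and len: "real_of_int (hi - lo + 1) \<le> N"
      and main: "X * N powr (- \<beta> - real k) * Z ^ (2 ^ k - 1) \<le> 1"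
      and sec: "Z\<^sup>2 \<le> N\<^sup>2 * (X * N powr (- \<beta> - real k))"
    define Z' where "Z' = \<kappa> * Z"
    define l where "l = X * N powr (- \<beta> - real k)"
    have l0: "0 < l" using X N by (simp add: l_def)
    have lnZ: "0 \<le> ln Z" using Z by simp
    have NZ: "0 \<le> N / Z" using N Z by simp
    show "\<bar>\<Sum>n\<in>{lo..hi}. psi (X * of_int n powr - \<beta>)\<bar> \<le> C * (N / Z * (1 + ln Z))"
    proof (cases "1 \<le> Z'")
      case False
      have "\<bar>\<Sum>n\<in>{lo..hi}. psi (X * of_int n powr - \<beta>)\<bar> \<le> N"
        using N len by (intro abs_sum_psi_trivial) auto
      also have "1 * N \<le> C * \<kappa> * N" using C N by (intro mult_right_mono) auto
      then have "N \<le> C * (\<kappa> * N)" by (simp add: mult.assoc)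
      also have "\<dots> \<le> C * (N / Z * (1 + ln Z))"
      proof (rule mult_left_mono[OF _ C(2)])
        have "\<kappa> * Z * N \<le> 1 * N" using False N unfolding Z'_def by (intro mult_right_mono) auto
        then have "\<kappa> * N \<le> N / Z * 1" using Z by (simp add: pos_le_divide_eq mult_ac)
        also have "\<dots> \<le> N / Z * (1 + ln Z)" using NZ lnZ by (intro mult_left_mono) auto
        finally show "\<kappa> * N \<le> N / Z * (1 + ln Z)" .
      qed
      finally show ?thesis .
    next
      case True
      define D where "D i u = (- 1) ^ i * pochhammer \<beta> i * X * u powr (- \<beta> - real i)" for i and u :: real
      have t2: "(1::nat) \<le> 2 ^ k - 1" using power_increasing[of 1 k "2::nat"] k by simp
      have "\<bar>\<Sum>n\<in>{lo..hi}. psi (D 0 (of_int n))\<bar> \<le> 66 * c * (N / Z') * (1 + ln Z')"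
      proof (rule psi_derivative_test[where sg = "(- 1) ^ k" and \<Lambda> = "c1 * l"])
        show "(- 1) ^ k = (1::real) \<or> (- 1) ^ k = (- 1 :: real)" by (cases "even k") auto
        show "derivs k D {real_of_int lo..real_of_int hi}"
          unfolding derivs_def
        proof (intro allI impI ballI)
          fix i u assume u: "u \<in> {real_of_int lo..real_of_int hi}"
          then have "0 < u" using lo N by simp
          then have "((\<lambda>u. u powr (- \<beta> - real i)) has_real_derivative (- \<beta> - real i) * u powr (- \<beta> - real i - 1)) (at u)"
            by (rule has_real_derivative_powr)
          then have "(D i has_real_derivative (- 1) ^ i * pochhammer \<beta> i * X * ((- \<beta> - real i) * u powr (- \<beta> - real i - 1))) (at u)"
            unfolding D_def[abs_def] by (rule DERIV_cmult)
          moreover have "(- 1) ^ i * pochhammer \<beta> i * X * ((- \<beta> - real i) * u powr (- \<beta> - real i - 1)) = D (Suc i) u"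
          proof -
            have "- \<beta> - real (Suc i) = - \<beta> - real i - 1" by simp
            then show ?thesis unfolding D_def pochhammer_Suc by (simp add: algebra_simps)
          qed
          ultimately show "(D i has_real_derivative D (Suc i) u) (at u)" by simp
        qed
        show "c1 * l \<le> (- 1) ^ k * D k u \<and> (- 1) ^ k * D k u \<le> c * (c1 * l)" if u: "u \<in> {real_of_int lo..real_of_int hi}" for u
        proof -
          have u': "N \<le> u" "u \<le> 2 * N" using u lo hi by auto
          have Dk: "(- 1) ^ k * D k u = P * X * u powr (- \<beta> - real k)"
            unfolding D_def P_def by (simp add: mult.assoc[symmetric] flip: power_mult_distrib)
          have up: "u powr (- \<beta> - real k) \<le> N powr (- \<beta> - real k)"
            using u' N \<beta> by (intro powr_mono2') auto
          have lw: "(2 * N) powr (- \<beta> - real k) \<le> u powr (- \<beta> - real k)"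
            using u' N \<beta> by (intro powr_mono2') auto
          have N2: "(2 * N) powr (- \<beta> - real k) = N powr (- \<beta> - real k) / c"
          proof -
            have "(2::real) powr (- \<beta> - real k) = 1 / c"
              unfolding c_def using powr_minus_divide[of 2 "\<beta> + real k"] by simp
            then show ?thesis using N by (simp add: powr_mult)
          qed
          have c1l: "c1 * l = P * X * (N powr (- \<beta> - real k) / c)" "c * (c1 * l) = P * X * N powr (- \<beta> - real k)"
            using c by (simp_all add: c1_def l_def)
          have PX: "0 \<le> P * X" using P X by simp
          show ?thesis
            unfolding c1l(2) Dk unfolding c1l(1)
            using mult_left_mono[OF up PX] mult_left_mono[OF lw PX] unfolding N2 by (rule conjI[rotated])
        qed
        show "c1 * l * Z' ^ (2 ^ k - 1) \<le> 1"
        proof -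
          have "c1 * l * Z' ^ (2 ^ k - 1) = (l * Z ^ (2 ^ k - 1)) * (c1 * \<kappa> ^ (2 ^ k - 1))"
            by (simp add: Z'_def power_mult_distrib)
          also have "\<dots> \<le> 1 * 1"
          proof (rule mult_mono)
            have "\<kappa> ^ (2 ^ k - 1) \<le> \<kappa> ^ 1" using kap t2 by (intro power_decreasing) auto
            then have "c1 * \<kappa> ^ (2 ^ k - 1) \<le> c1 * (1 / c1)" using kap c1 by (intro mult_left_mono) auto
            then show "c1 * \<kappa> ^ (2 ^ k - 1) \<le> 1" using c1 by simp
          qed (use main c1 kap in \<open>auto simp: l_def\<close>)
          finally show ?thesis by simp
        qed
        show "Z'\<^sup>2 \<le> N\<^sup>2 * (c1 * l)"
        proof -
          have "Z'\<^sup>2 = \<kappa>\<^sup>2 * Z\<^sup>2" by (simp add: Z'_def power_mult_distrib)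
          also have "\<dots> \<le> c1 * (N\<^sup>2 * l)"
          proof (rule mult_mono)
            have "\<kappa> * \<kappa> \<le> c1 * 1" using kap c1 by (intro mult_mono) auto
            then show "\<kappa>\<^sup>2 \<le> c1" by (simp add: power2_eq_square)
          qed (use sec c1 in \<open>auto simp: l_def\<close>)
          finally show ?thesis by (simp add: mult_ac)
        qed
      qed (use k c c1 l0 True N len in auto)
      also have "\<dots> \<le> 66 * c * (N / Z') * (1 + ln Z)"
      proof (rule mult_left_mono)
        have "Z' \<le> 1 * Z" unfolding Z'_def using kap Z by (intro mult_right_mono) auto
        then show "1 + ln Z' \<le> 1 + ln Z" using True Z by simp
      qed (use c N True in auto)
      also have "\<dots> = C * (N / Z * (1 + ln Z))" using kap by (simp add: C_def Z'_def)
      finally show ?thesis by (simp add: D_def)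
    qed
  qed
qed

lemma one_plus_ln_le_powr:
  fixes t \<epsilon> :: real
  assumes "0 < \<epsilon>" "1 \<le> t"
  shows "1 + ln t \<le> (1 + 1 / \<epsilon>) * t powr \<epsilon>"
proof -
  have "1 \<le> t powr \<epsilon>" using assms by (simp add: ge_one_powr_ge_zero)
  moreover have "\<epsilon> * ln t \<le> t powr \<epsilon>"
    using ln_le_minus_one[of "t powr \<epsilon>"] assms by (simp add: ln_powr)
  then have "ln t \<le> t powr \<epsilon> / \<epsilon>" using assms by (simp add: pos_le_divide_eq mult.commute)
  ultimately show ?thesis by (simp add: distrib_right)
qed

section \<open>Bounds for a single dyadic block\<close>

context
  fixes r :: nat and b e0 E :: real
  assumes r: "5 \<le> r"
  defines "b \<equiv> 2 ^ r" and "e0 \<equiv> (2 * real r - 4) / (b - 2 * real r)" and "E \<equiv> b + real r + e0"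
begin

lemma two_power_ge_r: "5 * real r + 5 \<le> b"
  using r unfolding b_def by (induction r rule: dec_induct) auto

lemma e0_bounds: "0 < e0" "e0 \<le> 1"
proof -
  have "0 < b - 2 * real r" using two_power_ge_r r by linarith
  then show "0 < e0" "e0 \<le> 1" using two_power_ge_r r by (auto simp: e0_def)
qed

lemma alpha_eq: "alpha r = 1 / E"
proof -
  have d: "0 < b - 2 * real r" using two_power_ge_r r by linarith
  have "E = ((b + real r) * (b - 2 * real r) + (2 * real r - 4)) / (b - 2 * real r)"
    using d by (simp add: E_def e0_def add_divide_distrib)
  moreover have "(b + real r) * (b - 2 * real r) + (2 * real r - 4) = 2 ^ (2 * r) - real r * 2 ^ r - 2 * (real r)\<^sup>2 + 2 * real r - 4"
    by (simp add: b_def power_mult power2_eq_square algebra_simps flip: power_mult_distrib)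
  ultimately show ?thesis by (simp add: alpha_def b_def)
qed

lemma alpha_less: "alpha r < 1 / (2 ^ r + real r)"
  unfolding alpha_eq using e0_bounds two_power_ge_r r by (simp add: E_def b_def frac_less2)

text \<open>All quantities are written as powers of N. The hypotheses of the tests then become the
  linear inequalities collected in \<open>test_ok\<close> and \<open>B_ok\<close>, so
  \<open>exponents\<close> applies.\<close>

lemma first_sum_block:
  obtains C where "0 \<le> C" "\<And>x N lo hi. 1 \<le> x \<Longrightarrow> 1 \<le> N \<Longrightarrow> N ^ (2 ^ r + 1) \<le> x \<Longrightarrow> N \<le> real_of_int lo \<Longrightarrow>
    real_of_int hi \<le> 2 * N \<Longrightarrow> real_of_int (hi - lo + 1) \<le> N \<Longrightarrow>
    \<bar>\<Sum>n\<in>{lo..hi}. psi (x / of_int n ^ (2 ^ r))\<bar> \<le> C * x powr alpha r"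
proof -
  have "\<exists>C\<ge>0. \<forall>X N Z lo hi. 0 < X \<longrightarrow> 1 \<le> N \<longrightarrow> 1 \<le> Z \<longrightarrow> N \<le> real_of_int lo \<longrightarrow>
    real_of_int hi \<le> 2 * N \<longrightarrow> real_of_int (hi - lo + 1) \<le> N \<longrightarrow>
    X * N powr (- b - real k) * Z ^ (2 ^ k - 1) \<le> 1 \<longrightarrow> Z\<^sup>2 \<le> N\<^sup>2 * (X * N powr (- b - real k)) \<longrightarrow>
    \<bar>\<Sum>n\<in>{lo..hi}. psi (X * of_int n powr - b)\<bar> \<le> C * (N / Z * (1 + ln Z))" if "2 \<le> k" for k
  proof -
    have "0 < b" by (simp add: b_def)
    then show ?thesis using monomial_psi_test[of b k, OF _ that] by metis
  qed
  then obtain Ck where Ck0: "\<And>k. 2 \<le> k \<Longrightarrow> 0 \<le> Ck k" and Ck: "\<And>k X N Z lo hi. 2 \<le> k \<Longrightarrow> 0 < X \<Longrightarrow> 1 \<le> N \<Longrightarrow> 1 \<le> Z \<Longrightarrow> N \<le> real_of_int lo \<Longrightarrow>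
    real_of_int hi \<le> 2 * N \<Longrightarrow> real_of_int (hi - lo + 1) \<le> N \<Longrightarrow>
    X * N powr (- b - real k) * Z ^ (2 ^ k - 1) \<le> 1 \<Longrightarrow> Z\<^sup>2 \<le> N\<^sup>2 * (X * N powr (- b - real k)) \<Longrightarrow>
    \<bar>\<Sum>n\<in>{lo..hi}. psi (X * of_int n powr - b)\<bar> \<le> Ck k * (N / Z * (1 + ln Z))"
    by metis
  define m where "m = r - 2"
  have m: "m + 2 = r" using r by (simp add: m_def)
  have b1: "(1::nat) \<le> 2 ^ r" by simp
  obtain CB where CB: "1 \<le> CB"
    "\<And>X N Z lo hi. 1 \<le> N \<Longrightarrow> 0 < X \<Longrightarrow> 1 \<le> Z \<Longrightarrow> N \<le> real_of_int lo \<Longrightarrow> real_of_int hi \<le> 2 * N \<Longrightarrow>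
       real_of_int (hi - lo + 1) \<le> N \<Longrightarrow> (Z ^ (2 ^ m))\<^sup>2 \<le> N \<Longrightarrow> Z\<^sup>2 \<le> N\<^sup>2 * (X / N ^ (m + 2)) \<Longrightarrow>
       (\<And>t. 1 \<le> t \<Longrightarrow> t \<le> Z ^ (2 ^ Suc m - 1) \<Longrightarrow> 1 < Z ^ (2 ^ m) * sqrt (t * (X / N ^ (m + 2))) \<Longrightarrow>
         (Z ^ (2 ^ m)) ^ 3 * (t * (X / N ^ (m + 2)))\<^sup>2 \<le> 1 \<and>
         (\<exists>s. 3 \<le> s \<and> s \<le> r + 3 \<and> (Z ^ (2 ^ m) * sqrt (t * (X / N ^ (m + 2)))) ^ (2 ^ s - 2) * N \<le> (N * (t * (X / N ^ (m + 2)))) ^ (s - 1) \<and>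
            (Z ^ (2 ^ m) * sqrt (t * (X / N ^ (m + 2))))\<^sup>2 * (N * (t * (X / N ^ (m + 2)))) ^ (s - 3) \<le> N)) \<Longrightarrow>
       \<bar>\<Sum>n\<in>{lo..hi}. psi (X * (N / of_int n) ^ 2 ^ r)\<bar> \<le> CB * (N / Z) * (1 + ln Z)"
    using B_range_psi_sum[OF b1, where m = m and S = "r + 3"] by blast
  define C1 where "C1 = CB + (\<Sum>k\<in>{2..r + 1}. Ck k)"
  define \<epsilon> where "\<epsilon> = 1 / (4 * b\<^sup>2)"
  define C where "C = 1 + C1 * (2 * (1 + 1 / \<epsilon>))"
  have b0: "0 < b" by (simp add: b_def)
  have b1r: "1 \<le> b" by (simp add: b_def)
  have eps: "0 < \<epsilon>" "\<epsilon> \<le> 1"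
  proof -
    show "0 < \<epsilon>" using b0 by (simp add: \<epsilon>_def)
    have "1 \<le> b\<^sup>2" using b1r by (rule one_le_power)
    then have "1 / (4 * b\<^sup>2) \<le> 1 / 1" by (intro frac_le) auto
    then show "\<epsilon> \<le> 1" by (simp add: \<epsilon>_def)
  qed
  have CkC: "Ck k \<le> C1" if "k \<in> {2..r + 1}" for k
    using member_le_sum[of k "{2..r + 1}" Ck] that Ck0 CB(1) by (simp add: C1_def)
  have "0 \<le> (\<Sum>k\<in>{2..r + 1}. Ck k)" by (rule sum_nonneg) (use Ck0 in auto)
  then have CBC: "CB \<le> C1" by (simp add: C1_def)
  have C1: "0 \<le> C1" using CBC CB(1) by simp
  have E0: "0 < E" using e0_bounds b0 by (simp add: E_def)
  have C1e: "0 \<le> C1 * (2 * (1 + 1 / \<epsilon>))" using C1 eps by simp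
  show ?thesis
  proof (rule that[of C])
    show "0 \<le> C" using C1e by (simp add: C_def)
    fix x N :: real and lo hi :: int
    assume x: "1 \<le> x" and N1: "1 \<le> N" and Nx: "N ^ (2 ^ r + 1) \<le> x" and lo: "N \<le> real_of_int lo"
      and hi: "real_of_int hi \<le> 2 * N" and len: "real_of_int (hi - lo + 1) \<le> N"
    define S where "S = \<bar>\<Sum>n\<in>{lo..hi}. psi (x / of_int n ^ (2 ^ r))\<bar>"
    have "S \<le> C * x powr alpha r"
    \<comment> \<open>In the nontrivial case N > x powr \<alpha> forces N > 1, so that logarithms to
      base N make sense, and p < E, so that y > -e0.\<close>
    proof (cases "N \<le> x powr alpha r")
      case True
      have "S \<le> N" unfolding S_def using N1 len by (intro abs_sum_psi_trivial) auto
      also have "\<dots> \<le> 1 * x powr alpha r" using True by simp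
      also have "\<dots> \<le> C * x powr alpha r" using C1e by (intro mult_right_mono) (auto simp: C_def)
      finally show ?thesis .
    next
      case False
      have a0: "0 < alpha r" using E0 by (simp add: alpha_eq)
      have "1 \<le> x powr alpha r" using x a0 by (simp add: ge_one_powr_ge_zero)
      then have N: "1 < N" using False by linarith
      have N0: "0 < N" using N by simp
      define L where "L = ln N"
      have L: "0 < L" using N by (simp add: L_def)
      have pow: "v = N powr (ln v / L)" if "0 < v" for v
        using that N L by (simp add: powr_def L_def)
      define p where "p = ln x / L"
      have xp: "x = N powr p" unfolding p_def using pow x by simp
      have pb: "b + 1 \<le> p"
      proof -
        have "N powr (b + 1) = N powr real (2 ^ r + 1)" by (simp add: b_def add.commute)
        also have "\<dots> = N ^ (2 ^ r + 1)" using N0 by (rule powr_realpow)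
        also have "\<dots> \<le> N powr p" using Nx xp by simp
        finally show ?thesis using N by simp
      qed
      have pE: "p < E"
      proof -
        have "N powr (p * alpha r) < N powr 1" using False N0 unfolding xp powr_powr by simp
        then have "p * alpha r < 1" using N by (simp only: powr_less_cancel_iff)
        then show ?thesis using E0 by (simp add: alpha_eq)
      qed
      \<comment> \<open>The r-th derivative of x / u ^ b at u of size N is N powr (p - b - r) up to
        a constant.\<close>
      define y where "y = b + real r - p"
      \<comment> \<open>Chosen so that N powr (1 - \<sigma> + \<epsilon>) = x powr \<alpha>. The
        surplus \<epsilon> pays for the factor 1 + ln Z.\<close>
      define \<sigma> where "\<sigma> = (y + e0) / E + \<epsilon>"
      define Z where "Z = N powr \<sigma>"
      have y: "- e0 \<le> y" "y \<le> real r - 1" using pb pE by (simp_all add: y_def E_def)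
      have ye: "(y + e0) / E = 1 - p / E" using E0 by (simp add: y_def E_def field_simps)
      have s0: "0 \<le> \<sigma>" using y E0 eps by (simp add: \<sigma>_def)
      have s2: "\<sigma> \<le> 2"
      proof -
        have "0 \<le> p / E" using pb b0 E0 by simp
        then show ?thesis unfolding \<sigma>_def ye using eps by linarith
      qed
      have Z1: "1 \<le> Z" using N s0 by (simp add: Z_def ge_one_powr_ge_zero)
      have Zp: "Z ^ n = N powr (real n * \<sigma>)" for n
        using N0 by (simp add: Z_def powr_power mult.commute)
      have bound: "N / Z * (1 + ln Z) \<le> 2 * (1 + 1 / \<epsilon>) * x powr alpha r"
      proof -
        have "1 + ln Z \<le> 2 * (1 + ln N)"
        proof -
          have "ln Z = \<sigma> * L" using N0 by (simp add: Z_def ln_powr L_def)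
          also have "\<dots> \<le> 2 * L" using s2 L by (intro mult_right_mono) auto
          finally show ?thesis by (simp add: L_def)
        qed
        also have "\<dots> \<le> 2 * ((1 + 1 / \<epsilon>) * N powr \<epsilon>)"
          using one_plus_ln_le_powr[of \<epsilon> N] eps N by simp
        finally have "N / Z * (1 + ln Z) \<le> N / Z * (2 * ((1 + 1 / \<epsilon>) * N powr \<epsilon>))"
          using N0 Z1 by (intro mult_left_mono) auto
        also have "\<dots> = 2 * (1 + 1 / \<epsilon>) * (N / Z * N powr \<epsilon>)" by simp
        also have "N / Z * N powr \<epsilon> = N powr (1 - \<sigma> + \<epsilon>)"
          using N0 by (simp add: Z_def powr_add powr_diff)
        also have "1 - \<sigma> + \<epsilon> = p * alpha r" unfolding \<sigma>_def ye by (simp add: alpha_eq)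
        also have "N powr (p * alpha r) = x powr alpha r" unfolding xp powr_powr ..
        finally show ?thesis .
      qed
      have "S \<le> C1 * (N / Z * (1 + ln Z))"
      proof -
        have NZ0: "0 \<le> N / Z * (1 + ln Z)" using N0 Z1 by simp
        have "(\<exists>k\<in>{2..r + 1}. test_ok r k y \<sigma>) \<or> B_ok r y \<sigma>"
        proof (rule exponents)
          show "- ((2 * real r - 4) / (2 ^ r - 2 * real r)) \<le> y" using y(1) by (simp only: e0_def b_def)
          show "\<sigma> = (y + (2 * real r - 4) / (2 ^ r - 2 * real r)) / (2 ^ r + real r + (2 * real r - 4) / (2 ^ r - 2 * real r)) + 1 / (4 * (2 ^ r)\<^sup>2)"
            by (simp only: \<sigma>_def \<epsilon>_def E_def e0_def b_def)
        qed (use r y in auto)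
        then show ?thesis
        proof
          assume "\<exists>k\<in>{2..r + 1}. test_ok r k y \<sigma>"
          then obtain k where k: "k \<in> {2..r + 1}" and ok: "test_ok r k y \<sigma>" by blast
          have k1: "1 \<le> (2::nat) ^ k" by simp
          have "x * N powr (- b - real k) = N powr (real r - real k - y)"
          proof -
            have e: "p + (- b - real k) = real r - real k - y" by (simp add: y_def)
            show ?thesis unfolding xp powr_add[symmetric] e ..
          qed
          note l = this
          have eq: "x / of_int n ^ (2 ^ r) = x * of_int n powr - b" if "n \<in> {lo..hi}" for n
          proof -
            have "0 < real_of_int n" using that lo N0 by simp
            then have "real_of_int n powr real (2 ^ r) = of_int n ^ (2 ^ r)" by (rule powr_realpow)
            then show ?thesis by (simp add: b_def powr_minus_divide)
          qed
          have "S = \<bar>\<Sum>n\<in>{lo..hi}. psi (x * of_int n powr - b)\<bar>"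
            unfolding S_def using eq by (intro arg_cong[where f = abs] sum.cong refl) simp
          also have "\<dots> \<le> Ck k * (N / Z * (1 + ln Z))"
          proof (rule Ck)
            show "x * N powr (- b - real k) * Z ^ (2 ^ k - 1) \<le> 1"
            proof -
              have "x * N powr (- b - real k) * Z ^ (2 ^ k - 1) = N powr ((real r - real k - y) + real (2 ^ k - 1) * \<sigma>)"
                unfolding l Zp by (simp flip: powr_add)
              also have "\<dots> \<le> N powr 0"
              proof (rule powr_mono)
                show "real r - real k - y + real (2 ^ k - 1) * \<sigma> \<le> 0"
                  using ok k1 by (simp add: test_ok_def of_nat_diff)
              qed (use N1 in simp)
              finally show ?thesis using N0 by simp
            qed
            show "Z\<^sup>2 \<le> N\<^sup>2 * (x * N powr (- b - real k))"
            proof -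
              have "Z\<^sup>2 = N powr (2 * \<sigma>)" unfolding Zp by simp
              also have "\<dots> \<le> N powr (2 + (real r - real k - y))" using ok N by (simp add: test_ok_def)
              also have "\<dots> = N powr 2 * N powr (real r - real k - y)" by (rule powr_add)
              also have "N powr 2 = N\<^sup>2" using N0 by (simp add: powr_numeral)
              finally show ?thesis by (simp only: l)
            qed
          qed (use k x N1 Z1 lo hi len in auto)
          also have "\<dots> \<le> C1 * (N / Z * (1 + ln Z))" using CkC[OF k] NZ0 by (rule mult_right_mono)
          finally show ?thesis .
        next
          assume ok: "B_ok r y \<sigma>"
          define X where "X = x / N ^ 2 ^ r"
          have X0: "0 < X" using x N0 by (simp add: X_def)
          define w where "w = 2 ^ r * \<sigma> / 4"
          have pm: "real (2 ^ m) = 2 ^ r / 4"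
          proof -
            have "(2::real) ^ r = 2 ^ m * 4" unfolding m[symmetric] power_add by simp
            then show ?thesis by simp
          qed
          have ZW: "Z ^ (2 ^ m) = N powr w" unfolding Zp pm w_def by simp
          have XL: "X / N ^ (m + 2) = N powr - y"
          proof -
            have "N ^ 2 ^ r = N powr b" "N ^ r = N powr real r"
              using N0 powr_realpow[of N "2 ^ r"] powr_realpow[of N r] by (simp_all add: b_def)
            then have "X / N ^ (m + 2) = N powr p / N powr b / N powr real r" unfolding X_def m by (simp add: xp)
            also have "\<dots> = N powr (p - b - real r)" by (simp add: powr_diff)
            also have "p - b - real r = - y" by (simp add: y_def)
            finally show ?thesis .
          qed
          have eq: "x / of_int n ^ (2 ^ r) = X * (N / of_int n) ^ 2 ^ r" for n
            using N0 by (simp add: X_def power_divide)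
          have "S \<le> CB * (N / Z) * (1 + ln Z)"
            unfolding S_def eq
          proof (rule CB(2))
            show "(Z ^ 2 ^ m)\<^sup>2 \<le> N"
            proof -
              have "(Z ^ 2 ^ m)\<^sup>2 = N powr (2 * w)" unfolding ZW using N0 by (simp add: powr_power mult.commute)
              also have "\<dots> \<le> N powr 1"
              proof (rule powr_mono)
                have "2 ^ r * \<sigma> / 4 \<le> 1/2" using ok unfolding B_ok_def by blast
                then show "2 * w \<le> 1" by (simp add: w_def)
              qed (rule N1)
              finally show ?thesis using N0 by simp
            qed
            show "Z\<^sup>2 \<le> N\<^sup>2 * (X / N ^ (m + 2))"
            proof -
              have "Z\<^sup>2 = N powr (2 * \<sigma>)" unfolding Zp by simp
              also have "\<dots> \<le> N powr (2 + - y)" using ok N by (simp add: B_ok_def)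
              also have "\<dots> = N powr 2 * N powr - y" by (rule powr_add)
              also have "N powr 2 = N\<^sup>2" using N0 by (simp add: powr_numeral)
              finally show ?thesis by (simp only: XL)
            qed
            fix t :: real
            assume t: "1 \<le> t" "t \<le> Z ^ (2 ^ Suc m - 1)" "1 < Z ^ 2 ^ m * sqrt (t * (X / N ^ (m + 2)))"
            \<comment> \<open>After r - 2 differences with shift product t (frequency included) the
              second derivative has size t * N powr -y = N powr -\<mu>. The bound on t and the case
              assumption give the two ends of the range of \<mu> in \<open>B_ok\<close>.\<close>
            define \<mu> where "\<mu> = y - ln t / L"
            have tN: "t = N powr (y - \<mu>)" using pow[of t] t by (simp add: \<mu>_def)
            have lam: "t * (X / N ^ (m + 2)) = N powr - \<mu>"
              unfolding tN XL by (simp flip: powr_add)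
            have sq: "sqrt (N powr - \<mu>) = N powr (- \<mu> / 2)"
              by (simp add: powr_half_sqrt[symmetric] powr_powr)
            have WL: "Z ^ 2 ^ m * sqrt (N powr - \<mu>) = N powr (w - \<mu> / 2)"
              unfolding ZW sq by (simp flip: powr_add)
            have NL: "N * N powr - \<mu> = N powr (1 - \<mu>)" using N0 by (simp add: powr_diff powr_minus_divide)
            have m1: "y - (2 ^ r / 2 - 1) * \<sigma> \<le> \<mu>"
            proof -
              have "1 \<le> (2::nat) ^ Suc m" by simp
              then have e: "real (2 ^ Suc m - 1) = 2 ^ r / 2 - 1" using pm by (simp add: of_nat_diff)
              have "N powr (y - \<mu>) \<le> N powr ((2 ^ r / 2 - 1) * \<sigma>)" using t(2) unfolding tN Zp e .
              then show ?thesis using N by simp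
            qed
            have m2: "\<mu> \<le> 2 * (2 ^ r * \<sigma> / 4)"
            proof -
              have "N powr 0 < N powr (w - \<mu> / 2)" using t(3) N0 unfolding lam WL by simp
              then have "0 < w - \<mu> / 2" using N by (simp only: powr_less_cancel_iff)
              then show ?thesis unfolding w_def by linarith
            qed
            from ok m1 m2 obtain s where m3: "3 * w \<le> 2 * \<mu>" and s: "s \<in> {3..r + 3}"
              "(2 ^ s - 2) * (w - \<mu> / 2) + 1 \<le> (real s - 1) * (1 - \<mu>)" "2 * (w - \<mu> / 2) + (real s - 3) * (1 - \<mu>) \<le> 1"
              unfolding B_ok_def w_def by blast
            show "(Z ^ 2 ^ m) ^ 3 * (t * (X / N ^ (m + 2)))\<^sup>2 \<le> 1 \<and>
              (\<exists>s. 3 \<le> s \<and> s \<le> r + 3 \<and> (Z ^ 2 ^ m * sqrt (t * (X / N ^ (m + 2)))) ^ (2 ^ s - 2) * N \<le> (N * (t * (X / N ^ (m + 2)))) ^ (s - 1) \<and>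
              (Z ^ 2 ^ m * sqrt (t * (X / N ^ (m + 2))))\<^sup>2 * (N * (t * (X / N ^ (m + 2)))) ^ (s - 3) \<le> N)"
              unfolding lam WL NL
            proof (intro conjI exI[of _ s])
              have pp: "(N powr a) ^ n = N powr (real n * a)" for a n
                using N0 by (simp add: powr_power mult.commute)
              show "(Z ^ 2 ^ m) ^ 3 * (N powr - \<mu>)\<^sup>2 \<le> 1"
              proof -
                have "(Z ^ 2 ^ m) ^ 3 * (N powr - \<mu>)\<^sup>2 = N powr (3 * w - 2 * \<mu>)"
                  unfolding ZW pp by (simp flip: powr_add)
                also have "\<dots> \<le> N powr 0" using m3 N by (intro powr_mono) auto
                finally show ?thesis using N0 by simp
              qed
              have "2 ^ 1 \<le> (2::nat) ^ s" using s(1) by (intro power_increasing) auto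
              then have s2: "real (2 ^ s - 2) = 2 ^ s - 2" by (simp add: of_nat_diff)
              show "(N powr (w - \<mu> / 2)) ^ (2 ^ s - 2) * N \<le> (N powr (1 - \<mu>)) ^ (s - 1)"
              proof -
                have "(N powr (w - \<mu> / 2)) ^ (2 ^ s - 2) * N = N powr ((2 ^ s - 2) * (w - \<mu> / 2) + 1)"
                  unfolding pp s2 powr_add using N0 by simp
                also have "\<dots> \<le> N powr ((real s - 1) * (1 - \<mu>))" using s(2) N by simp
                also have "real s - 1 = real (s - 1)" using s(1) by (simp add: of_nat_diff)
                finally show ?thesis unfolding pp .
              qed
              show "(N powr (w - \<mu> / 2))\<^sup>2 * (N powr (1 - \<mu>)) ^ (s - 3) \<le> N"
              proof -
                have "(N powr (w - \<mu> / 2))\<^sup>2 * (N powr (1 - \<mu>)) ^ (s - 3) = N powr (2 * (w - \<mu> / 2) + real (s - 3) * (1 - \<mu>))"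
                  unfolding pp powr_add by simp
                also have "real (s - 3) = real s - 3" using s(1) by (simp add: of_nat_diff)
                also have "N powr (2 * (w - \<mu> / 2) + (real s - 3) * (1 - \<mu>)) \<le> N powr 1"
                  using s(3) N by (intro powr_mono) auto
                finally show ?thesis using N0 by simp
              qed
            qed (use s(1) in auto)
          qed (use N1 X0 Z1 lo hi len in auto)
          also have "\<dots> = CB * (N / Z * (1 + ln Z))" by simp
          also have "\<dots> \<le> C1 * (N / Z * (1 + ln Z))" using CBC NZ0 by (rule mult_right_mono)
          finally show ?thesis .
        qed
      qed
      also have "\<dots> \<le> C1 * (2 * (1 + 1 / \<epsilon>) * x powr alpha r)" using bound C1 by (rule mult_left_mono)
      also have "\<dots> = (C1 * (2 * (1 + 1 / \<epsilon>))) * x powr alpha r" by simp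
      also have "\<dots> \<le> C * x powr alpha r" by (intro mult_right_mono) (auto simp: C_def)
      finally show ?thesis .
    qed
    then show "\<bar>\<Sum>n\<in>{lo..hi}. psi (x / of_int n ^ (2 ^ r))\<bar> \<le> C * x powr alpha r" by (simp only: S_def)
  qed
qed

text \<open>In the nontrivial range x lies between N powr (b + 1) and N powr E with E <= 5/4 * b +
  1. The second derivative therefore lies between N powr -1 and N powr (-3/4) up to constants, and
  order 2 always saves N powr (1/4). The target is weaker, since (b + 1) * \<alpha> >= 4/5.\<close>

lemma second_sum_block:
  obtains C where "0 \<le> C" "\<And>x N lo hi. 1 \<le> x \<Longrightarrow> 1 \<le> N \<Longrightarrow> N ^ (2 ^ r + 1) \<le> x \<Longrightarrow> N \<le> real_of_int lo \<Longrightarrow>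
    real_of_int hi \<le> 2 * N \<Longrightarrow> real_of_int (hi - lo + 1) \<le> N \<Longrightarrow>
    \<bar>\<Sum>n\<in>{lo..hi}. psi ((x / of_int n) powr (1 / b))\<bar> \<le> C * x powr alpha r"
proof -
  have b0: "0 < b" by (simp add: b_def)
  have E0: "0 < E" using e0_bounds b0 by (simp add: E_def)
  obtain K where K: "0 \<le> K" "\<And>X N Z lo hi. 0 < X \<Longrightarrow> 1 \<le> N \<Longrightarrow> 1 \<le> Z \<Longrightarrow> N \<le> real_of_int lo \<Longrightarrow>
    real_of_int hi \<le> 2 * N \<Longrightarrow> real_of_int (hi - lo + 1) \<le> N \<Longrightarrow>
    X * N powr (- (1 / b) - real 2) * Z ^ (2 ^ 2 - 1) \<le> 1 \<Longrightarrow> Z\<^sup>2 \<le> N\<^sup>2 * (X * N powr (- (1 / b) - real 2)) \<Longrightarrow>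
    \<bar>\<Sum>n\<in>{lo..hi}. psi (X * of_int n powr - (1 / b))\<bar> \<le> K * (N / Z * (1 + ln Z))"
    using monomial_psi_test[of "1 / b" 2] b0 by auto
  define C where "C = 1 + K * 21"
  show ?thesis
  proof (rule that[of C])
    show "0 \<le> C" using K(1) by (simp add: C_def)
    fix x N :: real and lo hi :: int
    assume x: "1 \<le> x" and N1: "1 \<le> N" and Nx: "N ^ (2 ^ r + 1) \<le> x" and lo: "N \<le> real_of_int lo"
      and hi: "real_of_int hi \<le> 2 * N" and len: "real_of_int (hi - lo + 1) \<le> N"
    define S where "S = \<bar>\<Sum>n\<in>{lo..hi}. psi ((x / of_int n) powr (1 / b))\<bar>"
    have Nx': "N powr (b + 1) \<le> x"
    proof -
      have "N powr (b + 1) = N powr real (2 ^ r + 1)" by (simp add: b_def add.commute)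
      also have "\<dots> = N ^ (2 ^ r + 1)" using N1 by (intro powr_realpow) auto
      finally show ?thesis using Nx by (simp only:)
    qed
    have "S \<le> C * x powr alpha r"
    proof (cases "N \<le> x powr alpha r")
      case True
      have "S \<le> N" unfolding S_def using N1 len by (intro abs_sum_psi_trivial) auto
      also have "\<dots> \<le> 1 * x powr alpha r" using True by simp
      also have "\<dots> \<le> C * x powr alpha r" using K(1) by (intro mult_right_mono) (auto simp: C_def)
      finally show ?thesis .
    next
      case False
      define X where "X = x powr (1 / b)"
      \<comment> \<open>N / Z = N powr (3/4); another N powr (1/20) absorbs the logarithm with the
        constant 1 + 20 = 21, and 3/4 + 1/20 = 4/5.\<close>
      define Z where "Z = N powr (1/4)"
      have N0: "0 < N" and x0: "0 < x" using N1 x by auto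
      have Z1: "1 \<le> Z" using N1 by (simp add: Z_def ge_one_powr_ge_zero)
      have xE: "x \<le> N powr E"
      proof -
        have "(x powr alpha r) powr E \<le> N powr E" using False E0 by (intro powr_mono2) auto
        then show ?thesis using E0 x0 by (simp add: powr_powr alpha_eq)
      qed
      have Eb: "E \<le> 5/4 * b + 1" using e0_bounds two_power_ge_r r by (simp add: E_def)
      have eq: "(x / of_int n) powr (1 / b) = X * of_int n powr - (1 / b)" if "n \<in> {lo..hi}" for n
      proof -
        have "0 < real_of_int n" using that lo N0 by simp
        then show ?thesis using x0 by (simp add: X_def powr_divide powr_minus_divide)
      qed
      have "S = \<bar>\<Sum>n\<in>{lo..hi}. psi (X * of_int n powr - (1 / b))\<bar>"
        unfolding S_def using eq by (intro arg_cong[where f = abs] sum.cong refl) simp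
      also have "\<dots> \<le> K * (N / Z * (1 + ln Z))"
      proof (rule K(2))
        have Z3: "Z ^ (2 ^ 2 - 1) = N powr (3/4)" using N0 by (simp add: Z_def powr_power)
        show "X * N powr (- (1 / b) - real 2) * Z ^ (2 ^ 2 - 1) \<le> 1"
          unfolding Z3
        proof -
          have "X \<le> (N powr E) powr (1 / b)" unfolding X_def using xE x0 b0 by (intro powr_mono2) auto
          also have "\<dots> = N powr (E / b)" by (simp add: powr_powr)
          also have "\<dots> \<le> N powr (5/4 + 1 / b)" using Eb b0 N1 by (intro powr_mono) (auto simp: field_simps)
          finally have "X * N powr (- (1 / b) - real 2) * N powr (3/4)
              \<le> N powr (5/4 + 1 / b) * N powr (- (1 / b) - real 2) * N powr (3/4)"
            by (intro mult_right_mono) auto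
          also have "N powr (5/4 + 1 / b) * N powr (- (1 / b) - real 2) * N powr (3/4) = 1"
            using N0 by (simp flip: powr_add)
          finally show "X * N powr (- (1 / b) - real 2) * N powr (3/4) \<le> 1" .
        qed
        show "Z\<^sup>2 \<le> N\<^sup>2 * (X * N powr (- (1 / b) - real 2))"
        proof -
          have "Z\<^sup>2 = N powr (1/2)" using N0 by (simp add: Z_def powr_power)
          also have "\<dots> \<le> N powr (2 + ((b + 1) / b + (- (1 / b) - real 2)))"
            using N1 b0 by (intro powr_mono) (auto simp: field_simps)
          also have "\<dots> = N\<^sup>2 * (N powr ((b + 1) / b) * N powr (- (1 / b) - real 2))"
            using N0 by (simp only: powr_add) (simp add: powr_numeral)
          also have "\<dots> \<le> N\<^sup>2 * (X * N powr (- (1 / b) - real 2))"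
          proof (intro mult_left_mono mult_right_mono)
            have "(N powr (b + 1)) powr (1 / b) \<le> X" unfolding X_def using Nx' b0 by (intro powr_mono2) auto
            then show "N powr ((b + 1) / b) \<le> X" by (simp add: powr_powr)
          qed auto
          finally show ?thesis .
        qed
      qed (use x0 N1 Z1 lo hi len in \<open>auto simp: X_def\<close>)
      also have "\<dots> \<le> K * (21 * x powr alpha r)"
      proof (rule mult_left_mono[OF _ K(1)])
        have "ln Z = 1/4 * ln N" using N0 by (simp add: Z_def ln_powr)
        moreover have "0 \<le> ln N" using N1 by simp
        ultimately have "1 + ln Z \<le> 1 + ln N" by linarith
        also have "\<dots> \<le> (1 + 1 / (1/20)) * N powr (1/20)" using N1 by (intro one_plus_ln_le_powr) auto
        finally have "N / Z * (1 + ln Z) \<le> N / Z * (21 * N powr (1/20))"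
          using N0 Z1 by (intro mult_left_mono) auto
        also have "\<dots> = 21 * N powr (4/5)"
        proof -
          have "N powr (4/5) = N powr (1 - 1/4 + 1/20)" by simp
          also have "\<dots> = N powr 1 / N powr (1/4) * N powr (1/20)" by (simp only: powr_add powr_diff)
          finally show ?thesis using N0 by (simp add: Z_def)
        qed
        also have "\<dots> \<le> 21 * N powr ((b + 1) * alpha r)"
        proof -
          have "4/5 \<le> (b + 1) * alpha r"
            using E0 e0_bounds two_power_ge_r by (simp add: alpha_eq pos_le_divide_eq E_def)
          then show ?thesis using N1 by (simp add: powr_mono)
        qed
        also have "N powr ((b + 1) * alpha r) = (N powr (b + 1)) powr alpha r" by (simp add: powr_powr)
        also have "21 * \<dots> \<le> 21 * x powr alpha r"
          using Nx' E0 by (intro mult_left_mono powr_mono2) (auto simp: alpha_eq)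
        finally show "N / Z * (1 + ln Z) \<le> 21 * x powr alpha r" by simp
      qed
      also have "\<dots> \<le> C * x powr alpha r" by (simp add: C_def distrib_right)
      finally show ?thesis .
    qed
    then show "\<bar>\<Sum>n\<in>{lo..hi}. psi ((x / of_int n) powr (1 / b))\<bar> \<le> C * x powr alpha r" by (simp only: S_def)
  qed
qed

end

text \<open>Induction on the binary length of the end point, splitting off the block from the
  highest power of two onwards. The number of blocks is at most 1 + k with 2 ^ k <= M, and k <= 2 *
  ln M because ln 2 >= 1/2.\<close>

lemma abs_sum_le_dyadic:
  fixes f :: "int \<Rightarrow> real" and B :: real
  assumes B: "\<And>N lo hi. 1 \<le> N \<Longrightarrow> N \<le> real M \<Longrightarrow> N \<le> real_of_int lo \<Longrightarrow> real_of_int hi \<le> 2 * N \<Longrightarrow>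
      real_of_int (hi - lo + 1) \<le> N \<Longrightarrow> \<bar>\<Sum>n\<in>{lo..hi}. f n\<bar> \<le> B"
    and M: "1 \<le> M"
  shows "\<bar>\<Sum>n=1..M. f (int n)\<bar> \<le> (1 + 2 * ln (real M)) * B"
proof -
  have B0: "0 \<le> B" using B[of 1 1 0] M by simp
  have ints: "(\<Sum>n=1..m. f (int n)) = (\<Sum>n\<in>{1..int m}. f n)" for m
    by (rule sum.reindex_bij_witness[where i = nat and j = int]) auto
  have main: "m < 2 ^ k \<Longrightarrow> m \<le> M \<Longrightarrow> \<bar>\<Sum>n\<in>{1..int m}. f n\<bar> \<le> real k * B" for k m
  proof (induction k arbitrary: m)
    case (Suc k)
    show ?case
    proof (cases "m < 2 ^ k")
      case True
      then have "\<bar>\<Sum>n\<in>{1..int m}. f n\<bar> \<le> real k * B" using Suc.prems by (intro Suc.IH)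
      also have "\<dots> \<le> real (Suc k) * B" using B0 by (intro mult_right_mono) auto
      finally show ?thesis .
    next
      case False
      \<comment> \<open>With j = 2 ^ k - 1 the last block starts at j + 1 = 2 ^ k, which is also its
        length parameter N; m < 2 ^ (k + 1) keeps it below 2 * N.\<close>
      define j where "j = (2::nat) ^ k - 1"
      have j: "(2::nat) ^ k = Suc j" by (simp add: j_def)
      have jm: "j < m" "m \<le> 2 * j + 1" using False Suc.prems j by auto
      have "{1..int m} = {1..int j} \<union> {int j + 1..int m}" using jm by auto
      then have "(\<Sum>n\<in>{1..int m}. f n) = (\<Sum>n\<in>{1..int j}. f n) + (\<Sum>n\<in>{int j + 1..int m}. f n)"
        by (simp only:) (rule sum.union_disjoint, auto)
      moreover have "\<bar>\<Sum>n\<in>{1..int j}. f n\<bar> \<le> real k * B" using jm j Suc.prems by (intro Suc.IH) auto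
      moreover have "\<bar>\<Sum>n\<in>{int j + 1..int m}. f n\<bar> \<le> B"
        using jm Suc.prems by (intro B[of "real j + 1"]) auto
      ultimately show ?thesis by (simp add: distrib_right)
    qed
  qed simp
  obtain k where k: "2 ^ k \<le> M" "M < 2 ^ Suc k"
    using ex_power_ivl1[of 2 M] M by auto
  have "real k \<le> 2 * ln (real M)"
  proof -
    have "real k * ln 2 = ln (2 ^ k)" by (simp add: ln_realpow)
    also have "\<dots> \<le> ln (real M)" using k M by (subst ln_le_cancel_iff) (auto simp: numeral_power_le_of_nat_cancel_iff)
    finally have "real k * ln 2 \<le> ln (real M)" .
    moreover have "real k * (1/2) \<le> real k * ln 2" using ln2_ge_two_thirds by (intro mult_left_mono) auto
    ultimately show ?thesis by simp
  qed
  have "\<bar>\<Sum>n=1..M. f (int n)\<bar> \<le> real (Suc k) * B" unfolding ints using k by (intro main) auto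
  also have "\<dots> \<le> (1 + 2 * ln (real M)) * B" using \<open>real k \<le> 2 * ln (real M)\<close> B0 by (intro mult_right_mono) auto
  finally show ?thesis .
qed

theorem theorem3:
  fixes r :: nat
  assumes "r \<ge> 5"
  shows "Delta1 (2 ^ r) \<in> O[at_top](\<lambda>x. x powr alpha r * ln x) \<and>
         alpha r < 1 / (2 ^ r + real r)"
proof
  show "alpha r < 1 / (2 ^ r + real r)" using assms by (rule alpha_less)
  have a0: "0 \<le> alpha r"
    using alpha_eq[OF assms] e0_bounds[OF assms] by simp
  define b where "b = (2::nat) ^ r"
  have b2: "2 \<le> b" unfolding b_def using power_increasing[of 1 r "2::nat"] assms by simp
  obtain C1 where C1: "0 \<le> C1" "\<And>x N lo hi. 1 \<le> x \<Longrightarrow> 1 \<le> N \<Longrightarrow> N ^ (b + 1) \<le> x \<Longrightarrow> N \<le> real_of_int lo \<Longrightarrow>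
    real_of_int hi \<le> 2 * N \<Longrightarrow> real_of_int (hi - lo + 1) \<le> N \<Longrightarrow>
    \<bar>\<Sum>n\<in>{lo..hi}. psi (x / of_int n ^ b)\<bar> \<le> C1 * x powr alpha r"
    unfolding b_def using first_sum_block[OF assms] by blast
  obtain C2 where C2: "0 \<le> C2" "\<And>x N lo hi. 1 \<le> x \<Longrightarrow> 1 \<le> N \<Longrightarrow> N ^ (b + 1) \<le> x \<Longrightarrow> N \<le> real_of_int lo \<Longrightarrow>
    real_of_int hi \<le> 2 * N \<Longrightarrow> real_of_int (hi - lo + 1) \<le> N \<Longrightarrow>
    \<bar>\<Sum>n\<in>{lo..hi}. psi ((x / of_int n) powr (1 / real b))\<bar> \<le> C2 * x powr alpha r"
    unfolding b_def using second_sum_block[OF assms] by (simp only: of_nat_power of_nat_numeral) blast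
  obtain C3 where C3: "\<And>x. 1 \<le> x \<Longrightarrow>
    \<bar>Delta1 b x + (\<Sum>n=1..nat \<lfloor>x powr (1 / real (b + 1))\<rfloor>. psi (x / real n ^ b))
       + (\<Sum>n=1..nat \<lfloor>x powr (1 / real (b + 1))\<rfloor>. psi ((x / real n) powr (1 / real b)))\<bar> \<le> C3"
    using Delta1_hyperbola[OF b2] by blast
  define C where "C = \<bar>C3\<bar> + 3 * C1 + 3 * C2"
  \<comment> \<open>For x >= e the logarithm is at least 1, so it absorbs the bounded error of the
    hyperbola method and the leading 1 in the count of blocks.\<close>
  have main: "\<bar>Delta1 b x\<bar> \<le> C * (x powr alpha r * ln x)" if x: "exp 1 \<le> x" for x
  proof -
    have x1: "1 \<le> x" using x one_le_exp_iff[of "1::real"] by linarith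
    have lx: "1 \<le> ln x" using x x1 by (simp add: ln_ge_iff)
    define Y where "Y = x powr (1 / real (b + 1))"
    define M where "M = nat \<lfloor>Y\<rfloor>"
    have Y1: "1 \<le> Y" using x1 by (simp add: Y_def ge_one_powr_ge_zero)
    have M: "1 \<le> M" "real M \<le> Y" unfolding M_def using Y1 by (simp_all add: le_nat_iff le_floor_iff)
    have Yx: "Y ^ (b + 1) = x" unfolding Y_def using x1 by (intro powr_inverse_power) auto
    have Nx: "N ^ (b + 1) \<le> x" if "1 \<le> N" "N \<le> real M" for N :: real
      unfolding Yx[symmetric] using that M by (intro power_mono) auto
    have lM: "ln (real M) \<le> ln x"
    proof -
      have "Y ^ 1 \<le> Y ^ (b + 1)" using Y1 by (intro power_increasing) auto
      then have "Y \<le> x" unfolding Yx by simp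
      then have "real M \<le> x" using M by linarith
      then show ?thesis using M by simp
    qed
    have q: "1 + 2 * ln (real M) \<le> 3 * ln x" using lM lx by linarith
    have p: "1 \<le> x powr alpha r" using x1 a0 by (rule ge_one_powr_ge_zero)
    have s1: "\<bar>\<Sum>n=1..M. psi (x / real n ^ b)\<bar> \<le> 3 * ln x * (C1 * x powr alpha r)"
    proof -
      have "\<bar>\<Sum>n=1..M. psi (x / of_int (int n) ^ b)\<bar> \<le> (1 + 2 * ln (real M)) * (C1 * x powr alpha r)"
        using C1(2)[OF x1] Nx M by (intro abs_sum_le_dyadic) auto
      also have "\<dots> \<le> 3 * ln x * (C1 * x powr alpha r)" using q C1(1) by (intro mult_right_mono) auto
      finally show ?thesis by simp
    qed
    have s2: "\<bar>\<Sum>n=1..M. psi ((x / real n) powr (1 / real b))\<bar> \<le> 3 * ln x * (C2 * x powr alpha r)"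
    proof -
      have "\<bar>\<Sum>n=1..M. psi ((x / of_int (int n)) powr (1 / real b))\<bar> \<le> (1 + 2 * ln (real M)) * (C2 * x powr alpha r)"
        using C2(2)[OF x1] Nx M by (intro abs_sum_le_dyadic) auto
      also have "\<dots> \<le> 3 * ln x * (C2 * x powr alpha r)" using q C2(1) by (intro mult_right_mono) auto
      finally show ?thesis by simp
    qed
    have "C3 \<le> \<bar>C3\<bar> * (x powr alpha r * ln x)"
    proof -
      have "1 * 1 \<le> x powr alpha r * ln x" using p lx by (intro mult_mono) auto
      then have "\<bar>C3\<bar> * 1 \<le> \<bar>C3\<bar> * (x powr alpha r * ln x)" by (intro mult_left_mono) auto
      then show ?thesis by linarith
    qed
    then have "\<bar>Delta1 b x\<bar> \<le> \<bar>C3\<bar> * (x powr alpha r * ln x) + 3 * ln x * (C1 * x powr alpha r) + 3 * ln x * (C2 * x powr alpha r)"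
      using C3[OF x1] s1 s2 unfolding M_def Y_def by linarith
    also have "\<dots> = C * (x powr alpha r * ln x)" by (simp add: C_def algebra_simps)
    finally show ?thesis .
  qed
  have "\<forall>\<^sub>F x in at_top. norm (Delta1 b x) \<le> C * norm (x powr alpha r * ln x)"
    using eventually_ge_at_top[of "exp 1"]
  proof (rule eventually_mono)
    fix x :: real assume x: "exp 1 \<le> x"
    have "1 \<le> x" using x one_le_exp_iff[of "1::real"] by linarith
    then show "norm (Delta1 b x) \<le> C * norm (x powr alpha r * ln x)" using main[OF x] by simp
  qed
  then have "Delta1 b \<in> O[at_top](\<lambda>x. x powr alpha r * ln x)" by (rule bigoI)
  then show "Delta1 (2 ^ r) \<in> O[at_top](\<lambda>x. x powr alpha r * ln x)" by (simp only: b_def)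
qed

end
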